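(* For every real $c\ge 1$, the kernel of the derivative map $\mathbf{D}:\mathrm{Aut}(S_c)\to\Gamma(S_c)$ is trivial, and $\mathrm{Aut}(S_c)$ is generated by four affine automorphisms $\widehat{-I}_c$, $\hat A_c$, $\hat D_c$, $\hat E_c$ described as follows: \begin{itemize} \item $\widehat{-I}_c$ swaps the two pieces $Q_c^+$ and $Q_c^-$ of $S_c$, rotating each piece by $\pi$; \item $\hat A_c$ is the automorphism induced by the Euclidean reflection in the vertical line $x=0$, which preserves the pieces $Q_c^+$ and $Q_c^-$ and preserves the gluing relations; \item $\hat D_c$ preserves the decomposition of $S_c$ into maximal horizontal cylinders and acts as a single right Dehn twist in each cylinder; \item $\hat E_c$ preserves the decomposition of $S_c$ into maximal cylinders of slope $1$ and acts as a single right Dehn twist in each cylinder. \end{itemize}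
   Context: The surfaces $S_c$: for real $c\ge 1$ let $T_c:\mathbb{R}^2\to\mathbb{R}^2$, $T_c(x,y)=(cx+(c-1)y+1,\ (c+1)x+cy+1)$, and $P_c^k=T_c^k(0,0)$ for $k\in\mathbb{Z}$ (for $c=1$, $P_1^k=(k,k^2)$). Let $Q_c^+$ be the convex hull of $\{P_c^k\}_{k\in\mathbb{Z}}$ (an infinite polygon with edges $\overline{P_c^kP_c^{k+1}}$), and let $Q_c^-$ be the image of $Q_c^+$ under the rotation by $\pi$. $S_c$ is the translation surface obtained by gluing each edge of $Q_c^+$ by a translation to its image edge in $Q_c^-$. For $A\in\mathrm{GL}(2,\mathbb{R})$ and a translation surface $S$ glued from polygons $P_i$, $A(S)$ is the surface glued from the $A(P_i)$ by the same edge identifications, and $A:S\to A(S)$ also denotes the induced map. The Veech group $\Gamma(S)$ is the group of $A\in\mathrm{GL}(2,\mathbb{R})$ for which there is a direction-preserving isometry $\varphi_A:A(S)\to S$. The affine automorphism group $\mathrm{Aut}(S)$ is the group of all maps $\hat A=\varphi_A\circ A:S\to S$ with $A\in\Gamma(S)$, and the derivative map $\mathbf{D}:\mathrm{Aut}(S)\to\Gamma(S)$ is $\hat A\mapsto A$. For a Euclidean cylinder with coordinates $\mathbb{R}/C\mathbb{Z}\times[0,H]$ (circumference $C$, height $H$, the first coordinate being along the cylinder direction), an affine map acts as a single right Dehn twist if it acts as $(x,y)\mapsto(x+\tfrac{C}{H}y,\,y)$; in particular it fixes each boundary point of the cylinder. *)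

theory Defs
  imports "HOL-Analysis.Analysis" "HOL-Algebra.Bij" "HOL-Algebra.Generated_Groups"
begin

section \<open>Translation surfaces glued from polygons\<close>

text \<open>
  An entry \<open>(i, e, j, v)\<close> of \<open>gluings\<close> says that the edge \<open>e\<close> of the polygon \<open>poly i\<close> is glued
  to the edge \<open>e + v\<close> of the polygon \<open>poly j\<close> by the translation by \<open>v\<close>.
\<close>

record 'i glued_surface =
  poly :: "'i \<Rightarrow> (real^2) set"
  gluings :: "('i \<times> (real^2) set \<times> 'i \<times> (real^2)) set"

type_synonym 'i surface_point = "('i \<times> (real^2)) set"

definition glued :: "'i glued_surface \<Rightarrow> (('i \<times> (real^2)) \<times> ('i \<times> (real^2))) set" where
  "glued S = {((i, p), (j, p + v)) | i e j v p. (i, e, j, v) \<in> gluings S \<and> p \<in> e}"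

definition same_point :: "'i glued_surface \<Rightarrow> (('i \<times> (real^2)) \<times> ('i \<times> (real^2))) set" where
  "same_point S = Restr ((glued S \<union> (glued S)\<inverse>)\<^sup>*) (Sigma UNIV (poly S))"

definition points :: "'i glued_surface \<Rightarrow> 'i surface_point set" where
  "points S = Sigma UNIV (poly S) // same_point S"

definition point_of :: "'i glued_surface \<Rightarrow> 'i \<Rightarrow> real^2 \<Rightarrow> 'i surface_point" where
  "point_of S i p = same_point S `` {(i, p)}"

text \<open>The vertices are points of the surface; they are its only possible singularities.\<close>

definition vertices :: "'i glued_surface \<Rightarrow> 'i surface_point set" where
  "vertices S = {x \<in> points S. \<exists>(i, p) \<in> x. p extreme_point_of poly S i}"

text \<open>
  \<open>joined S x y l\<close>: the points \<open>x\<close> and \<open>y\<close> are joined by a path of length \<open>l\<close> consisting of finitely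
  many straight segments, each lying in one of the polygons. The infimum of these lengths is the
  path metric of a (connected) surface.
\<close>

inductive joined :: "'i glued_surface \<Rightarrow> 'i surface_point \<Rightarrow> 'i surface_point \<Rightarrow> real \<Rightarrow> bool"
  for S :: "'i glued_surface" where
  refl: "x \<in> points S \<Longrightarrow> joined S x x 0"
| step: "joined S x (point_of S i p) l \<Longrightarrow> closed_segment p q \<subseteq> poly S i
    \<Longrightarrow> joined S x (point_of S i q) (l + dist p q)"

definition surface_dist :: "'i glued_surface \<Rightarrow> 'i surface_point \<Rightarrow> 'i surface_point \<Rightarrow> real" where
  "surface_dist S x y = Inf {l. joined S x y l}"

text \<open>
  A map preserves directions if it is a translation in local coordinates away from the vertices.
  A point on an edge has two representatives \<open>(i, p)\<close>, each of which sees only the half disc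
  \<open>p + h \<in> poly S i\<close>; the two together cover a full neighbourhood of the point.
\<close>

definition direction_preserving ::
  "'i glued_surface \<Rightarrow> 'j glued_surface \<Rightarrow> ('i surface_point \<Rightarrow> 'j surface_point) \<Rightarrow> bool" where
  "direction_preserving S S' f \<longleftrightarrow>
     (\<forall>x \<in> points S - vertices S. f x \<notin> vertices S' \<longrightarrow>
        (\<forall>(i, p) \<in> x. \<forall>(j, q) \<in> f x. \<forall>\<^sub>F h in nhds 0.
           p + h \<in> poly S i \<and> q + h \<in> poly S' j \<longrightarrow>
           f (point_of S i (p + h)) = point_of S' j (q + h)))"

definition surface_isometry ::
  "'i glued_surface \<Rightarrow> 'j glued_surface \<Rightarrow> ('i surface_point \<Rightarrow> 'j surface_point) \<Rightarrow> bool" where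
  "surface_isometry S S' f \<longleftrightarrow>
     bij_betw f (points S) (points S') \<and>
     (\<forall>x \<in> points S. \<forall>y \<in> points S. surface_dist S' (f x) (f y) = surface_dist S x y)"


section \<open>Affine automorphisms and the Veech group\<close>

definition linear_image :: "real^2^2 \<Rightarrow> 'i glued_surface \<Rightarrow> 'i glued_surface" where
  "linear_image A S =
     \<lparr>poly = (\<lambda>i. (*v) A ` poly S i),
      gluings = {(i, (*v) A ` e, j, A *v v) | i e j v. (i, e, j, v) \<in> gluings S}\<rparr>"

definition linear_map :: "real^2^2 \<Rightarrow> 'i surface_point \<Rightarrow> 'i surface_point" where
  "linear_map A x = (\<lambda>(i, p). (i, A *v p)) ` x"

definition veech_set :: "'i glued_surface \<Rightarrow> (real^2^2) set" where
  "veech_set S = {A. invertible A \<and>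
     (\<exists>\<phi>. surface_isometry (linear_image A S) S \<phi> \<and> direction_preserving (linear_image A S) S \<phi>)}"

definition veech_group :: "'i glued_surface \<Rightarrow> (real^2^2) monoid" where
  "veech_group S = \<lparr>carrier = veech_set S, mult = (**), one = mat 1\<rparr>"

definition affine_with_derivative ::
  "'i glued_surface \<Rightarrow> real^2^2 \<Rightarrow> ('i surface_point \<Rightarrow> 'i surface_point) \<Rightarrow> bool" where
  "affine_with_derivative S A f \<longleftrightarrow> A \<in> veech_set S \<and>
     (\<exists>\<phi>. surface_isometry (linear_image A S) S \<phi> \<and> direction_preserving (linear_image A S) S \<phi> \<and>
          f = restrict (\<phi> \<circ> linear_map A) (points S))"

definition affine_group ::
  "'i glued_surface \<Rightarrow> ('i surface_point \<Rightarrow> 'i surface_point) monoid" where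
  "affine_group S = (BijGroup (points S)) \<lparr>carrier := {f. \<exists>A. affine_with_derivative S A f}\<rparr>"

definition affine_derivative ::
  "'i glued_surface \<Rightarrow> ('i surface_point \<Rightarrow> 'i surface_point) \<Rightarrow> real^2^2" where
  "affine_derivative S f = (THE A. affine_with_derivative S A f)"

text \<open>
  \<open>f\<close> permutes the polygons by \<open>\<sigma>\<close>, mapping each polygon to its image by \<open>L\<close>, compatibly with the
  gluings.
\<close>

definition induced_by ::
  "'i glued_surface \<Rightarrow> ('i \<Rightarrow> 'i) \<Rightarrow> (real^2 \<Rightarrow> real^2) \<Rightarrow> ('i surface_point \<Rightarrow> 'i surface_point) \<Rightarrow> bool"
  where
  "induced_by S \<sigma> L f \<longleftrightarrow>
     (\<forall>i. L ` poly S i = poly S (\<sigma> i)) \<and>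
     (\<forall>i j. \<forall>p \<in> poly S i. \<forall>q \<in> poly S j.
        ((i, p), (j, q)) \<in> same_point S \<longleftrightarrow> ((\<sigma> i, L p), (\<sigma> j, L q)) \<in> same_point S) \<and>
     (\<forall>i. \<forall>p \<in> poly S i. f (point_of S i p) = point_of S (\<sigma> i) (L p))"


section \<open>Cylinders and Dehn twists\<close>

text \<open>
  Coordinates along a cylinder in direction \<open>u\<close>: the second axis is \<open>u\<close> turned by a positive right
  angle. This orientation is what makes the twist below a right twist.
\<close>

definition frame :: "real^2 \<Rightarrow> real \<times> real \<Rightarrow> real^2" where
  "frame u h = fst h *\<^sub>R u + snd h *\<^sub>R vector [- (u $ 2), u $ 1]"

text \<open>
  A cylinder of circumference \<open>C\<close> and height \<open>H\<close> in the direction of the unit vector \<open>u\<close> is given by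
  its coordinates \<open>\<psi>\<close> on \<open>\<real> \<times> [0, H]\<close>, periodic in the first variable. The open cylinder is embedded,
  contains no vertex, and its coordinates are Euclidean; \<open>\<psi>\<close> is continuous up to the boundary, which
  need not be embedded and may contain vertices.
\<close>

definition cylinder ::
  "'i glued_surface \<Rightarrow> real^2 \<Rightarrow> real \<Rightarrow> real \<Rightarrow> (real \<times> real \<Rightarrow> 'i surface_point) \<Rightarrow> bool" where
  "cylinder S u C H \<psi> \<longleftrightarrow>
     norm u = 1 \<and> C > 0 \<and> H > 0 \<and>
     \<psi> ` (UNIV \<times> {0..H}) \<subseteq> points S \<and>
     (\<forall>x. \<forall>y \<in> {0..H}. \<psi> (x + C, y) = \<psi> (x, y)) \<and>
     (\<forall>x x'. \<forall>y \<in> {0<..<H}. \<forall>y' \<in> {0<..<H}.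
        \<psi> (x, y) = \<psi> (x', y') \<longrightarrow> y = y' \<and> (\<exists>n::int. x' = x + of_int n * C)) \<and>
     (\<forall>z \<in> UNIV \<times> {0<..<H}. \<psi> z \<notin> vertices S \<and>
        (\<forall>(i, p) \<in> \<psi> z. \<forall>\<^sub>F h in nhds 0.
           p + frame u h \<in> poly S i \<longrightarrow> \<psi> (z + h) = point_of S i (p + frame u h))) \<and>
     (\<forall>z \<in> UNIV \<times> {0..H}.
        ((\<lambda>w. surface_dist S (\<psi> w) (\<psi> z)) \<longlongrightarrow> 0) (at z within UNIV \<times> {0..H}))"

definition maximal_cylinder ::
  "'i glued_surface \<Rightarrow> real^2 \<Rightarrow> real \<Rightarrow> real \<Rightarrow> (real \<times> real \<Rightarrow> 'i surface_point) \<Rightarrow> bool" where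
  "maximal_cylinder S u C H \<psi> \<longleftrightarrow> cylinder S u C H \<psi> \<and>
     (\<forall>C' H' \<psi>'. cylinder S u C' H' \<psi>' \<and>
        \<psi> ` (UNIV \<times> {0<..<H}) \<subseteq> \<psi>' ` (UNIV \<times> {0<..<H'}) \<longrightarrow>
        \<psi> ` (UNIV \<times> {0<..<H}) = \<psi>' ` (UNIV \<times> {0<..<H'}))"

definition closed_maximal_cylinders :: "'i glued_surface \<Rightarrow> real^2 \<Rightarrow> 'i surface_point set set" where
  "closed_maximal_cylinders S u =
     {\<psi> ` (UNIV \<times> {0..H}) | C H \<psi>. maximal_cylinder S u C H \<psi>}"

definition open_maximal_cylinders :: "'i glued_surface \<Rightarrow> real^2 \<Rightarrow> 'i surface_point set set" where
  "open_maximal_cylinders S u =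
     {\<psi> ` (UNIV \<times> {0<..<H}) | C H \<psi>. maximal_cylinder S u C H \<psi>}"

definition cylinder_decomposition :: "'i glued_surface \<Rightarrow> real^2 \<Rightarrow> bool" where
  "cylinder_decomposition S u \<longleftrightarrow>
     \<Union> (closed_maximal_cylinders S u) = points S \<and> disjoint (open_maximal_cylinders S u)"

definition right_twist_in_each_cylinder ::
  "'i glued_surface \<Rightarrow> real^2 \<Rightarrow> ('i surface_point \<Rightarrow> 'i surface_point) \<Rightarrow> bool" where
  "right_twist_in_each_cylinder S u f \<longleftrightarrow>
     cylinder_decomposition S u \<and>
     (`) f ` closed_maximal_cylinders S u = closed_maximal_cylinders S u \<and>
     (\<forall>C H \<psi>. maximal_cylinder S u C H \<psi> \<longrightarrow>
        (\<forall>x. \<forall>y \<in> {0..H}. f (\<psi> (x, y)) = \<psi> (x + C / H * y, y)))"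


section \<open>The surfaces \<open>S\<^sub>c\<close>\<close>

definition T_map :: "real \<Rightarrow> real^2 \<Rightarrow> real^2" where
  "T_map c p = vector [c * p $ 1 + (c - 1) * p $ 2 + 1, (c + 1) * p $ 1 + c * p $ 2 + 1]"

text \<open>The linear part of \<open>T_map c\<close> has determinant \<open>1\<close>, so its inverse is a genuine inverse.\<close>

definition P_vertex :: "real \<Rightarrow> int \<Rightarrow> real^2" where
  "P_vertex c k =
     (if k \<ge> 0 then (T_map c ^^ nat k) 0 else (inv_into UNIV (T_map c) ^^ nat (- k)) 0)"

datatype piece = QPlus | QMinus

fun Q_piece :: "real \<Rightarrow> piece \<Rightarrow> (real^2) set" where
  "Q_piece c QPlus = convex hull (range (P_vertex c))"
| "Q_piece c QMinus = uminus ` (convex hull (range (P_vertex c)))"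

text \<open>
  With \<open>a = P_vertex c k\<close> and \<open>b = P_vertex c (k + 1)\<close>, the rotated edge joins \<open>- a\<close> and \<open>- b\<close>, and
  the translation that carries the edge to it takes \<open>a\<close> to \<open>- b\<close> and \<open>b\<close> to \<open>- a\<close>.
\<close>

definition S_surface :: "real \<Rightarrow> piece glued_surface" where
  "S_surface c =
     \<lparr>poly = Q_piece c,
      gluings = {(QPlus, closed_segment (P_vertex c k) (P_vertex c (k + 1)),
                  QMinus, - (P_vertex c k + P_vertex c (k + 1))) | k. True}\<rparr>"

fun swap_pieces :: "piece \<Rightarrow> piece" where
  "swap_pieces QPlus = QMinus"
| "swap_pieces QMinus = QPlus"

definition reflect_x :: "real^2 \<Rightarrow> real^2" where
  "reflect_x p = vector [- (p $ 1), p $ 2]"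

end

theory Submission
  imports Defs
begin

text \<open>
Write \<open>P k\<close> for the vertices of the polygon \<open>Q\<close>, \<open>L\<close> for the linear part of \<open>T_map c\<close> and \<open>qform\<close>
for the quadratic form \<open>(c + 1) x\<^sup>2 - (c - 1) y\<^sup>2\<close>, which \<open>L\<close> preserves.

\<^bold>\<open>Affine automorphisms as locally affine homeomorphisms.\<close> An isometry of \<open>A(S)\<close> with \<open>S\<close> that
preserves directions is, seen on \<open>S\<close>, a homeomorphism that is affine with linear part \<open>A\<close> near
every regular point, and conversely (\<open>affine_with_derivative_iff\<close>). The point that needs an
argument is that such a map cannot send a regular point to a vertex: infinitely many short
segments in the upward direction leave a vertex, but only one leaves a regular point
(\<open>affine_data_vertex\<close>). Two such maps with the same linear part that agree at one regular point
agree everywhere (\<open>rigidity\<close>).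

\<^bold>\<open>The four automorphisms.\<close> The rotation and the reflection come from symmetries of the polygon. For
the twists, cut the polygon along all chords in direction \<open>u\<close>, horizontal or of slope 1. The
chords join \<open>P k\<close> to \<open>P (\<iota> - k)\<close> with \<open>\<iota>\<close> equal to 0 or 1, because the vertex sequence is
symmetric under a (possibly skew) reflection that reverses the indices and whose eigenvector for
\<open>-1\<close> is \<open>u\<close>. The slice between consecutive chords, together with its rotated copy, forms a
cylinder, and all these cylinders have the same ratio \<open>\<kappa>\<close> of circumference to height. Hence the
single right twists of all of them have the same derivative and fit together (\<open>twist_affine_aut\<close>).
That the twists act on every maximal cylinder rests on the fact that each maximal cylinder is one
of these: no line in direction \<open>u\<close> through a point of a chord avoids the vertices
(\<open>cylinder_in_zone\<close>).

\<^bold>\<open>Trivial kernel.\<close> Up to the gluing, the edge from \<open>P 0\<close> to \<open>P 1\<close> is the only saddle connection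
with holonomy \<open>(1, 1)\<close>, because the other chords of slope 1 are longer. An automorphism whose
derivative fixes \<open>(1, 1)\<close> therefore fixes this edge pointwise, so by rigidity the derivative
determines the automorphism (\<open>affine_aut_determined\<close>). In particular \<open>L\<close>, up to sign the product
of the two twist derivatives, is the derivative of an element of the subgroup generated by the
four automorphisms.

\<^bold>\<open>Generation.\<close> Let \<open>f\<close> be an automorphism and \<open>w\<close> the holonomy of the image of the first edge. This
image joins the two vertex points of the surface. Every saddle connection has \<open>qform w > 0\<close>,
because the polygon contains full rays in all upward directions with \<open>qform \<le> 0\<close> (\<open>saddle_qform\<close>).
The rotation, the reflection and \<open>L\<close> move \<open>w\<close> into the sector \<open>0 \<le> y \<le> x\<close> without changing
\<open>qform w\<close> (\<open>to_first_sector\<close>). If \<open>0 < y < x\<close>, the saddle connection crosses a horizontal cylinder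
and one of slope 1, which bounds \<open>y\<close> and \<open>x - y\<close> below. Reflecting and twisting horizontally
replaces \<open>(x, y)\<close> by \<open>(2 y - x, y)\<close> and lowers \<open>qform\<close> by \<open>4 (c + 1) y (x - y) \<ge> 16\<close>. So the
descent stops, and it stops on the diagonal, since horizontal saddle connections are closed
(\<open>reduce_to_diagonal\<close>). Lengths of diagonal saddle connections and heights of diagonal cylinders
then leave, after composing with generators, only derivatives \<open>p \<mapsto> p + a (y - x) (1, 1)\<close>. Tracing
the vertices on the boundary of the first diagonal cylinder shows that \<open>a\<close> is an integer multiple
of \<open>c + 1\<close>, so that the automorphism is a power of the diagonal twist (\<open>transvection_derivative\<close>,
\<open>derivative_in_GenM\<close>).
\<close>

section \<open>The polygon and its vertices\<close>

lemma vec2_eq_iff: "(p::real^2) = q \<longleftrightarrow> p $ 1 = q $ 1 \<and> p $ 2 = q $ 2"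
  by (simp add: vec_eq_iff forall_2)

definition cross2 :: "real^2 \<Rightarrow> real^2 \<Rightarrow> real" where
  "cross2 p q = p $ 1 * q $ 2 - p $ 2 * q $ 1"

lemma cross2_simps [simp]:
  "cross2 p (q + r) = cross2 p q + cross2 p r"
  "cross2 p (q - r) = cross2 p q - cross2 p r"
  "cross2 p (- q) = - cross2 p q"
  "cross2 p (t *\<^sub>R q) = t * cross2 p q"
  "cross2 p 0 = 0"
  "cross2 p p = 0"
  by (auto simp: cross2_def algebra_simps)

locale surf =
  fixes c :: real
  assumes c1: "c \<ge> 1"
begin

abbreviation "P \<equiv> P_vertex c"
abbreviation "S \<equiv> S_surface c"
abbreviation "X \<equiv> points (S_surface c)"
abbreviation "V \<equiv> vertices (S_surface c)"
abbreviation "Q \<equiv> Q_piece c QPlus"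

definition "E k = P (k + 1) - P k"
definition "edge k = closed_segment (P k) (P (k + 1))"
definition "edge_side k p = cross2 (E k) (p - P k)"
definition L :: "real^2 \<Rightarrow> real^2" where
  "L p = vector [c * p $ 1 + (c - 1) * p $ 2, (c + 1) * p $ 1 + c * p $ 2]"

text \<open>
The quadratic form preserved by \<open>L\<close>. All edges of the polygon have the same value, see \<open>qform_E\<close>.
\<close>

definition qform :: "real^2 \<Rightarrow> real" where
  "qform p = (c + 1) * (p $ 1)\<^sup>2 - (c - 1) * (p $ 2)\<^sup>2"

lemma L_nth [simp]: "L p $ 1 = c * p $ 1 + (c - 1) * p $ 2" "L p $ 2 = (c + 1) * p $ 1 + c * p $ 2"
  by (simp_all add: L_def)

lemma T_nth [simp]: "T_map c p $ 1 = c * p $ 1 + (c - 1) * p $ 2 + 1"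
  "T_map c p $ 2 = (c + 1) * p $ 1 + c * p $ 2 + 1"
  by (simp_all add: T_map_def)

lemma T_eq_L: "T_map c p - T_map c q = L (p - q)"
  by (simp add: vec2_eq_iff algebra_simps)

lemma cross2_L: "cross2 (L p) (L q) = cross2 p q"
  by (simp add: cross2_def) algebra

lemma qform_L: "qform (L p) = qform p"
  unfolding qform_def L_nth by algebra

definition Tinv :: "real^2 \<Rightarrow> real^2" where
  "Tinv p = vector [c * (p $ 1 - 1) - (c - 1) * (p $ 2 - 1), c * (p $ 2 - 1) - (c + 1) * (p $ 1 - 1)]"

lemma T_Tinv: "T_map c (Tinv p) = p"
  by (auto simp: vec2_eq_iff Tinv_def algebra_simps)

lemma Tinv_T: "Tinv (T_map c p) = p"
  by (auto simp: vec2_eq_iff Tinv_def algebra_simps)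

lemma inj_T: "inj (T_map c)"
  by (metis Tinv_T injI)

lemma surj_T: "surj (T_map c)"
  by (metis T_Tinv surjI)

lemma P_Suc: "P (k + 1) = T_map c (P k)"
proof (cases "k \<ge> 0")
  case True
  then have "nat (k + 1) = Suc (nat k)" by simp
  with True show ?thesis by (simp add: P_vertex_def)
next
  case False
  then have "nat (- k) = Suc (nat (- (k + 1)))" by simp
  then have "P k = inv_into UNIV (T_map c) ((inv_into UNIV (T_map c) ^^ nat (- (k + 1))) 0)"
    using False by (simp add: P_vertex_def)
  also have "(inv_into UNIV (T_map c) ^^ nat (- (k + 1))) 0 = P (k + 1)"
    using False by (cases "k = -1") (auto simp: P_vertex_def)
  finally show ?thesis using surj_T by (simp add: surj_f_inv_f)
qed

lemma P_0 [simp]: "P 0 = 0" by (simp add: P_vertex_def)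

lemma P_1: "P 1 = vector [1, 1]"
  using P_Suc[of 0] by (simp add: vec2_eq_iff)

lemma reflect_nth [simp]: "reflect_x p $ 1 = - (p $ 1)" "reflect_x p $ 2 = p $ 2"
  by (simp_all add: reflect_x_def)

lemma reflect_T: "T_map c (reflect_x (T_map c p)) = reflect_x p"
  by (simp add: vec2_eq_iff) algebra

text \<open>
The reflection conjugates \<open>T_map c\<close> to its inverse, so it reverses the vertex sequence.
\<close>

lemma P_neg: "P (- k) = reflect_x (P k)"
proof -
  have *: "P (- int n) = reflect_x (P (int n))" for n
  proof (induction n)
    case 0 then show ?case by (simp add: vec2_eq_iff)
  next
    case (Suc n)
    have "T_map c (P (- int (Suc n))) = P (- int n)"
      using P_Suc[of "- int (Suc n)"] by simp
    also have "\<dots> = T_map c (reflect_x (T_map c (P (int n))))" by (simp add: Suc reflect_T)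
    also have "T_map c (P (int n)) = P (int (Suc n))" using P_Suc[of "int n"] by (simp add: add.commute)
    finally show ?case using inj_T by (simp add: inj_eq)
  qed
  show ?thesis
  proof (cases "k \<ge> 0")
    case True then show ?thesis using *[of "nat k"] by simp
  next
    case False
    then have "P k = reflect_x (P (-k))" using *[of "nat (-k)"] by simp
    then show ?thesis by (simp add: vec2_eq_iff)
  qed
qed

lemma E_Suc: "E (k + 1) = L (E k)"
  unfolding E_def using P_Suc[of k] P_Suc[of "k + 1"] by (simp add: T_eq_L)

lemma E_0: "E 0 = vector [1, 1]" by (simp add: E_def P_1)

lemma E_neg: "E (- k - 1) $ 1 = E k $ 1" "E (- k - 1) $ 2 = - (E k $ 2)"
  using P_neg[of k] P_neg[of "k + 1"] by (simp_all add: E_def)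

lemma E_nonneg_bounds:
  assumes "k \<ge> 0" shows "E k $ 1 \<ge> 1 \<and> E k $ 2 \<ge> 1"
  using assms
proof (induction k rule: int_ge_induct)
  case base then show ?case by (simp add: E_0)
next
  case (step k)
  have "(c - 1) * E k $ 2 \<ge> 0" "c * E k $ 1 \<ge> 1" "c * E k $ 2 \<ge> 1"
    using step c1 mult_mono[of 1 c 1 "E k $ 1"] mult_mono[of 1 c 1 "E k $ 2"] by auto
  moreover have "(c + 1) * E k $ 1 \<ge> 0" using step c1 by simp
  ultimately show ?case by (simp add: E_Suc)
qed

lemma E1_ge: "E k $ 1 \<ge> 1"
  using E_nonneg_bounds[of k] E_nonneg_bounds[of "-k-1"] E_neg[of k] by (cases "k \<ge> 0") auto

lemma E_diff: "E (k + 1) $ 2 - E (k + 1) $ 1 = E k $ 1 + E k $ 2"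
  unfolding E_Suc L_nth by (simp add: algebra_simps)

lemma qform_E: "qform (E k) = 2"
proof (induction k rule: int_induct[where k = 0])
  case base then show ?case by (simp add: E_0 qform_def)
next
  case (step1 i) then show ?case by (simp add: E_Suc qform_L)
next
  case (step2 i) then show ?case using E_Suc[of "i - 1"] qform_L by simp
qed

lemma cross_E_shift: "cross2 (E (k + i)) (E (j + i)) = cross2 (E k) (E j)"
proof (induction i rule: int_induct[where k = 0])
  case base then show ?case by simp
next
  case (step1 i) then show ?case
    using E_Suc[of "k + i"] E_Suc[of "j + i"] by (simp add: cross2_L add.assoc)
next
  case (step2 i)
  have "E (k + i) = L (E (k + (i - 1)))" for k by (metis E_Suc add.assoc diff_add_cancel)
  with step2 show ?case by (metis cross2_L)
qed

text \<open>
The slopes of the edges increase. By invariance under \<open>L\<close> it is enough to compare with the edge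
\<open>(1, 1)\<close>.
\<close>

lemma cross_E_pos: assumes "k < j" shows "cross2 (E k) (E j) > 0"
proof -
  have "cross2 (E k) (E j) = cross2 (E 0) (E (j - k))" using cross_E_shift[of 0 k "j - k"] by simp
  also have "\<dots> = E (j - k) $ 2 - E (j - k) $ 1" by (simp add: cross2_def E_0)
  also have "\<dots> = E (j - k - 1) $ 1 + E (j - k - 1) $ 2" using E_diff[of "j - k - 1"] by simp
  also have "\<dots> > 0" using E_nonneg_bounds[of "j - k - 1"] assms by simp
  finally show ?thesis .
qed

lemma cross_E_neg: assumes "j < k" shows "cross2 (E k) (E j) < 0"
  using cross_E_pos[OF assms] by (simp add: cross2_def algebra_simps)

lemma P_step: "P (k + 1) = P k + E k" by (simp add: E_def)

lemma edge_side_P_step: "edge_side k (P (j + 1)) = edge_side k (P j) + cross2 (E k) (E j)"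
  by (simp add: edge_side_def P_step)

lemma edge_side_P [simp]: "edge_side k (P k) = 0" "edge_side k (P (k + 1)) = 0"
  by (simp_all add: edge_side_def P_step)

text \<open>
Convexity of the vertex sequence: the value at \<open>P j\<close> is a sum of cross products of edges, all of
the same sign on either side of the edge \<open>k\<close>.
\<close>

lemma edge_side_P_pos: assumes "j \<noteq> k" "j \<noteq> k + 1" shows "edge_side k (P j) > 0"
proof -
  have right: "edge_side k (P j) \<ge> 0 \<and> (j > k + 1 \<longrightarrow> edge_side k (P j) > 0)" if "j \<ge> k + 1" for j
    using that
  proof (induction j rule: int_ge_induct)
    case base then show ?case by simp
  next
    case (step j)
    then show ?case using cross_E_pos[of k j] by (auto simp: edge_side_P_step)
  qed
  have left: "edge_side k (P j) \<ge> 0 \<and> (j < k \<longrightarrow> edge_side k (P j) > 0)" if "j \<le> k" for j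
    using that
  proof (induction j rule: int_le_induct)
    case base then show ?case by simp
  next
    case (step j)
    then show ?case using cross_E_neg[of "j - 1" k] edge_side_P_step[of k "j - 1"] by auto
  qed
  from assms consider "j > k + 1" | "j < k" by linarith
  then show ?thesis using right[of j] left[of j] by cases auto
qed

lemma edge_side_P_nonneg: "edge_side k (P j) \<ge> 0"
  using edge_side_P_pos[of j k] by (cases "j = k \<or> j = k + 1") auto

lemma Px_mono: assumes "j \<le> k" shows "P k $ 1 - P j $ 1 \<ge> of_int (k - j)"
  using assms
proof (induction k rule: int_ge_induct)
  case base then show ?case by simp
next
  case (step k) then show ?case using E1_ge[of k] by (simp add: P_step)
qed

lemma P_inj [simp]: "P j = P k \<longleftrightarrow> j = k"
  using Px_mono[of j k] Px_mono[of k j] by (cases "j \<le> k") (auto intro!: antisym)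

lemma Px_sign: "k \<ge> 0 \<Longrightarrow> P k $ 1 \<ge> of_int k" "k \<le> 0 \<Longrightarrow> P k $ 1 \<le> of_int k"
  using Px_mono[of 0 k] Px_mono[of k 0] by auto

text \<open>
The first coordinates of the vertices are unbounded in both directions since each edge is at least
1 wide.
\<close>

lemma x_slab: obtains k where "P k $ 1 \<le> x" "x < P (k + 1) $ 1"
proof -
  define A where "A = {k::int. P k $ 1 \<le> x}"
  obtain n :: nat where n: "\<bar>x\<bar> < real n" using reals_Archimedean2 by blast
  have base: "- int n \<in> A" unfolding A_def using Px_sign(2)[of "- int n"] n by simp
  have up: "k \<le> int n" if "k \<in> A" for k
  proof (rule ccontr)
    assume k: "\<not> k \<le> int n"
    then have "P k $ 1 \<ge> of_int k" "real_of_int k \<ge> real n" using Px_sign(1)[of k] by linarith+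
    then show False using that n by (simp add: A_def)
  qed
  have "\<exists>k\<in>A. k + 1 \<notin> A"
  proof (rule ccontr)
    assume "\<not> ?thesis"
    then have st: "k + 1 \<in> A" if "k \<in> A" for k using that by blast
    have "k \<in> A" if "k \<ge> - int n" for k
      using that by (induction k rule: int_ge_induct) (auto simp: base st)
    from this[of "int n + 1"] up[of "int n + 1"] show False by simp
  qed
  then show ?thesis using that unfolding A_def by force
qed

end

section \<open>Parallel chords of the polygon\<close>

lemma frame_nth [simp]: "frame u h $ 1 = fst h * u $ 1 - snd h * u $ 2"
  "frame u h $ 2 = fst h * u $ 2 + snd h * u $ 1"
  by (simp_all add: frame_def)

lemma frame_linear: "frame u (z + w) = frame u z + frame u w" "frame u (z - w) = frame u z - frame u w"
  "frame u (t *\<^sub>R z) = t *\<^sub>R frame u z" "frame u (- z) = - frame u z" "frame u 0 = 0"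
  by (simp_all add: vec2_eq_iff algebra_simps)

definition unframe :: "real^2 \<Rightarrow> real^2 \<Rightarrow> real \<times> real" where
  "unframe u p = (u $ 1 * p $ 1 + u $ 2 * p $ 2, cross2 u p)"

lemma frame_unframe:
  assumes "norm u = 1" shows "frame u (unframe u p) = p" "unframe u (frame u z) = z"
proof -
  have u: "u $ 1 * u $ 1 + u $ 2 * u $ 2 = 1"
    using assms by (simp add: norm_eq_1 inner_vec_def sum_2)
  show "frame u (unframe u p) = p"
    unfolding vec2_eq_iff unframe_def cross2_def frame_nth fst_conv snd_conv
    using u by (intro conjI; algebra)
  show "unframe u (frame u z) = z"
    unfolding prod_eq_iff unframe_def cross2_def frame_nth fst_conv snd_conv
    using u by (intro conjI; algebra)
qed

lemma cross2_frame:
  assumes "norm u = 1" shows "cross2 (frame u z) (frame u w) = fst z * snd w - snd z * fst w"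
    "cross2 u (frame u z) = snd z"
proof -
  have u: "u $ 1 * u $ 1 + u $ 2 * u $ 2 = 1"
    using assms by (simp add: norm_eq_1 inner_vec_def sum_2)
  show "cross2 (frame u z) (frame u w) = fst z * snd w - snd z * fst w"
    "cross2 u (frame u z) = snd z"
    unfolding cross2_def frame_nth using u by algebra+
qed

lemma norm_frame: assumes "norm u = 1" shows "norm (frame u z) = norm z"
proof -
  have u: "u $ 1 * u $ 1 + u $ 2 * u $ 2 = 1"
    using assms by (simp add: norm_eq_1 inner_vec_def sum_2)
  have "(frame u z $ 1)\<^sup>2 + (frame u z $ 2)\<^sup>2 = (fst z)\<^sup>2 + (snd z)\<^sup>2"
    unfolding frame_nth using u by algebra
  then show ?thesis
    by (simp add: norm_vec_def L2_set_def sum_2 norm_prod_def power2_eq_square)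
qed

text \<open>
The common features of the two cylinder directions: \<open>u\<close> is the direction, the chord through \<open>P k\<close>
in direction \<open>u\<close> ends at \<open>P (\<iota> - k)\<close> and has length \<open>ell k\<close>, and the heights of the chords over
the line through the origin increase by at least 1. The last assumption says that the cylinders,
of circumference \<open>ell k + ell (k + 1)\<close>, all have the same modulus \<open>\<kappa>\<close>. It is what makes a
simultaneous twist affine.
\<close>

locale chords = surf +
  fixes u :: "real^2" and \<iota> :: int and \<kappa> :: real and ell :: "int \<Rightarrow> real"
  assumes norm_u: "norm u = 1"
    and iota01: "\<iota> = 0 \<or> \<iota> = 1"
    and chord: "P_vertex c k - P_vertex c (\<iota> - k) = ell k *\<^sub>R u"
    and ell_nonneg: "k \<ge> \<iota> \<Longrightarrow> 0 \<le> ell k"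
    and ht_d0: "cross2 u (P_vertex c \<iota>) = 0"
    and ht_step: "k \<ge> \<iota> \<Longrightarrow> cross2 u (P_vertex c (k + 1)) \<ge> cross2 u (P_vertex c k) + 1"
    and modulus: "k \<ge> \<iota> \<Longrightarrow>
      ell k + ell (k + 1) = \<kappa> * (cross2 u (P_vertex c (k + 1)) - cross2 u (P_vertex c k))"
begin

text \<open>
Data of the slice of the polygon between the chords \<open>k\<close> and \<open>k + 1\<close>, for \<open>k \<ge> \<iota>\<close>: \<open>Hk\<close> is its
height and \<open>Lk\<close> the circumference of the resulting cylinder, \<open>pt k\<close> gives coordinates along and
across the direction \<open>u\<close> with origin \<open>P k\<close>, and at height \<open>\<eta>\<close> the slice extends from \<open>lft k \<eta>\<close> to
\<open>rgt k \<eta>\<close>.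
\<close>

definition "ht k = cross2 u (P k)"
definition "Hk k = ht (k + 1) - ht k"
definition "e1 k = fst (unframe u (E k))"
definition "rgt k \<eta> = e1 k * \<eta> / Hk k"
definition "lft k \<eta> = - ell k + (e1 k - ell (k + 1) + ell k) * \<eta> / Hk k"
definition "pt k z = P k + frame u z"
definition "Lk k = ell k + ell (k + 1)"

lemmas frame_un = frame_unframe[OF norm_u]

lemma Hk_ge: "k \<ge> \<iota> \<Longrightarrow> Hk k \<ge> 1" using ht_step[of k] by (simp add: Hk_def ht_def)

lemma Lk_eq: "k \<ge> \<iota> \<Longrightarrow> Lk k = \<kappa> * Hk k" using modulus[of k] by (simp add: Hk_def ht_def Lk_def)

lemma ht_refl: "ht (\<iota> - k) = ht k"
proof -
  have "cross2 u (P k - P (\<iota> - k)) = 0" by (simp add: chord)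
  then show ?thesis by (simp add: ht_def)
qed

lemma E_frame: "E k = frame u (e1 k, Hk k)"
proof -
  have "unframe u (E k) = (e1 k, Hk k)"
    by (simp add: prod_eq_iff e1_def) (simp add: unframe_def Hk_def ht_def E_def)
  then show ?thesis by (metis frame_un(1))
qed

lemma frame_pair: "frame u (a, b) = a *\<^sub>R u + frame u (0, b)" by (simp add: vec2_eq_iff)

lemma P_refl: "P (\<iota> - k) = pt k (- ell k, 0)"
  using chord[of k] by (simp add: pt_def vec2_eq_iff algebra_simps)

lemma P_refl': "P (\<iota> - k - 1) = pt k (e1 k - ell (k + 1), Hk k)"
proof -
  have "P (\<iota> - k - 1) = P (k + 1) - ell (k + 1) *\<^sub>R u" using chord[of "k + 1"] by (simp add: algebra_simps)
  also have "\<dots> = P k + E k - ell (k + 1) *\<^sub>R u" by (simp add: P_step)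
  also have "\<dots> = pt k (e1 k - ell (k + 1), Hk k)" by (simp add: E_frame pt_def vec2_eq_iff algebra_simps)
  finally show ?thesis .
qed

lemma P_right: "P (k + 1) = pt k (e1 k, Hk k)" by (simp add: P_step E_frame pt_def)

lemma E_refl: "E (\<iota> - k - 1) = frame u (ell (k + 1) - ell k - e1 k, - Hk k)"
  using P_refl[of k] P_refl'[of k] by (simp add: E_def pt_def vec2_eq_iff algebra_simps)

lemma hgt_pt: "cross2 u (pt k z) = ht k + snd z"
  by (simp add: pt_def ht_def cross2_frame norm_u)

lemma edge_side_pt: "edge_side k (pt k (s, \<eta>)) = e1 k * \<eta> - Hk k * s"
  by (simp add: edge_side_def pt_def E_frame cross2_frame norm_u)

lemma edge_side_pt_refl: "edge_side (\<iota> - k - 1) (pt k (s, \<eta>)) = (ell (k + 1) - ell k - e1 k) * \<eta> + Hk k * (s + ell k)"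
proof -
  have "edge_side (\<iota> - k - 1) (pt k (s, \<eta>)) = cross2 (E (\<iota> - k - 1)) (pt k (s, \<eta>) - P (\<iota> - k))"
    using P_step[of "\<iota> - k - 1"] by (simp add: edge_side_def)
  also have "pt k (s, \<eta>) - P (\<iota> - k) = frame u (s + ell k, \<eta>)"
    by (simp add: P_refl pt_def frame_linear(2)[symmetric])
  finally show ?thesis unfolding E_refl by (simp add: cross2_frame norm_u)
qed

lemma edge_side_pt_iff: assumes "k \<ge> \<iota>"
  shows "edge_side k (pt k (s, \<eta>)) \<ge> 0 \<longleftrightarrow> s \<le> rgt k \<eta>"
    "edge_side (\<iota> - k - 1) (pt k (s, \<eta>)) \<ge> 0 \<longleftrightarrow> lft k \<eta> \<le> s"
proof -
  have H: "Hk k > 0" using Hk_ge[OF assms] by simp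
  show "edge_side k (pt k (s, \<eta>)) \<ge> 0 \<longleftrightarrow> s \<le> rgt k \<eta>"
    unfolding edge_side_pt rgt_def using H by (simp add: field_simps)
  show "edge_side (\<iota> - k - 1) (pt k (s, \<eta>)) \<ge> 0 \<longleftrightarrow> lft k \<eta> \<le> s"
    unfolding edge_side_pt_refl lft_def using H by (simp add: field_simps)
qed

lemma rgt_lft: "k \<ge> \<iota> \<Longrightarrow> rgt k \<eta> - lft k \<eta> = ell k * (1 - \<eta> / Hk k) + ell (k + 1) * (\<eta> / Hk k)"
  using Hk_ge[of k] by (simp add: rgt_def lft_def field_simps)

lemma convex_Q: "convex Q" by simp

lemma P_in_Q: "P k \<in> Q" by (simp add: hull_inc)

text \<open>
The slice is a possibly degenerate trapezoid; its point at relative height \<open>\<theta>\<close> is a convex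
combination of points on the two bounding edges.
\<close>

lemma zone_in_Q:
  assumes k: "k \<ge> \<iota>" and \<eta>: "0 \<le> \<eta>" "\<eta> \<le> Hk k" and s: "lft k \<eta> \<le> s" "s \<le> rgt k \<eta>"
  shows "pt k (s, \<eta>) \<in> Q"
proof -
  define \<theta> where "\<theta> = \<eta> / Hk k"
  have H: "Hk k > 0" using Hk_ge[OF k] by simp
  have \<theta>: "0 \<le> \<theta>" "\<theta> \<le> 1" using \<eta> H by (auto simp: \<theta>_def)
  have \<eta>': "\<eta> = \<theta> * Hk k" using H by (simp add: \<theta>_def)
  have r: "pt k (rgt k \<eta>, \<eta>) = (1 - \<theta>) *\<^sub>R P k + \<theta> *\<^sub>R P (k + 1)"
    using H unfolding P_right by (simp add: \<eta>' rgt_def pt_def vec2_eq_iff algebra_simps)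
  have l: "pt k (lft k \<eta>, \<eta>) = (1 - \<theta>) *\<^sub>R P (\<iota> - k) + \<theta> *\<^sub>R P (\<iota> - k - 1)"
    using H unfolding P_refl P_refl' by (simp add: \<eta>' lft_def pt_def vec2_eq_iff) (simp add: algebra_simps)
  have lr: "pt k (rgt k \<eta>, \<eta>) \<in> Q" "pt k (lft k \<eta>, \<eta>) \<in> Q"
    unfolding r l using \<theta> by (intro convexD[OF convex_Q] P_in_Q; simp)+
  obtain \<tau> where \<tau>: "0 \<le> \<tau>" "\<tau> \<le> 1" "s = (1 - \<tau>) * lft k \<eta> + \<tau> * rgt k \<eta>"
    using s by (metis atLeastAtMost_iff closed_segment_eq_real_ivl1 in_segment(1) order_trans real_scaleR_def)
  have "pt k (s, \<eta>) = (1 - \<tau>) *\<^sub>R pt k (lft k \<eta>, \<eta>) + \<tau> *\<^sub>R pt k (rgt k \<eta>, \<eta>)"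
    by (simp add: \<tau>(3) pt_def vec2_eq_iff algebra_simps)
  then show ?thesis using convexD[OF convex_Q lr(2,1), of "1 - \<tau>" \<tau>] \<tau> by simp
qed

lemma ht_ge: assumes "k \<ge> \<iota>" shows "ht k \<ge> of_int (k - \<iota>)"
  using assms
proof (induction k rule: int_ge_induct)
  case base then show ?case using ht_d0 by (simp add: ht_def)
next
  case (step k) then show ?case using Hk_ge[of k] by (simp add: Hk_def)
qed

lemma ht_nonneg: "ht k \<ge> 0"
  using ht_ge[of k] ht_ge[of "\<iota> - k"] iota01 by (cases "k \<ge> \<iota>") (auto simp: ht_refl)

lemma ht_strict: assumes "\<iota> \<le> j" "j < k" shows "ht j + 1 \<le> ht k"
proof -
  have "j + 1 \<le> k" using assms by simp
  then show ?thesis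
  proof (induction k rule: int_ge_induct)
    case base then show ?case using Hk_ge[of j] assms by (simp add: Hk_def)
  next
    case (step k) then show ?case using Hk_ge[of k] assms by (simp add: Hk_def)
  qed
qed

lemma zone_exists: assumes "h \<ge> 0" obtains k where "k \<ge> \<iota>" "ht k \<le> h" "h < ht (k + 1)"
proof -
  obtain n :: nat where n: "h < real n" using reals_Archimedean2 by blast
  have "\<exists>k\<ge>\<iota>. ht k \<le> h \<and> \<not> ht (k + 1) \<le> h"
  proof (rule ccontr)
    assume *: "\<not> ?thesis"
    have "ht k \<le> h" if "k \<ge> \<iota>" for k
      using that
    proof (induction k rule: int_ge_induct)
      case base then show ?case using ht_d0 assms by (simp add: ht_def)
    next
      case (step k) then show ?case using * by auto
    qed
    from this[of "\<iota> + int n"] ht_ge[of "\<iota> + int n"] n show False by simp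
  qed
  then show ?thesis using that by force
qed

lemma index_cases: obtains "j \<ge> \<iota>" | "\<iota> - j \<ge> \<iota>" "\<iota> - j > j"
  using iota01 by linarith

lemma hgt_Q_nonneg: assumes "p \<in> Q" shows "cross2 u p \<ge> 0"
proof -
  have "convex {p. cross2 u p \<ge> 0}"
    by (rule convexI) (auto intro!: add_nonneg_nonneg mult_nonneg_nonneg)
  then have "convex hull (range P) \<subseteq> {p. cross2 u p \<ge> 0}"
    by (rule hull_minimal[rotated]) (use ht_nonneg in \<open>auto simp: ht_def\<close>)
  then show ?thesis using assms by auto
qed

end

context surf begin

lemma P_refl_sum: "P (k + 1) $ 1 + P k $ 1 = E k $ 2"
  using P_Suc[of k] by (simp add: E_def algebra_simps)

lemma P_neg1: "P (1 - k) $ 1 = - c * P k $ 1 + (c - 1) * P k $ 2 + 1"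
  "P (1 - k) $ 2 = - (c + 1) * P k $ 1 + c * P k $ 2 + 1"
  using P_Suc[of "- k"] P_neg[of k] by (simp_all add: algebra_simps)

end

text \<open>
Horizontal chords join \<open>P k\<close> to its mirror image \<open>P (- k)\<close>.
\<close>

sublocale surf \<subseteq> hor: chords c "vector [1, 0]" 0 2 "\<lambda>k. 2 * P_vertex c k $ 1"
proof
  show "norm (vector [1, 0] :: real^2) = 1" by (simp add: norm_vec_def L2_set_def sum_2)
  fix k :: int
  show "P k - P (0 - k) = (2 * P k $ 1) *\<^sub>R vector [1, 0]" by (simp add: P_neg vec2_eq_iff)
  show "cross2 (vector [1, 0]) (P 0) = 0" by (simp add: cross2_def)
  assume k: "0 \<le> k"
  then show "0 \<le> 2 * P k $ 1" using Px_sign(1)[of k] by simp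
  show "cross2 (vector [1, 0]) (P (k + 1)) \<ge> cross2 (vector [1, 0]) (P k) + 1"
    using E_nonneg_bounds[OF k] by (simp add: cross2_def P_step)
  show "2 * P k $ 1 + 2 * P (k + 1) $ 1 =
      2 * (cross2 (vector [1, 0]) (P (k + 1)) - cross2 (vector [1, 0]) (P k))"
    using P_refl_sum[of k] by (simp add: cross2_def E_def)
qed simp

text \<open>
Chords of slope 1 join \<open>P k\<close> to \<open>P (1 - k)\<close>: the map \<open>T_map c \<circ> reflect_x\<close> is an affine involution
whose linear part negates \<open>(1, 1)\<close>.
\<close>

sublocale surf \<subseteq> dia: chords c "vector [1 / sqrt 2, 1 / sqrt 2]" 1 "2 * (c + 1)"
  "\<lambda>k. sqrt 2 * ((c + 1) * P_vertex c k $ 1 - (c - 1) * P_vertex c k $ 2 - 1)"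
proof
  show "norm (vector [1 / sqrt 2, 1 / sqrt 2] :: real^2) = 1"
    by (simp add: norm_vec_def L2_set_def sum_2 power_divide)
  fix k :: int
  show "P k - P (1 - k) = (sqrt 2 * ((c + 1) * P k $ 1 - (c - 1) * P k $ 2 - 1)) *\<^sub>R vector [1 / sqrt 2, 1 / sqrt 2]"
    by (simp add: P_neg1 vec2_eq_iff algebra_simps)
  show "cross2 (vector [1 / sqrt 2, 1 / sqrt 2]) (P 1) = 0" by (simp add: cross2_def P_1)
  assume k: "1 \<le> k"
  have "1 \<le> (c + 1) * P k $ 1 - (c - 1) * P k $ 2"
    using k
  proof (induction k rule: int_ge_induct)
    case base then show ?case by (simp add: P_1)
  next
    case (step k)
    have "(c + 1) * E k $ 1 - (c - 1) * E k $ 2 = E (k - 1) $ 1 * (c + 1) + E (k - 1) $ 2 * (c - 1)"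
      using E_Suc[of "k - 1"] by (simp add: algebra_simps)
    also have "\<dots> \<ge> 0" using E_nonneg_bounds[of "k - 1"] step c1 by simp
    finally show ?case using step unfolding P_step by (simp add: algebra_simps)
  qed
  then show "0 \<le> sqrt 2 * ((c + 1) * P k $ 1 - (c - 1) * P k $ 2 - 1)" by simp
  have s2: "2 / sqrt 2 = sqrt 2" by (simp add: real_div_sqrt)
  have edge_side: "cross2 (vector [1 / sqrt 2, 1 / sqrt 2]) p = (p $ 2 - p $ 1) / sqrt 2" for p
    by (simp add: cross2_def diff_divide_distrib)
  have "E k $ 2 - E k $ 1 \<ge> 2"
    using E_diff[of "k - 1"] E_nonneg_bounds[of "k - 1"] k by simp
  then have "(E k $ 2 - E k $ 1) / sqrt 2 \<ge> 2 / sqrt 2" by (intro divide_right_mono) auto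
  moreover have "sqrt 2 \<ge> 1" by simp
  ultimately have "(E k $ 2 - E k $ 1) / sqrt 2 \<ge> 1" unfolding s2 by linarith
  then show "cross2 (vector [1 / sqrt 2, 1 / sqrt 2]) (P (k + 1)) \<ge> cross2 (vector [1 / sqrt 2, 1 / sqrt 2]) (P k) + 1"
    unfolding edge_side by (simp add: P_step diff_divide_distrib add_divide_distrib)
  have "(c + 1) * (P k $ 1 + P (k + 1) $ 1) - (c - 1) * (P k $ 2 + P (k + 1) $ 2) - 2 = (c + 1) * (E k $ 2 - E k $ 1)"
    unfolding E_def using P_Suc[of k] by (simp add: algebra_simps)
  then have "sqrt 2 * ((c + 1) * (P k $ 1 + P (k + 1) $ 1) - (c - 1) * (P k $ 2 + P (k + 1) $ 2) - 2)
     = (2 / sqrt 2) * ((c + 1) * (E k $ 2 - E k $ 1))"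
    unfolding s2 by simp
  also have "\<dots> = 2 * (c + 1) * ((E k $ 2 - E k $ 1) / sqrt 2)" by simp
  also have "(E k $ 2 - E k $ 1) / sqrt 2 = (P (k + 1) $ 2 - P (k + 1) $ 1) / sqrt 2 - (P k $ 2 - P k $ 1) / sqrt 2"
    by (simp add: E_def diff_divide_distrib)
  finally show "sqrt 2 * ((c + 1) * P k $ 1 - (c - 1) * P k $ 2 - 1) +
      sqrt 2 * ((c + 1) * P (k + 1) $ 1 - (c - 1) * P (k + 1) $ 2 - 1) =
      2 * (c + 1) * (cross2 (vector [1 / sqrt 2, 1 / sqrt 2]) (P (k + 1)) - cross2 (vector [1 / sqrt 2, 1 / sqrt 2]) (P k))"
    unfolding edge_side by (simp add: algebra_simps)
qed (use c1 in auto)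

context surf begin

section \<open>Half-planes, edges and extreme points of the polygon\<close>

lemma edge_side_nonneg: assumes "p \<in> Q" shows "edge_side k p \<ge> 0"
proof -
  have "convex {p. edge_side k p \<ge> 0}"
  proof (rule convexI)
    fix p q and a b :: real assume *: "p \<in> {p. edge_side k p \<ge> 0}" "q \<in> {p. edge_side k p \<ge> 0}" "0 \<le> a" "0 \<le> b" "a + b = 1"
    have "a *\<^sub>R p + b *\<^sub>R q - P k = a *\<^sub>R (p - P k) + b *\<^sub>R (q - P k)"
      using * by (simp add: algebra_simps scaleR_add_left[symmetric])
    then have "edge_side k (a *\<^sub>R p + b *\<^sub>R q) = a * edge_side k p + b * edge_side k q" unfolding edge_side_def by (simp only: cross2_simps)
    then show "a *\<^sub>R p + b *\<^sub>R q \<in> {p. edge_side k p \<ge> 0}" using * by simp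
  qed
  then have "convex hull (range P) \<subseteq> {p. edge_side k p \<ge> 0}"
    by (rule hull_minimal[rotated]) (auto simp: edge_side_P_nonneg)
  then show ?thesis using assms by auto
qed

text \<open>
The convex hull of infinitely many points is cut out by the lines through its edges: a point on
the right side of all edges lies in some slice between two horizontal chords, and there only the
two bounding edges matter.
\<close>

theorem Q_halfplanes: "p \<in> Q \<longleftrightarrow> (\<forall>k. edge_side k p \<ge> 0)"
proof
  assume *: "\<forall>k. edge_side k p \<ge> 0"
  have "edge_side 0 p \<ge> 0" "edge_side (-1) p \<ge> 0" using * by auto
  then have "p $ 2 \<ge> 0" using E_neg[of 0] P_neg[of 1] by (simp add: edge_side_def cross2_def E_0 P_1)
  then obtain k where k: "k \<ge> 0" "hor.ht k \<le> p $ 2" "p $ 2 < hor.ht (k + 1)" using hor.zone_exists by blast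
  obtain s \<eta> where z: "p = hor.pt k (s, \<eta>)"
    by (metis add_diff_cancel_left' diff_add_cancel hor.frame_un(1) hor.pt_def surj_pair add.commute)
  have "cross2 (vector [1, 0]) p = p $ 2" by (simp add: cross2_def)
  then have \<eta>: "\<eta> = p $ 2 - hor.ht k" using z hor.hgt_pt[of k "(s, \<eta>)"] by simp
  show "p \<in> Q"
    unfolding z
  proof (rule hor.zone_in_Q)
    show "0 \<le> \<eta>" "\<eta> \<le> hor.Hk k" using \<eta> k by (auto simp: hor.Hk_def)
    show "hor.lft k \<eta> \<le> s" "s \<le> hor.rgt k \<eta>"
      using hor.edge_side_pt_iff[OF k(1), of s \<eta>] * z by auto
  qed (use k in auto)
qed (auto simp: edge_side_nonneg)

lemma edge_subset_Q: "edge k \<subseteq> Q"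
  unfolding edge_def by (intro closed_segment_subset hor.convex_Q hor.P_in_Q)

lemma edge_iff: "p \<in> edge k \<longleftrightarrow> p \<in> Q \<and> edge_side k p = 0"
proof
  assume p: "p \<in> edge k"
  then obtain t where "p = (1 - t) *\<^sub>R P k + t *\<^sub>R P (k + 1)" by (auto simp: edge_def in_segment)
  then have "p - P k = t *\<^sub>R E k" by (simp add: E_def algebra_simps)
  then show "p \<in> Q \<and> edge_side k p = 0" using p edge_subset_Q[of k] by (auto simp: edge_side_def)
next
  assume *: "p \<in> Q \<and> edge_side k p = 0"
  define t where "t = (p $ 1 - P k $ 1) / E k $ 1"
  have a: "E k $ 1 > 0" using E1_ge[of k] by simp
  have pt: "p = P k + t *\<^sub>R E k" using * a by (simp add: t_def vec2_eq_iff edge_side_def cross2_def field_simps)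
  have "edge_side (k - 1) p \<ge> 0" "edge_side (k + 1) p \<ge> 0" using * edge_side_nonneg by auto
  moreover have "edge_side (k - 1) p = t * cross2 (E (k - 1)) (E k)"
    unfolding pt using edge_side_P(2)[of "k - 1"] by (simp add: edge_side_def)
  moreover have "edge_side (k + 1) p = (t - 1) * cross2 (E (k + 1)) (E k)"
  proof -
    have "p - P (k + 1) = (t - 1) *\<^sub>R E k" unfolding pt P_step by (simp add: algebra_simps)
    then show ?thesis by (simp add: edge_side_def)
  qed
  ultimately have "t \<ge> 0" "t \<le> 1"
    using cross_E_pos[of "k - 1" k] cross_E_neg[of k "k + 1"]
    by (auto simp: zero_le_mult_iff)
  then show "p \<in> edge k" unfolding edge_def in_segment pt P_step
    by (intro exI[of _ t]) (simp add: algebra_simps)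
qed

text \<open>
The lines of the two adjacent edges support the polygon and meet in \<open>P k\<close> only.
\<close>

lemma extreme_P: "P k extreme_point_of Q"
proof -
  have eq: "z = P k" if "edge_side k z = 0" "edge_side (k - 1) z = 0" for z
  proof -
    have *: "cross2 (E k) (z - P k) = 0" using that by (simp add: edge_side_def)
    have "edge_side (k - 1) (P k) = 0" using edge_side_P(2)[of "k - 1"] by simp
    then have **: "cross2 (E (k - 1)) (z - P k) = 0" using that by (simp add: edge_side_def)
    have D: "cross2 (E (k - 1)) (E k) \<noteq> 0" using cross_E_pos[of "k - 1" k] by simp
    have "cross2 (E (k - 1)) (E k) * (z - P k) $ 1 = 0" "cross2 (E (k - 1)) (E k) * (z - P k) $ 2 = 0"
      using * ** unfolding cross2_def by algebra+
    then show ?thesis using D by (simp add: vec2_eq_iff)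
  qed
  show ?thesis
    unfolding extreme_point_of_def
  proof (intro conjI ballI notI)
    show "P k \<in> Q" by (rule hor.P_in_Q)
    fix a b assume ab: "a \<in> Q" "b \<in> Q" "P k \<in> open_segment a b"
    then obtain t where t: "0 < t" "t < 1" "P k = (1 - t) *\<^sub>R a + t *\<^sub>R b" "a \<noteq> b" by (auto simp: in_segment)
    have z: "edge_side j a = 0 \<and> edge_side j b = 0" if "edge_side j (P k) = 0" for j
    proof -
      have "P k - P j = (1 - t) *\<^sub>R (a - P j) + t *\<^sub>R (b - P j)" by (simp add: t(3) algebra_simps)
      then have "0 = (1 - t) * edge_side j a + t * edge_side j b" using that by (simp add: edge_side_def)
      moreover have "(1 - t) * edge_side j a \<ge> 0" "t * edge_side j b \<ge> 0"
        using edge_side_nonneg[OF ab(1)] edge_side_nonneg[OF ab(2)] t(1,2) by simp_all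
      ultimately have "(1 - t) * edge_side j a = 0 \<and> t * edge_side j b = 0" by linarith
      then show ?thesis using t by auto
    qed
    have k1: "edge_side (k - 1) (P k) = 0" using edge_side_P(2)[of "k - 1"] by simp
    have "a = P k" by (rule eq) (use z[OF edge_side_P(1)] z[OF k1] in auto)
    moreover have "b = P k" by (rule eq) (use z[OF edge_side_P(1)] z[OF k1] in auto)
    ultimately have "a = b" by simp
    then show False using t by simp
  qed
qed

lemma extreme_iff: "p extreme_point_of Q \<longleftrightarrow> p \<in> range P"
  using extreme_point_of_convex_hull[of p "range P"] extreme_P by auto

end

section \<open>Points and vertices of the surface\<close>

lemma equiv_same_point: "equiv (Sigma UNIV (poly S)) (same_point S)"
proof (rule equivI)
  have "sym (glued S \<union> (glued S)\<inverse>)" by (rule sym_Un_converse)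
  then have "sym ((glued S \<union> (glued S)\<inverse>)\<^sup>*)" by (rule sym_rtrancl)
  then show "sym (same_point S)" unfolding same_point_def sym_def by auto
  show "same_point S \<subseteq> Sigma UNIV (poly S) \<times> Sigma UNIV (poly S)" unfolding same_point_def by auto
  show "refl_on (Sigma UNIV (poly S)) (same_point S)"
    unfolding same_point_def refl_on_def by auto
  show "trans (same_point S)" unfolding same_point_def trans_def
    by (auto intro: rtrancl_trans)
qed

lemma point_of_in_points: "p \<in> poly S i \<Longrightarrow> point_of S i p \<in> points S"
  by (auto simp: points_def point_of_def intro: quotientI)

lemma points_cases:
  assumes "x \<in> points S" obtains i p where "p \<in> poly S i" "x = point_of S i p"
  using assms by (auto simp: points_def point_of_def elim!: quotientE)

lemma mem_point_of: "p \<in> poly S i \<Longrightarrow> (i, p) \<in> point_of S i p"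
  unfolding point_of_def using equiv_class_self[OF equiv_same_point[of S]] by auto

lemma mem_pointD:
  assumes "x \<in> points S" "(i, p) \<in> x"
  shows "p \<in> poly S i" "x = point_of S i p"
proof -
  obtain j q where q: "q \<in> poly S j" "x = point_of S j q" using points_cases[OF assms(1)] .
  then have s: "((j, q), (i, p)) \<in> same_point S" using assms by (auto simp: point_of_def)
  then show "p \<in> poly S i" by (auto simp: same_point_def)
  show "x = point_of S i p"
    using equiv_class_eq[OF equiv_same_point s] q by (simp add: point_of_def)
qed

lemma point_of_eq_iff:
  assumes "p \<in> poly S i" "q \<in> poly S j"
  shows "point_of S i p = point_of S j q \<longleftrightarrow> ((i, p), (j, q)) \<in> same_point S"
  unfolding point_of_def using assms by (intro eq_equiv_class_iff[OF equiv_same_point]) auto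

lemma extreme_point_of_linear_image:
  assumes "linear f" "inj f"
  shows "f p extreme_point_of (f ` A) \<longleftrightarrow> p extreme_point_of A"
  unfolding extreme_point_of_def
  using open_segment_linear_image[OF assms] inj_image_mem_iff[OF assms(2)] by auto

fun sg :: "piece \<Rightarrow> real" where "sg QPlus = 1" | "sg QMinus = - 1"

text \<open>
The gluing turns \<open>P k\<close> on the first piece into \<open>- P (k + 1)\<close> and \<open>P (k + 1)\<close> into \<open>- P k\<close> on the
second. So the parity of the index, shifted by one on the second piece, is constant along the
vertex identifications.
\<close>

fun par :: "piece \<Rightarrow> int" where "par QPlus = 0" | "par QMinus = 1"

lemma sg_cases: "sg i = 1 \<or> sg i = - 1" by (cases i) auto
lemma sg_sq [simp]: "sg i * sg i = 1" "sg i * (sg i * t) = t" "sg i *\<^sub>R sg i *\<^sub>R (p::real^2) = p"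
  by (cases i; simp)+
lemma sg_nz [simp]: "sg i \<noteq> 0" by (cases i) auto
lemma abs_sg [simp]: "\<bar>sg i\<bar> = 1" by (cases i) auto
lemma sg_swap [simp]: "sg (swap_pieces i) = - sg i" "swap_pieces (swap_pieces i) = i"
  "swap_pieces i \<noteq> i" "i \<noteq> swap_pieces i"
  by (cases i; simp)+
lemma par_swap: "even (m + par (swap_pieces i)) \<longleftrightarrow> odd (m + par i)"
  by (cases i) auto
lemma sg_eq_iff: "sg i *\<^sub>R (p::real^2) = q \<longleftrightarrow> p = sg i *\<^sub>R q"
  by (cases i) auto
lemma dist_sg: "dist (sg i *\<^sub>R p) (sg i *\<^sub>R (q::real^2)) = dist p q"
  by (cases i) (auto simp: dist_minus)
lemma piece_cases2: "i = j \<or> i = swap_pieces j" by (cases i; cases j) auto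

context surf begin

lemma poly_S: "p \<in> poly S i \<longleftrightarrow> sg i *\<^sub>R p \<in> Q"
proof (cases i)
  case QMinus
  have "p \<in> uminus ` A \<longleftrightarrow> - p \<in> A" for A :: "(real^2) set" by (metis imageE image_eqI minus_minus)
  with QMinus show ?thesis by (simp add: S_surface_def)
qed (simp add: S_surface_def)

lemma poly_S_convex: "convex (poly S i)"
  by (cases i) (auto simp: S_surface_def intro: convex_negations)

text \<open>
One gluing step, in either direction. Edge \<open>k\<close> of the second piece is minus edge \<open>k\<close> of the first.
\<close>

definition step :: "piece \<Rightarrow> real^2 \<Rightarrow> piece \<Rightarrow> real^2 \<Rightarrow> bool" where
  "step i p j q \<longleftrightarrow> (\<exists>k. j = swap_pieces i \<and> sg i *\<^sub>R p \<in> edge k \<and> q = p - sg i *\<^sub>R (P k + P (k + 1)))"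

text \<open>
\<open>(i, p)\<close> is a vertex of a polygon whose shifted index has parity \<open>b\<close>.
\<close>

definition vrep :: "piece \<Rightarrow> real^2 \<Rightarrow> bool \<Rightarrow> bool" where
  "vrep i p b \<longleftrightarrow> (\<exists>m. sg i *\<^sub>R p = P m \<and> (even (m + par i) = b))"

definition eqv :: "piece \<Rightarrow> real^2 \<Rightarrow> piece \<Rightarrow> real^2 \<Rightarrow> bool" where
  "eqv i p j q \<longleftrightarrow> (i = j \<and> p = q) \<or> step i p j q \<or> (\<exists>b. vrep i p b \<and> vrep j q b)"

lemma edge_flip: "q \<in> edge k \<longleftrightarrow> P k + P (k + 1) - q \<in> edge k"
proof -
  have *: "P k + P (k + 1) - q \<in> edge k" if "q \<in> edge k" for q
  proof -
    from that obtain t where t: "0 \<le> t" "t \<le> 1" "q = (1 - t) *\<^sub>R P k + t *\<^sub>R P (k + 1)" by (auto simp: edge_def in_segment)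
    have "P k + P (k + 1) - q = (1 - (1 - t)) *\<^sub>R P k + (1 - t) *\<^sub>R P (k + 1)" unfolding t(3) by (simp add: algebra_simps)
    then show ?thesis unfolding edge_def in_segment using t(1,2) by (intro exI[of _ "1 - t"]) auto
  qed
  show ?thesis using *[of q] *[of "P k + P (k + 1) - q"] by auto
qed

lemma edge_x: "p \<in> edge k \<Longrightarrow> P k $ 1 \<le> p $ 1 \<and> p $ 1 \<le> P (k + 1) $ 1"
  and edge_x_left: "p \<in> edge k \<Longrightarrow> p $ 1 = P k $ 1 \<Longrightarrow> p = P k"
  and edge_x_right: "p \<in> edge k \<Longrightarrow> p $ 1 = P (k + 1) $ 1 \<Longrightarrow> p = P (k + 1)"
proof -
  assume "p \<in> edge k"
  then obtain t where t: "0 \<le> t" "t \<le> 1" "p = P k + t *\<^sub>R E k"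
    by (auto simp: edge_def in_segment E_def algebra_simps)
  have a: "E k $ 1 \<ge> 1" by (rule E1_ge)
  have t1: "t * E k $ 1 \<le> 1 * E k $ 1" using t a by (intro mult_right_mono) auto
  show "P k $ 1 \<le> p $ 1 \<and> p $ 1 \<le> P (k + 1) $ 1" using t a t1 by (simp add: P_step)
  show "p = P k" if "p $ 1 = P k $ 1" using that t(3) a by auto
  show "p = P (k + 1)" if "p $ 1 = P (k + 1) $ 1" using that t(3) a by (auto simp: P_step)
qed

lemma edge_meet: assumes "p \<in> edge j" "p \<in> edge k" "j \<noteq> k" shows "p \<in> range P"
proof -
  have *: "p = P k" if "p \<in> edge j" "p \<in> edge k" "j < k" for j k
  proof -
    have "P k $ 1 \<ge> P (j + 1) $ 1" using Px_mono[of "j + 1" k] that by simp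
    then have "p $ 1 = P k $ 1" using edge_x[OF that(1)] edge_x[OF that(2)] by linarith
    then show ?thesis using edge_x_left that by blast
  qed
  show ?thesis using *[of j k] *[of k j] assms by (cases "j < k") auto
qed

lemma P_in_edge [simp]: "P m \<in> edge k \<longleftrightarrow> m = k \<or> m = k + 1"
proof -
  have "P m \<in> edge k \<longleftrightarrow> edge_side k (P m) = 0" using edge_iff hor.P_in_Q by blast
  then show ?thesis using edge_side_P_pos[of m k] edge_side_P[of k] by (metis less_irrefl)
qed

lemma step_sym: assumes "step i p j q" shows "step j q i p"
proof -
  obtain k where k: "j = swap_pieces i" "sg i *\<^sub>R p \<in> edge k" "q = p - sg i *\<^sub>R (P k + P (k + 1))"
    using assms by (auto simp: step_def)
  have "sg j *\<^sub>R q = P k + P (k + 1) - sg i *\<^sub>R p" using k by (cases i) (auto simp: algebra_simps)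
  then have "sg j *\<^sub>R q \<in> edge k" using k(2) edge_flip by simp
  then show ?thesis unfolding step_def using k by (intro exI[of _ k]) auto
qed

lemma step_vrep: assumes "step i p j q" "vrep i p b" shows "vrep j q b"
proof -
  obtain k where k: "j = swap_pieces i" "sg i *\<^sub>R p \<in> edge k" "q = p - sg i *\<^sub>R (P k + P (k + 1))"
    using assms by (auto simp: step_def)
  obtain m where m: "sg i *\<^sub>R p = P m" "even (m + par i) = b" using assms by (auto simp: vrep_def)
  have q: "sg j *\<^sub>R q = P k + P (k + 1) - P m" using k m(1)[symmetric] by (cases i) (auto simp: algebra_simps)
  have mk: "m = k \<or> m = k + 1" using k m by simp
  show ?thesis
  proof (cases "m = k")
    case True
    then show ?thesis unfolding vrep_def using q m par_swap[of "k + 1" i] k by (intro exI[of _ "k + 1"]) auto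
  next
    case False
    then have "m = k + 1" using mk by simp
    then show ?thesis unfolding vrep_def using q m par_swap[of k i] k by (intro exI[of _ k]) auto
  qed
qed

lemma vrep_unique: "vrep i p b \<Longrightarrow> vrep i p b' \<Longrightarrow> b = b'"
  by (auto simp: vrep_def)

lemma vertex_has_vrep: "sg i *\<^sub>R p \<in> range P \<Longrightarrow> \<exists>b. vrep i p b"
  by (auto simp: vrep_def)

lemma eqv_step: assumes "eqv i p j q" "step j q l r" shows "eqv i p l r"
  using assms(1)[unfolded eqv_def]
proof (elim disjE)
  assume "i = j \<and> p = q" then show ?thesis using assms(2) by (simp add: eqv_def)
next
  assume "\<exists>b. vrep i p b \<and> vrep j q b" then show ?thesis using step_vrep[OF assms(2)] by (auto simp: eqv_def)
next
  assume s: "step i p j q"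
  obtain k where k: "i = swap_pieces j" "sg j *\<^sub>R q \<in> edge k" "p = q - sg j *\<^sub>R (P k + P (k + 1))"
    using step_sym[OF s] by (auto simp: step_def)
  obtain k' where k': "l = swap_pieces j" "sg j *\<^sub>R q \<in> edge k'" "r = q - sg j *\<^sub>R (P k' + P (k' + 1))"
    using assms(2) by (auto simp: step_def)
  show ?thesis
  proof (cases "k = k'")
    case True then show ?thesis using k k' by (simp add: eqv_def)
  next
    case False
    then obtain b where "vrep j q b" using edge_meet k k' vertex_has_vrep by blast
    then show ?thesis using step_vrep[OF assms(2)] step_vrep[OF step_sym[OF s]] by (auto simp: eqv_def)
  qed
qed

lemma glued_step: "((i, p), (j, q)) \<in> glued S \<union> (glued S)\<inverse> \<longleftrightarrow> step i p j q"
proof -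
  have a: "((i, p), (j, q)) \<in> glued S \<longleftrightarrow> i = QPlus \<and> step i p j q" for i p j q
  proof
    assume "((i, p), (j, q)) \<in> glued S"
    then obtain k where "i = QPlus" "j = QMinus" "p \<in> edge k" "q = p + - (P k + P (k + 1))"
      unfolding glued_def edge_def by (auto simp: S_surface_def)
    then show "i = QPlus \<and> step i p j q" unfolding step_def by (auto intro!: exI[of _ k])
  next
    assume "i = QPlus \<and> step i p j q"
    then obtain k where k: "i = QPlus" "j = QMinus" "p \<in> edge k" "q = p + - (P k + P (k + 1))"
      unfolding step_def by auto
    have "(QPlus, edge k, QMinus, - (P k + P (k + 1))) \<in> gluings S"
      unfolding edge_def S_surface_def by auto
    then show "((i, p), (j, q)) \<in> glued S" using k unfolding glued_def by blast
  qed
  have "step i p j q \<Longrightarrow> i \<noteq> QPlus \<Longrightarrow> j = QPlus" by (cases i) (auto simp: step_def)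
  then show ?thesis using a[of i p j q] a[of j q i p] step_sym by (auto simp del: swap_pieces.simps)
qed

lemma vrep_connected:
  assumes "vrep i p b" "vrep j q b"
  shows "((i, p), (j, q)) \<in> (glued S \<union> (glued S)\<inverse>)\<^sup>*"
proof -
  let ?G = "glued S \<union> (glued S)\<inverse>"
  define base where "base i m = (if even m then i else swap_pieces i)" for i and m :: int
  have st: "((i, sg i *\<^sub>R P m), (swap_pieces i, sg (swap_pieces i) *\<^sub>R P (m + 1))) \<in> ?G" for i m
    unfolding glued_step step_def
    by (intro exI[of _ m]) (simp add: algebra_simps)
  have st': "((swap_pieces i, sg (swap_pieces i) *\<^sub>R P (m + 1)), (i, sg i *\<^sub>R P m)) \<in> ?G" for i m
    using st[of i m] by auto
  have *: "((i, sg i *\<^sub>R P m), (base i m, 0)) \<in> ?G\<^sup>*" for i m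
  proof (induction m arbitrary: i rule: int_induct[where k = 0])
    case base then show ?case by (simp add: base_def)
  next
    case (step1 m)
    have "((i, sg i *\<^sub>R P (m + 1)), (swap_pieces i, sg (swap_pieces i) *\<^sub>R P m)) \<in> ?G"
      using st'[of "swap_pieces i" m] by simp
    moreover have "base (swap_pieces i) m = base i (m + 1)" by (auto simp: base_def)
    ultimately show ?case using converse_rtrancl_into_rtrancl[OF _ step1(2)[of "swap_pieces i"]] by metis
  next
    case (step2 m)
    have "((i, sg i *\<^sub>R P (m - 1)), (swap_pieces i, sg (swap_pieces i) *\<^sub>R P m)) \<in> ?G"
      using st[of i "m - 1"] by simp
    moreover have "base (swap_pieces i) m = base i (m - 1)" by (auto simp: base_def)
    ultimately show ?case using converse_rtrancl_into_rtrancl[OF _ step2(2)[of "swap_pieces i"]] by metis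
  qed
  obtain m n where m: "p = sg i *\<^sub>R P m" "even (m + par i) = b" and n: "q = sg j *\<^sub>R P n" "even (n + par j) = b"
    using assms by (auto simp: vrep_def sg_eq_iff)
  have "base i m = base j n" using m(2) n(2) unfolding base_def by (cases i; cases j; cases b) simp_all
  then have "((i, p), (base j n, 0)) \<in> ?G\<^sup>*" using *[of i m] m by simp
  moreover have "((base j n, 0), (j, q)) \<in> ?G\<^sup>*"
    using *[of j n] n sym_rtrancl[OF sym_Un_converse[of "glued S"]] by (auto dest: symD)
  ultimately show ?thesis by (rule rtrancl_trans)
qed

text \<open>
Away from the vertices a point lies on at most one edge, so that at most one gluing step is
possible. A vertex lies on two edges, and repeated steps reach all vertices of the same shifted
parity but no others. Hence the surface has exactly two vertex points.
\<close>

theorem same_point_iff: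
  "((i, p), (j, q)) \<in> same_point S \<longleftrightarrow> p \<in> poly S i \<and> q \<in> poly S j \<and> eqv i p j q"
proof -
  have "eqv i p (fst y) (snd y)" if "((i, p), y) \<in> (glued S \<union> (glued S)\<inverse>)\<^sup>*" for y
    using that
  proof (induction rule: rtrancl_induct)
    case base then show ?case by (simp add: eqv_def)
  next
    case (step y z)
    then show ?case using eqv_step glued_step[of "fst y" "snd y" "fst z" "snd z"]
      by (metis prod.collapse)
  qed
  moreover have "((i, p), (j, q)) \<in> (glued S \<union> (glued S)\<inverse>)\<^sup>*" if "eqv i p j q"
    using that glued_step[of i p j q] vrep_connected[of i p _ j q] unfolding eqv_def by auto
  ultimately show ?thesis unfolding same_point_def by fastforce
qed

lemma point_eq: "p \<in> poly S i \<Longrightarrow> q \<in> poly S j \<Longrightarrow> point_of S i p = point_of S j q \<longleftrightarrow> eqv i p j q"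
  by (simp add: point_of_eq_iff same_point_iff)

lemma mem_point_iff:
  assumes "p \<in> poly S i" shows "(j, q) \<in> point_of S i p \<longleftrightarrow> q \<in> poly S j \<and> eqv i p j q"
  using assms by (simp add: point_of_def same_point_iff)

lemma eqv_poly: "p \<in> poly S i \<Longrightarrow> step i p j q \<Longrightarrow> q \<in> poly S j"
proof -
  assume "step i p j q"
  then have "step j q i p" by (rule step_sym)
  then show ?thesis unfolding step_def poly_S using edge_subset_Q by auto
qed

lemma extreme_poly: "p extreme_point_of poly S i \<longleftrightarrow> sg i *\<^sub>R p \<in> range P"
proof (cases i)
  case QPlus then show ?thesis using extreme_iff[of p] by (simp add: S_surface_def)
next
  case QMinus
  have "- (- p) extreme_point_of (uminus ` Q) \<longleftrightarrow> - p extreme_point_of Q"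
    by (rule extreme_point_of_linear_image) (auto intro: linear_uminus)
  with QMinus show ?thesis using extreme_iff[of "- p"] by (simp add: S_surface_def)
qed

lemma V_iff: "x \<in> V \<longleftrightarrow> x \<in> X \<and> (\<exists>i p. (i, p) \<in> x \<and> sg i *\<^sub>R p \<in> range P)"
  unfolding vertices_def by (auto simp: extreme_poly)

lemma V_subset: "V \<subseteq> X" unfolding vertices_def by auto

lemma vertex_poly: "sg i *\<^sub>R P m \<in> poly S i"
  by (simp add: poly_S hor.P_in_Q del: Q_piece.simps)

definition vtx :: "bool \<Rightarrow> piece surface_point" where
  "vtx b = point_of S QPlus (P (if b then 0 else 1))"

lemma vtx_eq: "point_of S i (sg i *\<^sub>R P m) = vtx (even (m + par i))"
proof -
  have "vrep i (sg i *\<^sub>R P m) (even (m + par i))" by (auto simp: vrep_def)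
  moreover have "vrep QPlus (P (if b then 0 else 1)) b" for b by (auto simp: vrep_def split: if_splits)
  ultimately have "eqv i (sg i *\<^sub>R P m) QPlus (P (if even (m + par i) then 0 else 1))"
    unfolding eqv_def by blast
  moreover have "P n \<in> poly S QPlus" for n using vertex_poly[of QPlus n] by simp
  ultimately show ?thesis unfolding vtx_def using point_eq[OF vertex_poly] by blast
qed

lemma vtx_mem: "(i, p) \<in> vtx b \<longleftrightarrow> vrep i p b"
proof
  assume v: "vrep i p b"
  then obtain m where m: "p = sg i *\<^sub>R P m" "even (m + par i) = b" by (auto simp: vrep_def sg_eq_iff)
  then have "vtx b = point_of S i p" using vtx_eq by simp
  then show "(i, p) \<in> vtx b" using mem_point_of[of p S i] vertex_poly[of i m] m by auto
next
  assume "(i, p) \<in> vtx b"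
  moreover have pp: "P n \<in> poly S QPlus" for n using vertex_poly[of QPlus n] by simp
  ultimately have e: "eqv QPlus (P (if b then 0 else 1)) i p" unfolding vtx_def by (subst (asm) mem_point_iff) auto
  have v: "vrep QPlus (P (if b then 0 else 1)) b" by (auto simp: vrep_def split: if_splits)
  from e v show "vrep i p b" unfolding eqv_def using step_vrep vrep_unique by blast
qed

lemma vtx_in_V: "vtx b \<in> V"
proof -
  have "vtx b \<in> X" unfolding vtx_def using vertex_poly[of QPlus] by (intro point_of_in_points) auto
  moreover have "(QPlus, P (if b then 0 else 1)) \<in> vtx b" unfolding vtx_mem by (auto simp: vrep_def split: if_splits)
  ultimately show ?thesis unfolding V_iff by (intro conjI exI[of _ QPlus]) auto
qed

lemma V_eq: "V = {vtx True, vtx False}"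
proof -
  have "x \<in> range vtx" if "x \<in> V" for x
  proof -
    from that obtain i p m where *: "x \<in> X" "(i, p) \<in> x" "sg i *\<^sub>R p = P m" unfolding V_iff by auto
    then have "p = sg i *\<^sub>R P m" by (simp add: sg_eq_iff)
    then show ?thesis using mem_pointD(2)[OF *(1,2)] vtx_eq by auto
  qed
  moreover have "range vtx = {vtx True, vtx False}" by (auto simp: UNIV_bool)
  ultimately show ?thesis using vtx_in_V by blast
qed

lemma vtx_neq: "vtx True \<noteq> vtx False"
proof
  assume "vtx True = vtx False"
  moreover have v: "vrep QPlus (P 0) True" unfolding vrep_def by (intro exI[of _ 0]) simp
  ultimately have "vrep QPlus (P 0) False" using vtx_mem by metis
  then show False using vrep_unique v by blast
qed

lemma vtx_inj [simp]: "vtx a = vtx b \<longleftrightarrow> a = b" using vtx_neq by (cases a; cases b) auto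

lemma V_rep: assumes "x \<in> V" "(i, p) \<in> x" shows "sg i *\<^sub>R p \<in> range P"
  using assms by (auto simp: V_eq vtx_mem vrep_def)

lemma point_of_V_iff: assumes "p \<in> poly S i" shows "point_of S i p \<in> V \<longleftrightarrow> sg i *\<^sub>R p \<in> range P"
  using V_rep[of "point_of S i p" i p] mem_point_of[OF assms] point_of_in_points[OF assms] V_iff by blast

lemma nonvertex_reps:
  assumes "x \<in> X - V" "(i, p) \<in> x" "(j, q) \<in> x"
  shows "(i = j \<and> p = q) \<or> step i p j q"
proof -
  have xp: "x = point_of S i p" "p \<in> poly S i" using mem_pointD[of x S i p] assms by auto
  have "(j, q) \<in> point_of S i p" using assms(3) unfolding xp(1) .
  then have "eqv i p j q" using mem_point_iff[OF xp(2)] by simp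
  moreover have "\<not> vrep i p b" for b
  proof
    assume "vrep i p b"
    then have "sg i *\<^sub>R p \<in> range P" unfolding vrep_def by blast
    then show False using assms(1) point_of_V_iff[OF xp(2)] xp(1) by simp
  qed
  ultimately show ?thesis unfolding eqv_def by blast
qed

lemma nonvertex_rep_unique:
  assumes "x \<in> X - V" "(i, p) \<in> x" "(i, q) \<in> x" shows "p = q"
  using nonvertex_reps[OF assms] by (auto simp: step_def)

lemma P_dist: "m \<noteq> n \<Longrightarrow> dist (P m) (P n) \<ge> 1"
proof -
  assume "m \<noteq> n"
  then have "\<bar>(P m - P n) $ 1\<bar> \<ge> 1" using Px_mono[of m n] Px_mono[of n m] by (cases "m < n") auto
  then show ?thesis unfolding dist_norm using component_le_norm_cart[of "P m - P n" 1] by linarith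
qed

lemma rep_unique:
  assumes "x \<in> X" "(i, p) \<in> x" "(i, q) \<in> x" "dist p q < 1" shows "p = q"
proof (cases "x \<in> V")
  case True
  then obtain m n where "p = sg i *\<^sub>R P m" "q = sg i *\<^sub>R P n"
    using V_rep[OF True assms(2)] V_rep[OF True assms(3)] by (auto simp: sg_eq_iff)
  then show ?thesis using assms(4) P_dist[of m n] by (cases "m = n") (auto simp: dist_sg)
qed (use assms nonvertex_rep_unique in auto)

text \<open>
Within distance \<open>r\<close> of any representative of \<open>x\<close> there are only points of edges through that
representative. This makes gluing steps near \<open>x\<close> commute with taking the difference to a
representative, see \<open>transfer\<close>.
\<close>

definition edge_radius :: "piece surface_point \<Rightarrow> real \<Rightarrow> bool" where
  "edge_radius x r \<longleftrightarrow> r > 0 \<and> (\<forall>(i, p) \<in> x. \<forall>q k. dist q p < r \<and> sg i *\<^sub>R q \<in> edge k \<longrightarrow> sg i *\<^sub>R p \<in> edge k)"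

lemma closed_edge: "closed (edge k)" by (simp add: edge_def)

lemma near_edge: "\<exists>r>0. \<forall>q k. dist q p < r \<and> q \<in> edge k \<longrightarrow> p \<in> edge k"
proof -
  obtain k0 where k0: "P k0 $ 1 \<le> p $ 1" "p $ 1 < P (k0 + 1) $ 1" using x_slab by blast
  have "\<forall>\<^sub>F q in nhds p. q \<in> edge k \<longrightarrow> p \<in> edge k" for k
  proof (cases "p \<in> edge k")
    case False
    then have "open (- edge k)" "p \<in> - edge k" using closed_edge by auto
    then have "\<forall>\<^sub>F q in nhds p. q \<in> - edge k" by (rule eventually_nhds_in_open)
    then show ?thesis by eventually_elim auto
  qed auto
  then have "\<forall>\<^sub>F q in nhds p. \<forall>k\<in>{k0-1..k0+1}. q \<in> edge k \<longrightarrow> p \<in> edge k"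
    by (intro eventually_ball_finite) auto
  then obtain r where r: "r > 0" "\<And>q k. dist q p < r \<Longrightarrow> k \<in> {k0-1..k0+1} \<Longrightarrow> q \<in> edge k \<Longrightarrow> p \<in> edge k"
    unfolding eventually_nhds_metric by auto
  have "p \<in> edge k" if "dist q p < min r 1" "q \<in> edge k" for q k
  proof -
    have "\<bar>(q - p) $ 1\<bar> < 1" using component_le_norm_cart[of "q - p" 1] that by (simp add: dist_norm)
    then have *: "\<bar>q $ 1 - p $ 1\<bar> < 1" by simp
    have "k < k0 + 2"
    proof (rule ccontr)
      assume "\<not> k < k0 + 2"
      then have "P k $ 1 \<ge> P (k0 + 1) $ 1 + 1" using Px_mono[of "k0 + 1" k] by simp
      then show False using edge_x[OF that(2)] * k0 by linarith
    qed
    moreover have "k + 1 > k0 - 1"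
    proof (rule ccontr)
      assume "\<not> k + 1 > k0 - 1"
      then have "P (k + 1) $ 1 + 1 \<le> P k0 $ 1" using Px_mono[of "k + 1" k0] by simp
      then show False using edge_x[OF that(2)] * k0 by linarith
    qed
    ultimately show ?thesis using r(2)[of q k] that by auto
  qed
  then show ?thesis using r(1) by (intro exI[of _ "min r 1"]) auto
qed

lemma near_edge_vertex: assumes "dist q (P m) < 1" "q \<in> edge k" shows "P m \<in> edge k"
proof -
  have "\<bar>(q - P m) $ 1\<bar> < 1" using component_le_norm_cart[of "q - P m" 1] assms by (simp add: dist_norm)
  then have *: "\<bar>q $ 1 - P m $ 1\<bar> < 1" by simp
  have "k \<le> m"
  proof (rule ccontr)
    assume "\<not> k \<le> m"
    then have "P k $ 1 \<ge> P m $ 1 + 1" using Px_mono[of m k] by simp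
    then show False using edge_x[OF assms(2)] * by linarith
  qed
  moreover have "m \<le> k + 1"
  proof (rule ccontr)
    assume "\<not> m \<le> k + 1"
    then have "P (k + 1) $ 1 + 1 \<le> P m $ 1" using Px_mono[of "k + 1" m] by simp
    then show False using edge_x[OF assms(2)] * by linarith
  qed
  ultimately show ?thesis by auto
qed

lemma edge_radius_mono: "edge_radius x r \<Longrightarrow> 0 < r' \<Longrightarrow> r' \<le> r \<Longrightarrow> edge_radius x r'"
  unfolding edge_radius_def by (safe; force)

lemma edge_radius_vertex: assumes "x \<in> V" shows "edge_radius x 1"
  unfolding edge_radius_def
proof (safe)
  fix i p q k assume *: "(i, p) \<in> x" "dist q p < 1" "sg i *\<^sub>R q \<in> edge k"
  obtain m where m: "sg i *\<^sub>R p = P m" using V_rep[OF assms *(1)] by auto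
  then show "sg i *\<^sub>R p \<in> edge k"
    using near_edge_vertex[of "sg i *\<^sub>R q" m k] * by (metis dist_sg)
qed auto

text \<open>
A regular point has at most one representative in each piece, and the edges are locally finite. At
a vertex, which has infinitely many representatives, the radius 1 works for all of them at once
since edges are at least 1 wide.
\<close>

lemma edge_radius_exists: assumes "x \<in> X" shows "\<exists>r. edge_radius x r \<and> r \<le> 1 / 2"
proof (cases "x \<in> V")
  case True
  then show ?thesis using edge_radius_mono[OF edge_radius_vertex, of x "1/2"] by auto
next
  case False
  obtain i p where p: "p \<in> poly S i" "x = point_of S i p" using points_cases[OF assms] .
  then have ip: "(i, p) \<in> x" using mem_point_of by auto
  define q where "q = (SOME q. (swap_pieces i, q) \<in> x)"
  have only: "(j, r) = (i, p) \<or> (j, r) = (swap_pieces i, q)" if "(j, r) \<in> x" for j r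
  proof (cases "j = i")
    case True
    then show ?thesis using nonvertex_rep_unique[of x i p r] that assms False ip by auto
  next
    case False2: False
    then have j: "j = swap_pieces i" using piece_cases2 by blast
    then have "(swap_pieces i, q) \<in> x" unfolding q_def using that someI by metis
    then show ?thesis using nonvertex_rep_unique[of x "swap_pieces i" q r] that assms False j by auto
  qed
  obtain r1 where r1: "r1 > 0" "\<And>z k. dist z (sg i *\<^sub>R p) < r1 \<Longrightarrow> z \<in> edge k \<Longrightarrow> sg i *\<^sub>R p \<in> edge k"
    using near_edge by metis
  let ?j = "swap_pieces i"
  obtain r2 where r2: "r2 > 0" "\<And>z k. dist z (sg ?j *\<^sub>R q) < r2 \<Longrightarrow> z \<in> edge k \<Longrightarrow> sg ?j *\<^sub>R q \<in> edge k"
    using near_edge by metis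
  have "edge_radius x (min (min r1 r2) (1/2))"
    unfolding edge_radius_def
  proof (safe)
    fix j p' z k
    assume *: "(j, p') \<in> x" "dist z p' < min (min r1 r2) (1/2)" "sg j *\<^sub>R z \<in> edge k"
    then have d: "dist (sg j *\<^sub>R z) (sg j *\<^sub>R p') < min r1 r2" using dist_sg by simp
    from only[OF *(1)] show "sg j *\<^sub>R p' \<in> edge k"
    proof
      assume "(j, p') = (i, p)" then show ?thesis using r1(2)[OF _ *(3)] d by auto
    next
      assume "(j, p') = (swap_pieces i, q)" then show ?thesis using r2(2)[OF _ *(3)] d by auto
    qed
  qed (use r1 r2 in auto)
  then show ?thesis by (intro exI[of _ "min (min r1 r2) (1/2)"]) auto
qed

text \<open>
If \<open>q\<close> is glued to \<open>q'\<close> by a step over an edge, that edge contains the representative \<open>p\<close> near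
\<open>q\<close>, and the same translation carries \<open>p\<close> to another representative of \<open>x\<close>.
\<close>

lemma transfer:
  assumes x: "x \<in> X" "edge_radius x r" "(i, p) \<in> x" and q: "dist q p < r" "q \<in> poly S i"
    and e: "eqv i q j q'" "q' \<in> poly S j"
  shows "\<exists>p'. (j, p') \<in> x \<and> q' - p' = q - p"
proof -
  have ed: "sg i *\<^sub>R p \<in> edge k" if "sg i *\<^sub>R q \<in> edge k" for k
    using x(2,3) q(1) that unfolding edge_radius_def by blast
  have pp: "p \<in> poly S i" "x = point_of S i p" using mem_pointD[OF x(1,3)] .
  show ?thesis using e(1) unfolding eqv_def
  proof (elim disjE)
    assume "i = j \<and> q = q'" then show ?thesis using x by auto
  next
    assume "step i q j q'"
    then obtain k where k: "j = swap_pieces i" "sg i *\<^sub>R q \<in> edge k" "q' = q - sg i *\<^sub>R (P k + P (k + 1))"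
      by (auto simp: step_def)
    define p' where "p' = p - sg i *\<^sub>R (P k + P (k + 1))"
    have "step i p j p'" unfolding step_def using ed k p'_def by blast
    moreover have "p' \<in> poly S j" using eqv_poly[OF pp(1) \<open>step i p j p'\<close>] .
    ultimately have "(j, p') \<in> x" using mem_point_iff[OF pp(1), of j p'] unfolding pp(2) eqv_def by simp
    then show ?thesis using k p'_def by auto
  next
    assume "\<exists>b. vrep i q b \<and> vrep j q' b"
    then obtain b m where b: "vrep i q b" "vrep j q' b" "sg i *\<^sub>R q = P m" by (auto simp: vrep_def)
    then have "sg i *\<^sub>R p \<in> edge m" "sg i *\<^sub>R p \<in> edge (m - 1)" using ed by auto
    then have "sg i *\<^sub>R p \<in> range P" using edge_meet[of _ m "m - 1"] by auto
    then obtain n where n: "sg i *\<^sub>R p = P n" by auto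
    then have "n = m" using \<open>sg i *\<^sub>R p \<in> edge m\<close> \<open>sg i *\<^sub>R p \<in> edge (m - 1)\<close> by auto
    then have "p = q" using n b(3) by (metis sg_eq_iff)
    then have "(j, q') \<in> x" using mem_point_iff[OF pp(1), of j q'] e unfolding pp(2) by simp
    then show ?thesis using \<open>p = q\<close> by auto
  qed
qed

lemma offset_unique:
  assumes x: "x \<in> X" "edge_radius x r" "r \<le> 1 / 2" and "(i, p) \<in> x" "(j, p') \<in> x"
    and q: "q \<in> poly S i" "q' \<in> poly S j" "point_of S i q = point_of S j q'" "dist q p < r" "dist q' p' < r"
  shows "q - p = q' - p'"
proof -
  have "eqv i q j q'" using q point_eq by blast
  then obtain p'' where p'': "(j, p'') \<in> x" "q' - p'' = q - p"
    using transfer[OF x(1,2) assms(4) q(4,1) _ q(2)] by blast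
  have "dist q' p'' < r" using p''(2) q(4) by (simp add: dist_norm)
  then have "dist p' p'' < 1" using q(5) x(3) dist_triangle[of p' p'' q'] by (simp add: dist_commute)
  then have "p' = p''" using rep_unique[OF x(1) assms(5) p''(1)] by simp
  then show ?thesis using p'' by simp
qed

section \<open>The polygon near a regular point\<close>

lemma slab_in_Q: assumes "P k $ 1 \<le> z $ 1" "z $ 1 \<le> P (k + 1) $ 1" "edge_side k z \<ge> 0" shows "z \<in> Q"
proof -
  have a: "E k $ 1 > 0" using E1_ge[of k] by simp
  define t where "t = (z $ 1 - P k $ 1) / E k $ 1"
  have t: "0 \<le> t" "t \<le> 1" using assms a by (auto simp: t_def P_step)
  define w where "w = (1 - t) *\<^sub>R P k + t *\<^sub>R P (k + 1)"
  have w: "w \<in> edge k" unfolding w_def edge_def in_segment using t by auto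
  have w1: "w $ 1 = z $ 1" using a unfolding w_def t_def P_step by (simp add: field_simps)
  have "edge_side k z = edge_side k w + E k $ 1 * (z $ 2 - w $ 2)" using w1 by (simp add: edge_side_def cross2_def algebra_simps)
  moreover have "edge_side k w = 0" using w edge_iff by blast
  ultimately have "z $ 2 \<ge> w $ 2" using assms(3) a by (simp add: zero_le_mult_iff)
  have "edge_side j z \<ge> 0" for j
  proof -
    have "edge_side j z = edge_side j w + E j $ 1 * (z $ 2 - w $ 2)" using w1 by (simp add: edge_side_def cross2_def algebra_simps)
    moreover have "edge_side j w \<ge> 0" using w edge_subset_Q edge_side_nonneg by blast
    moreover have "E j $ 1 * (z $ 2 - w $ 2) \<ge> 0" using E1_ge[of j] \<open>z $ 2 \<ge> w $ 2\<close> by (intro mult_nonneg_nonneg) auto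
    ultimately show ?thesis by simp
  qed
  then show ?thesis using Q_halfplanes by blast
qed

lemma edge_side_add: "edge_side k (p + h) = edge_side k p + cross2 (E k) h" by (simp add: edge_side_def)

lemma tendsto_comp: "((\<lambda>h. (p + h) $ i) \<longlongrightarrow> p $ i) (nhds (0::real^2))"
  by (rule tendsto_eq_intros refl tendsto_vec_nth tendsto_add tendsto_const filterlim_ident | simp)+

lemma tendsto_edge_side: "((\<lambda>h. edge_side k (p + h)) \<longlongrightarrow> edge_side k p) (nhds (0::real^2))"
proof -
  have c: "((\<lambda>h::real^2. h $ 1) \<longlongrightarrow> 0) (nhds 0)" "((\<lambda>h::real^2. h $ 2) \<longlongrightarrow> 0) (nhds 0)"
    using tendsto_comp[of 0 1] tendsto_comp[of 0 2] by simp_all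
  have "((\<lambda>h::real^2. edge_side k p + (E k $ 1 * h $ 2 - E k $ 2 * h $ 1)) \<longlongrightarrow> edge_side k p + (E k $ 1 * 0 - E k $ 2 * 0)) (nhds 0)"
    by (intro tendsto_intros c)
  then show ?thesis by (simp add: edge_side_add cross2_def)
qed

text \<open>
Near a point that is no vertex the polygon is the whole plane or a half-plane, according to
whether the point lies on an edge.
\<close>

lemma local_Q:
  assumes p: "p \<in> Q" "p \<notin> range P"
  shows "\<forall>\<^sub>F h in nhds 0. p + h \<in> Q \<longleftrightarrow> (\<forall>k. p \<in> edge k \<longrightarrow> cross2 (E k) h \<ge> 0)"
proof -
  obtain k where k: "P k $ 1 \<le> p $ 1" "p $ 1 < P (k + 1) $ 1" using x_slab by blast
  have only: "j = k \<or> j = k - 1 \<and> p $ 1 = P k $ 1" if "p \<in> edge j" for j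
  proof -
    have e: "P j $ 1 \<le> p $ 1" "p $ 1 \<le> P (j + 1) $ 1" using edge_x[OF that] by auto
    have "j < k + 1" using e k Px_mono[of "k + 1" j] by (cases "j < k + 1") auto
    moreover have "k \<le> j + 1" using e k Px_mono[of "j + 1" k] by (cases "k \<le> j + 1") auto
    ultimately have "j = k \<or> j = k - 1" by auto
    moreover have "p $ 1 = P k $ 1" if "j = k - 1" using that e k by simp
    ultimately show ?thesis by blast
  qed
  have ne: "\<not> (p \<in> edge j \<and> (p $ 1 = P j $ 1 \<or> p $ 1 = P (j + 1) $ 1))" for j
    using edge_x_left edge_x_right p by blast
  show ?thesis
  proof (cases "p $ 1 = P k $ 1")
    case True
    have no: "p \<notin> edge j" for j using only[of j] ne[of k] ne[of "k - 1"] True by auto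
    then have pos: "edge_side j p > 0" for j using edge_side_nonneg[OF p(1), of j] edge_iff[of p j] p by (auto simp: less_le)
    have x: "P (k - 1) $ 1 < p $ 1" using True Px_mono[of "k - 1" k] by simp
    have "\<forall>\<^sub>F h in nhds 0. P (k - 1) $ 1 < (p + h) $ 1 \<and> (p + h) $ 1 < P (k + 1) $ 1
      \<and> edge_side k (p + h) > 0 \<and> edge_side (k - 1) (p + h) > 0"
      by (intro eventually_conj order_tendstoD[OF tendsto_comp] order_tendstoD[OF tendsto_edge_side] pos k x)
    then show ?thesis
    proof eventually_elim
      case (elim h)
      then have "p + h \<in> Q" using slab_in_Q[of k "p + h"] slab_in_Q[of "k - 1" "p + h"]
        by (cases "(p + h) $ 1 \<ge> P k $ 1") auto
      then show ?case using no by simp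
    qed
  next
    case False
    then have x: "P k $ 1 < p $ 1" using k by simp
    have slab: "\<forall>\<^sub>F h in nhds 0. P k $ 1 < (p + h) $ 1 \<and> (p + h) $ 1 < P (k + 1) $ 1"
      by (intro eventually_conj order_tendstoD[OF tendsto_comp] k x)
    have iff: "p + h \<in> Q \<longleftrightarrow> edge_side k (p + h) \<ge> 0" if "P k $ 1 < (p + h) $ 1 \<and> (p + h) $ 1 < P (k + 1) $ 1" for h
      using that slab_in_Q[of k "p + h"] edge_side_nonneg by auto
    show ?thesis
    proof (cases "p \<in> edge k")
      case True
      then have z: "edge_side k p = 0" using edge_iff by blast
      show ?thesis using slab
      proof eventually_elim
        case (elim h)
        have "p + h \<in> Q \<longleftrightarrow> cross2 (E k) h \<ge> 0" using iff[OF elim] by (simp only: edge_side_add z add_0)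
        moreover have "p \<in> edge j \<longleftrightarrow> j = k" for j using only[of j] False True by auto
        ultimately show ?case by simp
      qed
    next
      case F: False
      then have "edge_side k p > 0" using edge_side_nonneg[OF p(1), of k] edge_iff[of p k] p by (auto simp: less_le)
      then have "\<forall>\<^sub>F h in nhds 0. edge_side k (p + h) > 0" by (rule order_tendstoD[OF tendsto_edge_side])
      then show ?thesis using slab
      proof eventually_elim
        case (elim h)
        have "p + h \<in> Q" using iff[OF elim(2)] elim(1) by (simp only: less_imp_le)
        moreover have "p \<notin> edge j" for j using only[of j] False F by auto
        ultimately show ?case by simp
      qed
    qed
  qed
qed

end

section \<open>The path metric\<close>

lemma joined_points:
  assumes "joined T x y l" shows "x \<in> points T" "y \<in> points T" "0 \<le> l"
proof -
  have "x \<in> points T \<and> y \<in> points T \<and> 0 \<le> l" using assms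
  proof induction
    case (step x i p l q)
    then have "q \<in> poly T i" by auto
    then show ?case using step point_of_in_points[of q T i] by auto
  qed auto
  then show "x \<in> points T" "y \<in> points T" "0 \<le> l" by auto
qed

lemma joined_trans:
  assumes "joined T y z m" "joined T x y l" shows "joined T x z (l + m)"
  using assms
proof (induction arbitrary: l)
  case (refl y) then show ?case by simp
next
  case (step y i p m q)
  then show ?case using joined.step[OF step(3)[OF step(4)] step(2)] by (simp add: add.assoc)
qed

lemma joined_segment:
  assumes "closed_segment p q \<subseteq> poly T i"
  shows "joined T (point_of T i p) (point_of T i q) (dist p q)"
proof -
  have "joined T (point_of T i p) (point_of T i p) 0"
    using assms by (intro joined.refl point_of_in_points) auto
  then show ?thesis using joined.step[OF _ assms] by fastforce
qed

lemma joined_sym: "joined T x y l \<Longrightarrow> joined T y x l"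
proof (induction rule: joined.induct)
  case (step x i p l q)
  have "joined T (point_of T i q) (point_of T i p) (dist q p)"
    using step by (intro joined_segment) (simp add: closed_segment_commute)
  from joined_trans[OF step(3) this] show ?case by (simp add: dist_commute add.commute)
qed (rule joined.refl)

text \<open>
The infimum that defines \<open>surface_dist\<close> is a distance only for points that are joined by some
path.
\<close>

definition connected_surface :: "'i glued_surface \<Rightarrow> bool" where
  "connected_surface T \<longleftrightarrow> (\<forall>x \<in> points T. \<forall>y \<in> points T. \<exists>l. joined T x y l)"

lemma surface_dist_le: "joined T x y l \<Longrightarrow> surface_dist T x y \<le> l"
  unfolding surface_dist_def by (intro cInf_lower bdd_belowI[of _ 0]) (auto dest: joined_points)

lemma surface_dist_sym: "surface_dist T x y = surface_dist T y x"
proof -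
  have "joined T x y = joined T y x" using joined_sym[of T x y] joined_sym[of T y x] by blast
  then show ?thesis by (simp add: surface_dist_def)
qed

lemma surface_dist_self: "x \<in> points T \<Longrightarrow> surface_dist T x x = 0"
  unfolding surface_dist_def
  by (intro cInf_eq_minimum) (auto intro: joined.refl dest: joined_points)

context
  fixes T :: "'i glued_surface" assumes con: "connected_surface T"
begin

lemma surface_dist_lessD:
  assumes "x \<in> points T" "y \<in> points T" "surface_dist T x y < e" shows "\<exists>l<e. joined T x y l"
  using assms cInf_lessD[of "{l. joined T x y l}" e] con
  unfolding surface_dist_def connected_surface_def by blast

lemma surface_dist_nonneg:
  assumes "x \<in> points T" "y \<in> points T" shows "0 \<le> surface_dist T x y"
  unfolding surface_dist_def using assms con unfolding connected_surface_def
  by (intro cInf_greatest) (auto dest: joined_points)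

lemma surface_dist_triangle:
  assumes "x \<in> points T" "y \<in> points T" "z \<in> points T"
  shows "surface_dist T x z \<le> surface_dist T x y + surface_dist T y z"
proof (rule field_le_epsilon)
  fix e :: real assume e: "0 < e"
  obtain l where l: "l < surface_dist T x y + e / 2" "joined T x y l"
    using surface_dist_lessD[OF assms(1,2), of "surface_dist T x y + e / 2"] e by auto
  obtain m where m: "m < surface_dist T y z + e / 2" "joined T y z m"
    using surface_dist_lessD[OF assms(2,3), of "surface_dist T y z + e / 2"] e by auto
  show "surface_dist T x z \<le> surface_dist T x y + surface_dist T y z + e"
    using surface_dist_le[OF joined_trans[OF m(2) l(2)]] l(1) m(1) by simp
qed

end

section \<open>Linear images of glued surfaces\<close>

lemma gluings_linear: "gluings (linear_image A T) = (\<lambda>(i, e, j, v). (i, (*v) A ` e, j, A *v v)) ` gluings T"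
  by (force simp: linear_image_def)

lemma poly_linear_image: "poly (linear_image A T) i = (*v) A ` poly T i"
  by (simp add: linear_image_def)

lemma linear_image_comp: "linear_image B (linear_image A T) = linear_image (B ** A) T"
proof (rule glued_surface.equality)
  show "poly (linear_image B (linear_image A T)) = poly (linear_image (B ** A) T)"
    by (auto simp: poly_linear_image fun_eq_iff image_image matrix_vector_mul_assoc)
  show "gluings (linear_image B (linear_image A T)) = gluings (linear_image (B ** A) T)"
    unfolding gluings_linear by (simp add: image_image case_prod_unfold matrix_vector_mul_assoc)
qed simp

lemma linear_image_1: "linear_image (mat 1) T = T"
  by (cases T) (auto simp: linear_image_def)

lemma linear_map_comp: "linear_map B (linear_map A x) = linear_map (B ** A) x"
  by (force simp: linear_map_def image_iff matrix_vector_mul_assoc)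

lemma linear_map_1 [simp]: "linear_map (mat 1) x = x"
  by (auto simp: linear_map_def)

lemma same_point_linear:
  assumes "((i, p), (j, q)) \<in> same_point T"
  shows "((i, A *v p), (j, A *v q)) \<in> same_point (linear_image A T)"
proof -
  define F where "F = (\<lambda>(i :: 'a, p). (i, A *v p))"
  have g: "(F a, F b) \<in> glued (linear_image A T)" if "(a, b) \<in> glued T" for a b
  proof -
    from that obtain i e j v p where *: "a = (i, p)" "b = (j, p + v)" "(i, e, j, v) \<in> gluings T" "p \<in> e"
      by (auto simp: glued_def)
    have "(i, (*v) A ` e, j, A *v v) \<in> gluings (linear_image A T)" using * by (auto simp: linear_image_def)
    then show ?thesis unfolding glued_def using * by (auto simp: F_def matrix_vector_right_distrib)
  qed
  have "(F a, F b) \<in> (glued (linear_image A T) \<union> (glued (linear_image A T))\<inverse>)\<^sup>*"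
    if "(a, b) \<in> (glued T \<union> (glued T)\<inverse>)\<^sup>*" for a b
    using that
  proof induction
    case (step b c)
    then have "(F b, F c) \<in> glued (linear_image A T) \<union> (glued (linear_image A T))\<inverse>"
      using step(2) g[of b c] g[of c b] by blast
    then show ?case using step by (meson rtrancl.rtrancl_into_rtrancl)
  qed auto
  from this[of "(i, p)" "(j, q)"] show ?thesis using assms
    by (auto simp: same_point_def F_def linear_image_def)
qed

context
  fixes A :: "real^2^2" assumes inv: "invertible A"
begin

lemma matrix_inv_cancel: "matrix_inv A ** A = mat 1" "A ** matrix_inv A = mat 1"
  "matrix_inv A *v (A *v p) = p" "A *v (matrix_inv A *v p) = p"
proof -
  have "A ** matrix_inv A = mat 1 \<and> matrix_inv A ** A = mat 1"
    unfolding matrix_inv_def using inv unfolding invertible_def by (rule someI_ex)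
  then show a: "matrix_inv A ** A = mat 1" and b: "A ** matrix_inv A = mat 1" by auto
  from a b show "matrix_inv A *v (A *v p) = p" "A *v (matrix_inv A *v p) = p"
    by (simp_all add: matrix_vector_mul_assoc)
qed

lemma same_point_linear_iff:
  "((i, A *v p), (j, A *v q)) \<in> same_point (linear_image A T) \<longleftrightarrow> ((i, p), (j, q)) \<in> same_point T"
  using same_point_linear[of i p j q T A] same_point_linear[of i "A *v p" j "A *v q" "linear_image A T" "matrix_inv A"]
  by (auto simp: linear_image_comp matrix_inv_cancel linear_image_1)

lemma matrix_cancel_eq [simp]: "A *v p = A *v q \<longleftrightarrow> p = q"
  by (metis matrix_inv_cancel(3))

lemma linear_map_point_of:
  fixes T :: "'i glued_surface"
  shows "linear_map A (point_of T i p) = point_of (linear_image A T) i (A *v p)"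
proof (rule Set.set_eqI)
  fix y :: "'i \<times> (real^2)"
  obtain j q where y: "y = (j, q)" by (cases y)
  have q: "q = A *v (matrix_inv A *v q)" by (simp add: matrix_inv_cancel)
  have "y \<in> linear_map A (point_of T i p) \<longleftrightarrow> (j, matrix_inv A *v q) \<in> point_of T i p"
    unfolding y linear_map_def by (subst q) auto
  also have "\<dots> \<longleftrightarrow> y \<in> point_of (linear_image A T) i (A *v p)"
    unfolding point_of_def y using same_point_linear_iff[of i p j "matrix_inv A *v q" T] by (simp add: matrix_inv_cancel)
  finally show "y \<in> linear_map A (point_of T i p) \<longleftrightarrow> y \<in> point_of (linear_image A T) i (A *v p)" .
qed

lemma poly_linear: "A *v p \<in> poly (linear_image A T) i \<longleftrightarrow> p \<in> poly T i"
  unfolding poly_linear_image by auto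

lemma points_linear: "points (linear_image A T) = linear_map A ` points T"
proof
  show "linear_map A ` points T \<subseteq> points (linear_image A T)"
    by (auto elim!: points_cases simp: linear_map_point_of intro!: point_of_in_points simp: poly_linear)
  show "points (linear_image A T) \<subseteq> linear_map A ` points T"
  proof
    fix x assume "x \<in> points (linear_image A T)"
    then obtain i p where p: "p \<in> poly (linear_image A T) i" "x = point_of (linear_image A T) i p" by (rule points_cases)
    then have "matrix_inv A *v p \<in> poly T i" using poly_linear[of "matrix_inv A *v p" T i] by (simp add: matrix_inv_cancel)
    moreover have "x = linear_map A (point_of T i (matrix_inv A *v p))" by (simp add: linear_map_point_of p matrix_inv_cancel)
    ultimately show "x \<in> linear_map A ` points T" by (metis image_eqI point_of_in_points)
  qed
qed

lemma linear_map_inv [simp]: "linear_map (matrix_inv A) (linear_map A x) = x"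
  "linear_map A (linear_map (matrix_inv A) x) = x"
  by (simp_all add: linear_map_comp matrix_inv_cancel)

lemma linear_map_mem: "(i, A *v p) \<in> linear_map A x \<longleftrightarrow> (i, p) \<in> x"
  unfolding linear_map_def by auto

lemma segment_linear: "closed_segment (A *v p) (A *v q) = (*v) A ` closed_segment p q"
  by (intro closed_segment_linear_image) auto

lemma extreme_linear: "A *v p extreme_point_of poly (linear_image A T) i \<longleftrightarrow> p extreme_point_of poly T i"
proof -
  have "inj ((*v) A)" by (metis injI matrix_inv_cancel(3))
  then show ?thesis using extreme_point_of_linear_image[of "(*v) A" p "poly T i"]
    by (simp add: linear_image_def)
qed

lemma vertices_linear: "x \<in> points T \<Longrightarrow> linear_map A x \<in> vertices (linear_image A T) \<longleftrightarrow> x \<in> vertices T"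
proof -
  assume x: "x \<in> points T"
  have "(\<exists>(i, p)\<in>linear_map A x. p extreme_point_of poly (linear_image A T) i) \<longleftrightarrow>
    (\<exists>(i, p)\<in>x. p extreme_point_of poly T i)"
    unfolding linear_map_def by (simp add: case_prod_unfold extreme_linear)
  then show ?thesis using x unfolding vertices_def points_linear by auto
qed

lemma joined_linear:
  assumes "joined T x y l"
  shows "\<exists>l' \<le> onorm ((*v) A) * l. joined (linear_image A T) (linear_map A x) (linear_map A y) l'"
  using assms
proof induction
  case (refl x)
  then show ?case using joined.refl[of "linear_map A x" "linear_image A T"] points_linear[of T]
    by (intro exI[of _ 0]) auto
next
  case (step x i p l q)
  then obtain l' where l': "l' \<le> onorm ((*v) A) * l" "joined (linear_image A T) (linear_map A x) (linear_map A (point_of T i p)) l'"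
    by blast
  have "closed_segment (A *v p) (A *v q) \<subseteq> poly (linear_image A T) i"
    unfolding segment_linear linear_image_def using step(2) by auto
  from joined.step[OF l'(2)[unfolded linear_map_point_of] this]
  have "joined (linear_image A T) (linear_map A x) (linear_map A (point_of T i q)) (l' + dist (A *v p) (A *v q))"
    by (simp add: linear_map_point_of)
  moreover have "dist (A *v p) (A *v q) \<le> onorm ((*v) A) * dist p q"
    using onorm[OF matrix_vector_mul_bounded_linear[of A], of "p - q"] by (simp add: dist_norm matrix_vector_mult_diff_distrib)
  ultimately show ?case using l'(1) by (intro exI[of _ "l' + dist (A *v p) (A *v q)"]) (auto simp: algebra_simps)
qed

lemma connected_linear: assumes "connected_surface T" shows "connected_surface (linear_image A T)"
  unfolding connected_surface_def points_linear
proof (intro ballI, elim imageE)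
  fix x y x' y' assume *: "x = linear_map A x'" "x' \<in> points T" "y = linear_map A y'" "y' \<in> points T"
  then obtain l where "joined T x' y' l" using assms unfolding connected_surface_def by blast
  from joined_linear[OF this] show "\<exists>l. joined (linear_image A T) x y l" using * by auto
qed

text \<open>
A linear map stretches lengths at most by its operator norm, so paths of one surface become paths
of the other of comparable length.
\<close>

lemma surface_dist_linear_le:
  assumes "connected_surface T" "x \<in> points T" "y \<in> points T"
  shows "surface_dist (linear_image A T) (linear_map A x) (linear_map A y) \<le> onorm ((*v) A) * surface_dist T x y"
proof (rule field_le_epsilon)
  fix e :: real assume e: "0 < e"
  define K where "K = onorm ((*v) A)"
  have K: "K \<ge> 0" unfolding K_def by (intro onorm_pos_le) simp
  obtain l where l: "l < surface_dist T x y + e / (K + 1)" "joined T x y l"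
    using surface_dist_lessD[OF assms, of "surface_dist T x y + e / (K + 1)"] e K by auto
  obtain l' where l': "l' \<le> K * l" "joined (linear_image A T) (linear_map A x) (linear_map A y) l'"
    using joined_linear[OF l(2)] unfolding K_def by blast
  have "K * l \<le> K * surface_dist T x y + K * (e / (K + 1))"
    using mult_left_mono[OF less_imp_le[OF l(1)] K] by (simp add: distrib_left)
  also have "K * (e / (K + 1)) \<le> e" using e K by (simp add: field_simps)
  finally show "surface_dist (linear_image A T) (linear_map A x) (linear_map A y) \<le> onorm ((*v) A) * surface_dist T x y + e"
    using surface_dist_le[OF l'(2)] l'(1) unfolding K_def by linarith
qed

end

lemma invertible_mat_1: "invertible (mat 1 :: real^2^2)"
  unfolding invertible_def by (intro exI[of _ "mat 1"]) simp

lemma invertible_matrix_inv: "invertible (A::real^2^2) \<Longrightarrow> invertible (matrix_inv A)"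
  unfolding invertible_def[of "matrix_inv A"] using matrix_inv_cancel(1,2) by blast

context surf begin

abbreviation "d \<equiv> surface_dist (S_surface c)"

text \<open>
The metric of the linear image, pulled back to \<open>S\<close>.
\<close>

definition "dA A x y = surface_dist (linear_image A S) (linear_map A x) (linear_map A y)"

lemma dA_1: "dA (mat 1) x y = d x y" by (simp add: dA_def linear_image_1)

lemma connected_S: "connected_surface S"
proof -
  have *: "\<exists>l. joined S x (vtx True) l" if "x \<in> X" for x
  proof -
    obtain i p where p: "p \<in> poly S i" "x = point_of S i p" using points_cases[OF \<open>x \<in> X\<close>] .
    let ?v = "sg i *\<^sub>R P (par i)"
    have "closed_segment p ?v \<subseteq> poly S i" using p vertex_poly poly_S_convex by (simp add: closed_segment_subset)
    from joined_segment[OF this] have "joined S x (vtx (even (par i + par i))) (dist p ?v)" using p vtx_eq by metis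
    then show ?thesis by auto
  qed
  show ?thesis unfolding connected_surface_def
  proof (intro ballI)
    fix x y assume "x \<in> X" "y \<in> X"
    then obtain l m where "joined S x (vtx True) l" "joined S y (vtx True) m" using * by metis
    then show "\<exists>l. joined S x y l" using joined_trans joined_sym by metis
  qed
qed

context
  fixes A :: "real^2^2" assumes inv: "invertible A"
begin

lemmas conA = connected_linear[OF inv connected_S]

lemma linX: "x \<in> X \<Longrightarrow> linear_map A x \<in> points (linear_image A S)" using points_linear[OF inv] by auto

lemma dA_triangle: "x \<in> X \<Longrightarrow> y \<in> X \<Longrightarrow> z \<in> X \<Longrightarrow> dA A x z \<le> dA A x y + dA A y z"
  unfolding dA_def by (intro surface_dist_triangle[OF conA] linX)

lemma dA_nonneg: "x \<in> X \<Longrightarrow> y \<in> X \<Longrightarrow> 0 \<le> dA A x y"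
  unfolding dA_def by (intro surface_dist_nonneg[OF conA] linX)

lemma dA_sym: "dA A x y = dA A y x" unfolding dA_def by (rule surface_dist_sym)

lemma dA_self: "x \<in> X \<Longrightarrow> dA A x x = 0" unfolding dA_def by (intro surface_dist_self linX)

lemma dA_le: "\<exists>K>0. \<forall>x\<in>X. \<forall>y\<in>X. dA A x y \<le> K * d x y"
proof (intro exI[of _ "onorm ((*v) A) + 1"] conjI ballI)
  have K: "onorm ((*v) A) \<ge> 0" by (intro onorm_pos_le) simp
  then show "0 < onorm ((*v) A) + 1" by simp
  fix x y assume xy: "x \<in> X" "y \<in> X"
  have "dA A x y \<le> onorm ((*v) A) * d x y"
    unfolding dA_def by (rule surface_dist_linear_le[OF inv connected_S xy])
  also have "\<dots> \<le> (onorm ((*v) A) + 1) * d x y"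
    using surface_dist_nonneg[OF connected_S xy] by (intro mult_right_mono) auto
  finally show "dA A x y \<le> (onorm ((*v) A) + 1) * d x y" .
qed

lemma le_dA: "\<exists>K>0. \<forall>x\<in>X. \<forall>y\<in>X. d x y \<le> K * dA A x y"
proof (intro exI[of _ "onorm ((*v) (matrix_inv A)) + 1"] conjI ballI)
  have K: "onorm ((*v) (matrix_inv A)) \<ge> 0" by (intro onorm_pos_le) simp
  then show "0 < onorm ((*v) (matrix_inv A)) + 1" by simp
  fix x y assume xy: "x \<in> X" "y \<in> X"
  have "d x y \<le> onorm ((*v) (matrix_inv A)) * dA A x y"
    using surface_dist_linear_le[OF invertible_matrix_inv[OF inv] conA linX linX, of x y] xy
    by (simp add: dA_def linear_image_comp matrix_inv_cancel[OF inv] linear_image_1 linear_map_comp)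
  also have "\<dots> \<le> (onorm ((*v) (matrix_inv A)) + 1) * dA A x y"
    using dA_nonneg[OF xy] by (intro mult_right_mono) auto
  finally show "d x y \<le> (onorm ((*v) (matrix_inv A)) + 1) * dA A x y" .
qed

lemma dA_segment:
  assumes "p \<in> poly S i" "q \<in> poly S i" shows "dA A (point_of S i p) (point_of S i q) \<le> norm (A *v (q - p))"
proof -
  have "closed_segment (A *v p) (A *v q) \<subseteq> poly (linear_image A S) i"
    unfolding segment_linear[OF inv] linear_image_def
    using closed_segment_subset[OF assms poly_S_convex] by auto
  from surface_dist_le[OF joined_segment[OF this]] show ?thesis
    by (simp add: dA_def linear_map_point_of[OF inv] dist_norm matrix_vector_mult_diff_distrib norm_minus_commute)
qed

end

lemmas d_triangle = dA_triangle[OF invertible_mat_1, unfolded dA_1]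
  and d_nonneg = dA_nonneg[OF invertible_mat_1, unfolded dA_1]
  and d_sym = dA_sym[OF invertible_mat_1, unfolded dA_1]
  and d_self = dA_self[OF invertible_mat_1, unfolded dA_1]
  and d_segment = dA_segment[OF invertible_mat_1, unfolded dA_1 matrix_vector_mul_lid]

section \<open>The metric of the surface separates points\<close>

lemma joined_near:
  assumes "joined S x y l" "edge_radius x r" "l < r"
  shows "\<exists>i p q. (i, p) \<in> x \<and> q \<in> poly S i \<and> y = point_of S i q \<and> dist q p \<le> l"
  using assms
proof induction
  case (refl x)
  then obtain i p where "p \<in> poly S i" "x = point_of S i p" using points_cases by blast
  then show ?case using mem_point_of by (intro exI[of _ i] exI[of _ p]) auto
next
  case (step x j z l w)
  have l: "l < r" using step.prems zero_le_dist[of z w] by linarith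
  then obtain i p q where *: "(i, p) \<in> x" "q \<in> poly S i" "point_of S j z = point_of S i q" "dist q p \<le> l"
    using step by blast
  have zw: "z \<in> poly S j" "w \<in> poly S j" using step(2) by auto
  have x: "x \<in> X" using joined_points[OF step(1)] by simp
  have "eqv i q j z" using *(2,3) zw point_eq by metis
  then obtain p' where p': "(j, p') \<in> x" "z - p' = q - p"
    using transfer[OF x step.prems(1) *(1) _ *(2) _ zw(1)] *(4) l by auto
  have "dist w p' \<le> dist w z + dist z p'" by (rule dist_triangle)
  also have "dist z p' = dist q p" by (simp add: dist_norm p')
  finally have "dist w p' \<le> l + dist z w" using *(4) by (simp add: dist_commute)
  then show ?case using p' zw by blast
qed

text \<open>
A path shorter than the radius cannot leave the fans of polygon pieces around \<open>x\<close>, so its end is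
visible along a straight segment from some representative of \<open>x\<close>.
\<close>

lemma near:
  assumes "x \<in> X" "y \<in> X" "edge_radius x r" "d x y < \<epsilon>" "\<epsilon> \<le> r"
  shows "\<exists>i p q. (i, p) \<in> x \<and> q \<in> poly S i \<and> y = point_of S i q \<and> dist q p < \<epsilon>"
proof -
  obtain l where l: "l < \<epsilon>" "joined S x y l" using surface_dist_lessD[OF connected_S assms(1,2,4)] by auto
  show ?thesis using joined_near[OF l(2) assms(3)] l(1) assms(5) by fastforce
qed

text \<open>
The path pseudometric is a metric, also at the two vertex points, at which infinitely many polygon
corners meet.
\<close>

theorem d_eq_0: assumes "x \<in> X" "y \<in> X" "d x y = 0" shows "x = y"
proof -
  obtain r where r: "edge_radius x r" "r \<le> 1 / 2" using edge_radius_exists assms by blast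
  have r0: "r > 0" using r by (simp add: edge_radius_def)
  obtain i p q where 1: "(i, p) \<in> x" "q \<in> poly S i" "y = point_of S i q" "dist q p < r"
    using near[OF assms(1,2) r(1), of r] assms(3) r0 by auto
  have "dist q p = 0"
  proof (rule ccontr)
    assume ne: "dist q p \<noteq> 0"
    obtain j p' q' where 2: "(j, p') \<in> x" "q' \<in> poly S j" "y = point_of S j q'" "dist q' p' < dist q p"
      using near[OF assms(1,2) r(1), of "dist q p"] assms(3) ne 1(4) by auto
    have "q - p = q' - p'"
      using offset_unique[OF assms(1) r(1,2) 1(1) 2(1) 1(2) 2(2) _ 1(4)] 1 2 by auto
    then show False using 2(4) by (simp add: dist_norm)
  qed
  then show ?thesis using mem_pointD(2)[OF assms(1) 1(1)] 1 by simp
qed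

section \<open>Moving a regular point by a vector\<close>

text \<open>
The point reached from a regular point by the vector \<open>h\<close>, for small \<open>h\<close>. For a point on an edge,
whichever representative sees the vector gives the same result.
\<close>

definition move :: "piece surface_point \<Rightarrow> real^2 \<Rightarrow> piece surface_point" where
  "move x h = (SOME y. \<exists>i p. (i, p) \<in> x \<and> p + h \<in> poly S i \<and> y = point_of S i (p + h))"

lemma move_well_defined:
  assumes x: "x \<in> X - V" "(i, p) \<in> x" "(j, q) \<in> x" and h: "p + h \<in> poly S i" "q + h \<in> poly S j"
  shows "point_of S i (p + h) = point_of S j (q + h)"
proof -
  from nonvertex_reps[OF x] show ?thesis
  proof
    assume "step i p j q"
    then obtain k where k: "j = swap_pieces i" "sg i *\<^sub>R p \<in> edge k" "q = p - sg i *\<^sub>R (P k + P (k + 1))"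
      by (auto simp: step_def)
    have a: "sg i *\<^sub>R p + sg i *\<^sub>R h \<in> Q" using h(1) by (simp add: poly_S scaleR_add_right del: Q_piece.simps)
    have "sg j *\<^sub>R q = P k + P (k + 1) - sg i *\<^sub>R p" using k by (cases i) (auto simp: algebra_simps)
    then have b: "P k + P (k + 1) - sg i *\<^sub>R p - sg i *\<^sub>R h \<in> Q"
      using h(2) k(1) by (simp add: poly_S scaleR_add_right del: Q_piece.simps)
    have z: "edge_side k (sg i *\<^sub>R p) = 0" using k(2) edge_iff by blast
    have "edge_side k (P k + P (k + 1) - sg i *\<^sub>R p - sg i *\<^sub>R h) = - edge_side k (sg i *\<^sub>R p) - cross2 (E k) (sg i *\<^sub>R h)"
      by (simp add: edge_side_def P_step)
    then have "cross2 (E k) (sg i *\<^sub>R h) \<le> 0" using edge_side_nonneg[OF b, of k] z by simp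
    moreover have "cross2 (E k) (sg i *\<^sub>R h) \<ge> 0" using edge_side_nonneg[OF a, of k] z by (simp only: edge_side_add)
    ultimately have "edge_side k (sg i *\<^sub>R p + sg i *\<^sub>R h) = 0" using z by (simp only: edge_side_add)
    then have "sg i *\<^sub>R (p + h) \<in> edge k" using a edge_iff by (simp add: scaleR_add_right)
    then have "step i (p + h) j (q + h)" unfolding step_def using k by (intro exI[of _ k]) auto
    then show ?thesis using h point_eq by (simp add: eqv_def)
  qed simp
qed

lemma move_eq: assumes "x \<in> X - V" "(i, p) \<in> x" "p + h \<in> poly S i" shows "move x h = point_of S i (p + h)"
  unfolding move_def
  by (rule someI2[of _ "point_of S i (p + h)"]) (use assms move_well_defined in blast)+

text \<open>
The point \<open>x\<close> has an embedded disc of radius \<open>r\<close>: every short vector is seen by one of its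
representatives.
\<close>

definition disc :: "piece surface_point \<Rightarrow> real \<Rightarrow> bool" where
  "disc x r \<longleftrightarrow> edge_radius x r \<and> r \<le> 1 / 2 \<and> (\<forall>h. norm h < r \<longrightarrow> (\<exists>i p. (i, p) \<in> x \<and> p + h \<in> poly S i))"

text \<open>
By \<open>local_Q\<close>, a point on an edge sees a half-disc in each of its two representatives, and these
are complementary.
\<close>

lemma full_disc_covered: assumes "x \<in> X - V" shows "\<forall>\<^sub>F h in nhds 0. \<exists>i p. (i, p) \<in> x \<and> p + h \<in> poly S i"
proof -
  obtain i p where p: "p \<in> poly S i" "x = point_of S i p" using points_cases assms by blast
  then have ip: "(i, p) \<in> x" using mem_point_of by auto
  have sgh: "filterlim (\<lambda>h::real^2. sg i *\<^sub>R h) (nhds 0) (nhds 0)" for i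
    by (rule tendsto_eq_intros refl filterlim_ident | simp)+
  have loc: "\<forall>\<^sub>F h in nhds 0. q + h \<in> poly S j \<longleftrightarrow> (\<forall>k. sg j *\<^sub>R q \<in> edge k \<longrightarrow> cross2 (E k) (sg j *\<^sub>R h) \<ge> 0)"
    if "(j, q) \<in> x" for j q
  proof -
    have q: "q \<in> poly S j" "x = point_of S j q" using mem_pointD[of x S j q] that assms by auto
    then have "sg j *\<^sub>R q \<in> Q" "sg j *\<^sub>R q \<notin> range P" using poly_S point_of_V_iff assms by auto
    from eventually_compose_filterlim[OF local_Q[OF this] sgh[of j]] show ?thesis
      by eventually_elim (simp add: poly_S scaleR_add_right del: Q_piece.simps)
  qed
  show ?thesis
  proof (cases "\<exists>k. sg i *\<^sub>R p \<in> edge k")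
    case False
    then show ?thesis using loc[OF ip] ip by (auto elim!: eventually_mono)
  next
    case True
    then obtain k where k: "sg i *\<^sub>R p \<in> edge k" by blast
    let ?j = "swap_pieces i" and ?q = "p - sg i *\<^sub>R (P k + P (k + 1))"
    have st: "step i p ?j ?q" unfolding step_def using k by blast
    then have jq: "(?j, ?q) \<in> x" using p mem_point_iff eqv_poly[OF p(1) st] by (auto simp: eqv_def)
    have nv: "sg i *\<^sub>R p \<notin> range P" using p point_of_V_iff assms by auto
    have "sg ?j *\<^sub>R ?q = P k + P (k + 1) - sg i *\<^sub>R p" by (simp add: algebra_simps)
    then have kq: "sg ?j *\<^sub>R ?q \<in> edge k" using k edge_flip by simp
    have nvq: "sg ?j *\<^sub>R ?q \<notin> range P"
      using mem_pointD[of x S ?j ?q] jq assms point_of_V_iff[of ?q ?j] by auto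
    have o1: "\<And>k'. sg i *\<^sub>R p \<in> edge k' \<Longrightarrow> k' = k" using edge_meet[OF k] nv by blast
    have o2: "\<And>k'. sg ?j *\<^sub>R ?q \<in> edge k' \<Longrightarrow> k' = k" using edge_meet[OF kq] nvq by blast
    from loc[OF ip] loc[OF jq] show ?thesis
    proof eventually_elim
      case (elim h)
      have "p + h \<in> poly S i \<longleftrightarrow> cross2 (E k) (sg i *\<^sub>R h) \<ge> 0" using elim(1) k o1 by blast
      moreover have "?q + h \<in> poly S ?j \<longleftrightarrow> cross2 (E k) (sg ?j *\<^sub>R h) \<ge> 0" using elim(2) kq o2 by blast
      moreover have "cross2 (E k) (sg ?j *\<^sub>R h) = - cross2 (E k) (sg i *\<^sub>R h)" by simp
      ultimately have "p + h \<in> poly S i \<or> ?q + h \<in> poly S ?j" by linarith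
      then show ?case using ip jq by blast
    qed
  qed
qed

lemma disc_exists: assumes "x \<in> X - V" shows "\<exists>r>0. disc x r"
proof -
  obtain r1 where r1: "edge_radius x r1" "r1 \<le> 1 / 2" using edge_radius_exists assms by blast
  obtain r2 where r2: "r2 > 0" "\<And>h. dist h 0 < r2 \<Longrightarrow> \<exists>i p. (i, p) \<in> x \<and> p + h \<in> poly S i"
    using full_disc_covered[OF assms] unfolding eventually_nhds_metric by blast
  have "r1 > 0" using r1 by (simp add: edge_radius_def)
  then show ?thesis using r1 r2 edge_radius_mono[OF r1(1), of "min r1 r2"]
    by (intro exI[of _ "min r1 r2"]) (auto simp: disc_def)
qed

lemma disc_pos: "disc x r \<Longrightarrow> r > 0" by (simp add: disc_def edge_radius_def)

lemma move_0 [simp]: assumes "x \<in> X - V" shows "move x 0 = x"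
proof -
  obtain i p where p: "p \<in> poly S i" "x = point_of S i p" using points_cases assms by blast
  have "move x 0 = point_of S i (p + 0)"
    by (rule move_eq[OF assms]) (use p mem_point_of in auto)
  then show ?thesis using p by simp
qed

context
  fixes x r assumes x: "x \<in> X - V" and g: "disc x r"
begin

lemma move_rep: assumes "norm h < r"
  obtains i p where "(i, p) \<in> x" "p \<in> poly S i" "p + h \<in> poly S i" "move x h = point_of S i (p + h)" "x = point_of S i p"
proof -
  obtain i p where ip: "(i, p) \<in> x" "p + h \<in> poly S i" using assms g unfolding disc_def by blast
  then show ?thesis using that move_eq[OF x ip] mem_pointD[of x S i p] x by auto
qed

lemma move_nonvertex: assumes "norm h < r" shows "move x h \<in> X - V"
proof -
  obtain i p where p: "(i, p) \<in> x" "p \<in> poly S i" "p + h \<in> poly S i" "move x h = point_of S i (p + h)" "x = point_of S i p"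
    using move_rep[OF assms] .
  have "sg i *\<^sub>R (p + h) \<notin> range P"
  proof
    assume "sg i *\<^sub>R (p + h) \<in> range P"
    then obtain m where "sg i *\<^sub>R (p + h) = P m" by auto
    then have e: "sg i *\<^sub>R (p + h) \<in> edge m" "sg i *\<^sub>R (p + h) \<in> edge (m - 1)" by auto
    have t: "edge_radius x r" using g by (simp add: disc_def)
    have dd: "dist (p + h) p < r" using assms by (simp add: dist_norm)
    have "sg i *\<^sub>R p \<in> edge m" "sg i *\<^sub>R p \<in> edge (m - 1)" using t p(1) dd e unfolding edge_radius_def by blast+
    then have "sg i *\<^sub>R p \<in> range P" using edge_meet[of _ m "m - 1"] by auto
    then show False using p(2,5) x point_of_V_iff by auto
  qed
  then show ?thesis using p point_of_V_iff point_of_in_points by auto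
qed

lemma dA_move: assumes "invertible A" "norm h < r" shows "dA A x (move x h) \<le> norm (A *v h)"
  using dA_segment[OF assms(1)] by (rule_tac move_rep[OF assms(2)]) fastforce

lemma d_move: assumes "norm h < r" shows "d x (move x h) \<le> norm h"
  using dA_move[OF invertible_mat_1 assms] by (simp add: dA_1)

lemma move_inj: assumes "norm h < r" "norm h' < r" "move x h = move x h'" shows "h = h'"
proof -
  obtain i p where p: "(i, p) \<in> x" "p \<in> poly S i" "p + h \<in> poly S i" "move x h = point_of S i (p + h)" "x = point_of S i p"
    using move_rep[OF assms(1)] .
  obtain j q where q: "(j, q) \<in> x" "q \<in> poly S j" "q + h' \<in> poly S j" "move x h' = point_of S j (q + h')" "x = point_of S j q"
    using move_rep[OF assms(2)] .
  have "(p + h) - p = (q + h') - q"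
    by (rule offset_unique[of x r i p j q]) (use x g p q assms in \<open>auto simp: disc_def dist_norm\<close>)
  then show ?thesis by simp
qed

lemma near_move: assumes "y \<in> X" "d x y < \<epsilon>" "\<epsilon> \<le> r" shows "\<exists>h. norm h < \<epsilon> \<and> y = move x h"
proof -
  obtain i p q where *: "(i, p) \<in> x" "q \<in> poly S i" "y = point_of S i q" "dist q p < \<epsilon>"
    using near[of x y r \<epsilon>] x g assms by (auto simp: disc_def)
  then show ?thesis using move_eq[OF x *(1), of "q - p"] by (intro exI[of _ "q - p"]) (auto simp: dist_norm)
qed

end

lemma move_separated:
  assumes "x \<in> X - V" "y \<in> X - V" "x \<noteq> y" shows "\<forall>\<^sub>F h in nhds 0. move x h \<noteq> move y h"
proof -
  obtain r s where r: "disc x r" and s: "disc y s" using disc_exists assms by meson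
  have dpos: "d x y > 0" using d_eq_0[of x y] d_nonneg[of x y] assms by force
  define e where "e = min (min r s) (d x y / 2)"
  have e: "e > 0" using disc_pos[OF r] disc_pos[OF s] dpos by (simp add: e_def)
  have "move x h \<noteq> move y h" if "norm h < e" for h
  proof
    assume eq: "move x h = move y h"
    have h: "norm h < r" "norm h < s" "norm h < d x y / 2" using that by (auto simp: e_def)
    have m: "move x h \<in> X" "move y h \<in> X" using move_nonvertex[OF _ r h(1)] move_nonvertex[OF _ s h(2)] assms by auto
    have "d x y \<le> d x (move x h) + d (move x h) y" using d_triangle assms m by auto
    also have "\<dots> \<le> norm h + norm h"
      using d_move[OF assms(1) r h(1)] d_move[OF assms(2) s h(2)] d_sym by (simp add: eq)
    finally show False using h by simp
  qed
  then show ?thesis unfolding eventually_nhds_metric using e by (intro exI[of _ e]) auto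
qed

section \<open>Maps that are local translations\<close>

text \<open>
\<open>\<gamma>\<close> is locally a translation when read in the coordinates \<open>\<Lambda>\<close>; in other words \<open>\<Lambda>\<close> is a developing
map for \<open>\<gamma>\<close>. Straight paths, charts of cylinders and the inclusions of the polygons are all of
this kind.
\<close>

definition loctrans :: "'z::topological_space set \<Rightarrow> ('z \<Rightarrow> real^2) \<Rightarrow> ('z \<Rightarrow> piece surface_point) \<Rightarrow> bool" where
  "loctrans Z \<Lambda> \<gamma> \<longleftrightarrow> (\<forall>z\<in>Z. \<gamma> z \<in> X - V \<and> (\<forall>\<^sub>F w in at z within Z. \<gamma> w = move (\<gamma> z) (\<Lambda> w - \<Lambda> z)))"

lemma loctrans_subset: "loctrans Z \<Lambda> \<gamma> \<Longrightarrow> Z' \<subseteq> Z \<Longrightarrow> loctrans Z' \<Lambda> \<gamma>"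
  unfolding loctrans_def by (auto intro: filter_leD[OF at_le])

lemma tendsto_dev:
  assumes "continuous_on Z \<Lambda>" "z \<in> Z"
  shows "filterlim (\<lambda>w. \<Lambda> w - \<Lambda> z) (nhds (0::real^2)) (at z within Z)"
  using assms tendsto_diff[OF _ tendsto_const, of \<Lambda> "\<Lambda> z" "at z within Z" "\<Lambda> z"]
  by (auto simp: continuous_on_def)

text \<open>
Analytic continuation: the set on which two such maps agree is open and closed.
\<close>

theorem loctrans_agree:
  assumes c: "connected Z" "continuous_on Z \<Lambda>" and l: "loctrans Z \<Lambda> \<gamma>" "loctrans Z \<Lambda> \<delta>"
    and z: "z0 \<in> Z" "\<gamma> z0 = \<delta> z0" "z \<in> Z"
  shows "\<gamma> z = \<delta> z"
proof -
  have "(\<gamma> z0 = \<delta> z0) = (\<gamma> z = \<delta> z)"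
  proof (rule connected_local_const[OF c(1) z(1) z(3), of "\<lambda>z. \<gamma> z = \<delta> z"], rule ballI)
    fix a assume a: "a \<in> Z"
    have ev: "\<forall>\<^sub>F w in at a within Z. \<gamma> w = move (\<gamma> a) (\<Lambda> w - \<Lambda> a)" "\<forall>\<^sub>F w in at a within Z. \<delta> w = move (\<delta> a) (\<Lambda> w - \<Lambda> a)"
      and n: "\<gamma> a \<in> X - V" "\<delta> a \<in> X - V"
      using l a unfolding loctrans_def by auto
    show "\<forall>\<^sub>F b in at a within Z. (\<gamma> a = \<delta> a) = (\<gamma> b = \<delta> b)"
    proof (cases "\<gamma> a = \<delta> a")
      case True
      from ev show ?thesis by eventually_elim (simp add: True)
    next
      case False
      have "\<forall>\<^sub>F w in at a within Z. move (\<gamma> a) (\<Lambda> w - \<Lambda> a) \<noteq> move (\<delta> a) (\<Lambda> w - \<Lambda> a)"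
        by (rule eventually_compose_filterlim[OF move_separated[OF n False] tendsto_dev[OF c(2) a]])
      with ev show ?thesis by eventually_elim (simp add: False)
    qed
  qed
  then show ?thesis using z by simp
qed

text \<open>
A straight path has length \<open>norm (A *v w)\<close> per unit of time locally; subdivide the interval.
\<close>

theorem loctrans_lipschitz:
  fixes \<gamma> :: "real \<Rightarrow> piece surface_point"
  assumes l: "loctrans {s..t} (\<lambda>t. t *\<^sub>R w) \<gamma>" and A: "invertible A" and st: "s \<le> t"
  shows "dA A (\<gamma> s) (\<gamma> t) \<le> norm (A *v w) * (t - s)"
proof -
  have inX: "\<gamma> p \<in> X" if "p \<in> {s..t}" for p using l that unfolding loctrans_def by auto
  define R where "R p q \<longleftrightarrow> s \<le> p \<and> q \<le> t \<longrightarrow> dA A (\<gamma> p) (\<gamma> q) \<le> norm (A *v w) * (q - p)" for p q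
  have "R s t"
    using st
  proof (rule Bolzano[of s t R])
    fix p q r assume *: "R p q" "R q r" "p \<le> q" "q \<le> r"
    show "R p r" unfolding R_def
    proof (intro impI)
      assume "s \<le> p \<and> r \<le> t"
      then have "dA A (\<gamma> p) (\<gamma> r) \<le> dA A (\<gamma> p) (\<gamma> q) + dA A (\<gamma> q) (\<gamma> r)" using * by (intro dA_triangle[OF A] inX) auto
      also have "\<dots> \<le> norm (A *v w) * (q - p) + norm (A *v w) * (r - q)" using * \<open>s \<le> p \<and> r \<le> t\<close> unfolding R_def by auto
      finally show "dA A (\<gamma> p) (\<gamma> r) \<le> norm (A *v w) * (r - p)" by (simp add: algebra_simps)
    qed
  next
    fix x assume "s \<le> x" "x \<le> t"
    then have x: "x \<in> {s..t}" using st by auto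
    then have n: "\<gamma> x \<in> X - V" using l unfolding loctrans_def by auto
    obtain \<rho> where \<rho>: "disc (\<gamma> x) \<rho>" using disc_exists[OF n] by auto
    have "filterlim (\<lambda>y. y *\<^sub>R w - x *\<^sub>R w) (nhds 0) (at x within {s..t})"
      by (rule tendsto_dev) (use x in \<open>auto intro!: continuous_intros\<close>)
    then have "\<forall>\<^sub>F y in at x within {s..t}. norm (y *\<^sub>R w - x *\<^sub>R w) < \<rho>"
      using disc_pos[OF \<rho>] tendsto_iff[of "\<lambda>y. y *\<^sub>R w - x *\<^sub>R w" 0] by (auto simp: dist_norm)
    moreover have "\<forall>\<^sub>F y in at x within {s..t}. \<gamma> y = move (\<gamma> x) (y *\<^sub>R w - x *\<^sub>R w)"
      using l x unfolding loctrans_def by auto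
    ultimately have "\<forall>\<^sub>F y in at x within {s..t}. dA A (\<gamma> x) (\<gamma> y) \<le> norm (A *v w) * \<bar>y - x\<bar>"
    proof eventually_elim
      case (elim y)
      have "dA A (\<gamma> x) (\<gamma> y) \<le> norm (A *v (y *\<^sub>R w - x *\<^sub>R w))" using dA_move[OF n \<rho> A elim(1)] elim(2) by simp
      also have "y *\<^sub>R w - x *\<^sub>R w = (y - x) *\<^sub>R w" by (simp add: algebra_simps)
      finally show ?case by (simp add: matrix_vector_mult_scaleR mult.commute)
    qed
    then obtain \<delta> where \<delta>: "\<delta> > 0" "\<And>y. y \<in> {s..t} \<Longrightarrow> y \<noteq> x \<Longrightarrow> dist y x < \<delta> \<Longrightarrow> dA A (\<gamma> x) (\<gamma> y) \<le> norm (A *v w) * \<bar>y - x\<bar>"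
      unfolding eventually_at by blast
    have \<delta>': "dA A (\<gamma> x) (\<gamma> y) \<le> norm (A *v w) * \<bar>y - x\<bar>" if "y \<in> {s..t}" "dist y x < \<delta>" for y
      using \<delta>(2)[of y] that dA_self[OF A, of "\<gamma> x"] n by (cases "y = x") auto
    show "\<exists>d>0. \<forall>p q. p \<le> x \<and> x \<le> q \<and> q - p < d \<longrightarrow> R p q"
    proof (intro exI[of _ \<delta>] conjI allI impI \<delta>(1))
      fix p q assume pq: "p \<le> x \<and> x \<le> q \<and> q - p < \<delta>"
      show "R p q" unfolding R_def
      proof (intro impI)
        assume "s \<le> p \<and> q \<le> t"
        then have i: "p \<in> {s..t}" "q \<in> {s..t}" using pq x by auto
        have "dA A (\<gamma> p) (\<gamma> q) \<le> dA A (\<gamma> p) (\<gamma> x) + dA A (\<gamma> x) (\<gamma> q)" using i x by (intro dA_triangle[OF A] inX) auto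
        also have "\<dots> \<le> norm (A *v w) * (x - p) + norm (A *v w) * (q - x)"
          using \<delta>'[OF i(1)] \<delta>'[OF i(2)] pq dA_sym[OF A, of "\<gamma> p" "\<gamma> x"] by (auto simp: dist_real_def)
        finally show "dA A (\<gamma> p) (\<gamma> q) \<le> norm (A *v w) * (q - p)" by (simp add: algebra_simps)
      qed
    qed
  qed
  then show ?thesis using st unfolding R_def by auto
qed

lemma loctrans_poly:
  assumes "Z \<subseteq> poly S i" "\<And>p. p \<in> Z \<Longrightarrow> sg i *\<^sub>R p \<notin> range P"
  shows "loctrans Z (\<lambda>p. p) (point_of S i)"
  unfolding loctrans_def
proof (intro ballI conjI)
  fix p assume p: "p \<in> Z"
  then have pp: "p \<in> poly S i" using assms by auto
  then show n: "point_of S i p \<in> X - V" using point_of_V_iff[OF pp] assms(2)[OF p] point_of_in_points by auto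
  show "\<forall>\<^sub>F q in at p within Z. point_of S i q = move (point_of S i p) (q - p)"
    unfolding eventually_at_filter
    by (rule always_eventually) (use assms(1) move_eq[OF n mem_point_of[OF pp]] in auto)
qed

lemma loctrans_compose:
  assumes "loctrans Z \<Lambda> \<gamma>" "continuous_on Y g" "g ` Y \<subseteq> Z"
  shows "loctrans Y (\<lambda>y. \<Lambda> (g y)) (\<lambda>y. \<gamma> (g y))"
  unfolding loctrans_def
proof (intro ballI conjI)
  fix y assume y: "y \<in> Y"
  then have gy: "g y \<in> Z" using assms(3) by auto
  then show n: "\<gamma> (g y) \<in> X - V" using assms(1) unfolding loctrans_def by auto
  have "\<forall>\<^sub>F w in at (g y) within Z. \<gamma> w = move (\<gamma> (g y)) (\<Lambda> w - \<Lambda> (g y))" using assms(1) gy unfolding loctrans_def by auto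
  then obtain U where U: "open U" "g y \<in> U" "\<And>w. w \<in> U \<Longrightarrow> w \<in> Z \<Longrightarrow> \<gamma> w = move (\<gamma> (g y)) (\<Lambda> w - \<Lambda> (g y))"
    unfolding eventually_at_topological using move_0[OF n] by (metis diff_self)
  have "(g \<longlongrightarrow> g y) (at y within Y)" using assms(2) y by (auto simp: continuous_on_def)
  then have "\<forall>\<^sub>F v in at y within Y. g v \<in> U" using U topological_tendstoD by blast
  then show "\<forall>\<^sub>F v in at y within Y. \<gamma> (g v) = move (\<gamma> (g y)) (\<Lambda> (g v) - \<Lambda> (g y))"
    unfolding eventually_at_filter by eventually_elim (use U assms(3) in auto)
qed

lemma not_vertex_on_segment:
  assumes "p \<in> poly S i" "q \<in> poly S i" "p \<noteq> q" "0 < t" "t < 1"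
  shows "p + t *\<^sub>R (q - p) \<in> poly S i" "sg i *\<^sub>R (p + t *\<^sub>R (q - p)) \<notin> range P"
proof -
  have o: "p + t *\<^sub>R (q - p) \<in> open_segment p q"
    unfolding in_segment using assms by (auto intro!: exI[of _ t] simp: algebra_simps)
  then have "\<not> (p + t *\<^sub>R (q - p)) extreme_point_of poly S i"
    using assms unfolding extreme_point_of_def by blast
  then show "sg i *\<^sub>R (p + t *\<^sub>R (q - p)) \<notin> range P" by (simp add: extreme_poly)
  show "p + t *\<^sub>R (q - p) \<in> poly S i"
    using o closed_segment_subset[OF assms(1,2) poly_S_convex] segment_open_subset_closed by blast
qed

lemma loctrans_dev:
  assumes "loctrans Z \<Lambda> \<gamma>" "\<And>z w. z \<in> Z \<Longrightarrow> w \<in> Z \<Longrightarrow> \<Lambda> w - \<Lambda> z = \<Lambda>' w - \<Lambda>' z"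
  shows "loctrans Z \<Lambda>' \<gamma>"
  unfolding loctrans_def
proof (intro ballI conjI)
  fix z assume z: "z \<in> Z"
  then show "\<gamma> z \<in> X - V" using assms(1) unfolding loctrans_def by auto
  have "\<forall>\<^sub>F w in at z within Z. \<gamma> w = move (\<gamma> z) (\<Lambda> w - \<Lambda> z)" using assms(1) z unfolding loctrans_def by auto
  then show "\<forall>\<^sub>F w in at z within Z. \<gamma> w = move (\<gamma> z) (\<Lambda>' w - \<Lambda>' z)"
    unfolding eventually_at_filter by eventually_elim (use assms(2) z in auto)
qed

lemma loctrans_ray:
  fixes Z :: "real set"
  assumes "\<And>t. t \<in> Z \<Longrightarrow> p + t *\<^sub>R w \<in> poly S i" "\<And>t. t \<in> Z \<Longrightarrow> sg i *\<^sub>R (p + t *\<^sub>R w) \<notin> range P"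
  shows "loctrans Z (\<lambda>t. t *\<^sub>R w) (\<lambda>t. point_of S i (p + t *\<^sub>R w))"
proof -
  have "loctrans ((\<lambda>t. p + t *\<^sub>R w) ` Z) (\<lambda>p. p) (point_of S i)"
    by (rule loctrans_poly) (use assms in auto)
  then have "loctrans Z (\<lambda>t. p + t *\<^sub>R w) (\<lambda>t. point_of S i (p + t *\<^sub>R w))"
    by (rule loctrans_compose) (auto intro!: continuous_intros)
  then show ?thesis by (rule loctrans_dev) auto
qed

text \<open>
A straight path that runs into the point \<open>x\<close>, which may be a vertex, starts out as a straight
segment from one representative of \<open>x\<close>. Near \<open>x\<close> the offset from a representative is well defined;
its difference to \<open>t *\<^sub>R w\<close> is locally constant and tends to 0.
\<close>

theorem germ:
  assumes x: "x \<in> X" and b: "0 < b" and l: "loctrans {0<..<b} (\<lambda>t. t *\<^sub>R w) \<gamma>"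
    and lim: "((\<lambda>t. d x (\<gamma> t)) \<longlongrightarrow> 0) (at_right 0)"
  obtains i p \<delta> where "(i, p) \<in> x" "0 < \<delta>" "\<delta> \<le> b"
    "\<And>t. 0 < t \<Longrightarrow> t < \<delta> \<Longrightarrow> p + t *\<^sub>R w \<in> poly S i \<and> \<gamma> t = point_of S i (p + t *\<^sub>R w)"
proof -
  obtain r where r: "edge_radius x r" "r \<le> 1 / 2" using edge_radius_exists[OF x] by blast
  have r0: "r > 0" using r by (simp add: edge_radius_def)
  have "\<forall>\<^sub>F t in at_right 0. d x (\<gamma> t) < r" using lim r0 order_tendstoD(2) by blast
  then obtain b' where b': "b' > 0" "\<And>t. 0 < t \<Longrightarrow> t < b' \<Longrightarrow> d x (\<gamma> t) < r"
    unfolding eventually_at_right_field by auto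
  define \<beta> where "\<beta> = min b b'"
  have \<beta>: "\<beta> > 0" "\<beta> \<le> b" "\<And>t. 0 < t \<Longrightarrow> t < \<beta> \<Longrightarrow> d x (\<gamma> t) < r" using b b' by (auto simp: \<beta>_def)
  have inX: "\<gamma> t \<in> X - V" if "0 < t" "t < \<beta>" for t using l that \<beta>(2) unfolding loctrans_def by auto
  \<comment> \<open>by \<open>offset_unique\<close> the offset does not depend on the representative\<close>
  define off where "off t = (SOME h. \<exists>i p. (i, p) \<in> x \<and> p + h \<in> poly S i \<and> \<gamma> t = point_of S i (p + h) \<and> norm h < r)" for t
  have ex: "\<exists>h. \<exists>i p. (i, p) \<in> x \<and> p + h \<in> poly S i \<and> \<gamma> t = point_of S i (p + h) \<and> norm h < \<epsilon>"
    if tt: "0 < t" "t < \<beta>" "d x (\<gamma> t) < \<epsilon>" "\<epsilon> \<le> r" for t \<epsilon>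
  proof -
    have "\<gamma> t \<in> X" using inX[OF tt(1,2)] by simp
    from near[OF x this r(1) tt(3,4)]
    obtain i p q where "(i, p) \<in> x" "q \<in> poly S i" "\<gamma> t = point_of S i q" "dist q p < \<epsilon>" by blast
    moreover have "p + (q - p) = q" by simp
    ultimately show ?thesis by (intro exI[of _ "q - p"] exI[of _ i] exI[of _ p]) (simp add: dist_norm)
  qed
  have offE: "\<exists>i p. (i, p) \<in> x \<and> p + off t \<in> poly S i \<and> \<gamma> t = point_of S i (p + off t) \<and> norm (off t) < r"
    if "0 < t" "t < \<beta>" for t
    using someI_ex[OF ex[OF that \<beta>(3)[OF that]]] unfolding off_def by auto
  have off_eq: "off t = h"
    if t: "0 < t" "t < \<beta>" and h: "(j, q) \<in> x" "q + h \<in> poly S j" "\<gamma> t = point_of S j (q + h)" "norm h < r" for t h j q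
  proof -
    obtain i p where o: "(i, p) \<in> x" "p + off t \<in> poly S i" "\<gamma> t = point_of S i (p + off t)" "norm (off t) < r"
      using offE[OF t] by blast
    have "(p + off t) - p = (q + h) - q"
      by (rule offset_unique[OF x r o(1) h(1) o(2) h(2)]) (use o h in \<open>auto simp: dist_norm\<close>)
    then show ?thesis by simp
  qed
  have loc: "\<forall>\<^sub>F y in at a within {0<..<\<beta>}. off a - a *\<^sub>R w = off y - y *\<^sub>R w" if a: "a \<in> {0<..<\<beta>}" for a
  proof -
    have a': "0 < a" "a < \<beta>" using a by auto
    obtain i p where o: "(i, p) \<in> x" "p + off a \<in> poly S i" "\<gamma> a = point_of S i (p + off a)" "norm (off a) < r"
      using offE[OF a'] by blast
    have sub: "loctrans {0<..<\<beta>} (\<lambda>t. t *\<^sub>R w) \<gamma>" by (rule loctrans_subset[OF l]) (use \<beta>(2) in auto)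
    have td: "filterlim (\<lambda>y. y *\<^sub>R w - a *\<^sub>R w) (nhds 0) (at a within {0<..<\<beta>})"
      by (rule tendsto_dev) (use a in \<open>auto intro!: continuous_intros\<close>)
    have "((\<lambda>y. norm (off a + (y *\<^sub>R w - a *\<^sub>R w))) \<longlongrightarrow> norm (off a + 0)) (at a within {0<..<\<beta>})"
      by (intro tendsto_norm tendsto_add tendsto_const td)
    then have "\<forall>\<^sub>F y in at a within {0<..<\<beta>}. norm (off a + (y *\<^sub>R w - a *\<^sub>R w)) < r"
      using o(4) by (auto dest: order_tendstoD)
    moreover have "\<forall>\<^sub>F y in at a within {0<..<\<beta>}. \<exists>j q. (j, q) \<in> \<gamma> a \<and> q + (y *\<^sub>R w - a *\<^sub>R w) \<in> poly S j"
      by (rule eventually_compose_filterlim[OF full_disc_covered[OF inX[OF a']] td])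
    moreover have "\<forall>\<^sub>F y in at a within {0<..<\<beta>}. \<gamma> y = move (\<gamma> a) (y *\<^sub>R w - a *\<^sub>R w)"
      using sub a unfolding loctrans_def by auto
    moreover have "\<forall>\<^sub>F y in at a within {0<..<\<beta>}. y \<in> {0<..<\<beta>}" by (simp add: eventually_at_filter)
    ultimately show ?thesis
    proof eventually_elim
      case (elim y)
      then obtain j q where q: "(j, q) \<in> \<gamma> a" "q + (y *\<^sub>R w - a *\<^sub>R w) \<in> poly S j" by blast
      have "q \<in> poly S j \<and> eqv i (p + off a) j q" using q(1) o(3) mem_point_iff[OF o(2)] by simp
      then obtain p' where p': "(j, p') \<in> x" "q - p' = off a"
        using transfer[OF x r(1) o(1) _ o(2), of j q] o(4) by (auto simp: dist_norm)
      have e: "q + (y *\<^sub>R w - a *\<^sub>R w) = p' + (off a + (y *\<^sub>R w - a *\<^sub>R w))" using p' by (simp add: algebra_simps)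
      have "\<gamma> y = point_of S j (q + (y *\<^sub>R w - a *\<^sub>R w))" using elim(3) move_eq[OF inX[OF a'] q] by simp
      then have "off y = off a + (y *\<^sub>R w - a *\<^sub>R w)"
        using elim(1,4) p' q(2) unfolding e by (intro off_eq[of y j p']) auto
      then show ?case by simp
    qed
  qed
  define a0 where "a0 = off (\<beta>/2) - (\<beta>/2) *\<^sub>R w"
  have off_lin: "off t = a0 + t *\<^sub>R w" if "0 < t" "t < \<beta>" for t
  proof -
    have "off (\<beta>/2) - (\<beta>/2) *\<^sub>R w = off t - t *\<^sub>R w"
      by (rule connected_local_const[of "{0<..<\<beta>}"]) (use that loc \<beta>(1) in auto)
    then show ?thesis by (simp add: a0_def)
  qed
  have "a0 = 0"
  proof (rule ccontr)
    assume "a0 \<noteq> 0"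
    define e where "e = min r (norm a0 / 2)"
    have e: "e > 0" "e \<le> r" "e \<le> norm a0 / 2" using r0 \<open>a0 \<noteq> 0\<close> by (auto simp: e_def)
    have 1: "\<forall>\<^sub>F t in at_right 0. d x (\<gamma> t) < e" using lim e(1) order_tendstoD(2) by blast
    have "((\<lambda>t. norm (t *\<^sub>R w)) \<longlongrightarrow> norm (0 *\<^sub>R w)) (at_right 0)" by (intro tendsto_intros)
    then have 2: "\<forall>\<^sub>F t in at_right 0. norm (t *\<^sub>R w) < norm a0 / 2"
      by (rule order_tendstoD(2)) (simp add: \<open>a0 \<noteq> 0\<close>)
    have 3: "\<forall>\<^sub>F t in at_right 0. t \<in> {0<..<\<beta>}" using \<beta>(1) by (rule eventually_at_right_real)
    have "\<forall>\<^sub>F t in at_right (0::real). False" using 1 2 3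
    proof eventually_elim
      case (elim t)
      then have t: "0 < t" "t < \<beta>" by auto
      obtain h j q where h: "(j, q) \<in> x" "q + h \<in> poly S j" "\<gamma> t = point_of S j (q + h)" "norm h < e"
        using ex[OF t elim(1) e(2)] by blast
      have "off t = h" using off_eq[OF t h(1,2,3)] h(4) e(2) by simp
      then have "a0 = h - t *\<^sub>R w" using off_lin[OF t] by (metis add_diff_cancel_right')
      then have "norm a0 \<le> norm h + norm (t *\<^sub>R w)" by (metis norm_triangle_ineq4)
      then show False using h(4) e(3) elim(2) by simp
    qed
    then show False by (simp add: trivial_limit_at_right_real)
  qed
  then have off: "off t = t *\<^sub>R w" if "0 < t" "t < \<beta>" for t using off_lin[OF that] by simp
  define t0 where "t0 = \<beta> / 2"
  have t0: "0 < t0" "t0 < \<beta>" using \<beta>(1) by (auto simp: t0_def)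
  obtain i p where o: "(i, p) \<in> x" "p + t0 *\<^sub>R w \<in> poly S i" "\<gamma> t0 = point_of S i (p + t0 *\<^sub>R w)"
    using offE[OF t0] off[OF t0] by auto
  have pp: "p \<in> poly S i" using mem_pointD[OF x o(1)] by simp
  have nv0: "sg i *\<^sub>R (p + t0 *\<^sub>R w) \<notin> range P" using inX[OF t0] point_of_V_iff[OF o(2)] o(3) by auto
  have seg: "p + t *\<^sub>R w \<in> poly S i \<and> sg i *\<^sub>R (p + t *\<^sub>R w) \<notin> range P" if t: "0 < t" "t \<le> t0" for t
  proof (cases "t = t0 \<or> w = 0")
    case True then show ?thesis using o(2) nv0 by auto
  next
    case False
    have e: "p + t *\<^sub>R w = p + (t / t0) *\<^sub>R ((p + t0 *\<^sub>R w) - p)" using t0 by simp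
    show ?thesis unfolding e
      using not_vertex_on_segment[OF pp o(2), of "t / t0"] False t t0 by auto
  qed
  have ray: "loctrans {0<..t0} (\<lambda>t. t *\<^sub>R w) (\<lambda>t. point_of S i (p + t *\<^sub>R w))"
    by (rule loctrans_ray) (use seg in auto)
  have sub0: "loctrans {0<..t0} (\<lambda>t. t *\<^sub>R w) \<gamma>" by (rule loctrans_subset[OF l]) (use t0 \<beta>(2) in auto)
  have "\<gamma> t = point_of S i (p + t *\<^sub>R w)" if "0 < t" "t \<le> t0" for t
    by (rule loctrans_agree[OF _ _ sub0 ray, of t0])
       (use that t0 o in \<open>auto intro!: continuous_intros\<close>)
  then show ?thesis using seg t0 \<beta>(2) by (intro that[OF o(1), of t0]) auto
qed

section \<open>Affine maps\<close>

definition cont :: "(piece surface_point \<Rightarrow> piece surface_point) \<Rightarrow> bool" where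
  "cont f \<longleftrightarrow> (\<forall>x\<in>X. \<forall>\<epsilon>>0. \<exists>\<delta>>0. \<forall>y\<in>X. d x y < \<delta> \<longrightarrow> d (f x) (f y) < \<epsilon>)"

text \<open>
Continuity matters at the vertices, near which there is no affine chart.
\<close>

definition affine_map :: "real^2^2 \<Rightarrow> (piece surface_point \<Rightarrow> piece surface_point) \<Rightarrow> bool" where
  "affine_map M f \<longleftrightarrow> (\<forall>x\<in>X. f x \<in> X \<and> (f x \<in> V \<longleftrightarrow> x \<in> V)) \<and>
     (\<forall>x\<in>X-V. \<forall>\<^sub>F h in nhds 0. f (move x h) = move (f x) (M *v h)) \<and> cont f"

definition affine_aut :: "real^2^2 \<Rightarrow> (piece surface_point \<Rightarrow> piece surface_point) \<Rightarrow> bool" where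
  "affine_aut M f \<longleftrightarrow> invertible M \<and> f \<in> extensional X \<and> affine_map M f \<and>
     (\<exists>g. affine_map (matrix_inv M) g \<and> (\<forall>x\<in>X. g (f x) = x \<and> f (g x) = x))"

lemma matrix_tendsto_0: "filterlim (\<lambda>h. M *v h) (nhds 0) (nhds (0::real^2))" for M :: "real^2^2"
proof -
  have "((*v) M \<longlongrightarrow> M *v 0) (at 0)"
    using linear_continuous_at[OF matrix_vector_mul_bounded_linear, of 0 M] unfolding continuous_at .
  then show ?thesis using tendsto_at_iff_tendsto_nhds[of "(*v) M" 0] by simp
qed

lemma eventually_move_in: "x \<in> X - V \<Longrightarrow> \<forall>\<^sub>F h in nhds 0. move x h \<in> X - V"
proof -
  assume x: "x \<in> X - V"
  then obtain r where r: "r > 0" "disc x r" using disc_exists by blast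
  show ?thesis unfolding eventually_nhds_metric using move_nonvertex[OF x r(2)] r(1) by (intro exI[of _ r]) auto
qed

lemma affine_map_cong: assumes "affine_map M f" "\<And>x. x \<in> X \<Longrightarrow> f x = g x" shows "affine_map M g"
proof -
  have "\<forall>\<^sub>F h in nhds 0. g (move x h) = move (g x) (M *v h)" if x: "x \<in> X - V" for x
  proof -
    have "\<forall>\<^sub>F h in nhds 0. f (move x h) = move (f x) (M *v h)" using assms(1) x unfolding affine_map_def by blast
    then show ?thesis using eventually_move_in[OF x]
      by eventually_elim (use assms(2) x in auto)
  qed
  moreover have "cont f" using assms(1) unfolding affine_map_def by blast
  then have "cont g" unfolding cont_def by (simp add: assms(2))
  ultimately show ?thesis using assms unfolding affine_map_def by auto
qed

lemma cont_comp: assumes "cont f" "cont g" "\<And>x. x \<in> X \<Longrightarrow> g x \<in> X" shows "cont (\<lambda>x. f (g x))"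
  unfolding cont_def
proof (intro ballI allI impI)
  fix x and e :: real assume x: "x \<in> X" and e: "0 < e"
  obtain e' where e': "e' > 0" "\<forall>y\<in>X. d (g x) y < e' \<longrightarrow> d (f (g x)) (f y) < e"
    using assms(1,3) x e unfolding cont_def by meson
  obtain e'' where "e'' > 0" "\<forall>y\<in>X. d x y < e'' \<longrightarrow> d (g x) (g y) < e'"
    using assms(2) x e' unfolding cont_def by meson
  then show "\<exists>\<delta>>0. \<forall>y\<in>X. d x y < \<delta> \<longrightarrow> d (f (g x)) (f (g y)) < e" using e' assms(3) by blast
qed

lemma affine_map_comp: assumes "affine_map M f" "affine_map N g" shows "affine_map (M ** N) (\<lambda>x. f (g x))"
proof -
  have "\<forall>\<^sub>F h in nhds 0. f (g (move x h)) = move (f (g x)) (M ** N *v h)" if x: "x \<in> X - V" for x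
  proof -
    have "\<forall>\<^sub>F h in nhds 0. g (move x h) = move (g x) (N *v h)" using assms(2) x unfolding affine_map_def by blast
    moreover have "\<forall>\<^sub>F k in nhds 0. f (move (g x) k) = move (f (g x)) (M *v k)"
      using assms x unfolding affine_map_def by blast
    then have "\<forall>\<^sub>F h in nhds 0. f (move (g x) (N *v h)) = move (f (g x)) (M *v (N *v h))"
      by (rule eventually_compose_filterlim[OF _ matrix_tendsto_0])
    ultimately show ?thesis by eventually_elim (simp add: matrix_vector_mul_assoc)
  qed
  moreover have "cont (\<lambda>x. f (g x))" 
    by (rule cont_comp[of f g]) (use assms in \<open>auto simp: affine_map_def\<close>)
  ultimately show ?thesis using assms unfolding affine_map_def by simp
qed

lemma affine_map_id: "affine_map (mat 1) (\<lambda>x. x)"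
proof -
  have "cont (\<lambda>x. x)" unfolding cont_def
  proof (intro ballI allI impI)
    fix x and e :: real assume "0 < e"
    then show "\<exists>\<delta>>0. \<forall>y\<in>X. d x y < \<delta> \<longrightarrow> d x y < e" by (intro exI[of _ e]) simp
  qed
  then show ?thesis unfolding affine_map_def by simp
qed

lemma affine_map_loctrans:
  assumes "affine_map M f" "loctrans Z \<Lambda> \<gamma>" "continuous_on Z \<Lambda>"
  shows "loctrans Z (\<lambda>z. M *v \<Lambda> z) (\<lambda>z. f (\<gamma> z))"
  unfolding loctrans_def
proof (intro ballI conjI)
  fix z assume z: "z \<in> Z"
  have n: "\<gamma> z \<in> X - V" and e: "\<forall>\<^sub>F w in at z within Z. \<gamma> w = move (\<gamma> z) (\<Lambda> w - \<Lambda> z)"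
    using assms(2) z unfolding loctrans_def by auto
  show "f (\<gamma> z) \<in> X - V" using assms(1) n unfolding affine_map_def by auto
  have "\<forall>\<^sub>F h in nhds 0. f (move (\<gamma> z) h) = move (f (\<gamma> z)) (M *v h)" using assms(1) n unfolding affine_map_def by blast
  from eventually_compose_filterlim[OF this tendsto_dev[OF assms(3) z]] e
  show "\<forall>\<^sub>F w in at z within Z. f (\<gamma> w) = move (f (\<gamma> z)) (M *v \<Lambda> w - M *v \<Lambda> z)"
    by eventually_elim (simp add: matrix_vector_mult_diff_distrib)
qed

text \<open>
On the open segment between \<open>p\<close> and \<open>q\<close> the map is a straight path. Continuity of the map extends
the estimate to the end points.
\<close>

lemma affine_map_segment:
  assumes "affine_map N g" "invertible A" "p \<in> poly S i" "q \<in> poly S i"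
  shows "dA A (g (point_of S i p)) (g (point_of S i q)) \<le> norm (A *v (N *v (q - p)))"
proof (cases "p = q")
  case True
  then show ?thesis using dA_self[OF assms(2)] assms point_of_in_points[OF assms(3)] unfolding affine_map_def by auto
next
  case False
  define \<gamma> where "\<gamma> t = g (point_of S i (p + t *\<^sub>R (q - p)))" for t
  note seg = not_vertex_on_segment[OF assms(3,4) False]
  have "loctrans {0<..<1} (\<lambda>t. t *\<^sub>R (q - p)) (\<lambda>t. point_of S i (p + t *\<^sub>R (q - p)))"
    by (rule loctrans_ray) (use seg in auto)
  from affine_map_loctrans[OF assms(1) this] have lt: "loctrans {0<..<1} (\<lambda>t. t *\<^sub>R (N *v (q - p))) \<gamma>"
    unfolding \<gamma>_def by (simp add: matrix_vector_mult_scaleR continuous_intros)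
  define D where "D = norm (A *v (N *v (q - p)))"
  have D: "D \<ge> 0" by (simp add: D_def)
  have px: "point_of S i p \<in> X" "point_of S i q \<in> X" using assms by (auto intro: point_of_in_points)
  have gX: "g x \<in> X" if "x \<in> X" for x using assms(1) that unfolding affine_map_def by auto
  have \<gamma>X: "\<gamma> t \<in> X" if "0 < t" "t < 1" for t unfolding \<gamma>_def by (intro gX point_of_in_points seg(1)[OF that])
  obtain K where K: "K > 0" "\<forall>x\<in>X. \<forall>y\<in>X. dA A x y \<le> K * d x y" using dA_le[OF assms(2)] by blast
  have "dA A (g (point_of S i p)) (g (point_of S i q)) \<le> D + e" if e: "e > 0" for e
  proof -
    define e' where "e' = e / (2 * K)"
    have e': "e' > 0" using e K by (simp add: e'_def)
    have near_end: "\<exists>\<delta>>0. \<forall>z\<in>X. d x z < \<delta> \<longrightarrow> dA A (g x) (g z) < e / 2" if x: "x \<in> X" for x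
    proof -
      obtain \<delta> where \<delta>: "\<delta> > 0" "\<forall>z\<in>X. d x z < \<delta> \<longrightarrow> d (g x) (g z) < e'"
        using assms(1) x e' unfolding affine_map_def cont_def by meson
      have "dA A (g x) (g z) < e / 2" if z: "z \<in> X" "d x z < \<delta>" for z
      proof -
        have "dA A (g x) (g z) \<le> K * d (g x) (g z)" using K gX x z by auto
        also have "\<dots> < K * e'" using \<delta> z K by auto
        finally show ?thesis using K by (simp add: e'_def)
      qed
      then show ?thesis using \<delta> by blast
    qed
    obtain \<delta>1 where \<delta>1: "\<delta>1 > 0" "\<forall>z\<in>X. d (point_of S i p) z < \<delta>1 \<longrightarrow> dA A (g (point_of S i p)) (g z) < e / 2"
      using near_end px by blast
    obtain \<delta>2 where \<delta>2: "\<delta>2 > 0" "\<forall>z\<in>X. d (point_of S i q) z < \<delta>2 \<longrightarrow> dA A (g (point_of S i q)) (g z) < e / 2"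
      using near_end px by blast
    define n where "n = norm (q - p)"
    have n: "n > 0" using False by (simp add: n_def)
    define s where "s = min (1/3) (min \<delta>1 \<delta>2 / (2 * n))"
    have s: "0 < s" "s < 1/2" "s * n < \<delta>1" "s * n < \<delta>2"
    proof -
      have "s * n \<le> (min \<delta>1 \<delta>2 / (2 * n)) * n" unfolding s_def using n by (intro mult_right_mono) auto
      then have "s * n \<le> min \<delta>1 \<delta>2 / 2" using n by simp
      then show "s * n < \<delta>1" "s * n < \<delta>2" using \<delta>1(1) \<delta>2(1) by auto
      show "0 < s" using \<delta>1(1) \<delta>2(1) n by (simp add: s_def)
      show "s < 1/2" by (simp add: s_def min_less_iff_disj)
    qed
    have sx: "p + s *\<^sub>R (q - p) \<in> poly S i" "p + (1 - s) *\<^sub>R (q - p) \<in> poly S i" using seg(1) s by auto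
    have "d (point_of S i p) (point_of S i (p + s *\<^sub>R (q - p))) \<le> norm (s *\<^sub>R (q - p))"
      using d_segment[OF assms(3) sx(1)] by simp
    then have 1: "dA A (g (point_of S i p)) (\<gamma> s) < e / 2"
      using \<delta>1(2) point_of_in_points[OF sx(1)] s(1,3) unfolding \<gamma>_def n_def by auto
    have "(p + (1 - s) *\<^sub>R (q - p)) - q = (- s) *\<^sub>R (q - p)" by (simp add: algebra_simps)
    then have "d (point_of S i q) (point_of S i (p + (1 - s) *\<^sub>R (q - p))) \<le> norm ((- s) *\<^sub>R (q - p))"
      using d_segment[OF assms(4) sx(2)] by simp
    then have 2: "dA A (g (point_of S i q)) (\<gamma> (1 - s)) < e / 2"
      using \<delta>2(2) point_of_in_points[OF sx(2)] s(1,4) unfolding \<gamma>_def n_def by auto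
    have "dA A (\<gamma> s) (\<gamma> (1 - s)) \<le> D * ((1 - s) - s)"
      unfolding D_def by (rule loctrans_lipschitz[OF loctrans_subset[OF lt] assms(2)]) (use s in auto)
    also have "\<dots> \<le> D" using D s by (simp add: mult_left_le)
    finally have 3: "dA A (\<gamma> s) (\<gamma> (1 - s)) \<le> D" .
    have g1: "g (point_of S i p) \<in> X" "g (point_of S i q) \<in> X" "\<gamma> s \<in> X" "\<gamma> (1 - s) \<in> X" using gX px \<gamma>X s by auto
    have "dA A (g (point_of S i p)) (g (point_of S i q)) \<le> dA A (g (point_of S i p)) (\<gamma> s) + dA A (\<gamma> s) (g (point_of S i q))"
      using dA_triangle[OF assms(2)] g1 by blast
    also have "dA A (\<gamma> s) (g (point_of S i q)) \<le> dA A (\<gamma> s) (\<gamma> (1 - s)) + dA A (\<gamma> (1 - s)) (g (point_of S i q))"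
      using dA_triangle[OF assms(2)] g1 by blast
    also have "dA A (\<gamma> (1 - s)) (g (point_of S i q)) < e / 2" using 2 dA_sym[OF assms(2)] by metis
    finally show ?thesis using 1 3 by linarith
  qed
  then show ?thesis unfolding D_def by (rule field_le_epsilon)
qed

text \<open>
Apply \<open>affine_map_segment\<close> to the segments of a path. With the reverse inequality for the inverse
map this turns local affinity into an isometry of the linear image.
\<close>

lemma affine_map_dist:
  assumes g: "affine_map N g" "invertible N" and A: "invertible A" and xy: "x \<in> X" "y \<in> X"
  shows "dA A (g x) (g y) \<le> dA (A ** N) x y"
proof -
  define B where "B = A ** N"
  have B: "invertible B" unfolding B_def using A g(2) by (rule invertible_mult)
  have gX: "g x \<in> X" if "x \<in> X" for x using g that unfolding affine_map_def by auto
  have *: "\<forall>y\<in>X. y' = linear_map B y \<longrightarrow> dA A (g x) (g y) \<le> l"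
    if "joined (linear_image B S) x' y' l" "x' = linear_map B x" for x' y' l
    using that
  proof induction
    case (refl z)
    show ?case
    proof (intro ballI impI)
      fix y assume "y \<in> X" "z = linear_map B y"
      then have "y = x" using refl(2) linear_map_inv(1)[OF B] by metis
      then show "dA A (g x) (g y) \<le> 0" using dA_self[OF A] gX xy by simp
    qed
  next
    case (step z i p' l q')
    have in': "p' \<in> (*v) B ` poly S i" "q' \<in> (*v) B ` poly S i" using step(2) unfolding poly_linear_image by auto
    then obtain p q where pq: "p' = B *v p" "q' = B *v q" "p \<in> poly S i" "q \<in> poly S i" by blast
    show ?case
    proof (intro ballI impI)
      fix y assume y: "y \<in> X" "point_of (linear_image B S) i q' = linear_map B y"
      then have "linear_map B y = linear_map B (point_of S i q)" using linear_map_point_of[OF B] pq by metis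
      then have yq: "y = point_of S i q" using linear_map_inv(1)[OF B] by metis
      have pX: "point_of S i p \<in> X" using point_of_in_points[OF pq(3)] .
      have "point_of (linear_image B S) i p' = linear_map B (point_of S i p)" using linear_map_point_of[OF B] pq by metis
      then have 1: "dA A (g x) (g (point_of S i p)) \<le> l" using step pX by blast
      have "dA A (g (point_of S i p)) (g y) \<le> norm (A *v (N *v (q - p)))"
        unfolding yq by (rule affine_map_segment[OF g(1) A pq(3,4)])
      also have "\<dots> = dist p' q'"
        unfolding pq B_def by (simp add: dist_norm matrix_vector_mult_diff_distrib matrix_vector_mul_assoc norm_minus_commute)
      finally have "dA A (g (point_of S i p)) (g y) \<le> dist p' q'" .
      then show "dA A (g x) (g y) \<le> l + dist p' q'"
        using 1 dA_triangle[OF A gX[OF xy(1)] gX[OF pX] gX[OF y(1)]] by linarith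
    qed
  qed
  have "\<exists>l. joined (linear_image B S) (linear_map B x) (linear_map B y) l"
    using conA[OF B] linX[OF B] xy unfolding connected_surface_def by auto
  then have "dA A (g x) (g y) \<le> dA B x y"
    unfolding dA_def[of B] surface_dist_def by (intro cInf_greatest) (use * xy in blast)+
  then show ?thesis by (simp only: B_def)
qed

section \<open>Affine automorphisms as locally affine homeomorphisms\<close>

lemma Q_up: assumes "p \<in> Q" "0 \<le> t" shows "p + vector [0, t] \<in> Q"
  unfolding Q_halfplanes
proof
  fix k
  have "edge_side k (p + vector [0, t]) = edge_side k p + E k $ 1 * t" by (simp add: edge_side_add cross2_def)
  then show "0 \<le> edge_side k (p + vector [0, t])"
    using edge_side_nonneg[OF assms(1), of k] E1_ge[of k] assms(2) by simp
qed

lemma vertical: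
  assumes "0 < t" shows "P m + t *\<^sub>R vector [0, 1] \<in> poly S QPlus" "P m + t *\<^sub>R vector [0, 1] \<notin> range P"
proof -
  have e: "t *\<^sub>R vector [0, 1] = (vector [0, t] :: real^2)" by (simp add: vec2_eq_iff)
  show "P m + t *\<^sub>R vector [0, 1] \<in> poly S QPlus"
    using Q_up[OF hor.P_in_Q, of t m] assms unfolding e by (simp add: poly_S del: Q_piece.simps)
  have "edge_side k (P m + vector [0, t]) > 0" for k
  proof -
    have "edge_side k (P m + vector [0, t]) = edge_side k (P m) + E k $ 1 * t" by (simp add: edge_side_add cross2_def)
    moreover have "E k $ 1 * t > 0" using E1_ge[of k] assms by simp
    ultimately show ?thesis using edge_side_P_nonneg[of k m] by linarith
  qed
  then have pos: "edge_side k (P m + vector [0, t]) > 0" for k .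
  show "P m + t *\<^sub>R vector [0, 1] \<notin> range P" unfolding e
  proof
    assume "P m + vector [0, t] \<in> range P"
    then obtain j where "P m + vector [0, t] = P j" by blast
    then show False using pos[of j] edge_side_P(1)[of j] by simp
  qed
qed

lemma affine_map_inverse_local:
  assumes M: "invertible M" and gf: "\<And>x. x \<in> X \<Longrightarrow> g (f x) = x"
    and x: "x \<in> X - V" and l: "\<forall>\<^sub>F h in nhds 0. f (move x h) = move (f x) (M *v h)"
  shows "\<forall>\<^sub>F k in nhds 0. g (move (f x) k) = move x (matrix_inv M *v k)"
proof -
  have "\<forall>\<^sub>F h in nhds 0. f (move x h) = move (f x) (M *v h) \<and> move x h \<in> X - V"
    using l eventually_move_in[OF x] by eventually_elim simp
  from eventually_compose_filterlim[OF this matrix_tendsto_0[of "matrix_inv M"]]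
  show ?thesis
  proof eventually_elim
    case (elim k)
    then have "g (move (f x) k) = g (f (move x (matrix_inv M *v k)))" using matrix_inv_cancel(4)[OF M] by simp
    also have "\<dots> = move x (matrix_inv M *v k)" using gf elim by blast
    finally show ?case .
  qed
qed

text \<open>
The information about the pair of a map and its inverse that can be read off from an isometry that
preserves directions. It does not exclude that regular points are mapped to vertices.
\<close>

definition affine_data :: "real^2^2 \<Rightarrow> (piece surface_point \<Rightarrow> piece surface_point) \<Rightarrow> (piece surface_point \<Rightarrow> piece surface_point) \<Rightarrow> bool" where
  "affine_data M f g \<longleftrightarrow> invertible M \<and> (\<forall>x\<in>X. f x \<in> X \<and> g x \<in> X \<and> g (f x) = x \<and> f (g x) = x) \<and> cont f \<and> cont g \<and>
    (\<forall>x\<in>X-V. f x \<notin> V \<longrightarrow> (\<forall>\<^sub>F h in nhds 0. f (move x h) = move (f x) (M *v h)))"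

lemma affine_data_inverse: assumes "affine_data M f g" shows "affine_data (matrix_inv M) g f"
  unfolding affine_data_def
proof (intro conjI ballI impI)
  show "invertible (matrix_inv M)" using assms invertible_matrix_inv unfolding affine_data_def by blast
  fix y assume y: "y \<in> X - V" "g y \<notin> V"
  then have x: "g y \<in> X - V" "f (g y) = y" using assms unfolding affine_data_def by auto
  have pl: "\<forall>x\<in>X-V. f x \<notin> V \<longrightarrow> (\<forall>\<^sub>F h in nhds 0. f (move x h) = move (f x) (M *v h))"
    using assms unfolding affine_data_def by blast
  have "f (g y) \<notin> V" using x(2) y(1) by simp
  then have "\<forall>\<^sub>F h in nhds 0. f (move (g y) h) = move (f (g y)) (M *v h)" using pl x(1) by blast
  from affine_map_inverse_local[OF _ _ x(1) this, of g] show "\<forall>\<^sub>F k in nhds 0. g (move y k) = move (g y) (matrix_inv M *v k)"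
    using assms x(2) unfolding affine_data_def by auto
qed (use assms in \<open>auto simp: affine_data_def\<close>)

text \<open>
If a regular point \<open>x\<close> were mapped to a vertex, the inverse would carry the upward rays from all
polygon corners at this vertex to straight germs at \<open>x\<close> with one and the same direction. There is
only one such germ at a regular point, but already the rays from \<open>P m\<close> and \<open>P (m + 2)\<close> are
disjoint.
\<close>

lemma affine_data_vertex: assumes p: "affine_data M f g" and x: "x \<in> X - V" shows "f x \<notin> V"
proof
  assume "f x \<in> V"
  then obtain b where b: "f x = vtx b" using V_eq by blast
  have pr: "\<And>x. x \<in> X \<Longrightarrow> f x \<in> X" "\<And>x. x \<in> X \<Longrightarrow> g x \<in> X" "\<And>x. x \<in> X \<Longrightarrow> g (f x) = x" "\<And>x. x \<in> X \<Longrightarrow> f (g x) = x"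
    and cg: "cont g" using p unfolding affine_data_def by auto
  let ?e = "vector [0, 1] :: real^2"
  let ?v = "matrix_inv M *v ?e"
  have vX: "vtx b' \<in> X" for b' using vtx_in_V V_subset by blast
  have e1: "norm ?e = 1" by (simp add: norm_vec_def L2_set_def sum_2)
  \<comment> \<open>every vertical germ at the vertex is pulled back to the same germ at the regular point\<close>
  have key: "\<exists>\<delta>>0. \<forall>t. 0 < t \<and> t < \<delta> \<longrightarrow> g (point_of S QPlus (P m + t *\<^sub>R ?e)) = move x (t *\<^sub>R ?v)"
    if m: "even m = b" for m
  proof -
    define \<gamma> where "\<gamma> t = point_of S QPlus (P m + t *\<^sub>R ?e)" for t
    have vm: "vtx b = point_of S QPlus (P m)" using vtx_eq[of QPlus m] m by simp
    have \<gamma>n: "\<gamma> t \<in> X - V" if "0 < t" for t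
      unfolding \<gamma>_def using vertical[OF that, of m] point_of_V_iff[of "P m + t *\<^sub>R ?e" QPlus] point_of_in_points by auto
    have d\<gamma>: "d (vtx b) (\<gamma> t) \<le> t" if "0 < t" for t
    proof -
      have "P m \<in> poly S QPlus" using vertex_poly[of QPlus m] by simp
      from d_segment[OF this vertical(1)[OF that, of m]] show ?thesis
        unfolding vm \<gamma>_def using e1 that by simp
    qed
    have ray: "loctrans {0<..<b'} (\<lambda>t. t *\<^sub>R ?e) \<gamma>" for b'
      unfolding \<gamma>_def by (rule loctrans_ray) (use vertical in auto)
    have dpos: "d (vtx b) (f (vtx b')) > 0" for b'
    proof -
      have "vtx b \<noteq> f (vtx b')" using pr(3)[OF vX[of b']] pr(3)[of x] b x vtx_in_V[of b'] by auto
      then show ?thesis using d_eq_0[OF vX pr(1)[OF vX]] d_nonneg[OF vX pr(1)[OF vX], of b b'] by force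
    qed
    define \<delta>0 where "\<delta>0 = min (d (vtx b) (f (vtx True))) (d (vtx b) (f (vtx False)))"
    have \<delta>0: "\<delta>0 > 0" using dpos by (simp add: \<delta>0_def)
    have gn: "g (\<gamma> t) \<in> X - V" if t: "0 < t" "t < \<delta>0" for t
    proof -
      have "g (\<gamma> t) \<noteq> vtx b'" for b'
      proof
        assume "g (\<gamma> t) = vtx b'"
        then have "\<gamma> t = f (vtx b')" using pr(4)[of "\<gamma> t"] \<gamma>n[OF t(1)] by simp
        moreover have "\<delta>0 \<le> d (vtx b) (f (vtx b'))" by (cases b') (auto simp: \<delta>0_def)
        ultimately show False using d\<gamma>[OF t(1)] t(2) by simp
      qed
      then show ?thesis using pr(2)[of "\<gamma> t"] \<gamma>n[OF t(1)] V_eq by auto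
    qed
    have gl: "loctrans {0<..<\<delta>0} (\<lambda>t. t *\<^sub>R ?v) (\<lambda>t. g (\<gamma> t))"
      unfolding loctrans_def
    proof (intro ballI conjI)
      fix t assume t: "t \<in> {0<..<\<delta>0}"
      then show "g (\<gamma> t) \<in> X - V" using gn by auto
      have "\<forall>\<^sub>F k in nhds 0. g (move (\<gamma> t) k) = move (g (\<gamma> t)) (matrix_inv M *v k)"
        using affine_data_inverse[OF p] \<gamma>n[of t] gn[of t] t unfolding affine_data_def by auto
      moreover have "filterlim (\<lambda>s. s *\<^sub>R ?e - t *\<^sub>R ?e) (nhds 0) (at t within {0<..<\<delta>0})"
        by (rule tendsto_dev) (use t in \<open>auto intro!: continuous_intros\<close>)
      ultimately have 1: "\<forall>\<^sub>F s in at t within {0<..<\<delta>0}. g (move (\<gamma> t) (s *\<^sub>R ?e - t *\<^sub>R ?e)) =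
          move (g (\<gamma> t)) (matrix_inv M *v (s *\<^sub>R ?e - t *\<^sub>R ?e))"
        by (rule eventually_compose_filterlim)
      have 2: "\<forall>\<^sub>F s in at t within {0<..<\<delta>0}. \<gamma> s = move (\<gamma> t) (s *\<^sub>R ?e - t *\<^sub>R ?e)"
        using ray t unfolding loctrans_def by blast
      from 1 2 show "\<forall>\<^sub>F s in at t within {0<..<\<delta>0}. g (\<gamma> s) = move (g (\<gamma> t)) (s *\<^sub>R ?v - t *\<^sub>R ?v)"
        by eventually_elim (simp add: matrix_vector_mult_diff_distrib matrix_vector_mult_scaleR)
    qed
    have lim: "((\<lambda>t. d x (g (\<gamma> t))) \<longlongrightarrow> 0) (at_right 0)"
    proof (rule tendstoI)
      fix \<epsilon> :: real assume "0 < \<epsilon>"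
      then obtain \<delta> where \<delta>: "\<delta> > 0" "\<forall>y\<in>X. d (vtx b) y < \<delta> \<longrightarrow> d (g (vtx b)) (g y) < \<epsilon>"
        using cg vX[of b] unfolding cont_def by meson
      have gv: "g (vtx b) = x" using b pr(3) x by force
      have "\<forall>\<^sub>F t in at_right 0. t \<in> {0<..<\<delta>}" using \<delta>(1) by (rule eventually_at_right_real)
      then show "\<forall>\<^sub>F t in at_right 0. dist (d x (g (\<gamma> t))) 0 < \<epsilon>"
      proof eventually_elim
        case (elim t)
        then have "d x (g (\<gamma> t)) < \<epsilon>" using \<delta>(2) d\<gamma>[of t] \<gamma>n[of t] gv by auto
        moreover have "0 \<le> d x (g (\<gamma> t))" using d_nonneg[of x "g (\<gamma> t)"] x pr(2) \<gamma>n[of t] elim by auto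
        ultimately show ?case by simp
      qed
    qed
    obtain i p \<delta> where g: "(i, p) \<in> x" "0 < \<delta>" "\<delta> \<le> \<delta>0"
      "\<And>t. 0 < t \<Longrightarrow> t < \<delta> \<Longrightarrow> p + t *\<^sub>R ?v \<in> poly S i \<and> g (\<gamma> t) = point_of S i (p + t *\<^sub>R ?v)"
      by (rule germ[OF DiffD1[OF x] \<delta>0 gl lim], rule that)
    have "g (\<gamma> t) = move x (t *\<^sub>R ?v)" if "0 < t" "t < \<delta>" for t
      using g(4)[OF that] move_eq[OF x g(1), of "t *\<^sub>R ?v"] by simp
    then show ?thesis using g(2) unfolding \<gamma>_def by blast
  qed
  \<comment> \<open>two different corners of the first piece at the vertex\<close>
  define m :: int where "m = (if b then 0 else 1)"
  have m: "even m = b" "even (m + 2) = b" by (auto simp: m_def)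
  obtain \<delta>1 where \<delta>1: "\<delta>1 > 0" "\<And>t. 0 < t \<Longrightarrow> t < \<delta>1 \<Longrightarrow> g (point_of S QPlus (P m + t *\<^sub>R ?e)) = move x (t *\<^sub>R ?v)"
    using key[OF m(1)] by blast
  obtain \<delta>2 where \<delta>2: "\<delta>2 > 0" "\<And>t. 0 < t \<Longrightarrow> t < \<delta>2 \<Longrightarrow> g (point_of S QPlus (P (m + 2) + t *\<^sub>R ?e)) = move x (t *\<^sub>R ?v)"
    using key[OF m(2)] by blast
  define t where "t = min \<delta>1 \<delta>2 / 2"
  have t: "0 < t" "t < \<delta>1" "t < \<delta>2" using \<delta>1 \<delta>2 by (auto simp: t_def)
  let ?a = "P m + t *\<^sub>R ?e" and ?b = "P (m + 2) + t *\<^sub>R ?e"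
  have pa: "?a \<in> poly S QPlus" "?b \<in> poly S QPlus" using vertical t by auto
  then have "point_of S QPlus ?a = point_of S QPlus ?b"
    using \<delta>1(2)[OF t(1,2)] \<delta>2(2)[OF t(1,3)] pr(4)[OF point_of_in_points[OF pa(1)]] pr(4)[OF point_of_in_points[OF pa(2)]] by metis
  then have "(QPlus, ?b) \<in> point_of S QPlus ?a" using mem_point_of[OF pa(2)] by simp
  moreover have "point_of S QPlus ?a \<in> X - V"
    using point_of_V_iff[OF pa(1)] vertical(2)[OF t(1), of m] point_of_in_points[OF pa(1)] by simp
  ultimately have "?a = ?b" using nonvertex_rep_unique mem_point_of[OF pa(1)] by blast
  then show False by simp
qed

lemma affine_data_affine_map: assumes "affine_data M f g" shows "affine_map M f" "affine_map (matrix_inv M) g"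
proof -
  have *: "affine_map M f" if p: "affine_data M f g" for M f g
  proof -
    have "f x \<in> V \<longleftrightarrow> x \<in> V" if x: "x \<in> X" for x
    proof
      assume "x \<in> V"
      show "f x \<in> V"
      proof (rule ccontr)
        assume "f x \<notin> V"
        then have "f x \<in> X - V" using p x unfolding affine_data_def by auto
        from affine_data_vertex[OF affine_data_inverse[OF p] this] show False using p x \<open>x \<in> V\<close> unfolding affine_data_def by auto
      qed
    qed (use affine_data_vertex[OF p] x in blast)
    then show ?thesis using p unfolding affine_data_def affine_map_def by auto
  qed
  show "affine_map M f" "affine_map (matrix_inv M) g" using *[OF assms] *[OF affine_data_inverse[OF assms]] .
qed

lemma nonvertex_finite: assumes "x \<in> X - V" shows "finite x"
proof -
  have "inj_on fst x" unfolding inj_on_def using nonvertex_rep_unique[OF assms] by fastforce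
  moreover have "finite (fst ` x)"
    by (rule finite_subset[of _ "{QPlus, QMinus}"]) (auto, metis piece.exhaust)
  ultimately show ?thesis using finite_imageD by blast
qed

text \<open>
From left to right, preservation of directions gives affinity near the regular points with regular
image, and \<open>affine_data_vertex\<close> supplies the statement about vertices. From right to left,
\<open>affine_map_dist\<close> for the map and its inverse gives the isometry.
\<close>

theorem affine_with_derivative_iff: "affine_with_derivative S M f \<longleftrightarrow> affine_aut M f"
proof
  assume "affine_with_derivative S M f"
  then obtain \<phi> where M: "invertible M" and iso: "surface_isometry (linear_image M S) S \<phi>"
    and dp: "direction_preserving (linear_image M S) S \<phi>" and f: "f = restrict (\<phi> \<circ> linear_map M) X"
    unfolding affine_with_derivative_def veech_set_def by blast
  have fx: "f x = \<phi> (linear_map M x)" if "x \<in> X" for x using f that by simp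
  have bij: "bij_betw f X X"
  proof -
    have "inj_on (linear_map M) X" by (rule inj_on_inverseI[of _ "linear_map (matrix_inv M)"]) (simp add: M)
    then have "bij_betw (linear_map M) X (points (linear_image M S))"
      unfolding bij_betw_def points_linear[OF M] by simp
    from bij_betw_trans[OF this, of \<phi> X] iso have "bij_betw (\<phi> \<circ> linear_map M) X X"
      unfolding surface_isometry_def by blast
    then show ?thesis unfolding f by (simp add: bij_betw_restrict_eq)
  qed
  define g where "g = inv_into X f"
  have fg: "f x \<in> X" "g x \<in> X" "g (f x) = x" "f (g x) = x" if "x \<in> X" for x
    using bij that unfolding g_def
    by (auto simp: bij_betw_def bij_betw_inv_into_left bij_betw_inv_into_right inv_into_into)
  have df: "d (f x) (f y) = dA M x y" if "x \<in> X" "y \<in> X" for x y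
    using iso linX[OF M] that unfolding surface_isometry_def dA_def by (simp add: fx)
  obtain K where K: "K > 0" "\<forall>x\<in>X. \<forall>y\<in>X. dA M x y \<le> K * d x y" using dA_le[OF M] by blast
  obtain K' where K': "K' > 0" "\<forall>x\<in>X. \<forall>y\<in>X. d x y \<le> K' * dA M x y" using le_dA[OF M] by blast
  have "cont f" unfolding cont_def
  proof (intro ballI allI impI)
    fix x and e :: real assume x: "x \<in> X" and e: "0 < e"
    have "d (f x) (f y) < e" if y: "y \<in> X" "d x y < e / K" for y
    proof -
      have "d (f x) (f y) \<le> K * d x y" using K x y by (simp add: df)
      also have "\<dots> < e" using y(2) K(1) by (simp add: pos_less_divide_eq mult.commute)
      finally show ?thesis .
    qed
    then show "\<exists>\<delta>>0. \<forall>y\<in>X. d x y < \<delta> \<longrightarrow> d (f x) (f y) < e" using e K(1) by (intro exI[of _ "e / K"]) auto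
  qed
  moreover have "cont g" unfolding cont_def
  proof (intro ballI allI impI)
    fix x and e :: real assume x: "x \<in> X" and e: "0 < e"
    have "d (g x) (g y) < e" if y: "y \<in> X" "d x y < e / K'" for y
    proof -
      have "d (g x) (g y) \<le> K' * dA M (g x) (g y)" using K' x y fg by auto
      also have "dA M (g x) (g y) = d x y" using df[of "g x" "g y"] fg x y by simp
      also have "K' * d x y < e" using y(2) K'(1) by (simp add: pos_less_divide_eq mult.commute)
      finally show ?thesis .
    qed
    then show "\<exists>\<delta>>0. \<forall>y\<in>X. d x y < \<delta> \<longrightarrow> d (g x) (g y) < e" using e K'(1) by (intro exI[of _ "e / K'"]) auto
  qed
  moreover have "\<forall>\<^sub>F h in nhds 0. f (move x h) = move (f x) (M *v h)" if x: "x \<in> X - V" "f x \<notin> V" for x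
  proof -
    have fxn: "f x \<in> X - V" using x fg by auto
    have lx: "linear_map M x \<in> points (linear_image M S) - vertices (linear_image M S)"
      using x linX[OF M] vertices_linear[OF M, of x S] by auto
    have "\<forall>\<^sub>F h in nhds 0. \<forall>a\<in>x. \<forall>b\<in>f x.
        M *v snd a + M *v h \<in> poly (linear_image M S) (fst a) \<and> snd b + M *v h \<in> poly S (fst b) \<longrightarrow>
        \<phi> (point_of (linear_image M S) (fst a) (M *v snd a + M *v h)) = point_of S (fst b) (snd b + M *v h)"
    proof (intro eventually_ball_finite nonvertex_finite[OF x(1)] nonvertex_finite[OF fxn] ballI)
      fix a b assume ab: "a \<in> x" "b \<in> f x"
      then have "(fst a, M *v snd a) \<in> linear_map M x" "(fst b, snd b) \<in> \<phi> (linear_map M x)"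
        using linear_map_mem[OF M, of "fst a" "snd a" x] fx[of x] x by auto
      then have "\<forall>\<^sub>F k in nhds 0. M *v snd a + k \<in> poly (linear_image M S) (fst a) \<and> snd b + k \<in> poly S (fst b) \<longrightarrow>
        \<phi> (point_of (linear_image M S) (fst a) (M *v snd a + k)) = point_of S (fst b) (snd b + k)"
        using dp lx x fx[of x] unfolding direction_preserving_def by fastforce
      then show "\<forall>\<^sub>F h in nhds 0. M *v snd a + M *v h \<in> poly (linear_image M S) (fst a) \<and> snd b + M *v h \<in> poly S (fst b) \<longrightarrow>
        \<phi> (point_of (linear_image M S) (fst a) (M *v snd a + M *v h)) = point_of S (fst b) (snd b + M *v h)"
        by (rule eventually_compose_filterlim[OF _ matrix_tendsto_0])
    qed
    moreover have "\<forall>\<^sub>F h in nhds 0. \<exists>j q. (j, q) \<in> f x \<and> q + M *v h \<in> poly S j"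
      by (rule eventually_compose_filterlim[OF full_disc_covered[OF fxn] matrix_tendsto_0])
    ultimately show ?thesis using full_disc_covered[OF x(1)]
    proof eventually_elim
      case (elim h)
      obtain j q where q: "(j, q) \<in> f x" "q + M *v h \<in> poly S j" using elim by blast
      obtain i p where p: "(i, p) \<in> x" "p + h \<in> poly S i" using elim by blast
      have "M *v p + M *v h \<in> poly (linear_image M S) i"
        using poly_linear[OF M, of "p + h" S i] p(2) by (simp add: matrix_vector_right_distrib)
      then have "\<phi> (point_of (linear_image M S) i (M *v p + M *v h)) = point_of S j (q + M *v h)"
        using elim(1) p q by fastforce
      also have "\<dots> = move (f x) (M *v h)" using move_eq[OF fxn q] by simp
      also have "point_of (linear_image M S) i (M *v p + M *v h) = linear_map M (move x h)"
        using move_eq[OF _ p] x linear_map_point_of[OF M, of S i "p + h"] by (simp add: matrix_vector_right_distrib)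
      finally show ?case using fx[of "move x h"] move_eq[OF _ p] x point_of_in_points[OF p(2)] by simp
    qed
  qed
  ultimately have affine_data: "affine_data M f g" unfolding affine_data_def using M fg by blast
  show "affine_aut M f" unfolding affine_aut_def
  proof (intro conjI exI[of _ g] ballI M affine_data_affine_map[OF affine_data] fg)
    show "f \<in> extensional X" unfolding f by simp
  qed
next
  assume a: "affine_aut M f"
  then have M: "invertible M" and fe: "f \<in> extensional X" and hf: "affine_map M f"
    and "\<exists>g. affine_map (matrix_inv M) g \<and> (\<forall>x\<in>X. g (f x) = x \<and> f (g x) = x)" unfolding affine_aut_def by simp_all
  then obtain g where hg: "affine_map (matrix_inv M) g" and "\<forall>x\<in>X. g (f x) = x \<and> f (g x) = x" by (elim exE conjE)
  then have fg: "\<And>x. x \<in> X \<Longrightarrow> g (f x) = x" "\<And>x. x \<in> X \<Longrightarrow> f (g x) = x" by simp_all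
  have fX: "f x \<in> X" "g x \<in> X" if "x \<in> X" for x using hf hg that unfolding affine_map_def by auto
  define \<phi> where "\<phi> = f \<circ> linear_map (matrix_inv M)"
  have \<phi>: "\<phi> (linear_map M x) = f x" for x unfolding \<phi>_def using M by simp
  have iso: "surface_isometry (linear_image M S) S \<phi>" unfolding surface_isometry_def points_linear[OF M]
  proof (intro conjI ballI)
    show "bij_betw \<phi> (linear_map M ` X) X"
      by (rule bij_betwI[of _ _ _ "\<lambda>x. linear_map M (g x)"]) (use \<phi> fg fX in auto)
    fix x' y' assume "x' \<in> linear_map M ` X" "y' \<in> linear_map M ` X"
    then obtain x y where xy: "x \<in> X" "y \<in> X" "x' = linear_map M x" "y' = linear_map M y" by blast
    have "dA (mat 1) (f x) (f y) \<le> dA (mat 1 ** M) x y" by (rule affine_map_dist[OF hf M invertible_mat_1 xy(1,2)])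
    moreover have "dA M (g (f x)) (g (f y)) \<le> dA (M ** matrix_inv M) (f x) (f y)"
      by (rule affine_map_dist[OF hg invertible_matrix_inv[OF M] M]) (use fX xy in auto)
    ultimately have "d (f x) (f y) = dA M x y"
      using fg xy by (simp add: matrix_inv_cancel[OF M] dA_1)
    then show "surface_dist S (\<phi> x') (\<phi> y') = surface_dist (linear_image M S) x' y'"
      unfolding xy \<phi> dA_def .
  qed
  have dp: "direction_preserving (linear_image M S) S \<phi>" unfolding direction_preserving_def
  proof (intro ballI impI, clarify)
    fix x' i p' j q assume x': "x' \<in> points (linear_image M S)" "x' \<notin> vertices (linear_image M S)" "\<phi> x' \<notin> V"
      and ip: "(i, p') \<in> x'" "(j, q) \<in> \<phi> x'"
    obtain x where x: "x \<in> X" "x' = linear_map M x" using x'(1) points_linear[OF M, of S] by auto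
    have xn: "x \<in> X - V" "f x \<in> X - V" using x x' vertices_linear[OF M, of x S] \<phi> fX by auto
    obtain p where p: "p' = M *v p" "(i, p) \<in> x" using ip x unfolding linear_map_def by auto
    have "\<forall>\<^sub>F k in nhds 0. f (move x k) = move (f x) (M *v k)" using hf xn unfolding affine_map_def by blast
    from eventually_compose_filterlim[OF this matrix_tendsto_0[of "matrix_inv M"]]
    show "\<forall>\<^sub>F h in nhds 0. p' + h \<in> poly (linear_image M S) i \<and> q + h \<in> poly S j \<longrightarrow>
        \<phi> (point_of (linear_image M S) i (p' + h)) = point_of S j (q + h)"
    proof (eventually_elim, intro impI)
      fix h assume e: "f (move x (matrix_inv M *v h)) = move (f x) (M *v (matrix_inv M *v h))"
        and h: "p' + h \<in> poly (linear_image M S) i \<and> q + h \<in> poly S j"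
      define k where "k = matrix_inv M *v h"
      have hk: "h = M *v k" by (simp add: k_def matrix_inv_cancel[OF M])
      have ph: "p' + h = M *v (p + k)" by (simp add: p hk matrix_vector_right_distrib)
      then have pk: "p + k \<in> poly S i" using h poly_linear[OF M, of "p + k" S i] by simp
      have "\<phi> (point_of (linear_image M S) i (p' + h)) = f (point_of S i (p + k))"
        unfolding ph linear_map_point_of[OF M, symmetric] \<phi> ..
      also have "point_of S i (p + k) = move x k" using move_eq[OF xn(1) p(2) pk] by simp
      also have "f (move x k) = move (f x) h" using e by (simp add: hk[symmetric] k_def[symmetric])
      also have "\<dots> = point_of S j (q + h)" using move_eq[OF xn(2), of j q h] ip(2) x(2) \<phi> h by simp
      finally show "\<phi> (point_of (linear_image M S) i (p' + h)) = point_of S j (q + h)" .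
    qed
  qed
  have "f = restrict (\<phi> \<circ> linear_map M) X"
    using fe by (auto simp: fun_eq_iff \<phi> extensional_def restrict_def)
  then show "affine_with_derivative S M f"
    unfolding affine_with_derivative_def veech_set_def using M iso dp by blast
qed

end

section \<open>Derivatives and the group of affine automorphisms\<close>

lemma matrix_inv_unique:
  fixes M M' :: "real^2^2"
  assumes "M ** M' = mat 1" "M' ** M = mat 1" shows "invertible M" "matrix_inv M = M'"
proof -
  show i: "invertible M" using assms unfolding invertible_def by blast
  have "matrix_inv M = matrix_inv M ** (M ** M')" by (simp add: assms)
  also have "\<dots> = M'" by (simp add: matrix_mul_assoc matrix_inv_cancel[OF i])
  finally show "matrix_inv M = M'" .
qed

definition mat2 :: "real \<Rightarrow> real \<Rightarrow> real \<Rightarrow> real \<Rightarrow> real^2^2" where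
  "mat2 a b e f = vector [vector [a, b], vector [e, f]]"

lemma mat2_mult [simp]: "(mat2 a b e f *v p) $ 1 = a * p $ 1 + b * p $ 2"
  "(mat2 a b e f *v p) $ 2 = e * p $ 1 + f * p $ 2"
  by (simp_all add: mat2_def matrix_vector_mult_def sum_2)

lemma mat2_eqI:
  fixes M N :: "real^2^2"
  assumes "\<And>p. (M *v p) $ 1 = (N *v p) $ 1" "\<And>p. (M *v p) $ 2 = (N *v p) $ 2" shows "M = N"
  unfolding matrix_eq by (auto simp: vec2_eq_iff assms)

lemma mult_matrix_vector: "(M ** N) *v p = M *v (N *v (p :: real^2))" for M N :: "real^2^2"
  by (simp add: matrix_vector_mul_assoc)

context surf begin

lemma nonvertex_exists: "point_of S QPlus (P 0 + 1 *\<^sub>R vector [0, 1]) \<in> X - V"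
  using vertical[of 1 0] point_of_V_iff[of "P 0 + 1 *\<^sub>R vector [0, 1]" QPlus] point_of_in_points by auto

lemma affine_autI:
  assumes "M ** M' = mat 1" "M' ** M = mat 1" "f \<in> extensional X" "affine_map M f" "affine_map M' g"
    "\<And>x. x \<in> X \<Longrightarrow> g (f x) = x" "\<And>x. x \<in> X \<Longrightarrow> f (g x) = x"
  shows "affine_aut M f"
  unfolding affine_aut_def using assms matrix_inv_unique[OF assms(1,2)] by (intro conjI exI[of _ g]) auto

lemma affine_autD:
  assumes "affine_aut M f"
  shows "invertible M" "f \<in> extensional X" "affine_map M f" "\<And>x. x \<in> X \<Longrightarrow> f x \<in> X"
    "\<exists>g. affine_map (matrix_inv M) g \<and> (\<forall>x\<in>X. g (f x) = x \<and> f (g x) = x)"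
  using assms unfolding affine_aut_def affine_map_def by simp_all

theorem derivative_unique: assumes "affine_map M f" "affine_map N f" shows "M = N"
proof -
  obtain x where x: "x \<in> X - V" using nonvertex_exists by blast
  have fx: "f x \<in> X - V" using assms(1) x unfolding affine_map_def by auto
  obtain r where r: "r > 0" "disc (f x) r" using disc_exists[OF fx] by blast
  have small: "\<forall>\<^sub>F h in nhds 0. norm (K *v h) < r" for K :: "real^2^2"
  proof -
    have "\<forall>\<^sub>F k in nhds (0::real^2). norm k < r" unfolding eventually_nhds_metric using r(1) by (intro exI[of _ r]) auto
    then show ?thesis by (rule eventually_compose_filterlim[OF _ matrix_tendsto_0])
  qed
  have "\<forall>\<^sub>F h in nhds 0. M *v h = N *v h"
  proof -
    have "\<forall>\<^sub>F h in nhds 0. f (move x h) = move (f x) (M *v h)" "\<forall>\<^sub>F h in nhds 0. f (move x h) = move (f x) (N *v h)"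
      using assms x unfolding affine_map_def by auto
    with small[of M] small[of N] show ?thesis
      by eventually_elim (metis move_inj[OF fx r(2)])
  qed
  then obtain e where e: "e > 0" "\<And>h. norm h < e \<Longrightarrow> M *v h = N *v h" unfolding eventually_nhds_metric by auto
  have "M *v v = N *v v" for v
  proof -
    define t where "t = e / (2 * (norm v + 1))"
    have nv: "norm v + 1 > 0" using norm_ge_zero[of v] by linarith
    have t: "t > 0" using e nv by (simp add: t_def)
    have "0 < norm v + 2" by (rule add_nonneg_pos) simp_all
    then have lt: "norm v < 2 * (norm v + 1)" by simp
    have "norm (t *\<^sub>R v) = t * norm v" using t by simp
    also have "\<dots> < t * (2 * (norm v + 1))" using lt t by (rule mult_strict_left_mono)
    also have "\<dots> = e" using nv by (simp add: t_def)
    finally have "M *v (t *\<^sub>R v) = N *v (t *\<^sub>R v)" by (rule e(2))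
    then show ?thesis using t by (simp add: matrix_vector_mult_scaleR)
  qed
  then show ?thesis by (simp add: matrix_eq)
qed

text \<open>
The composites with the polygon inclusions are local translations with the same developing map, so
agreement spreads within each polygon, from one polygon to the other through the midpoint of an
edge, and by continuity to the vertices.
\<close>

theorem rigidity:
  assumes f: "affine_map M f" "affine_map M g" and x0: "x0 \<in> X - V" "f x0 = g x0" and x: "x \<in> X"
  shows "f x = g x"
proof -
  have piece: "f (point_of S i q) = g (point_of S i q)"
    if p: "p \<in> poly S i" "sg i *\<^sub>R p \<notin> range P" and pe: "f (point_of S i p) = g (point_of S i p)"
    and q: "q \<in> poly S i" "sg i *\<^sub>R q \<notin> range P" for i p q
  proof (cases "p = q")
    case False
    have seg: "p + t *\<^sub>R (q - p) \<in> poly S i \<and> sg i *\<^sub>R (p + t *\<^sub>R (q - p)) \<notin> range P" if "t \<in> {0..1}" for t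
      using not_vertex_on_segment[OF p(1) q(1) False, of t] that p q by (cases "t = 0 \<or> t = 1") auto
    have "loctrans {0..1} (\<lambda>t. t *\<^sub>R (q - p)) (\<lambda>t. point_of S i (p + t *\<^sub>R (q - p)))"
      by (rule loctrans_ray) (use seg in auto)
    note l = affine_map_loctrans[OF f(1) this] affine_map_loctrans[OF f(2) this]
    have c: "continuous_on {0..1::real} (\<lambda>t. t *\<^sub>R (q - p))" by (intro continuous_intros)
    have c': "continuous_on {0..1::real} (\<lambda>t. M *v (t *\<^sub>R (q - p)))"
      by (simp add: matrix_vector_mult_scaleR) (intro continuous_intros)
    have "f (point_of S i (p + 1 *\<^sub>R (q - p))) = g (point_of S i (p + 1 *\<^sub>R (q - p)))"
      by (rule loctrans_agree[OF _ c' l(1)[OF c] l(2)[OF c], of 0]) (use pe in auto)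
    then show ?thesis by simp
  qed (use pe in simp)
  obtain i p where p: "p \<in> poly S i" "x0 = point_of S i p" using points_cases x0 by blast
  have pn: "sg i *\<^sub>R p \<notin> range P" using p x0 point_of_V_iff by auto
  \<comment> \<open>the midpoint of the first edge has representatives in both pieces\<close>
  define m where "m = (1/2) *\<^sub>R P 1"
  have m01: "m = P 0 + (1/2) *\<^sub>R (P 1 - P 0)" by (simp add: m_def)
  have P01: "P 0 \<in> poly S QPlus" "P 1 \<in> poly S QPlus" using vertex_poly[of QPlus 0] vertex_poly[of QPlus 1] by simp_all
  have "P 0 \<noteq> P 1" using P_inj[of 0 1] by linarith
  from not_vertex_on_segment[OF P01 this, of "1/2"] have m: "m \<in> poly S QPlus" "m \<notin> range P" unfolding m01 by auto
  have me: "m \<in> edge 0" unfolding edge_def in_segment m_def by (intro exI[of _ "1/2"]) simp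
  have st: "step QPlus m QMinus (- m)"
    unfolding step_def
  proof (intro exI[of _ 0] conjI)
    have "P 1 = m + m" by (simp add: m_def vec2_eq_iff)
    then show "- m = m - sg QPlus *\<^sub>R (P 0 + P (0 + 1))" by simp
  qed (use me in simp_all)
  have m': "- m \<in> poly S QMinus" "sg QMinus *\<^sub>R (- m) \<notin> range P" using eqv_poly[OF m(1) st] m(2) by auto
  have mm: "point_of S QPlus m = point_of S QMinus (- m)" using point_eq[OF m(1) m'(1)] st by (simp add: eqv_def)
  have mi: "sg i *\<^sub>R m \<in> poly S i" "sg i *\<^sub>R sg i *\<^sub>R m \<notin> range P" "point_of S i (sg i *\<^sub>R m) = point_of S QPlus m" for i
    using m m' mm by (cases i; simp)+
  have "f (point_of S QPlus m) = g (point_of S QPlus m)"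
    using piece[OF p(1) pn _ mi(1,2)] p x0 mi(3) by metis
  then have all: "f (point_of S j q) = g (point_of S j q)" if "q \<in> poly S j" "sg j *\<^sub>R q \<notin> range P" for j q
    using piece[OF mi(1,2) _ that] mi(3) by metis
  have non: "f y = g y" if y: "y \<in> X - V" for y
  proof -
    obtain j q where "q \<in> poly S j" "y = point_of S j q" using points_cases y by blast
    then show ?thesis using all[of q j] y point_of_V_iff[of q j] by auto
  qed
  show ?thesis
  proof (cases "x \<in> V")
    case True
    then obtain b where b: "x = vtx b" using V_eq by blast
    define n :: int where "n = (if b then 0 else 1)"
    have xn: "x = point_of S QPlus (P n)" unfolding b vtx_def n_def by simp
    have Pn: "P n \<in> poly S QPlus" using vertex_poly[of QPlus n] by simp
    have fX: "f y \<in> X" "g y \<in> X" if "y \<in> X" for y using f that unfolding affine_map_def by auto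
    have "d (f x) (g x) \<le> 0 + e" if e: "0 < e" for e
    proof -
      obtain \<delta>1 where \<delta>1: "\<delta>1 > 0" "\<forall>y\<in>X. d x y < \<delta>1 \<longrightarrow> d (f x) (f y) < e / 2"
        using f(1) x e half_gt_zero[OF e] unfolding affine_map_def cont_def by meson
      obtain \<delta>2 where \<delta>2: "\<delta>2 > 0" "\<forall>y\<in>X. d x y < \<delta>2 \<longrightarrow> d (g x) (g y) < e / 2"
        using f(2) x e half_gt_zero[OF e] unfolding affine_map_def cont_def by meson
      define t where "t = min \<delta>1 \<delta>2 / 2"
      have t: "0 < t" "t < \<delta>1" "t < \<delta>2" using \<delta>1 \<delta>2 by (auto simp: t_def)
      define y where "y = point_of S QPlus (P n + t *\<^sub>R vector [0, 1])"
      have y: "y \<in> X - V" unfolding y_def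
        using vertical[OF t(1), of n] point_of_V_iff[of "P n + t *\<^sub>R vector [0, 1]" QPlus] point_of_in_points by auto
      have e1: "norm (vector [0, 1] :: real^2) = 1" by (simp add: norm_vec_def L2_set_def sum_2)
      have "d x y \<le> t" unfolding xn y_def using d_segment[OF Pn vertical(1)[OF t(1), of n]] e1 t by simp
      then have "d (f x) (f y) < e / 2" "d (g x) (g y) < e / 2" using \<delta>1 \<delta>2 t y by auto
      moreover have "d (f x) (g x) \<le> d (f x) (f y) + d (f y) (g x)" using d_triangle fX x y by auto
      moreover have "f y = g y" using non[OF y] .
      ultimately show ?thesis using d_sym[of "g x" "g y"] by simp
    qed
    then have "d (f x) (g x) \<le> 0" by (rule field_le_epsilon)
    then show ?thesis using d_eq_0[of "f x" "g x"] d_nonneg[of "f x" "g x"] fX x by force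
  qed (use non x in blast)
qed

lemma affine_aut_ext: assumes "affine_aut M f" "affine_aut N g" "\<And>x. x \<in> X \<Longrightarrow> f x = g x" shows "f = g"
  using assms affine_autD(2) extensionalityI by metis

lemma affine_aut_comp: assumes "affine_aut M f" "affine_aut N g" shows "affine_aut (M ** N) (compose X f g)"
proof -
  obtain f' where f': "affine_map (matrix_inv M) f'" "\<forall>x\<in>X. f' (f x) = x \<and> f (f' x) = x" using affine_autD(5)[OF assms(1)] by blast
  obtain g' where g': "affine_map (matrix_inv N) g'" "\<forall>x\<in>X. g' (g x) = x \<and> g (g' x) = x" using affine_autD(5)[OF assms(2)] by blast
  have i: "invertible M" "invertible N" using assms affine_autD by auto
  have X': "f' x \<in> X" "g' x \<in> X" if "x \<in> X" for x using f' g' that unfolding affine_map_def by auto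
  show ?thesis
  proof (rule affine_autI[of _ "matrix_inv N ** matrix_inv M" _ "\<lambda>x. g' (f' x)"])
    show "M ** N ** (matrix_inv N ** matrix_inv M) = mat 1"
      by (metis matrix_inv_cancel(2)[OF i(1)] matrix_inv_cancel(2)[OF i(2)] matrix_mul_assoc matrix_mul_rid)
    show "matrix_inv N ** matrix_inv M ** (M ** N) = mat 1"
      by (metis matrix_inv_cancel(1)[OF i(1)] matrix_inv_cancel(1)[OF i(2)] matrix_mul_assoc matrix_mul_rid)
    show "compose X f g \<in> extensional X" by (simp add: compose_def)
    show "affine_map (M ** N) (compose X f g)"
      by (rule affine_map_cong[OF affine_map_comp[OF affine_autD(3)[OF assms(1)] affine_autD(3)[OF assms(2)]]]) (simp add: compose_def)
    show "affine_map (matrix_inv N ** matrix_inv M) (\<lambda>x. g' (f' x))" by (rule affine_map_comp[OF g'(1) f'(1)])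
    fix x assume x: "x \<in> X"
    then show "g' (f' (compose X f g x)) = x" using f' g' affine_autD(4)[OF assms(2)] by (simp add: compose_def)
    show "compose X f g (g' (f' x)) = x" using f' g' x X' by (simp add: compose_def)
  qed
qed

lemma affine_aut_bij: assumes "affine_aut M f" shows "f \<in> Bij X"
proof -
  obtain g where g: "affine_map (matrix_inv M) g" "\<forall>x\<in>X. g (f x) = x \<and> f (g x) = x" using affine_autD(5)[OF assms] by blast
  have "bij_betw f X X"
    by (rule bij_betwI[of _ _ _ g]) (use g affine_autD(4)[OF assms] in \<open>auto simp: affine_map_def\<close>)
  then show ?thesis using affine_autD(2)[OF assms] by (simp add: Bij_def)
qed

lemma affine_aut_inv: assumes "affine_aut M f" shows "affine_aut (matrix_inv M) (restrict (inv_into X f) X)"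
proof -
  obtain g where g: "affine_map (matrix_inv M) g" "\<forall>x\<in>X. g (f x) = x \<and> f (g x) = x" using affine_autD(5)[OF assms] by blast
  have gX: "g x \<in> X" if "x \<in> X" for x using g that unfolding affine_map_def by auto
  have b: "bij_betw f X X" using affine_aut_bij[OF assms] by (simp add: Bij_def)
  have i: "inv_into X f x = g x" if "x \<in> X" for x
    using inv_into_f_f[of f X "g x"] b gX[OF that] g(2) that by (auto simp: bij_betw_def)
  note M = affine_autD(1)[OF assms]
  show ?thesis
    by (rule affine_autI[of _ M _ f])
       (use i g affine_autD(3,4)[OF assms] gX matrix_inv_cancel[OF M] affine_map_cong[OF g(1), of "restrict (inv_into X f) X"] in auto)
qed

lemma affine_aut_id: "affine_aut (mat 1) (\<lambda>x\<in>X. x)"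
  by (rule affine_autI[of _ "mat 1" _ "\<lambda>x. x"])
     (auto intro: affine_map_id affine_map_cong[OF affine_map_id])

definition "Aut = {f. \<exists>M. affine_aut M f}"

lemma affine_group_eq: "affine_group S = BijGroup X \<lparr>carrier := Aut\<rparr>"
  by (simp add: affine_group_def affine_with_derivative_iff Aut_def)

lemma Aut_subgroup: "subgroup Aut (BijGroup X)"
proof
  show "Aut \<subseteq> carrier (BijGroup X)" using affine_aut_bij by (auto simp: Aut_def BijGroup_def)
  fix f g assume fg: "f \<in> Aut" "g \<in> Aut"
  then obtain M N where "affine_aut M f" "affine_aut N g" by (auto simp: Aut_def)
  then show "f \<otimes>\<^bsub>BijGroup X\<^esub> g \<in> Aut"
    using affine_aut_comp[of M f N g] affine_aut_bij[of M f] affine_aut_bij[of N g] by (auto simp: Aut_def BijGroup_def)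
next
  show "\<one>\<^bsub>BijGroup X\<^esub> \<in> Aut" using affine_aut_id by (auto simp: Aut_def BijGroup_def)
  fix f assume f: "f \<in> Aut"
  then obtain M where "affine_aut M f" by (auto simp: Aut_def)
  then show "inv\<^bsub>BijGroup X\<^esub> f \<in> Aut"
    using affine_aut_inv[of M f] affine_aut_bij[of M f] by (auto simp: Aut_def inv_BijGroup)
qed

lemma group_Aut: "group (affine_group S)"
  unfolding affine_group_eq using Aut_subgroup group.subgroup_imp_group[OF group_BijGroup] by blast

lemma carrier_Aut: "carrier (affine_group S) = Aut" by (simp add: affine_group_eq)
lemma one_Aut: "\<one>\<^bsub>affine_group S\<^esub> = (\<lambda>x\<in>X. x)" by (simp add: affine_group_eq BijGroup_def)
lemma mult_Aut: "f \<in> Aut \<Longrightarrow> g \<in> Aut \<Longrightarrow> f \<otimes>\<^bsub>affine_group S\<^esub> g = compose X f g"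
  using affine_aut_bij by (auto simp: affine_group_eq BijGroup_def Aut_def)

lemma derivative_affine_aut: assumes "affine_aut M f" shows "affine_derivative S f = M"
  unfolding affine_derivative_def affine_with_derivative_iff
  by (rule the_equality[of "\<lambda>A. affine_aut A f", OF assms]) (use derivative_unique affine_autD(3) assms in blast)

section \<open>Automorphisms induced by symmetries of the polygon\<close>

text \<open>
An affine map of the plane with linear part \<open>N\<close> that permutes the vertices, preserving or
reversing their order.
\<close>

definition polygon_symmetry :: "(real^2 \<Rightarrow> real^2) \<Rightarrow> real^2^2 \<Rightarrow> (int \<Rightarrow> int) \<Rightarrow> bool" where
  "polygon_symmetry \<tau> N \<pi> \<longleftrightarrow> (\<forall>p q. \<tau> p - \<tau> q = N *v (p - q)) \<and> (\<forall>k. \<tau> (P k) = P (\<pi> k)) \<and>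
     ((\<forall>k. \<pi> (k + 1) = \<pi> k + 1) \<or> (\<forall>k. \<pi> (k + 1) = \<pi> k - 1))"

definition on_piece :: "(piece \<Rightarrow> piece) \<Rightarrow> (real^2 \<Rightarrow> real^2) \<Rightarrow> piece \<Rightarrow> real^2 \<Rightarrow> real^2" where
  "on_piece \<sigma> \<tau> i p = sg (\<sigma> i) *\<^sub>R \<tau> (sg i *\<^sub>R p)"

text \<open>
The map of the surface given by \<open>\<tau>\<close> on the first piece and by its conjugate under the rotation on
the second, possibly followed by the rotation that exchanges the two pieces.
\<close>

definition symmetry_map :: "(piece \<Rightarrow> piece) \<Rightarrow> (real^2 \<Rightarrow> real^2) \<Rightarrow> piece surface_point \<Rightarrow> piece surface_point" where
  "symmetry_map \<sigma> \<tau> = (\<lambda>x\<in>X. SOME y. \<exists>(i, p) \<in> x. y = point_of S (\<sigma> i) (on_piece \<sigma> \<tau> i p))"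

context
  fixes \<sigma> \<tau> N \<pi> assumes \<sigma>: "\<sigma> = id \<or> \<sigma> = swap_pieces" and t: "polygon_symmetry \<tau> N \<pi>"
begin

lemma tau_affine: "\<tau> p = \<tau> q + N *v (p - q)" using t by (metis polygon_symmetry_def add_diff_cancel_left' diff_add_cancel add.commute)
lemma tau_P: "\<tau> (P k) = P (\<pi> k)" using t by (simp add: polygon_symmetry_def)

lemma pi_parity: "even (\<pi> m) \<longleftrightarrow> even (m + \<pi> 0)"
proof (induction m rule: int_induct[where k = 0])
  case (step1 i)
  have "\<pi> (i + 1) = \<pi> i + 1 \<or> \<pi> (i + 1) = \<pi> i - 1" using t by (auto simp: polygon_symmetry_def)
  then show ?case using step1 by auto
next
  case (step2 i)
  have "\<pi> (i - 1 + 1) = \<pi> (i - 1) + 1 \<or> \<pi> (i - 1 + 1) = \<pi> (i - 1) - 1" using t unfolding polygon_symmetry_def by blast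
  then show ?case using step2 by auto
qed auto

lemma tau_Q: assumes "p \<in> Q" shows "\<tau> p \<in> Q"
proof -
  have "convex {p. \<tau> p \<in> Q}"
  proof (rule convexI)
    fix p q and a b :: real assume *: "p \<in> {p. \<tau> p \<in> Q}" "q \<in> {p. \<tau> p \<in> Q}" "0 \<le> a" "0 \<le> b" "a + b = 1"
    then have a: "a = 1 - b" by simp
    have "\<tau> (a *\<^sub>R p + b *\<^sub>R q) = \<tau> p + N *v ((a *\<^sub>R p + b *\<^sub>R q) - p)" by (rule tau_affine)
    also have "(a *\<^sub>R p + b *\<^sub>R q) - p = b *\<^sub>R (q - p)" by (simp add: a algebra_simps)
    also have "N *v (b *\<^sub>R (q - p)) = b *\<^sub>R (\<tau> q - \<tau> p)" using tau_affine[of q p] by (simp add: matrix_vector_mult_scaleR)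
    finally have "\<tau> (a *\<^sub>R p + b *\<^sub>R q) = a *\<^sub>R \<tau> p + b *\<^sub>R \<tau> q" by (simp add: a algebra_simps)
    then show "a *\<^sub>R p + b *\<^sub>R q \<in> {p. \<tau> p \<in> Q}" using convexD[OF hor.convex_Q, of "\<tau> p" "\<tau> q" a b] * by simp
  qed
  then have "convex hull (range P) \<subseteq> {p. \<tau> p \<in> Q}"
    by (rule hull_minimal[rotated]) (use tau_P hor.P_in_Q in \<open>auto simp del: Q_piece.simps\<close>)
  then show ?thesis using assms by auto
qed

lemma sg_on_piece: "sg (\<sigma> i) *\<^sub>R on_piece \<sigma> \<tau> i p = \<tau> (sg i *\<^sub>R p)" by (simp add: on_piece_def)

lemma on_piece_poly: "p \<in> poly S i \<Longrightarrow> on_piece \<sigma> \<tau> i p \<in> poly S (\<sigma> i)"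
  unfolding poly_S sg_on_piece by (rule tau_Q)

lemma tau_edge: assumes "p \<in> edge k"
  shows "\<exists>j. \<tau> p \<in> edge j \<and> P (\<pi> k) + P (\<pi> (k + 1)) = P j + P (j + 1)"
proof -
  obtain s where s: "0 \<le> s" "s \<le> 1" "p = (1 - s) *\<^sub>R P k + s *\<^sub>R P (k + 1)" using assms by (auto simp: edge_def in_segment)
  have "p - P k = s *\<^sub>R (P (k + 1) - P k)" by (simp add: s(3) algebra_simps)
  then have "\<tau> p = P (\<pi> k) + s *\<^sub>R (P (\<pi> (k + 1)) - P (\<pi> k))"
    using tau_affine[of p "P k"] tau_affine[of "P (k + 1)" "P k"] by (simp add: tau_P matrix_vector_mult_scaleR)
  then have *: "\<tau> p = (1 - s) *\<^sub>R P (\<pi> k) + s *\<^sub>R P (\<pi> (k + 1))" by (simp add: algebra_simps)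
  have "\<pi> (k + 1) = \<pi> k + 1 \<or> \<pi> (k + 1) = \<pi> k - 1" using t by (auto simp: polygon_symmetry_def)
  then show ?thesis
  proof
    assume "\<pi> (k + 1) = \<pi> k + 1"
    then show ?thesis using * s by (intro exI[of _ "\<pi> k"]) (auto simp: edge_def in_segment)
  next
    assume "\<pi> (k + 1) = \<pi> k - 1"
    then show ?thesis using * s by (intro exI[of _ "\<pi> k - 1"]) (auto simp: edge_def in_segment add.commute intro!: exI[of _ "1 - s"])
  qed
qed

lemma on_piece_eqv: assumes "eqv i p j q" shows "eqv (\<sigma> i) (on_piece \<sigma> \<tau> i p) (\<sigma> j) (on_piece \<sigma> \<tau> j q)"
  using assms[unfolded eqv_def]
proof (elim disjE)
  assume "step i p j q"
  then obtain k where k: "j = swap_pieces i" "sg i *\<^sub>R p \<in> edge k" "q = p - sg i *\<^sub>R (P k + P (k + 1))"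
    by (auto simp: step_def)
  obtain l where l: "\<tau> (sg i *\<^sub>R p) \<in> edge l" "P (\<pi> k) + P (\<pi> (k + 1)) = P l + P (l + 1)" using tau_edge[OF k(2)] by blast
  have sj: "sg j *\<^sub>R q = P k + P (k + 1) - sg i *\<^sub>R p" using k by (cases i) (auto simp: algebra_simps)
  have "\<tau> (sg j *\<^sub>R q) = \<tau> (P (k + 1)) - N *v (sg i *\<^sub>R p - P k)"
    using tau_affine[of "sg j *\<^sub>R q" "P (k + 1)"] unfolding sj
    by (simp add: matrix_vector_mult_diff_distrib)
  also have "N *v (sg i *\<^sub>R p - P k) = \<tau> (sg i *\<^sub>R p) - \<tau> (P k)" using tau_affine[of "sg i *\<^sub>R p" "P k"] by simp
  finally have tj: "\<tau> (sg j *\<^sub>R q) = P l + P (l + 1) - \<tau> (sg i *\<^sub>R p)" using l(2) by (simp add: tau_P algebra_simps)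
  have s: "\<sigma> j = swap_pieces (\<sigma> i)" using \<sigma> k by auto
  have "step (\<sigma> i) (on_piece \<sigma> \<tau> i p) (\<sigma> j) (on_piece \<sigma> \<tau> j q)"
    unfolding step_def
  proof (intro exI[of _ l] conjI s)
    show "sg (\<sigma> i) *\<^sub>R on_piece \<sigma> \<tau> i p \<in> edge l" using l by (simp only: sg_on_piece)
    show "on_piece \<sigma> \<tau> j q = on_piece \<sigma> \<tau> i p - sg (\<sigma> i) *\<^sub>R (P l + P (l + 1))"
      unfolding on_piece_def tj s by (simp add: scaleR_diff_right)
  qed
  then show ?thesis by (simp add: eqv_def)
next
  assume "\<exists>b. vrep i p b \<and> vrep j q b"
  then obtain m n where m: "sg i *\<^sub>R p = P m" "sg j *\<^sub>R q = P n" "even (m + par i) = even (n + par j)" by (auto simp: vrep_def)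
  have pp: "par (swap_pieces i) = 1 - par i" for i by (cases i) auto
  have "even (\<pi> m + par (\<sigma> i)) = even (\<pi> n + par (\<sigma> j))"
    using \<sigma> m(3) pi_parity[of m] pi_parity[of n] by (auto simp: pp)
  then have "vrep (\<sigma> i) (on_piece \<sigma> \<tau> i p) (even (\<pi> m + par (\<sigma> i))) \<and> vrep (\<sigma> j) (on_piece \<sigma> \<tau> j q) (even (\<pi> m + par (\<sigma> i)))"
    unfolding vrep_def sg_on_piece m tau_P by blast
  then show ?thesis unfolding eqv_def by blast
qed (auto simp: eqv_def)

lemma symmetry_map_point: assumes "p \<in> poly S i" shows "symmetry_map \<sigma> \<tau> (point_of S i p) = point_of S (\<sigma> i) (on_piece \<sigma> \<tau> i p)"
proof -
  have "\<exists>(j, q)\<in>point_of S i p. point_of S (\<sigma> i) (on_piece \<sigma> \<tau> i p) = point_of S (\<sigma> j) (on_piece \<sigma> \<tau> j q)"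
    using mem_point_of[OF assms] by blast
  moreover have "y = point_of S (\<sigma> i) (on_piece \<sigma> \<tau> i p)"
    if "\<exists>(j, q)\<in>point_of S i p. y = point_of S (\<sigma> j) (on_piece \<sigma> \<tau> j q)" for y
  proof -
    from that obtain j q where jq: "(j, q) \<in> point_of S i p" "y = point_of S (\<sigma> j) (on_piece \<sigma> \<tau> j q)" by blast
    then have "q \<in> poly S j" "eqv i p j q" using mem_point_iff[OF assms] by auto
    then show ?thesis using point_eq[OF on_piece_poly on_piece_poly] on_piece_eqv assms jq(2) by metis
  qed
  ultimately have "(SOME y. \<exists>(j, q)\<in>point_of S i p. y = point_of S (\<sigma> j) (on_piece \<sigma> \<tau> j q)) = point_of S (\<sigma> i) (on_piece \<sigma> \<tau> i p)"
    by (rule some_equality)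
  then show ?thesis unfolding symmetry_map_def using point_of_in_points[OF assms] by simp
qed

lemma on_piece_add:
  assumes s: "\<And>i. sg (\<sigma> i) * sg i = s" shows "on_piece \<sigma> \<tau> i (p + h) = on_piece \<sigma> \<tau> i p + (s *\<^sub>R N) *v h"
proof -
  have "\<tau> (sg i *\<^sub>R (p + h)) = \<tau> (sg i *\<^sub>R p) + N *v (sg i *\<^sub>R h)"
    using tau_affine[of "sg i *\<^sub>R (p + h)" "sg i *\<^sub>R p"] by (simp add: scaleR_add_right)
  then have "on_piece \<sigma> \<tau> i (p + h) = on_piece \<sigma> \<tau> i p + (sg (\<sigma> i) * sg i) *\<^sub>R (N *v h)"
    unfolding on_piece_def by (simp add: scaleR_add_right matrix_vector_mult_scaleR)
  then show ?thesis by (simp add: s scaleR_matrix_vector_assoc)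
qed

text \<open>
The map is affine on each polygon, and the two half-discs at a point of an edge are carried to the
two half-discs at its image.
\<close>

lemma symmetry_map_affine_map:
  assumes s: "\<And>i. sg (\<sigma> i) * sg i = s" and inj: "inj \<tau>" and surj: "surj \<pi>"
  shows "affine_map (s *\<^sub>R N) (symmetry_map \<sigma> \<tau>)"
  unfolding affine_map_def
proof (intro conjI ballI)
  have V: "symmetry_map \<sigma> \<tau> x \<in> V \<longleftrightarrow> x \<in> V" and inX: "symmetry_map \<sigma> \<tau> x \<in> X" if xX: "x \<in> X" for x
  proof -
    obtain i p where p: "p \<in> poly S i" "x = point_of S i p" using points_cases[OF xX] .
    show "symmetry_map \<sigma> \<tau> x \<in> X" unfolding p symmetry_map_point[OF p(1)] by (intro point_of_in_points on_piece_poly p)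
    have "\<tau> q \<in> range P \<longleftrightarrow> q \<in> range P" for q
    proof
      assume "\<tau> q \<in> range P"
      then obtain k where "\<tau> q = \<tau> (P k)" using surj tau_P by (metis imageE surjD)
      then show "q \<in> range P" using inj by (auto dest: injD)
    qed (use tau_P in auto)
    then show "symmetry_map \<sigma> \<tau> x \<in> V \<longleftrightarrow> x \<in> V"
      unfolding p symmetry_map_point[OF p(1)] by (simp add: point_of_V_iff on_piece_poly p sg_on_piece)
  qed
  fix x assume x: "x \<in> X"
  show "symmetry_map \<sigma> \<tau> x \<in> X" "symmetry_map \<sigma> \<tau> x \<in> V \<longleftrightarrow> x \<in> V" using V inX x by auto
next
  fix x assume x: "x \<in> X - V"
  have pn: "symmetry_map \<sigma> \<tau> x \<in> X - V"
  proof -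
    obtain i p where p: "p \<in> poly S i" "x = point_of S i p" using points_cases x by blast
    have "\<tau> (sg i *\<^sub>R p) \<notin> range P"
    proof
      assume "\<tau> (sg i *\<^sub>R p) \<in> range P"
      then obtain k where "\<tau> (sg i *\<^sub>R p) = \<tau> (P k)" using surj tau_P by (metis imageE surjD)
      then have "sg i *\<^sub>R p \<in> range P" using inj by (auto dest: injD)
      then show False using x p point_of_V_iff by auto
    qed
    then show ?thesis unfolding p symmetry_map_point[OF p(1)]
      using point_of_V_iff[OF on_piece_poly[OF p(1)]] point_of_in_points[OF on_piece_poly[OF p(1)]] by (simp add: sg_on_piece)
  qed
  show "\<forall>\<^sub>F h in nhds 0. symmetry_map \<sigma> \<tau> (move x h) = move (symmetry_map \<sigma> \<tau> x) ((s *\<^sub>R N) *v h)"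
    using full_disc_covered[OF x]
  proof eventually_elim
    case (elim h)
    then obtain i p where ip: "(i, p) \<in> x" "p + h \<in> poly S i" by blast
    have p: "p \<in> poly S i" "x = point_of S i p" using mem_pointD[of x S i p] ip x by auto
    have a: "symmetry_map \<sigma> \<tau> (move x h) = point_of S (\<sigma> i) (on_piece \<sigma> \<tau> i p + (s *\<^sub>R N) *v h)"
      unfolding move_eq[OF x ip] symmetry_map_point[OF ip(2)] on_piece_add[OF s] ..
    have "(\<sigma> i, on_piece \<sigma> \<tau> i p) \<in> symmetry_map \<sigma> \<tau> x" using mem_point_of[OF on_piece_poly[OF p(1)]] unfolding p(2) symmetry_map_point[OF p(1)] .
    from move_eq[OF pn this, of "(s *\<^sub>R N) *v h"] on_piece_poly[OF ip(2)] show ?case unfolding a on_piece_add[OF s] by simp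
  qed
next
  show "cont (symmetry_map \<sigma> \<tau>)" unfolding cont_def
  proof (intro ballI allI impI)
    fix x and e :: real assume x: "x \<in> X" and e: "0 < e"
    obtain r where r: "edge_radius x r" using edge_radius_exists[OF x] by blast
    then have r0: "r > 0" by (simp add: edge_radius_def)
    define K where "K = onorm ((*v) (s *\<^sub>R N)) + 1"
    have "onorm ((*v) (s *\<^sub>R N)) \<ge> 0" by (intro onorm_pos_le) simp
    then have K: "K > 0" by (simp add: K_def)
    have Kn: "norm ((s *\<^sub>R N) *v h) \<le> K * norm h" for h
    proof -
      have "norm ((s *\<^sub>R N) *v h) \<le> onorm ((*v) (s *\<^sub>R N)) * norm h" by (rule onorm) simp
      also have "\<dots> \<le> K * norm h" unfolding K_def by (intro mult_right_mono) auto
      finally show ?thesis .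
    qed
    define \<delta> where "\<delta> = min r (e / K)"
    have \<delta>: "\<delta> > 0" "\<delta> \<le> r" "K * \<delta> \<le> e" using r0 e K by (auto simp: \<delta>_def min_def field_simps)
    have "d (symmetry_map \<sigma> \<tau> x) (symmetry_map \<sigma> \<tau> y) < e" if y: "y \<in> X" "d x y < \<delta>" for y
    proof -
      obtain i p q where *: "(i, p) \<in> x" "q \<in> poly S i" "y = point_of S i q" "dist q p < \<delta>"
        using near[OF x y(1) r y(2) \<delta>(2)] by blast
      have p: "p \<in> poly S i" "x = point_of S i p" using mem_pointD[OF x *(1)] .
      have "on_piece \<sigma> \<tau> i q = on_piece \<sigma> \<tau> i p + (s *\<^sub>R N) *v (q - p)" using on_piece_add[OF s, of i p "q - p"] by simp
      then have "d (symmetry_map \<sigma> \<tau> x) (symmetry_map \<sigma> \<tau> y) \<le> norm ((s *\<^sub>R N) *v (q - p))"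
        using d_segment[OF on_piece_poly[OF p(1)] on_piece_poly[OF *(2)]] unfolding p(2) *(3) symmetry_map_point[OF p(1)] symmetry_map_point[OF *(2)] by simp
      also have "\<dots> \<le> K * norm (q - p)" by (rule Kn)
      also have "\<dots> < K * \<delta>" using *(4) K by (simp add: dist_norm)
      finally show ?thesis using \<delta>(3) by simp
    qed
    then show "\<exists>\<delta>>0. \<forall>y\<in>X. d x y < \<delta> \<longrightarrow> d (symmetry_map \<sigma> \<tau> x) (symmetry_map \<sigma> \<tau> y) < e" using \<delta>(1) by blast
  qed
qed

end

lemma symmetry_map_involution:
  assumes \<sigma>: "\<sigma> = id \<or> \<sigma> = swap_pieces" and t: "polygon_symmetry \<tau> N \<pi>" and inv: "\<And>p. \<tau> (\<tau> p) = p" and x: "x \<in> X"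
  shows "symmetry_map \<sigma> \<tau> (symmetry_map \<sigma> \<tau> x) = x"
proof -
  obtain i p where p: "p \<in> poly S i" "x = point_of S i p" using points_cases[OF x] .
  have "\<sigma> (\<sigma> i) = i" using \<sigma> by auto
  then show ?thesis unfolding p(2) symmetry_map_point[OF \<sigma> t p(1)] symmetry_map_point[OF \<sigma> t on_piece_poly[OF \<sigma> t p(1)]]
    by (simp add: on_piece_def inv)
qed

lemma symmetry_map_affine_aut:
  assumes \<sigma>: "\<sigma> = id \<or> \<sigma> = swap_pieces" and t: "polygon_symmetry \<tau> N \<pi>" and inv: "\<And>p. \<tau> (\<tau> p) = p"
    and s: "\<And>i. sg (\<sigma> i) * sg i = s"
  shows "affine_aut (s *\<^sub>R N) (symmetry_map \<sigma> \<tau>)"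
proof -
  have NN: "N *v (N *v v) = v" for v
  proof -
    have "\<tau> (\<tau> v) - \<tau> (\<tau> 0) = N *v (N *v (v - 0))" using t unfolding polygon_symmetry_def by metis
    then show ?thesis by (simp add: inv)
  qed
  have "P (\<pi> (\<pi> k)) = \<tau> (\<tau> (P k))" for k using t by (simp add: polygon_symmetry_def)
  then have "\<pi> (\<pi> k) = k" for k by (simp add: inv)
  then have bij: "inj \<tau>" "surj \<pi>" using inj_on_inverseI[of UNIV \<tau> \<tau>] surjI[of \<pi> \<pi>] inv by auto
  have ss: "s * s = 1" using s[of QPlus] sg_cases[of "\<sigma> QPlus"] by auto
  have square: "(s *\<^sub>R N) ** (s *\<^sub>R N) = mat 1"
    unfolding matrix_eq using NN ss
    by (auto simp: mult_matrix_vector scaleR_matrix_vector_assoc[symmetric] matrix_vector_mult_scaleR)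
  have a: "affine_map (s *\<^sub>R N) (symmetry_map \<sigma> \<tau>)" by (rule symmetry_map_affine_map[OF \<sigma> t s]) (use bij in auto)
  show ?thesis
    by (rule affine_autI[OF square square _ a a]) (use symmetry_map_involution[OF \<sigma> t inv] in \<open>auto simp: symmetry_map_def\<close>)
qed

lemma symmetry_map_induced:
  assumes \<sigma>: "\<sigma> = id \<or> \<sigma> = swap_pieces" and t: "polygon_symmetry \<tau> N \<pi>" and inv: "\<And>p. \<tau> (\<tau> p) = p"
    and L: "\<And>i p. on_piece \<sigma> \<tau> i p = F p"
  shows "induced_by S \<sigma> F (symmetry_map \<sigma> \<tau>)"
  unfolding induced_by_def
proof (intro conjI allI ballI)
  have FF: "F (F p) = p" for p
  proof -
    have "on_piece \<sigma> \<tau> (\<sigma> QPlus) (on_piece \<sigma> \<tau> QPlus p) = p" using \<sigma> by (auto simp: on_piece_def inv)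
    then show ?thesis by (simp add: L)
  qed
  have \<sigma>\<sigma>: "\<sigma> (\<sigma> i) = i" for i using \<sigma> by auto
  have Fpoly: "F p \<in> poly S (\<sigma> i)" if "p \<in> poly S i" for i p using on_piece_poly[OF \<sigma> t that] by (simp add: L)
  show "F ` poly S i = poly S (\<sigma> i)" for i
  proof
    show "poly S (\<sigma> i) \<subseteq> F ` poly S i"
    proof
      fix p assume "p \<in> poly S (\<sigma> i)"
      then have "F p \<in> poly S i" using Fpoly[of p "\<sigma> i"] \<sigma>\<sigma> by simp
      then show "p \<in> F ` poly S i" using FF by (metis image_eqI)
    qed
  qed (use Fpoly in auto)
  fix i j p q assume pq: "p \<in> poly S i" "q \<in> poly S j"
  show "((i, p), j, q) \<in> same_point S \<longleftrightarrow> ((\<sigma> i, F p), \<sigma> j, F q) \<in> same_point S"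
    using on_piece_eqv[OF \<sigma> t, of i p j q] on_piece_eqv[OF \<sigma> t, of "\<sigma> i" "F p" "\<sigma> j" "F q"] Fpoly pq
    by (auto simp: same_point_iff L FF \<sigma>\<sigma>)
next
  fix i p assume p: "p \<in> poly S i"
  show "symmetry_map \<sigma> \<tau> (point_of S i p) = point_of S (\<sigma> i) (F p)" using symmetry_map_point[OF \<sigma> t p] by (simp add: L)
qed

definition "minusI = symmetry_map swap_pieces (\<lambda>p. p)"
definition "reflA = symmetry_map id reflect_x"

definition "refl_matrix = mat2 (-1) 0 0 1"
definition "shift_matrix = mat2 c (c - 1) (c + 1) c"

lemma shift_matrix_L: "shift_matrix *v p = L p" by (simp add: vec2_eq_iff shift_matrix_def)

lemma polygon_symmetry_id: "polygon_symmetry (\<lambda>p. p) (mat 1) (\<lambda>k. k)" by (simp add: polygon_symmetry_def)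
lemma polygon_symmetry_refl: "polygon_symmetry reflect_x refl_matrix (\<lambda>k. - k)"
  by (simp add: polygon_symmetry_def P_neg refl_matrix_def vec2_eq_iff)

lemma affine_aut_minusI: "affine_aut (- mat 1) minusI"
  using symmetry_map_affine_aut[of swap_pieces "\<lambda>p. p" "mat 1" "\<lambda>k. k" "-1"] polygon_symmetry_id
  by (simp add: minusI_def)

lemma affine_aut_reflA: "affine_aut refl_matrix reflA"
  using symmetry_map_affine_aut[of id reflect_x refl_matrix "\<lambda>k. - k" 1] polygon_symmetry_refl
  by (simp add: reflA_def vec2_eq_iff)

lemma induced_minusI: "induced_by S swap_pieces uminus minusI"
  unfolding minusI_def by (rule symmetry_map_induced[OF _ polygon_symmetry_id]) (simp_all add: on_piece_def)

lemma induced_reflA: "induced_by S id reflect_x reflA"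
proof -
  have "on_piece id reflect_x i p = reflect_x p" for i p by (cases i) (simp_all add: on_piece_def vec2_eq_iff)
  then show ?thesis unfolding reflA_def by (intro symmetry_map_induced[OF _ polygon_symmetry_refl]) (simp_all add: vec2_eq_iff)
qed

end

context chords begin

section \<open>The cylinders between consecutive chords\<close>

lemma ell_pos: assumes "k \<ge> \<iota>" shows "ell (k + 1) > 0"
proof -
  have "ell (k + 1) \<noteq> 0"
  proof
    assume "ell (k + 1) = 0"
    then have "P (k + 1) = P (\<iota> - (k + 1))" using chord[of "k + 1"] by simp
    then show False using assms iota01 by auto
  qed
  then show ?thesis using ell_nonneg[of "k + 1"] assms by simp
qed

lemma Lk_pos: "k \<ge> \<iota> \<Longrightarrow> Lk k > 0"
  using ell_pos[of k] ell_nonneg[of k] by (simp add: Lk_def)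

lemma kappa_pos: "\<kappa> > 0"
  using Lk_pos[of \<iota>] Lk_eq[of \<iota>] Hk_ge[of \<iota>] by (simp add: zero_less_mult_iff)

definition "strip k = (UNIV :: real set) \<times> {0..Hk k}"
definition "ostrip k = (UNIV :: real set) \<times> {0<..<Hk k}"

text \<open>
The coordinates \<open>pt k\<close> of the first piece are continued to the second across edge \<open>k\<close>.
\<close>

definition Cen :: "int \<Rightarrow> piece \<Rightarrow> real^2" where
  "Cen k i = (if i = QPlus then 0 else P k + P (k + 1))"

text \<open>
The representatives of the point with coordinates \<open>z\<close> in the universal cover of cylinder \<open>k\<close>. The
slice of the first piece and that of the second alternate along the cylinder; \<open>m\<close> counts the
turns.
\<close>

definition Dev :: "int \<Rightarrow> real \<times> real \<Rightarrow> (piece \<times> (real^2)) set" where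
  "Dev k z = {(i, p). p \<in> poly S i \<and> (\<exists>m::int. p = pt k (z - (of_int m * Lk k, 0)) - Cen k i)}"

definition \<psi> :: "int \<Rightarrow> real \<times> real \<Rightarrow> piece surface_point" where
  "\<psi> k z = (SOME x. \<exists>(i, p) \<in> Dev k z. x = point_of S i p)"

lemma pt_add: "pt k (z + w) = pt k z + frame u w" by (simp add: pt_def frame_linear)

lemma pt_shift: "pt k (s, \<eta>) + t *\<^sub>R u = pt k (s + t, \<eta>)"
  by (simp add: pt_def vec2_eq_iff algebra_simps)

lemma pt_inject [simp]: "pt k z = pt k w \<longleftrightarrow> z = w"
  unfolding pt_def by (metis add_left_cancel frame_un(2))

lemma pt_surj: obtains z where "p = pt k z"
  using frame_un(1)[of "p - P k"] unfolding pt_def by (metis add.commute diff_add_cancel)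

lemma Dev_add: assumes "(i, p) \<in> Dev k z" "p + frame u v \<in> poly S i" shows "(i, p + frame u v) \<in> Dev k (z + v)"
proof -
  obtain m :: int where "p = pt k (z - (of_int m * Lk k, 0)) - Cen k i" using assms by (auto simp: Dev_def)
  then have "p + frame u v = pt k (z + v - (of_int m * Lk k, 0)) - Cen k i"
    using pt_add[of k "z - (of_int m * Lk k, 0)" v] by (simp add: algebra_simps)
  then show ?thesis using assms(2) by (auto simp: Dev_def)
qed

lemma Dev_period: "Dev k (z + (of_int n * Lk k, 0)) = Dev k z"
proof -
  have "Dev k z \<subseteq> Dev k (z + (of_int n * Lk k, 0))" for z n
  proof
    fix ip assume "ip \<in> Dev k z"
    then obtain i p and m :: int where *: "ip = (i, p)" "p \<in> poly S i" "p = pt k (z - (of_int m * Lk k, 0)) - Cen k i"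
      by (auto simp: Dev_def)
    have "z - (of_int m * Lk k, 0) = z + (of_int n * Lk k, 0) - (of_int (m + n) * Lk k, 0)"
      by (simp add: prod_eq_iff algebra_simps)
    then have "p = pt k (z + (of_int n * Lk k, 0) - (of_int (m + n) * Lk k, 0)) - Cen k i" using *(3) by simp
    then show "ip \<in> Dev k (z + (of_int n * Lk k, 0))" using *(1,2) unfolding Dev_def by blast
  qed
  moreover have "z + (of_int n * Lk k, 0) + (of_int (- n) * Lk k, 0) = z" by (simp add: prod_eq_iff)
  ultimately show ?thesis by (metis subset_antisym)
qed

lemma psi_period: "\<psi> k (x + of_int n * Lk k, y) = \<psi> k (x, y)"
  using Dev_period[of k "(x, y)" n] by (simp add: \<psi>_def)

lemma pt_in_Q: assumes "k \<ge> \<iota>" "0 \<le> \<eta>" "\<eta> \<le> Hk k"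
  shows "pt k (s, \<eta>) \<in> Q \<longleftrightarrow> lft k \<eta> \<le> s \<and> s \<le> rgt k \<eta>"
  using zone_in_Q[OF assms] edge_side_nonneg[of "pt k (s, \<eta>)" k] edge_side_nonneg[of "pt k (s, \<eta>)" "\<iota> - k - 1"] edge_side_pt_iff[OF assms(1)]
  by blast

lemma pt_reflect: "P k + P (k + 1) - pt k (s, \<eta>) = pt k (e1 k - s, Hk k - \<eta>)"
  unfolding P_right by (simp add: pt_def vec2_eq_iff algebra_simps)

lemma lft_reflect: assumes "k \<ge> \<iota>" shows "rgt k (Hk k - \<eta>) = e1 k - rgt k \<eta>"
   "lft k (Hk k - \<eta>) = e1 k - Lk k - lft k \<eta>"
  using Hk_ge[OF assms] by (simp_all add: rgt_def lft_def Lk_def field_simps)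

lemma pt_in_Q_minus: assumes "k \<ge> \<iota>" "0 \<le> \<eta>" "\<eta> \<le> Hk k"
  shows "P k + P (k + 1) - pt k (s, \<eta>) \<in> Q \<longleftrightarrow> rgt k \<eta> \<le> s \<and> s \<le> lft k \<eta> + Lk k"
proof -
  have "0 \<le> Hk k - \<eta>" "Hk k - \<eta> \<le> Hk k" using assms by auto
  then show ?thesis unfolding pt_reflect pt_in_Q[OF assms(1) \<open>0 \<le> Hk k - \<eta>\<close> \<open>Hk k - \<eta> \<le> Hk k\<close>] lft_reflect[OF assms(1)]
    by auto
qed

lemma poly_minus: "p - Cen k QMinus \<in> poly S QMinus \<longleftrightarrow> P k + P (k + 1) - p \<in> Q"
proof -
  have "- (p - (P k + P (k + 1))) = P k + P (k + 1) - p" by simp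
  then show ?thesis by (simp add: poly_S Cen_def del: Q_piece.simps)
qed

text \<open>
At each height the slice of the first piece together with that of the second makes up one
circumference.
\<close>

lemma gap: assumes "k \<ge> \<iota>" "0 \<le> \<eta>" "\<eta> \<le> Hk k" shows "lft k \<eta> \<le> rgt k \<eta>" "rgt k \<eta> \<le> lft k \<eta> + Lk k"
proof -
  define \<theta> where "\<theta> = \<eta> / Hk k"
  have \<theta>: "0 \<le> \<theta>" "\<theta> \<le> 1" using assms Hk_ge[OF assms(1)] by (auto simp: \<theta>_def)
  have e: "0 \<le> ell k" "0 \<le> ell (k + 1)" using ell_nonneg assms by auto
  have r: "rgt k \<eta> - lft k \<eta> = ell k * (1 - \<theta>) + ell (k + 1) * \<theta>" using rgt_lft[OF assms(1)] by (simp add: \<theta>_def)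
  have "0 \<le> ell k * (1 - \<theta>)" "0 \<le> ell (k + 1) * \<theta>" using e \<theta> by auto
  then show "lft k \<eta> \<le> rgt k \<eta>" using r by linarith
  have "ell k * (1 - \<theta>) \<le> ell k * 1" "ell (k + 1) * \<theta> \<le> ell (k + 1) * 1" using e \<theta> by (intro mult_left_mono; simp)+
  then show "rgt k \<eta> \<le> lft k \<eta> + Lk k" using r by (simp add: Lk_def)
qed

lemma Dev_nonempty: assumes k: "k \<ge> \<iota>" and z: "z \<in> strip k" shows "\<exists>i p. (i, p) \<in> Dev k z"
proof -
  obtain s \<eta> where z': "z = (s, \<eta>)" "0 \<le> \<eta>" "\<eta> \<le> Hk k" using z by (auto simp: strip_def)
  define m where "m = \<lfloor>(s - lft k \<eta>) / Lk k\<rfloor>"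
  have L: "Lk k > 0" using Lk_pos[OF k] .
  have "of_int m \<le> (s - lft k \<eta>) / Lk k" "(s - lft k \<eta>) / Lk k \<le> of_int m + 1" unfolding m_def by linarith+
  then have m: "of_int m * Lk k \<le> s - lft k \<eta>" "s - lft k \<eta> \<le> (of_int m + 1) * Lk k"
    using L by (simp_all add: pos_le_divide_eq pos_divide_le_eq)
  define t where "t = s - of_int m * Lk k"
  have t: "lft k \<eta> \<le> t" "t \<le> lft k \<eta> + Lk k" using m by (auto simp: t_def algebra_simps)
  have zt: "z - (of_int m * Lk k, 0) = (t, \<eta>)" by (simp add: z' t_def)
  show ?thesis
  proof (cases "t \<le> rgt k \<eta>")
    case True
    then have "pt k (t, \<eta>) \<in> Q" using pt_in_Q[OF k z'(2,3)] t by blast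
    then have "pt k (z - (of_int m * Lk k, 0)) - Cen k QPlus \<in> poly S QPlus"
      unfolding zt by (simp add: poly_S Cen_def del: Q_piece.simps)
    then show ?thesis unfolding Dev_def by blast
  next
    case False
    then have "P k + P (k + 1) - pt k (t, \<eta>) \<in> Q" using pt_in_Q_minus[OF k z'(2,3)] t by simp
    then have "pt k (z - (of_int m * Lk k, 0)) - Cen k QMinus \<in> poly S QMinus"
      unfolding zt poly_minus .
    then show ?thesis unfolding Dev_def by blast
  qed
qed

lemma Cen_sum: "P (\<iota> - k - 1) + P (\<iota> - k) = P k + P (k + 1) - Lk k *\<^sub>R u"
  using chord[of k] chord[of "k + 1"] by (simp add: Lk_def algebra_simps)

lemma glue_right: assumes k: "k \<ge> \<iota>" "0 \<le> \<eta>" "\<eta> \<le> Hk k"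
  shows "point_of S QPlus (pt k (rgt k \<eta>, \<eta>)) = point_of S QMinus (pt k (rgt k \<eta>, \<eta>) - Cen k QMinus)"
proof -
  let ?p = "pt k (rgt k \<eta>, \<eta>)"
  have Q: "?p \<in> Q" using pt_in_Q[OF k] gap[OF k] by simp
  have "edge_side k ?p = 0" using Hk_ge[OF k(1)] by (simp add: edge_side_pt rgt_def)
  then have "?p \<in> edge k" using Q edge_iff by blast
  then have st: "step QPlus ?p QMinus (?p - Cen k QMinus)" unfolding step_def Cen_def by (intro exI[of _ k]) simp
  have "?p \<in> poly S QPlus" using Q by (simp add: poly_S del: Q_piece.simps)
  then show ?thesis using point_eq eqv_poly[OF _ st] st unfolding eqv_def by blast
qed

lemma glue_left: assumes k: "k \<ge> \<iota>" "0 \<le> \<eta>" "\<eta> \<le> Hk k"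
  shows "point_of S QMinus (pt k (lft k \<eta> + Lk k, \<eta>) - Cen k QMinus) = point_of S QPlus (pt k (lft k \<eta>, \<eta>))"
proof -
  let ?p = "pt k (lft k \<eta>, \<eta>)" and ?j = "\<iota> - k - 1"
  have Q: "?p \<in> Q" using pt_in_Q[OF k] gap[OF k] by simp
  have "edge_side ?j ?p = 0" unfolding edge_side_pt_refl lft_def using Hk_ge[OF k(1)] by (simp add: field_simps)
  then have e: "?p \<in> edge ?j" using Q edge_iff by blast
  have "pt k (lft k \<eta> + Lk k, \<eta>) - Cen k QMinus = ?p - (P ?j + P (?j + 1))"
  proof -
    have "pt k (lft k \<eta> + Lk k, \<eta>) = ?p + Lk k *\<^sub>R u" by (simp add: pt_shift)
    then show ?thesis using Cen_sum[of k] by (simp add: Cen_def algebra_simps)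
  qed
  then have st: "step QPlus ?p QMinus (pt k (lft k \<eta> + Lk k, \<eta>) - Cen k QMinus)"
    unfolding step_def using e by (intro exI[of _ ?j]) simp
  have "?p \<in> poly S QPlus" using Q by (simp add: poly_S del: Q_piece.simps)
  then have "point_of S QPlus ?p = point_of S QMinus (pt k (lft k \<eta> + Lk k, \<eta>) - Cen k QMinus)"
    using point_eq eqv_poly[OF _ st] st unfolding eqv_def by blast
  then show ?thesis by simp
qed

lemma int_mult_bounds:
  fixes m :: int and L :: real
  assumes "L > 0" "of_int m * L \<le> L" shows "m \<le> 1"
proof -
  have "of_int m \<le> (1 :: real)" using assms by (metis mult_le_cancel_right2 not_less)
  then show ?thesis by simp
qed

text \<open>
The representatives at height \<open>\<eta>\<close> form a chain of intervals, alternating between the two pieces,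
whose common end points are glued. So all representatives of one point of the universal cover give
the same point of the surface.
\<close>

lemma Dev_same:
  assumes k: "k \<ge> \<iota>" and z: "z \<in> strip k" and "(i, p) \<in> Dev k z" "(j, q) \<in> Dev k z"
  shows "point_of S i p = point_of S j q"
proof -
  obtain s \<eta> where z': "z = (s, \<eta>)" "0 \<le> \<eta>" "\<eta> \<le> Hk k" using z by (auto simp: strip_def)
  define a where "a = lft k \<eta>"
  define b where "b = rgt k \<eta>"
  let ?L = "Lk k"
  have L: "?L > 0" using Lk_pos[OF k] .
  have ab: "a \<le> b" "b \<le> a + ?L" using gap[OF k z'(2,3)] by (auto simp: a_def b_def)
  define A where "A t = point_of S QPlus (pt k (t, \<eta>))" for t
  define B where "B t = point_of S QMinus (pt k (t, \<eta>) - Cen k QMinus)" for t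
  have G: "A b = B b" "B (a + ?L) = A a"
    using glue_right[OF k z'(2,3)] glue_left[OF k z'(2,3)] by (auto simp: A_def B_def a_def b_def)
  have rep: "\<exists>m::int. (i = QPlus \<and> a \<le> s - of_int m * ?L \<and> s - of_int m * ?L \<le> b \<and> point_of S i p = A (s - of_int m * ?L))
     \<or> (i = QMinus \<and> b \<le> s - of_int m * ?L \<and> s - of_int m * ?L \<le> a + ?L \<and> point_of S i p = B (s - of_int m * ?L))"
    if ip: "(i, p) \<in> Dev k z" for i p
  proof -
    obtain m :: int where m: "p \<in> poly S i" "p = pt k (s - of_int m * ?L, \<eta>) - Cen k i" using ip z' by (auto simp: Dev_def)
    show ?thesis
    proof (cases i)
      case QPlus
      then show ?thesis using m pt_in_Q[OF k z'(2,3), of "s - of_int m * ?L"]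
        by (intro exI[of _ m]) (auto simp: A_def Cen_def poly_S a_def b_def simp del: Q_piece.simps)
    next
      case QMinus
      then show ?thesis using m pt_in_Q_minus[OF k z'(2,3), of "s - of_int m * ?L"] poly_minus
        by (intro exI[of _ m]) (auto simp: B_def a_def b_def)
    qed
  qed
  have AA: "A t = A t'" if "a \<le> t" "t \<le> b" "a \<le> t'" "t' \<le> b" "t - t' = of_int n * ?L" and n0: "n \<ge> 0" for t t' and n :: int
  proof -
    have "of_int n * ?L \<le> ?L" using that ab by linarith
    then have "n \<le> 1" using int_mult_bounds[OF L] by blast
    then consider "n = 0" | "n = 1" using n0 by linarith
    then show ?thesis
    proof cases
      case 2
      then have "t = b" "t' = a" "b = a + ?L" using that ab by auto
      then show ?thesis using G by simp
    qed (use that in simp)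
  qed
  have BB: "B t = B t'" if "b \<le> t" "t \<le> a + ?L" "b \<le> t'" "t' \<le> a + ?L" "t - t' = of_int n * ?L" and n0: "n \<ge> 0" for t t' and n :: int
  proof -
    have "of_int n * ?L \<le> ?L" using that ab by linarith
    then have "n \<le> 1" using int_mult_bounds[OF L] by blast
    then consider "n = 0" | "n = 1" using n0 by linarith
    then show ?thesis
    proof cases
      case 2
      then have "t = a + ?L" "t' = b" "b = a" using that ab by auto
      then show ?thesis using G by simp
    qed (use that in simp)
  qed
  have AB: "A t = B t'" if "a \<le> t" "t \<le> b" "b \<le> t'" "t' \<le> a + ?L" "t' - t = of_int n * ?L" for t t' and n :: int
  proof -
    have "of_int n * ?L \<le> ?L" using that ab by linarith
    then have n1: "n \<le> 1" using int_mult_bounds[OF L] by blast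
    have "of_int n * ?L \<ge> 0" using that by linarith
    then have "n \<ge> 0" using L by (simp add: zero_le_mult_iff)
    then consider "n = 0" | "n = 1" using n1 by linarith
    then show ?thesis
    proof cases
      case 1
      then have "t = b" "t' = b" using that by auto
      then show ?thesis using G by simp
    next
      case 2
      then have "t = a" "t' = a + ?L" using that by auto
      then show ?thesis using G by simp
    qed
  qed
  have diff: "(s - of_int m * ?L) - (s - of_int n * ?L) = of_int (n - m) * ?L" for m n :: int by (simp add: algebra_simps)
  from rep[OF assms(3)] obtain m :: int where M: "(i = QPlus \<and> a \<le> s - of_int m * ?L \<and> s - of_int m * ?L \<le> b \<and> point_of S i p = A (s - of_int m * ?L))
     \<or> (i = QMinus \<and> b \<le> s - of_int m * ?L \<and> s - of_int m * ?L \<le> a + ?L \<and> point_of S i p = B (s - of_int m * ?L))" by blast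
  from rep[OF assms(4)] obtain n :: int where N: "(j = QPlus \<and> a \<le> s - of_int n * ?L \<and> s - of_int n * ?L \<le> b \<and> point_of S j q = A (s - of_int n * ?L))
     \<or> (j = QMinus \<and> b \<le> s - of_int n * ?L \<and> s - of_int n * ?L \<le> a + ?L \<and> point_of S j q = B (s - of_int n * ?L))" by blast
  show ?thesis
  proof (cases "i = QPlus")
    case i: True
    from M i have M1: "a \<le> s - of_int m * ?L" "s - of_int m * ?L \<le> b" "point_of S i p = A (s - of_int m * ?L)" by blast+
    show ?thesis
    proof (cases "j = QPlus")
      case True
      from N True have N1: "a \<le> s - of_int n * ?L" "s - of_int n * ?L \<le> b" "point_of S j q = A (s - of_int n * ?L)" by blast+
      show ?thesis
      proof (cases "n \<ge> m")
        case True
        then have "0 \<le> n - m" by simp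
        from AA[OF M1(1,2) N1(1,2) diff this] show ?thesis unfolding M1(3) N1(3) .
      next
        case False
        then have "0 \<le> m - n" by simp
        from AA[OF N1(1,2) M1(1,2) diff this] show ?thesis unfolding M1(3) N1(3) by (rule sym)
      qed
    next
      case False
      from N False have N1: "b \<le> s - of_int n * ?L" "s - of_int n * ?L \<le> a + ?L" "point_of S j q = B (s - of_int n * ?L)" by blast+
      show ?thesis using AB[OF M1(1,2) N1(1,2) diff] unfolding M1(3) N1(3) .
    qed
  next
    case i: False
    from M i have M1: "b \<le> s - of_int m * ?L" "s - of_int m * ?L \<le> a + ?L" "point_of S i p = B (s - of_int m * ?L)" by blast+
    show ?thesis
    proof (cases "j = QPlus")
      case True
      from N True have N1: "a \<le> s - of_int n * ?L" "s - of_int n * ?L \<le> b" "point_of S j q = A (s - of_int n * ?L)" by blast+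
      show ?thesis using AB[OF N1(1,2) M1(1,2) diff] unfolding M1(3) N1(3) by (rule sym)
    next
      case False
      from N False have N1: "b \<le> s - of_int n * ?L" "s - of_int n * ?L \<le> a + ?L" "point_of S j q = B (s - of_int n * ?L)" by blast+
      show ?thesis
      proof (cases "n \<ge> m")
        case True
        then have "0 \<le> n - m" by simp
        from BB[OF M1(1,2) N1(1,2) diff this] show ?thesis unfolding M1(3) N1(3) .
      next
        case False
        then have "0 \<le> m - n" by simp
        from BB[OF N1(1,2) M1(1,2) diff this] show ?thesis unfolding M1(3) N1(3) by (rule sym)
      qed
    qed
  qed
qed

lemma psi_eq: assumes "k \<ge> \<iota>" "z \<in> strip k" "(i, p) \<in> Dev k z" shows "\<psi> k z = point_of S i p"
  unfolding \<psi>_def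
proof (rule some_equality)
  show "\<exists>(j, q)\<in>Dev k z. point_of S i p = point_of S j q"
    by (rule bexI[OF _ assms(3)]) simp
  fix x assume "\<exists>(j, q)\<in>Dev k z. x = point_of S j q"
  then obtain jq where jq: "jq \<in> Dev k z" "x = point_of S (fst jq) (snd jq)"
    unfolding case_prod_unfold by (rule bexE)
  from jq(1) have "(fst jq, snd jq) \<in> Dev k z" by simp
  from Dev_same[OF assms(1,2) this assms(3)] show "x = point_of S i p" unfolding jq(2) .
qed

lemma psi_in: assumes "k \<ge> \<iota>" "z \<in> strip k" shows "\<psi> k z \<in> X"
proof -
  obtain i p where ip: "(i, p) \<in> Dev k z" using Dev_nonempty[OF assms] by blast
  then have "p \<in> poly S i" by (auto simp: Dev_def)
  then show ?thesis using psi_eq[OF assms ip] point_of_in_points by simp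
qed

lemma Dev_subset: assumes "k \<ge> \<iota>" "z \<in> strip k" shows "Dev k z \<subseteq> \<psi> k z"
proof
  fix ip assume "ip \<in> Dev k z"
  then obtain i p where ip: "ip = (i, p)" "(i, p) \<in> Dev k z" by (cases ip) auto
  then have "p \<in> poly S i" by (auto simp: Dev_def)
  then show "ip \<in> \<psi> k z" using psi_eq[OF assms ip(2)] mem_point_of ip(1) by simp
qed

lemma hgt_minus: "cross2 u (P k + P (k + 1) - p) = ht k + ht (k + 1) - cross2 u p"
  by (simp add: ht_def)

lemma Dev_height: assumes "(i, p) \<in> Dev k z"
  shows "cross2 u (sg i *\<^sub>R p) = (if i = QPlus then ht k + snd z else ht (k + 1) - snd z)"
proof -
  obtain m :: int where m: "p = pt k (z - (of_int m * Lk k, 0)) - Cen k i" using assms by (auto simp: Dev_def)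
  show ?thesis
  proof (cases i)
    case QPlus then show ?thesis using m by (simp add: Cen_def hgt_pt)
  next
    case QMinus
    then have "sg i *\<^sub>R p = P k + P (k + 1) - pt k (z - (of_int m * Lk k, 0))" using m by (simp add: Cen_def)
    then show ?thesis using QMinus by (simp only: hgt_minus hgt_pt) simp
  qed
qed

lemma Dev_of:
  assumes p: "p \<in> poly S i" and h: "ht k \<le> cross2 u (sg i *\<^sub>R p)" "cross2 u (sg i *\<^sub>R p) \<le> ht (k + 1)"
  obtains z where "z \<in> strip k" "(i, p) \<in> Dev k z"
proof -
  obtain z where z: "p + Cen k i = pt k z" using pt_surj by blast
  have "p = pt k (z - (of_int 0 * Lk k, 0)) - Cen k i" using z by (simp add: zero_prod_def[symmetric] algebra_simps)
  then have D: "(i, p) \<in> Dev k z" using p unfolding Dev_def by blast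
  from Dev_height[OF D] h have "0 \<le> snd z \<and> snd z \<le> Hk k" by (auto simp: Hk_def split: if_splits)
  then have "z \<in> strip k" by (cases z) (auto simp: strip_def)
  then show ?thesis using that D by blast
qed

lemma ostrip_strip: "ostrip k \<subseteq> strip k" by (auto simp: strip_def ostrip_def)

lemma ht_mono: "\<iota> \<le> j \<Longrightarrow> j \<le> k \<Longrightarrow> ht j \<le> ht k"
  using ht_strict[of j k] by (cases "j = k") auto

lemma ht_between:
  assumes "k \<ge> \<iota>" "j \<ge> \<iota>" "ht k < h" "h < ht (k + 1)" "ht j \<le> h" "h \<le> ht (j + 1)" shows "j = k"
proof (rule ccontr)
  assume "j \<noteq> k"
  then consider "j + 1 \<le> k" | "k + 1 \<le> j" by linarith
  then show False using ht_mono[of "j + 1" k] ht_mono[of "k + 1" j] assms by cases auto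
qed

lemma ht_not_between: assumes "k \<ge> \<iota>" "ht k < ht j" "ht j < ht (k + 1)" shows False
proof -
  have *: False if "j \<ge> \<iota>" "ht k < ht j" "ht j < ht (k + 1)" for j
    using ht_mono[of j k] ht_mono[of "k + 1" j] assms(1) that by (cases "j \<le> k") auto
  show False by (rule index_cases[of j]) (use *[of j] *[of "\<iota> - j"] assms ht_refl[of j] in auto)
qed

lemma edge_between:
  assumes k: "k \<ge> \<iota>" and h: "ht k < cross2 u p" "cross2 u p < ht (k + 1)" and p: "p \<in> edge j"
  shows "j = k \<or> j = \<iota> - k - 1"
proof -
  obtain t where t: "0 \<le> t" "t \<le> 1" "p = (1 - t) *\<^sub>R P j + t *\<^sub>R P (j + 1)" using p by (auto simp: edge_def in_segment)
  then have c: "cross2 u p = (1 - t) * ht j + t * ht (j + 1)" by (simp add: ht_def)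
  show ?thesis
  proof (cases "j \<ge> \<iota>")
    case True
    have m: "ht j \<le> ht (j + 1)" using ht_mono[of j "j + 1"] True by simp
    have "(1 - t) * ht j + t * ht j \<le> cross2 u p" unfolding c using t m by (intro add_left_mono mult_left_mono) auto
    moreover have "cross2 u p \<le> (1 - t) * ht (j + 1) + t * ht (j + 1)" unfolding c using t m by (intro add_right_mono mult_left_mono) auto
    ultimately have "ht j \<le> cross2 u p" "cross2 u p \<le> ht (j + 1)" by (auto simp: algebra_simps)
    then show ?thesis using ht_between[OF k True h] by blast
  next
    case False
    let ?j = "\<iota> - j - 1"
    have j: "?j \<ge> \<iota>"
    proof (rule ccontr)
      assume "\<not> ?j \<ge> \<iota>"
      then have "j = 0" "\<iota> = 1" using False iota01 by auto
      then have "ht j = 0" "ht (j + 1) = 0" using ht_refl[of 1] ht_d0 by (auto simp: ht_def)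
      then show False using c h ht_nonneg[of k] by simp
    qed
    have e: "ht j = ht (?j + 1)" "ht (j + 1) = ht ?j" using ht_refl[of j] ht_refl[of "j + 1"] by (simp_all add: algebra_simps)
    have m: "ht ?j \<le> ht (?j + 1)" using ht_mono[of ?j "?j + 1"] j by simp
    have "(1 - t) * ht ?j + t * ht ?j \<le> cross2 u p" unfolding c e using t m by (intro add_right_mono mult_left_mono) auto
    moreover have "cross2 u p \<le> (1 - t) * ht (?j + 1) + t * ht (?j + 1)" unfolding c e using t m by (intro add_left_mono mult_left_mono) auto
    ultimately have "ht ?j \<le> cross2 u p" "cross2 u p \<le> ht (?j + 1)" by (auto simp: algebra_simps)
    then have "?j = k" using ht_between[OF k j h] by blast
    then show ?thesis by auto
  qed
qed

lemma Dev_height_open: assumes "z \<in> ostrip k" "(i, p) \<in> Dev k z"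
  shows "ht k < cross2 u (sg i *\<^sub>R p)" "cross2 u (sg i *\<^sub>R p) < ht (k + 1)"
  using Dev_height[OF assms(2)] assms(1) by (auto simp: ostrip_def Hk_def)

lemma Dev_nonvertex: assumes k: "k \<ge> \<iota>" and z: "z \<in> ostrip k" "(i, p) \<in> Dev k z" shows "sg i *\<^sub>R p \<notin> range P"
proof
  assume "sg i *\<^sub>R p \<in> range P"
  then obtain j where "sg i *\<^sub>R p = P j" by blast
  then show False using ht_not_between[OF k, of j] Dev_height_open[OF z] by (simp add: ht_def)
qed

text \<open>
In the interior of the cylinder a representative can only be glued over the two edges that bound
the slice, and these gluings stay in \<open>Dev k z\<close>.
\<close>

lemma Dev_closed: assumes k: "k \<ge> \<iota>" and z: "z \<in> ostrip k" and ip: "(i, p) \<in> Dev k z" and e: "eqv i p j q" "q \<in> poly S j"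
  shows "(j, q) \<in> Dev k z"
  using e(1)[unfolded eqv_def]
proof (elim disjE)
  assume "i = j \<and> p = q" then show ?thesis using ip by simp
next
  assume "\<exists>b. vrep i p b \<and> vrep j q b" then show ?thesis using Dev_nonvertex[OF k z ip] by (auto simp: vrep_def)
next
  assume "step i p j q"
  then obtain l where l: "j = swap_pieces i" "sg i *\<^sub>R p \<in> edge l" "q = p - sg i *\<^sub>R (P l + P (l + 1))" by (auto simp: step_def)
  obtain m :: int where m: "p = pt k (z - (of_int m * Lk k, 0)) - Cen k i" using ip by (auto simp: Dev_def)
  have sh: "pt k (z - (of_int m * Lk k, 0)) + (of_int r * Lk k) *\<^sub>R u = pt k (z - (of_int (m - r) * Lk k, 0))" for r
    by (simp add: pt_def vec2_eq_iff algebra_simps)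
  have "l = k \<or> l = \<iota> - k - 1" using edge_between[OF k Dev_height_open[OF z ip] l(2)] .
  then have "\<exists>n::int. q = pt k (z - (of_int n * Lk k, 0)) - Cen k j"
  proof
    assume "l = k"
    then show ?thesis using l m by (intro exI[of _ m], cases i) (auto simp: Cen_def)
  next
    assume lk: "l = \<iota> - k - 1"
    have C: "P l + P (l + 1) = P k + P (k + 1) - Lk k *\<^sub>R u" using Cen_sum[of k] lk by simp
    show ?thesis
    proof (cases i)
      case QPlus
      have "q = pt k (z - (of_int m * Lk k, 0)) + (of_int 1 * Lk k) *\<^sub>R u - Cen k j"
        using l m QPlus by (simp add: Cen_def C)
      then show ?thesis unfolding sh by blast
    next
      case QMinus
      have "q = pt k (z - (of_int m * Lk k, 0)) + (of_int (-1) * Lk k) *\<^sub>R u - Cen k j"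
        using l m QMinus by (simp add: Cen_def C)
      then show ?thesis unfolding sh by blast
    qed
  qed
  then show ?thesis using e(2) by (auto simp: Dev_def)
qed

lemma psi_open: assumes "k \<ge> \<iota>" "z \<in> ostrip k" shows "\<psi> k z = Dev k z" "\<psi> k z \<in> X - V"
proof -
  have z: "z \<in> strip k" using assms ostrip_strip by auto
  obtain i p where ip: "(i, p) \<in> Dev k z" using Dev_nonempty[OF assms(1) z] by blast
  have p: "p \<in> poly S i" using ip by (auto simp: Dev_def)
  have e: "\<psi> k z = point_of S i p" by (rule psi_eq[OF assms(1) z ip])
  have "\<psi> k z \<subseteq> Dev k z"
  proof
    fix jq assume "jq \<in> \<psi> k z"
    then obtain j q where "jq = (j, q)" "eqv i p j q" "q \<in> poly S j" unfolding e using mem_point_iff[OF p] by (cases jq) auto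
    then show "jq \<in> Dev k z" using Dev_closed[OF assms ip] by simp
  qed
  then show "\<psi> k z = Dev k z" using Dev_subset[OF assms(1) z] by auto
  show "\<psi> k z \<in> X - V" unfolding e using point_of_V_iff[OF p] Dev_nonvertex[OF assms ip] point_of_in_points[OF p] by simp
qed

text \<open>
In the interior of the cylinder the coordinates determine, and are determined by, the
representatives. So the cylinder is embedded and disjoint from the other ones.
\<close>

lemma psi_meet:
  assumes k: "k \<ge> \<iota>" "z \<in> ostrip k" and k': "k' \<ge> \<iota>" "z' \<in> strip k'" and eq: "\<psi> k z = \<psi> k' z'"
  shows "k' = k \<and> (\<exists>n::int. z' = z + (of_int n * Lk k, 0))"
proof -
  obtain i p where ip: "(i, p) \<in> Dev k' z'" using Dev_nonempty[OF k'] by blast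
  then have ip': "(i, p) \<in> Dev k z" using Dev_subset[OF k'] psi_open(1)[OF k] eq by auto
  have h: "ht k' \<le> cross2 u (sg i *\<^sub>R p)" "cross2 u (sg i *\<^sub>R p) \<le> ht (k' + 1)"
    using Dev_height[OF ip] k'(2) by (auto simp: strip_def Hk_def)
  have kk: "k' = k" using ht_between[OF k(1) k'(1) Dev_height_open[OF k(2) ip'] h] .
  obtain m :: int where m: "p = pt k (z - (of_int m * Lk k, 0)) - Cen k i" using ip' by (auto simp: Dev_def)
  obtain n :: int where "p = pt k (z' - (of_int n * Lk k, 0)) - Cen k i" using ip kk by (auto simp: Dev_def)
  with m have "z - (of_int m * Lk k, 0) = z' - (of_int n * Lk k, 0)" by simp
  then have "z' = z + (of_int (n - m) * Lk k, 0)" by (simp add: prod_eq_iff algebra_simps)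
  then show ?thesis using kk by blast
qed

lemma open_ostrip: "open (ostrip k)" unfolding ostrip_def by (intro open_Times) auto

lemma convex_ostrip: "convex (ostrip k)" unfolding ostrip_def by (intro convex_Times) auto

lemma continuous_frame [continuous_intros]: "continuous_on Z f \<Longrightarrow> continuous_on Z (\<lambda>x. frame v (f x))"
  unfolding frame_def by (intro continuous_intros) auto

lemma psi_loctrans: assumes k: "k \<ge> \<iota>" shows "loctrans (ostrip k) (frame u) (\<psi> k)"
  unfolding loctrans_def
proof (intro ballI conjI)
  fix z assume z: "z \<in> ostrip k"
  show n: "\<psi> k z \<in> X - V" by (rule psi_open(2)[OF k z])
  have "filterlim (\<lambda>w. frame u w - frame u z) (nhds 0) (at z within ostrip k)"
    by (rule tendsto_dev) (auto intro!: continuous_intros z)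
  from eventually_compose_filterlim[OF full_disc_covered[OF n] this]
  have "\<forall>\<^sub>F w in at z within ostrip k. \<exists>i p. (i, p) \<in> \<psi> k z \<and> p + (frame u w - frame u z) \<in> poly S i" .
  moreover have "\<forall>\<^sub>F w in at z within ostrip k. w \<in> ostrip k" by (simp add: eventually_at_filter)
  ultimately show "\<forall>\<^sub>F w in at z within ostrip k. \<psi> k w = move (\<psi> k z) (frame u w - frame u z)"
  proof eventually_elim
    case (elim w)
    then obtain i p where ip: "(i, p) \<in> \<psi> k z" "p + (frame u w - frame u z) \<in> poly S i" by blast
    then have "p + frame u (w - z) \<in> poly S i" "(i, p) \<in> Dev k z" using psi_open(1)[OF k z] by (simp_all add: frame_linear)
    then have "(i, p + frame u (w - z)) \<in> Dev k (z + (w - z))" by (intro Dev_add)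
    then have "(i, p + (frame u w - frame u z)) \<in> Dev k w" by (simp add: frame_linear)
    then have "\<psi> k w = point_of S i (p + (frame u w - frame u z))" using psi_eq[OF k] elim(2) ostrip_strip by blast
    then show ?case using move_eq[OF n ip] by simp
  qed
qed

lemma psi_lipschitz_open:
  assumes k: "k \<ge> \<iota>" and zw: "z \<in> ostrip k" "w \<in> ostrip k" shows "d (\<psi> k z) (\<psi> k w) \<le> norm (w - z)"
proof -
  have seg: "z + t *\<^sub>R (w - z) \<in> ostrip k" if "t \<in> {0..1}" for t
  proof -
    have "z + t *\<^sub>R (w - z) = (1 - t) *\<^sub>R z + t *\<^sub>R w" by (simp add: algebra_simps)
    then show ?thesis using convexD[OF convex_ostrip zw, of "1 - t" t] that by simp
  qed
  have "loctrans {0..1} (\<lambda>t. frame u (z + t *\<^sub>R (w - z))) (\<lambda>t. \<psi> k (z + t *\<^sub>R (w - z)))"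
    by (rule loctrans_compose[OF psi_loctrans[OF k]]) (use seg in \<open>auto intro!: continuous_intros\<close>)
  then have "loctrans {0..1} (\<lambda>t. t *\<^sub>R frame u (w - z)) (\<lambda>t. \<psi> k (z + t *\<^sub>R (w - z)))"
    by (rule loctrans_dev) (simp add: frame_linear algebra_simps)
  from loctrans_lipschitz[OF this invertible_mat_1] show ?thesis
    by (simp add: dA_1 norm_frame norm_u)
qed

text \<open>
From every point of the closed cylinder a segment inside one polygon leads into the open cylinder.
The direction \<open>v\<close> comes from the midpoint of edge \<open>k\<close>, which lies strictly between the two chords.
\<close>

lemma psi_inner: assumes k: "k \<ge> \<iota>" and z: "z \<in> strip k"
  shows "\<exists>v C. C \<ge> 0 \<and> (\<forall>\<epsilon>. 0 < \<epsilon> \<and> \<epsilon> \<le> 1 \<longrightarrow> z + \<epsilon> *\<^sub>R v \<in> ostrip k \<and> d (\<psi> k z) (\<psi> k (z + \<epsilon> *\<^sub>R v)) \<le> C * \<epsilon>)"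
proof -
  obtain i p where ip: "(i, p) \<in> Dev k z" using Dev_nonempty[OF k z] by blast
  have p: "p \<in> poly S i" using ip by (auto simp: Dev_def)
  define m where "m = sg i *\<^sub>R ((1/2) *\<^sub>R (P k + P (k + 1)))"
  have "(1/2) *\<^sub>R P k + (1/2) *\<^sub>R P (k + 1) \<in> Q" by (intro convexD[OF convex_Q] P_in_Q) auto
  then have m: "m \<in> poly S i" by (simp add: m_def poly_S scaleR_add_right del: Q_piece.simps)
  define v where "v = unframe u (m - p)"
  have fv: "frame u v = m - p" by (simp add: v_def frame_un)
  have "(i, p + frame u v) \<in> Dev k (z + v)" by (rule Dev_add[OF ip]) (simp add: fv m)
  from Dev_height[OF this] have h: "snd (z + v) = Hk k / 2"
    by (cases i) (auto simp: fv m_def ht_def Hk_def field_simps)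
  have "z + \<epsilon> *\<^sub>R v \<in> ostrip k \<and> d (\<psi> k z) (\<psi> k (z + \<epsilon> *\<^sub>R v)) \<le> norm (m - p) * \<epsilon>" if e: "0 < \<epsilon>" "\<epsilon> \<le> 1" for \<epsilon>
  proof -
    have H: "Hk k > 0" using Hk_ge[OF k] by simp
    have sz: "0 \<le> snd z" "snd z \<le> Hk k" using z by (auto simp: strip_def)
    have "snd (z + \<epsilon> *\<^sub>R v) = (1 - \<epsilon>) * snd z + \<epsilon> * snd (z + v)" by (simp add: algebra_simps)
    also have "\<dots> = (1 - \<epsilon>) * snd z + \<epsilon> * (Hk k / 2)" by (simp only: h)
    finally have s: "snd (z + \<epsilon> *\<^sub>R v) = (1 - \<epsilon>) * snd z + \<epsilon> * (Hk k / 2)" .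
    have "(1 - \<epsilon>) * snd z \<ge> 0" "(1 - \<epsilon>) * snd z \<le> (1 - \<epsilon>) * Hk k" using sz e by (auto intro: mult_left_mono)
    moreover have "\<epsilon> * (Hk k / 2) > 0" "\<epsilon> * (Hk k / 2) < \<epsilon> * Hk k" using e H by auto
    moreover have "(1 - \<epsilon>) * Hk k + \<epsilon> * Hk k = Hk k" by (simp add: algebra_simps)
    ultimately have "0 < snd (z + \<epsilon> *\<^sub>R v)" "snd (z + \<epsilon> *\<^sub>R v) < Hk k" unfolding s by linarith+
    then have o: "z + \<epsilon> *\<^sub>R v \<in> ostrip k" by (cases "z + \<epsilon> *\<^sub>R v") (auto simp: ostrip_def)
    have pe: "p + \<epsilon> *\<^sub>R (m - p) \<in> poly S i"
      using convexD[OF poly_S_convex p m, of "1 - \<epsilon>" \<epsilon>] e by (simp add: algebra_simps)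
    have "p + \<epsilon> *\<^sub>R (m - p) = p + frame u (\<epsilon> *\<^sub>R v)" by (simp add: fv frame_linear)
    then have "(i, p + \<epsilon> *\<^sub>R (m - p)) \<in> Dev k (z + \<epsilon> *\<^sub>R v)" using Dev_add[OF ip, of "\<epsilon> *\<^sub>R v"] pe by simp
    then have "\<psi> k (z + \<epsilon> *\<^sub>R v) = point_of S i (p + \<epsilon> *\<^sub>R (m - p))" using psi_eq[OF k] o ostrip_strip by blast
    then show ?thesis using o d_segment[OF p pe] psi_eq[OF k z ip] e by (simp add: mult.commute)
  qed
  then show ?thesis by (intro exI[of _ v] exI[of _ "norm (m - p)"]) auto
qed

theorem psi_lipschitz:
  assumes k: "k \<ge> \<iota>" and zw: "z \<in> strip k" "w \<in> strip k" shows "d (\<psi> k z) (\<psi> k w) \<le> norm (w - z)"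
proof -
  obtain v C where v: "C \<ge> 0" "\<And>\<epsilon>. 0 < \<epsilon> \<Longrightarrow> \<epsilon> \<le> 1 \<Longrightarrow> z + \<epsilon> *\<^sub>R v \<in> ostrip k \<and> d (\<psi> k z) (\<psi> k (z + \<epsilon> *\<^sub>R v)) \<le> C * \<epsilon>"
    using psi_inner[OF k zw(1)] by blast
  obtain v' C' where v': "C' \<ge> 0" "\<And>\<epsilon>. 0 < \<epsilon> \<Longrightarrow> \<epsilon> \<le> 1 \<Longrightarrow> w + \<epsilon> *\<^sub>R v' \<in> ostrip k \<and> d (\<psi> k w) (\<psi> k (w + \<epsilon> *\<^sub>R v')) \<le> C' * \<epsilon>"
    using psi_inner[OF k zw(2)] by blast
  define K where "K = C + C' + norm (v' - v) + 1"
  have K: "K > 0" unfolding K_def by (intro add_nonneg_pos add_nonneg_nonneg v(1) v'(1) norm_ge_zero) simp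
  show ?thesis
  proof (rule field_le_epsilon)
    fix e :: real assume e: "0 < e"
    define \<epsilon> where "\<epsilon> = min 1 (e / K)"
    have \<epsilon>: "0 < \<epsilon>" "\<epsilon> \<le> 1" "K * \<epsilon> \<le> e" using e K by (auto simp: \<epsilon>_def min_def field_simps)
    let ?z = "z + \<epsilon> *\<^sub>R v" and ?w = "w + \<epsilon> *\<^sub>R v'"
    have o: "?z \<in> ostrip k" "?w \<in> ostrip k" using v(2)[OF \<epsilon>(1,2)] v'(2)[OF \<epsilon>(1,2)] by auto
    have inX: "\<psi> k z \<in> X" "\<psi> k w \<in> X" "\<psi> k ?z \<in> X" "\<psi> k ?w \<in> X" using psi_in[OF k] zw o ostrip_strip by blast+
    have "d (\<psi> k z) (\<psi> k w) \<le> d (\<psi> k z) (\<psi> k ?z) + d (\<psi> k ?z) (\<psi> k w)" by (rule d_triangle[OF inX(1,3,2)])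
    also have "d (\<psi> k ?z) (\<psi> k w) \<le> d (\<psi> k ?z) (\<psi> k ?w) + d (\<psi> k ?w) (\<psi> k w)" by (rule d_triangle[OF inX(3,4,2)])
    also have "d (\<psi> k ?z) (\<psi> k ?w) \<le> norm (?w - ?z)" by (rule psi_lipschitz_open[OF k o])
    also have "?w - ?z = (w - z) + \<epsilon> *\<^sub>R (v' - v)" by (simp add: algebra_simps)
    also have "norm ((w - z) + \<epsilon> *\<^sub>R (v' - v)) \<le> norm (w - z) + \<epsilon> * norm (v' - v)"
      using norm_triangle_ineq[of "w - z" "\<epsilon> *\<^sub>R (v' - v)"] \<epsilon>(1) by simp
    finally have "d (\<psi> k z) (\<psi> k w) \<le> C * \<epsilon> + (norm (w - z) + \<epsilon> * norm (v' - v) + C' * \<epsilon>)"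
      using v(2)[OF \<epsilon>(1,2)] v'(2)[OF \<epsilon>(1,2)] d_sym[of "\<psi> k ?w" "\<psi> k w"] by linarith
    also have "\<dots> \<le> norm (w - z) + K * \<epsilon>" using \<epsilon>(1) by (simp add: K_def algebra_simps)
    finally show "d (\<psi> k z) (\<psi> k w) \<le> norm (w - z) + e" using \<epsilon>(3) by simp
  qed
qed

lemma psi_surj: assumes "x \<in> X" obtains k z where "k \<ge> \<iota>" "z \<in> strip k" "x = \<psi> k z"
proof -
  obtain i p where p: "p \<in> poly S i" "x = point_of S i p" using points_cases[OF assms] .
  have "sg i *\<^sub>R p \<in> Q" using p poly_S by blast
  then have "0 \<le> cross2 u (sg i *\<^sub>R p)" by (rule hgt_Q_nonneg)
  then obtain k where k: "k \<ge> \<iota>" "ht k \<le> cross2 u (sg i *\<^sub>R p)" "cross2 u (sg i *\<^sub>R p) < ht (k + 1)" by (rule zone_exists)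
  obtain z where "z \<in> strip k" "(i, p) \<in> Dev k z" using Dev_of[OF p(1) k(2)] k(3) by auto
  then show ?thesis using that[OF k(1)] psi_eq[OF k(1)] p(2) by metis
qed

text \<open>
The closed cylinder need not be embedded, but its coordinates do not increase distances.
\<close>

theorem psi_cylinder: assumes k: "k \<ge> \<iota>" shows "cylinder S u (Lk k) (Hk k) (\<psi> k)"
  unfolding cylinder_def
proof (intro conjI)
  show "norm u = 1" by (rule norm_u)
  show "0 < Lk k" by (rule Lk_pos[OF k])
  show "0 < Hk k" using Hk_ge[OF k] by simp
  show "\<psi> k ` (UNIV \<times> {0..Hk k}) \<subseteq> X" using psi_in[OF k] by (auto simp: strip_def)
  show "\<forall>x. \<forall>y\<in>{0..Hk k}. \<psi> k (x + Lk k, y) = \<psi> k (x, y)" using psi_period[of k _ 1] by simp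
  show "\<forall>x x'. \<forall>y\<in>{0<..<Hk k}. \<forall>y'\<in>{0<..<Hk k}. \<psi> k (x, y) = \<psi> k (x', y') \<longrightarrow> y = y' \<and> (\<exists>n::int. x' = x + of_int n * Lk k)"
  proof (intro allI ballI impI)
    fix x x' y y' assume *: "y \<in> {0<..<Hk k}" "y' \<in> {0<..<Hk k}" "\<psi> k (x, y) = \<psi> k (x', y')"
    then have "(x, y) \<in> ostrip k" "(x', y') \<in> strip k" by (auto simp: ostrip_def strip_def)
    from psi_meet[OF k this(1) k this(2) *(3)] show "y = y' \<and> (\<exists>n::int. x' = x + of_int n * Lk k)" by auto
  qed
  show "\<forall>z\<in>UNIV \<times> {0<..<Hk k}. \<psi> k z \<notin> V \<and> (\<forall>(i, p)\<in>\<psi> k z. \<forall>\<^sub>F h in nhds 0. p + frame u h \<in> poly S i \<longrightarrow> \<psi> k (z + h) = point_of S i (p + frame u h))"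
  proof (intro ballI conjI)
    fix z assume "z \<in> (UNIV :: real set) \<times> {0<..<Hk k}"
    then have z: "z \<in> ostrip k" by (simp add: ostrip_def)
    show "\<psi> k z \<notin> V" using psi_open(2)[OF k z] by simp
    show "case ip of (i, p) \<Rightarrow> \<forall>\<^sub>F h in nhds 0. p + frame u h \<in> poly S i \<longrightarrow> \<psi> k (z + h) = point_of S i (p + frame u h)"
      if m: "ip \<in> \<psi> k z" for ip
    proof -
      obtain i p where ip: "ip = (i, p)" "(i, p) \<in> Dev k z" using m psi_open(1)[OF k z] by (cases ip) auto
      have "((\<lambda>h. z + h) \<longlongrightarrow> z + 0) (nhds 0)" by (intro tendsto_add tendsto_const filterlim_ident)
      then have "\<forall>\<^sub>F h in nhds 0. z + h \<in> ostrip k" using topological_tendstoD[OF _ open_ostrip[of k]] z by simp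
      then have "\<forall>\<^sub>F h in nhds 0. p + frame u h \<in> poly S i \<longrightarrow> \<psi> k (z + h) = point_of S i (p + frame u h)"
      proof eventually_elim
        case (elim h)
        then show ?case using Dev_add[OF ip(2), of h] psi_eq[OF k, of "z + h" i "p + frame u h"] ostrip_strip by blast
      qed
      then show ?thesis by (simp add: ip)
    qed
  qed
  show "\<forall>z\<in>UNIV \<times> {0..Hk k}. ((\<lambda>w. d (\<psi> k w) (\<psi> k z)) \<longlongrightarrow> 0) (at z within UNIV \<times> {0..Hk k})"
  proof
    fix z assume "z \<in> (UNIV :: real set) \<times> {0..Hk k}"
    then have z: "z \<in> strip k" by (simp add: strip_def)
    have lim: "((\<lambda>w. norm (w - z)) \<longlongrightarrow> 0) (at z within strip k)"
      using LIM_zero[OF tendsto_ident_at[of z "strip k"]] tendsto_norm_zero by blast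
    show "((\<lambda>w. d (\<psi> k w) (\<psi> k z)) \<longlongrightarrow> 0) (at z within UNIV \<times> {0..Hk k})"
      unfolding strip_def[symmetric]
    proof (rule tendsto_sandwich[OF _ _ tendsto_const lim])
      have "0 \<le> d (\<psi> k w) (\<psi> k z) \<and> d (\<psi> k w) (\<psi> k z) \<le> norm (w - z)" if "w \<in> strip k" for w
        using d_nonneg[OF psi_in[OF k that] psi_in[OF k z]] psi_lipschitz[OF k that z] by (simp add: norm_minus_commute)
      then show "\<forall>\<^sub>F w in at z within strip k. 0 \<le> d (\<psi> k w) (\<psi> k z)"
        "\<forall>\<^sub>F w in at z within strip k. d (\<psi> k w) (\<psi> k z) \<le> norm (w - z)"
        by (auto simp: eventually_at_filter)
    qed
  qed
qed

section \<open>Maximal cylinders\<close>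

text \<open>
The point lies on one of the chords that separate the cylinders.
\<close>

definition on_level :: "piece surface_point \<Rightarrow> bool" where
  "on_level x \<longleftrightarrow> (\<exists>i p j. (i, p) \<in> x \<and> cross2 u (sg i *\<^sub>R p) = ht j)"

lemma ht_index: obtains k where "k \<ge> \<iota>" "ht k = ht j" "j = k \<or> j = \<iota> - k"
  by (rule index_cases[of j]) (use that[of j] that[of "\<iota> - j"] ht_refl[of j] in auto)

text \<open>
The section of the polygon at the height of a vertex is a chord.
\<close>

lemma level_point:
  assumes k: "k \<ge> \<iota>" and q: "q \<in> Q" "cross2 u q = ht k"
  obtains s where "q = pt k (s, 0)" "- ell k \<le> s" "s \<le> 0"
proof -
  obtain z where z: "q = pt k z" using pt_surj by blast
  then have s: "z = (fst z, 0)" using q(2) hgt_pt[of k z] by (simp add: prod_eq_iff)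
  have "0 \<le> Hk k" using Hk_ge[OF k] by simp
  then have "lft k 0 \<le> fst z \<and> fst z \<le> rgt k 0" using pt_in_Q[OF k order_refl, of "fst z"] q(1) z s by simp
  then show ?thesis using that[of "fst z"] z s by (simp add: lft_def rgt_def)
qed

lemma chord_hits_vertex:
  assumes x: "x \<in> X - V" "(i, p) \<in> x" "cross2 u (sg i *\<^sub>R p) = ht j"
  obtains \<tau> where "\<tau> > 0" "\<And>t. 0 \<le> t \<Longrightarrow> t < \<tau> \<Longrightarrow> p + t *\<^sub>R u \<in> poly S i \<and> sg i *\<^sub>R (p + t *\<^sub>R u) \<notin> range P"
    "p + \<tau> *\<^sub>R u \<in> poly S i" "sg i *\<^sub>R (p + \<tau> *\<^sub>R u) \<in> range P"
proof -
  have p: "p \<in> poly S i" "x = point_of S i p" using mem_pointD[of x S i p] x by auto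
  have pn: "sg i *\<^sub>R p \<notin> range P" using point_of_V_iff[OF p(1)] p(2) x by auto
  obtain k where k: "k \<ge> \<iota>" "ht k = ht j" by (rule ht_index)
  have "sg i *\<^sub>R p \<in> Q" using p poly_S by blast
  from level_point[OF k(1) this] obtain s where s: "sg i *\<^sub>R p = pt k (s, 0)" "- ell k \<le> s" "s \<le> 0"
    using x(3) k(2) by metis
  define \<tau> where "\<tau> = (if i = QPlus then - s else s + ell k)"
  have \<tau>0: "\<tau> \<ge> 0" using s by (auto simp: \<tau>_def)
  have "sg i *\<^sub>R (p + \<tau> *\<^sub>R u) = pt k (s, 0) + (sg i * \<tau>) *\<^sub>R u" by (simp add: scaleR_add_right s(1))
  also have "\<dots> = pt k (s + sg i * \<tau>, 0)" by (rule pt_shift)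
  also have "\<dots> = (if i = QPlus then P k else P (\<iota> - k))"
    by (cases i) (auto simp: \<tau>_def P_refl pt_def zero_prod_def[symmetric] frame_linear)
  finally have v: "sg i *\<^sub>R (p + \<tau> *\<^sub>R u) \<in> range P" by auto
  then obtain m where "p + \<tau> *\<^sub>R u = sg i *\<^sub>R P m" by (auto simp: sg_eq_iff)
  then have vp: "p + \<tau> *\<^sub>R u \<in> poly S i" using vertex_poly by simp
  have "\<tau> \<noteq> 0" using v pn by auto
  then have \<tau>: "\<tau> > 0" using \<tau>0 by simp
  have u0: "u \<noteq> 0" using norm_u by auto
  have "p + t *\<^sub>R u \<in> poly S i \<and> sg i *\<^sub>R (p + t *\<^sub>R u) \<notin> range P" if t: "0 \<le> t" "t < \<tau>" for t
  proof (cases "t = 0")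
    case True then show ?thesis using p pn by simp
  next
    case False
    have e: "p + t *\<^sub>R u = p + (t / \<tau>) *\<^sub>R ((p + \<tau> *\<^sub>R u) - p)" using \<tau> by simp
    have "p \<noteq> p + \<tau> *\<^sub>R u" using \<tau> u0 by simp
    then show ?thesis unfolding e using not_vertex_on_segment[OF p(1) vp, of "t / \<tau>"] t False \<tau> by auto
  qed
  then show ?thesis using that \<tau> v vp by blast
qed

text \<open>
A path in direction \<open>u\<close> that starts on a chord reaches the end of the chord, which is a vertex.
\<close>

lemma no_line_on_level:
  assumes l: "loctrans {0..} (\<lambda>t. t *\<^sub>R u) \<gamma>" and lev: "on_level (\<gamma> 0)" shows False
proof -
  have n: "\<gamma> t \<in> X - V" if "t \<ge> 0" for t using l that unfolding loctrans_def by auto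
  obtain i p j where ip: "(i, p) \<in> \<gamma> 0" "cross2 u (sg i *\<^sub>R p) = ht j" using lev unfolding on_level_def by blast
  obtain \<tau> where \<tau>: "\<tau> > 0" "\<And>t. 0 \<le> t \<Longrightarrow> t < \<tau> \<Longrightarrow> p + t *\<^sub>R u \<in> poly S i \<and> sg i *\<^sub>R (p + t *\<^sub>R u) \<notin> range P"
    "p + \<tau> *\<^sub>R u \<in> poly S i" "sg i *\<^sub>R (p + \<tau> *\<^sub>R u) \<in> range P"
    by (rule chord_hits_vertex[OF n[OF order_refl] ip]) blast
  have p0: "\<gamma> 0 = point_of S i p" using mem_pointD(2)[of "\<gamma> 0" S i p] n[of 0] ip by auto
  have ray: "loctrans {0..<\<tau>} (\<lambda>t. t *\<^sub>R u) (\<lambda>t. point_of S i (p + t *\<^sub>R u))"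
    by (rule loctrans_ray) (use \<tau>(2) in auto)
  have sub: "loctrans {0..<\<tau>} (\<lambda>t. t *\<^sub>R u) \<gamma>" by (rule loctrans_subset[OF l]) auto
  have agree: "\<gamma> t = point_of S i (p + t *\<^sub>R u)" if "0 \<le> t" "t < \<tau>" for t
    by (rule loctrans_agree[OF _ _ sub ray, of 0]) (use that \<tau>(1) p0 in \<open>auto intro!: continuous_intros\<close>)
  let ?v = "point_of S i (p + \<tau> *\<^sub>R u)"
  have vX: "?v \<in> X" by (rule point_of_in_points[OF \<tau>(3)])
  have gX: "\<gamma> \<tau> \<in> X" using n[of \<tau>] \<tau>(1) by simp
  have "d (\<gamma> \<tau>) ?v \<le> 0 + e" if e: "0 < e" for e
  proof -
    define t where "t = max 0 (\<tau> - e / 2)"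
    have t: "0 \<le> t" "t < \<tau>" "\<tau> - t \<le> e / 2" using \<tau>(1) e by (auto simp: t_def max_def)
    have "d (\<gamma> t) (\<gamma> \<tau>) \<le> norm u * (\<tau> - t)"
      using loctrans_lipschitz[OF loctrans_subset[OF l] invertible_mat_1, of t \<tau>] t by (simp add: dA_1)
    moreover have "d (\<gamma> t) ?v \<le> norm ((p + \<tau> *\<^sub>R u) - (p + t *\<^sub>R u))"
      unfolding agree[OF t(1,2)] by (rule d_segment) (use \<tau> t in auto)
    moreover have "(p + \<tau> *\<^sub>R u) - (p + t *\<^sub>R u) = (\<tau> - t) *\<^sub>R u" by (simp add: algebra_simps)
    ultimately have "d (\<gamma> t) (\<gamma> \<tau>) \<le> \<tau> - t" "d (\<gamma> t) ?v \<le> \<tau> - t" using t by (simp_all add: norm_u)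
    moreover have "d (\<gamma> \<tau>) ?v \<le> d (\<gamma> \<tau>) (\<gamma> t) + d (\<gamma> t) ?v" using d_triangle[OF gX _ vX, of "\<gamma> t"] n[OF t(1)] by simp
    ultimately show ?thesis using t(3) d_sym[of "\<gamma> t" "\<gamma> \<tau>"] by simp
  qed
  then have "d (\<gamma> \<tau>) ?v \<le> 0" by (rule field_le_epsilon)
  then have "\<gamma> \<tau> = ?v" using d_eq_0[OF gX vX] d_nonneg[OF gX vX] by simp
  then show False using n[of \<tau>] \<tau> point_of_V_iff[OF \<tau>(3)] by simp
qed

lemma psi_boundary_level: assumes k: "k \<ge> \<iota>" and z: "z \<in> strip k - ostrip k" shows "on_level (\<psi> k z)"
proof -
  have zs: "z \<in> strip k" using z by simp
  obtain i p where ip: "(i, p) \<in> Dev k z" using Dev_nonempty[OF k zs] by blast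
  have "snd z = 0 \<or> snd z = Hk k" using z by (cases z) (auto simp: strip_def ostrip_def)
  then have "\<exists>j. cross2 u (sg i *\<^sub>R p) = ht j"
    using Dev_height[OF ip] by (cases i) (auto simp: Hk_def)
  then show ?thesis unfolding on_level_def using ip Dev_subset[OF k zs] by blast
qed

lemma cylinder_loctrans:
  assumes "cylinder S u C H \<phi>" shows "loctrans (UNIV \<times> {0<..<H}) (frame u) \<phi>"
  unfolding loctrans_def
proof (intro ballI conjI)
  let ?Z = "(UNIV :: real set) \<times> {0<..<H}"
  fix z assume z: "z \<in> ?Z"
  have *: "\<phi> z \<notin> V" "\<And>i p. (i, p) \<in> \<phi> z \<Longrightarrow> \<forall>\<^sub>F h in nhds 0. p + frame u h \<in> poly S i \<longrightarrow> \<phi> (z + h) = point_of S i (p + frame u h)"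
    using assms z unfolding cylinder_def by blast+
  have "\<phi> ` (UNIV \<times> {0..H}) \<subseteq> X" using assms unfolding cylinder_def by blast
  moreover have "z \<in> UNIV \<times> {0..H}" using z by auto
  ultimately show n: "\<phi> z \<in> X - V" using *(1) by blast
  have "\<forall>\<^sub>F h in nhds 0. \<forall>ip\<in>\<phi> z. snd ip + frame u h \<in> poly S (fst ip) \<longrightarrow> \<phi> (z + h) = point_of S (fst ip) (snd ip + frame u h)"
    by (intro eventually_ball_finite nonvertex_finite[OF n] ballI *(2)) simp
  moreover have "filterlim (\<lambda>w. w - z) (nhds 0) (at z within ?Z)"
    by (rule LIM_zero) (rule tendsto_ident_at)
  ultimately have 1: "\<forall>\<^sub>F w in at z within ?Z. \<forall>ip\<in>\<phi> z. snd ip + frame u (w - z) \<in> poly S (fst ip) \<longrightarrow> \<phi> (z + (w - z)) = point_of S (fst ip) (snd ip + frame u (w - z))"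
    by (rule eventually_compose_filterlim)
  have "filterlim (\<lambda>w. frame u w - frame u z) (nhds 0) (at z within ?Z)"
    by (rule tendsto_dev) (auto intro!: continuous_intros z)
  from eventually_compose_filterlim[OF full_disc_covered[OF n] this] 1
  show "\<forall>\<^sub>F w in at z within ?Z. \<phi> w = move (\<phi> z) (frame u w - frame u z)"
  proof eventually_elim
    case (elim w)
    then obtain i p where ip: "(i, p) \<in> \<phi> z" "p + (frame u w - frame u z) \<in> poly S i" by blast
    then have "\<phi> w = point_of S i (p + (frame u w - frame u z))"
      using elim(2) by (force simp: frame_linear)
    then show ?case using move_eq[OF n ip] by simp
  qed
qed

text \<open>
Both maps are continuous up to the boundary, so their agreement at nearby interior points passes
to the limit.
\<close>

lemma cylinder_limit:
  assumes cyl: "cylinder S u C H \<phi>" and k: "k \<ge> \<iota>" and z: "z \<in> UNIV \<times> {0..H}" "z + a \<in> strip k"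
    and v: "\<And>\<epsilon>. 0 < \<epsilon> \<Longrightarrow> \<epsilon> \<le> 1 \<Longrightarrow> z + \<epsilon> *\<^sub>R v \<in> UNIV \<times> {0..H} \<and> z + \<epsilon> *\<^sub>R v + a \<in> strip k \<and> \<phi> (z + \<epsilon> *\<^sub>R v) = \<psi> k (z + \<epsilon> *\<^sub>R v + a)"
  shows "\<phi> z = \<psi> k (z + a)"
proof -
  let ?Z = "(UNIV :: real set) \<times> {0..H}"
  have inX: "\<phi> w \<in> X" if "w \<in> ?Z" for w using cyl that unfolding cylinder_def by blast
  have lim: "((\<lambda>w. d (\<phi> w) (\<phi> z)) \<longlongrightarrow> 0) (at z within ?Z)" using cyl z unfolding cylinder_def by blast
  have pX: "\<psi> k (z + a) \<in> X" by (rule psi_in[OF k z(2)])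
  have "d (\<phi> z) (\<psi> k (z + a)) \<le> 0 + e" if e: "0 < e" for e
  proof -
    have "\<forall>\<^sub>F w in at z within ?Z. d (\<phi> w) (\<phi> z) < e / 2" using lim e by (intro order_tendstoD(2)[OF lim]) simp
    then obtain \<delta> where \<delta>: "\<delta> > 0" "\<And>w. w \<in> ?Z \<Longrightarrow> w \<noteq> z \<Longrightarrow> dist w z < \<delta> \<Longrightarrow> d (\<phi> w) (\<phi> z) < e / 2"
      unfolding eventually_at by blast
    have n1: "norm v + 1 > 0" by (rule add_nonneg_pos) simp_all
    define \<epsilon> where "\<epsilon> = min 1 (min \<delta> (e / 2) / (norm v + 1))"
    have \<epsilon>: "0 < \<epsilon>" "\<epsilon> \<le> 1" using \<delta>(1) e n1 by (auto simp: \<epsilon>_def)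
    have "\<epsilon> * (norm v + 1) \<le> (min \<delta> (e / 2) / (norm v + 1)) * (norm v + 1)"
      unfolding \<epsilon>_def using n1 by (intro mult_right_mono) auto
    also have "\<dots> = min \<delta> (e / 2)" using n1 by (metis less_irrefl nonzero_eq_divide_eq)
    finally have b: "\<epsilon> * norm v + \<epsilon> \<le> min \<delta> (e / 2)" by (simp only: distrib_left mult_1_right)
    let ?w = "z + \<epsilon> *\<^sub>R v"
    note vw = v[OF \<epsilon>]
    have dw: "dist ?w z < \<delta>" using b \<epsilon>(1) by (simp add: dist_norm)
    have 1: "d (\<phi> ?w) (\<phi> z) < e / 2"
      using \<delta>(2)[of ?w] vw dw d_self[OF inX[OF z(1)]] e by (cases "?w = z") auto
    have "d (\<psi> k (?w + a)) (\<psi> k (z + a)) \<le> norm (z + a - (?w + a))" by (rule psi_lipschitz[OF k]) (use vw z in auto)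
    also have "\<dots> \<le> e / 2" using b \<epsilon>(1) by simp
    finally have 2: "d (\<phi> ?w) (\<psi> k (z + a)) \<le> e / 2" using vw by simp
    have "d (\<phi> z) (\<psi> k (z + a)) \<le> d (\<phi> z) (\<phi> ?w) + d (\<phi> ?w) (\<psi> k (z + a))"
      by (rule d_triangle[OF inX[OF z(1)] inX[OF conjunct1[OF vw]] pX])
    then show ?thesis using 1 2 d_sym[of "\<phi> z" "\<phi> ?w"] by simp
  qed
  then have "d (\<phi> z) (\<psi> k (z + a)) \<le> 0" by (rule field_le_epsilon)
  then show ?thesis using d_eq_0[OF inX[OF z(1)] pX] d_nonneg[OF inX[OF z(1)] pX] by simp
qed

text \<open>
The curves along a cylinder are closed, straight in direction \<open>u\<close> and regular, so they avoid the
chords. Hence the open cylinder starts out in a slice between two consecutive chords, with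
coordinates that differ from \<open>\<psi> k\<close> by a translation. If it left the slice, it would contain a
point of a chord by \<open>cylinder_limit\<close>.
\<close>

theorem cylinder_in_zone:
  assumes cyl: "cylinder S u C H \<phi>"
  obtains k a where "k \<ge> \<iota>" "\<And>z. z \<in> UNIV \<times> {0<..<H} \<Longrightarrow> z + a \<in> ostrip k \<and> \<phi> z = \<psi> k (z + a)"
proof -
  let ?Z = "(UNIV :: real set) \<times> {0<..<H}"
  have H: "H > 0" using cyl unfolding cylinder_def by blast
  note lt = cylinder_loctrans[OF cyl]
  have nolev: "\<not> on_level (\<phi> z)" if z: "z \<in> ?Z" for z
  proof
    assume lev: "on_level (\<phi> z)"
    have "loctrans {0..} (\<lambda>t. frame u (z + (t, 0))) (\<lambda>t. \<phi> (z + (t, 0)))"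
      by (rule loctrans_compose[OF lt]) (use z in \<open>auto intro!: continuous_intros\<close>)
    then have "loctrans {0..} (\<lambda>t. t *\<^sub>R u) (\<lambda>t. \<phi> (z + (t, 0)))"
      by (rule loctrans_dev) (simp add: vec2_eq_iff algebra_simps)
    from no_line_on_level[OF this] lev show False by (simp add: zero_prod_def[symmetric])
  qed
  define z0 where "z0 = (0 :: real, H / 2)"
  have z0: "z0 \<in> ?Z" using H by (simp add: z0_def)
  have "\<phi> z0 \<in> X" using lt z0 unfolding loctrans_def by blast
  then obtain k z1 where k: "k \<ge> \<iota>" and z1: "z1 \<in> strip k" "\<phi> z0 = \<psi> k z1" by (rule psi_surj)
  have z1o: "z1 \<in> ostrip k" using psi_boundary_level[OF k, of z1] nolev[OF z0] z1 by auto
  define a where "a = z1 - z0"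
  define Y where "Y = {z \<in> ?Z. z + a \<in> ostrip k}"
  have agree: "\<phi> z = \<psi> k (z + a)" if z: "z \<in> Y" for z
  proof -
    have Yeq: "Y = ?Z \<inter> (\<lambda>z. - a + z) ` ostrip k"
    proof -
      have "z + a \<in> ostrip k \<longleftrightarrow> z \<in> (\<lambda>z. - a + z) ` ostrip k" for z
      proof
        assume "z + a \<in> ostrip k"
        then show "z \<in> (\<lambda>z. - a + z) ` ostrip k" by (intro image_eqI[of _ _ "z + a"]) simp_all
      qed auto
      then show ?thesis unfolding Y_def by blast
    qed
    have "convex Y" unfolding Yeq
      by (intro convex_Int convex_Times convex_translation convex_ostrip) auto
    have l1: "loctrans Y (frame u) \<phi>" by (rule loctrans_subset[OF lt]) (auto simp: Y_def)
    have "loctrans Y (\<lambda>z. frame u (z + a)) (\<lambda>z. \<psi> k (z + a))"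
      by (rule loctrans_compose[OF psi_loctrans[OF k]]) (auto simp: Y_def intro!: continuous_intros)
    then have l2: "loctrans Y (frame u) (\<lambda>z. \<psi> k (z + a))" by (rule loctrans_dev) (simp add: frame_linear)
    show ?thesis
      by (rule loctrans_agree[OF convex_connected[OF \<open>convex Y\<close>] _ l1 l2, of z0])
         (use z z0 z1o z1 in \<open>auto simp: Y_def a_def intro!: continuous_intros\<close>)
  qed
  have all: "z + a \<in> ostrip k" if z: "z \<in> ?Z" for z
  proof (rule ccontr)
    assume no: "z + a \<notin> ostrip k"
    define y0 where "y0 = H / 2"
    define y where "y = snd z"
    define b where "b = snd a"
    have y: "0 < y" "y < H" using z by (auto simp: y_def)
    have y0: "0 < y0 + b" "y0 + b < Hk k" "0 < y0" "y0 < H"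
      using z1o H unfolding a_def b_def y0_def z0_def by (auto simp: ostrip_def)
    have ny: "y + b \<le> 0 \<or> Hk k \<le> y + b" using no unfolding y_def b_def by (auto simp: ostrip_def mem_Times_iff)
    define y1 where "y1 = (if y + b \<le> 0 then - b else Hk k - b)"
    have y1: "0 < y1" "y1 < H" "y1 + b = 0 \<or> y1 + b = Hk k" using ny y y0 by (auto simp: y1_def)
    let ?z = "(0 :: real, y1)" and ?v = "(0 :: real, y0 - y1)"
    have zc: "?z \<in> UNIV \<times> {0..H}" "?z + a \<in> strip k" "?z + a \<notin> ostrip k"
      using y1 Hk_ge[OF k] by (auto simp: strip_def ostrip_def b_def prod_eq_iff mem_Times_iff)
    have "\<phi> ?z = \<psi> k (?z + a)"
    proof (rule cylinder_limit[OF cyl k zc(1,2)])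
      fix \<epsilon> :: real assume e: "0 < \<epsilon>" "\<epsilon> \<le> 1"
      have c: "y1 + \<epsilon> * (y0 - y1) = (1 - \<epsilon>) * y1 + \<epsilon> * y0" by (simp add: algebra_simps)
      have 1: "0 < y1 + \<epsilon> * (y0 - y1)" "y1 + \<epsilon> * (y0 - y1) < H"
      proof -
        show "0 < y1 + \<epsilon> * (y0 - y1)" unfolding c using e y1 y0 by (intro add_nonneg_pos) auto
        have "(1 - \<epsilon>) * y1 \<le> (1 - \<epsilon>) * H" "\<epsilon> * y0 < \<epsilon> * H" using e y1 y0 by (auto intro: mult_left_mono)
        then show "y1 + \<epsilon> * (y0 - y1) < H" unfolding c by (simp add: algebra_simps)
      qed
      have 2: "0 < y1 + \<epsilon> * (y0 - y1) + b" "y1 + \<epsilon> * (y0 - y1) + b < Hk k"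
      proof -
        have c2: "y1 + \<epsilon> * (y0 - y1) + b = (1 - \<epsilon>) * (y1 + b) + \<epsilon> * (y0 + b)" by (simp add: algebra_simps)
        have yy: "0 \<le> y1 + b" "y1 + b \<le> Hk k" using y1(3) Hk_ge[OF k] by auto
        show "0 < y1 + \<epsilon> * (y0 - y1) + b" unfolding c2 using e yy y0 by (intro add_nonneg_pos) auto
        have "(1 - \<epsilon>) * (y1 + b) \<le> (1 - \<epsilon>) * Hk k" "\<epsilon> * (y0 + b) < \<epsilon> * Hk k" using e yy y0 by (auto intro: mult_left_mono)
        then show "y1 + \<epsilon> * (y0 - y1) + b < Hk k" unfolding c2 by (simp add: algebra_simps)
      qed
      have inY: "?z + \<epsilon> *\<^sub>R ?v \<in> Y"
        unfolding Y_def using 1 2 by (auto simp: ostrip_def b_def mem_Times_iff)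
      then show "?z + \<epsilon> *\<^sub>R ?v \<in> UNIV \<times> {0..H} \<and> ?z + \<epsilon> *\<^sub>R ?v + a \<in> strip k \<and> \<phi> (?z + \<epsilon> *\<^sub>R ?v) = \<psi> k (?z + \<epsilon> *\<^sub>R ?v + a)"
        using agree[OF inY] ostrip_strip[of k] unfolding Y_def by auto
    qed
    then show False using psi_boundary_level[OF k, of "?z + a"] zc nolev[of ?z] y1 by auto
  qed
  show ?thesis by (rule that[OF k, of a]) (use all agree in \<open>auto simp: Y_def\<close>)
qed

lemma zone_disjoint:
  assumes "k \<ge> \<iota>" "k' \<ge> \<iota>" "z \<in> ostrip k" "z' \<in> ostrip k'" "\<psi> k z = \<psi> k' z'" shows "k' = k"
  using psi_meet[OF assms(1,3,2) _ assms(5)] assms(4) ostrip_strip by blast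

text \<open>
A larger cylinder would lie in a single open slice again, by \<open>cylinder_in_zone\<close>, and slices are
disjoint.
\<close>

theorem psi_maximal: assumes k: "k \<ge> \<iota>" shows "maximal_cylinder S u (Lk k) (Hk k) (\<psi> k)"
  unfolding maximal_cylinder_def
proof (intro conjI allI impI psi_cylinder[OF k])
  fix C' H' \<phi> assume a: "cylinder S u C' H' \<phi> \<and> \<psi> k ` (UNIV \<times> {0<..<Hk k}) \<subseteq> \<phi> ` (UNIV \<times> {0<..<H'})"
  obtain k' w where k': "k' \<ge> \<iota>" "\<And>z. z \<in> UNIV \<times> {0<..<H'} \<Longrightarrow> z + w \<in> ostrip k' \<and> \<phi> z = \<psi> k' (z + w)"
    using cylinder_in_zone[of C' H' \<phi>] a by blast
  have sub: "\<phi> ` (UNIV \<times> {0<..<H'}) \<subseteq> \<psi> k' ` ostrip k'" using k'(2) by blast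
  have o: "(0, Hk k / 2) \<in> ostrip k" using Hk_ge[OF k] by (simp add: ostrip_def)
  then have "\<psi> k (0, Hk k / 2) \<in> \<psi> k' ` ostrip k'" using a sub unfolding ostrip_def by blast
  then have "k' = k" using zone_disjoint[OF k k'(1) o] by blast
  then show "\<psi> k ` (UNIV \<times> {0<..<Hk k}) = \<phi> ` (UNIV \<times> {0<..<H'})" using a sub unfolding ostrip_def by blast
qed

lemma Ioo_eq: "{a<..<b} = {a'<..<b'} \<Longrightarrow> a < b \<Longrightarrow> a' < b' \<Longrightarrow> a = a' \<and> b = (b' :: real)"
  by (metis cInf_greaterThanLessThan cSup_greaterThanLessThan)

text \<open>
By \<open>cylinder_in_zone\<close> a maximal cylinder lies in some slice, by maximality it fills the slice, and
the only freedom left is the origin of the coordinate along the cylinder.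
\<close>

theorem maximal_cylinder_shape:
  assumes "maximal_cylinder S u C H \<phi>"
  obtains k a where "k \<ge> \<iota>" "H = Hk k" "C = Lk k" "\<And>z. z \<in> strip k \<Longrightarrow> \<phi> z = \<psi> k (z + (a, 0))"
proof -
  have cyl: "cylinder S u C H \<phi>" and max: "\<And>C' H' \<psi>'. cylinder S u C' H' \<psi>' \<Longrightarrow>
     \<phi> ` (UNIV \<times> {0<..<H}) \<subseteq> \<psi>' ` (UNIV \<times> {0<..<H'}) \<Longrightarrow> \<phi> ` (UNIV \<times> {0<..<H}) = \<psi>' ` (UNIV \<times> {0<..<H'})"
    using assms unfolding maximal_cylinder_def by blast+
  have H: "H > 0" and C: "C > 0" using cyl unfolding cylinder_def by blast+
  obtain k w where k: "k \<ge> \<iota>" and kw: "\<And>z. z \<in> UNIV \<times> {0<..<H} \<Longrightarrow> z + w \<in> ostrip k \<and> \<phi> z = \<psi> k (z + w)"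
    using cylinder_in_zone[OF cyl] by blast
  have "\<phi> ` (UNIV \<times> {0<..<H}) \<subseteq> \<psi> k ` (UNIV \<times> {0<..<Hk k})" using kw unfolding ostrip_def by blast
  then have eq: "\<phi> ` (UNIV \<times> {0<..<H}) = \<psi> k ` ostrip k" using max[OF psi_cylinder[OF k]] unfolding ostrip_def by blast
  have Hpos: "Hk k > 0" using Hk_ge[OF k] by simp
  have "{snd w<..<H + snd w} = {0<..<Hk k}"
  proof (rule Set.set_eqI)
    fix y
    show "y \<in> {snd w<..<H + snd w} \<longleftrightarrow> y \<in> {0<..<Hk k}"
    proof
      assume "y \<in> {snd w<..<H + snd w}"
      then have "(0, y - snd w) \<in> (UNIV :: real set) \<times> {0<..<H}" by auto
      from kw[OF this] show "y \<in> {0<..<Hk k}" by (simp add: ostrip_def mem_Times_iff)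
    next
      assume "y \<in> {0<..<Hk k}"
      then have o: "(0, y) \<in> ostrip k" by (simp add: ostrip_def)
      then obtain z where z: "z \<in> UNIV \<times> {0<..<H}" "\<psi> k (0, y) = \<phi> z" using eq by blast
      then have "\<psi> k (0, y) = \<psi> k (z + w)" "z + w \<in> strip k" using kw[OF z(1)] ostrip_strip by auto
      from psi_meet[OF k o k this(2,1)] obtain n :: int where "z + w = (0, y) + (of_int n * Lk k, 0)" by blast
      from arg_cong[OF this, of snd] have "snd z + snd w = y" by simp
      then show "y \<in> {snd w<..<H + snd w}" using z(1) by (auto simp: mem_Times_iff)
    qed
  qed
  from Ioo_eq[OF this] have w0: "snd w = 0" "H = Hk k" using H Hpos by auto
  then have w: "w = (fst w, 0)" by (simp add: prod_eq_iff)
  let ?y = "Hk k / 2"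
  have y: "?y \<in> {0<..<H}" "?y \<in> {0..H}" using Hpos w0 by auto
  have \<phi>y: "\<phi> (x, ?y) = \<psi> k (x + fst w, ?y)" for x
    using kw[of "(x, ?y)"] y(1) w by (metis (no_types, lifting) UNIV_I add.right_neutral add_Pair mem_Sigma_iff)
  have o: "(x, ?y) \<in> ostrip k" "(x, ?y) \<in> strip k" for x using Hpos by (auto simp: ostrip_def strip_def)
  have "\<phi> (0 + C, ?y) = \<phi> (0, ?y)" using cyl y(2) unfolding cylinder_def by blast
  then have "\<psi> k (0 + fst w, ?y) = \<psi> k (C + fst w, ?y)" by (simp add: \<phi>y)
  from psi_meet[OF k o(1) k o(2) this] obtain n :: int where n: "C = of_int n * Lk k" by auto
  have "\<psi> k (0 + fst w, ?y) = \<psi> k (0 + fst w + of_int 1 * Lk k, ?y)" by (rule psi_period[symmetric])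
  then have "\<phi> (0, ?y) = \<phi> (Lk k, ?y)" unfolding \<phi>y by (simp add: add.commute)
  then obtain m :: int where m: "Lk k = 0 + of_int m * C" using cyl y(1) unfolding cylinder_def by blast
  have L: "Lk k > 0" by (rule Lk_pos[OF k])
  have "of_int n * Lk k > 0" using C by (simp only: n[symmetric])
  moreover have "of_int m * C > 0" using L unfolding m by simp
  ultimately have "real_of_int n > 0" "real_of_int m > 0" using zero_less_mult_pos2 L C by blast+
  then have "n > 0" "m > 0" by simp_all
  have "Lk k = of_int (m * n) * Lk k" using m n by simp
  then have "m * n = 1" using L by (metis mult_cancel_right1 of_int_eq_1_iff less_irrefl)
  then have "n = 1" using \<open>n > 0\<close> \<open>m > 0\<close> by (metis zmult_eq_1_iff less_minus_one_simps(3) not_less_iff_gr_or_eq)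
  then have CL: "C = Lk k" using n by simp
  have "\<phi> z = \<psi> k (z + (fst w, 0))" if z: "z \<in> strip k" for z
  proof (rule cylinder_limit[OF cyl k])
    show "z \<in> UNIV \<times> {0..H}" using z w0 by (simp add: strip_def)
    show "z + (fst w, 0) \<in> strip k" using z by (auto simp: strip_def)
    fix \<epsilon> :: real assume e: "0 < \<epsilon>" "\<epsilon> \<le> 1"
    have sz: "0 \<le> snd z" "snd z \<le> Hk k" using z by (auto simp: strip_def)
    have c: "snd z + \<epsilon> * (?y - snd z) = (1 - \<epsilon>) * snd z + \<epsilon> * ?y" by (simp add: algebra_simps)
    have 1: "0 < snd z + \<epsilon> * (?y - snd z)" unfolding c using e sz Hpos by (intro add_nonneg_pos) auto
    have "(1 - \<epsilon>) * snd z \<le> (1 - \<epsilon>) * Hk k" "\<epsilon> * ?y < \<epsilon> * Hk k" using e sz Hpos by (auto intro: mult_left_mono)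
    then have 2: "snd z + \<epsilon> * (?y - snd z) < Hk k" unfolding c by (simp add: algebra_simps)
    have "z + \<epsilon> *\<^sub>R (0, ?y - snd z) \<in> UNIV \<times> {0<..<H}" using 1 2 w0 by (auto simp: mem_Times_iff)
    from kw[OF this] show "z + \<epsilon> *\<^sub>R (0, ?y - snd z) \<in> UNIV \<times> {0..H} \<and> z + \<epsilon> *\<^sub>R (0, ?y - snd z) + (fst w, 0) \<in> strip k \<and>
        \<phi> (z + \<epsilon> *\<^sub>R (0, ?y - snd z)) = \<psi> k (z + \<epsilon> *\<^sub>R (0, ?y - snd z) + (fst w, 0))"
      using w ostrip_strip 1 2 w0 by (auto simp: mem_Times_iff)
  qed
  then show ?thesis using that k w0(2) CL by blast
qed

lemma psi_shift_image: "(\<lambda>z. \<psi> k (z + (a, 0))) ` strip k = \<psi> k ` strip k"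
proof -
  have "(\<lambda>z. z + (a, 0)) ` strip k = strip k"
  proof
    show "strip k \<subseteq> (\<lambda>z. z + (a, 0)) ` strip k"
    proof
      fix z assume "z \<in> strip k"
      then have "z - (a, 0) \<in> strip k" by (auto simp: strip_def)
      then show "z \<in> (\<lambda>z. z + (a, 0)) ` strip k" by (metis diff_add_cancel image_eqI)
    qed
  qed (auto simp: strip_def)
  then show ?thesis by (metis image_image)
qed

lemma closed_maximal: "closed_maximal_cylinders S u = {\<psi> k ` strip k | k. k \<ge> \<iota>}"
proof
  show "{\<psi> k ` strip k | k. k \<ge> \<iota>} \<subseteq> closed_maximal_cylinders S u"
  proof
    fix A assume "A \<in> {\<psi> k ` strip k | k. k \<ge> \<iota>}"
    then obtain k where k: "k \<ge> \<iota>" "A = \<psi> k ` strip k" by blast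
    show "A \<in> closed_maximal_cylinders S u"
      unfolding closed_maximal_cylinders_def k(2) strip_def
      by (rule CollectI, rule exI[of _ "Lk k"], rule exI[of _ "Hk k"], rule exI[of _ "\<psi> k"])
         (simp add: psi_maximal[OF k(1)])
  qed
  show "closed_maximal_cylinders S u \<subseteq> {\<psi> k ` strip k | k. k \<ge> \<iota>}"
  proof
    fix A assume "A \<in> closed_maximal_cylinders S u"
    then obtain C H \<phi> where A: "A = \<phi> ` (UNIV \<times> {0..H})" "maximal_cylinder S u C H \<phi>"
      unfolding closed_maximal_cylinders_def by (elim CollectE exE conjE)
    obtain k a where k: "k \<ge> \<iota>" "H = Hk k" "C = Lk k" "\<And>z. z \<in> strip k \<Longrightarrow> \<phi> z = \<psi> k (z + (a, 0))"
      by (rule maximal_cylinder_shape[OF A(2)], rule that)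
    have "A = \<phi> ` strip k" using A k(2) by (simp add: strip_def)
    also have "\<dots> = (\<lambda>z. \<psi> k (z + (a, 0))) ` strip k" by (rule image_cong) (use k(4) in auto)
    also have "\<dots> = \<psi> k ` strip k" by (rule psi_shift_image)
    finally show "A \<in> {\<psi> k ` strip k | k. k \<ge> \<iota>}" using k(1) by (intro CollectI exI[of _ k] conjI)
  qed
qed

lemma open_maximal_zone: assumes "A \<in> open_maximal_cylinders S u" shows "\<exists>k\<ge>\<iota>. A = \<psi> k ` ostrip k"
proof -
  from assms obtain C H \<phi> where A: "A = \<phi> ` (UNIV \<times> {0<..<H})" "maximal_cylinder S u C H \<phi>"
    unfolding open_maximal_cylinders_def by (elim CollectE exE conjE)
  then have cyl: "cylinder S u C H \<phi>" unfolding maximal_cylinder_def by blast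
  obtain k w where k: "k \<ge> \<iota>" "\<And>z. z \<in> UNIV \<times> {0<..<H} \<Longrightarrow> z + w \<in> ostrip k \<and> \<phi> z = \<psi> k (z + w)"
    using cylinder_in_zone[OF cyl] by blast
  have "\<phi> ` (UNIV \<times> {0<..<H}) \<subseteq> \<psi> k ` (UNIV \<times> {0<..<Hk k})" using k(2) unfolding ostrip_def by blast
  then have "A = \<psi> k ` ostrip k" using A psi_cylinder[OF k(1)] unfolding maximal_cylinder_def ostrip_def by blast
  then show ?thesis using k(1) by blast
qed

theorem decomposition: "cylinder_decomposition S u"
  unfolding cylinder_decomposition_def
proof
  show "\<Union> (closed_maximal_cylinders S u) = X"
  proof
    show "\<Union> (closed_maximal_cylinders S u) \<subseteq> X" unfolding closed_maximal using psi_in by blast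
    show "X \<subseteq> \<Union> (closed_maximal_cylinders S u)"
    proof
      fix x assume "x \<in> X"
      then obtain k z where "k \<ge> \<iota>" "z \<in> strip k" "x = \<psi> k z" by (rule psi_surj)
      then show "x \<in> \<Union> (closed_maximal_cylinders S u)" unfolding closed_maximal by blast
    qed
  qed
  show "disjoint (open_maximal_cylinders S u)"
  proof (rule disjointI)
    fix A B assume "A \<in> open_maximal_cylinders S u" "B \<in> open_maximal_cylinders S u" "A \<noteq> B"
    then obtain k k' where k: "k \<ge> \<iota>" "A = \<psi> k ` ostrip k" "k' \<ge> \<iota>" "B = \<psi> k' ` ostrip k'" using open_maximal_zone by metis
    then show "A \<inter> B = {}" using zone_disjoint[OF k(1,3)] \<open>A \<noteq> B\<close> by blast
  qed
qed

section \<open>Dehn twists\<close>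

text \<open>
\<open>n\<close> right twists in coordinates: as \<open>\<kappa> * Hk k = Lk k\<close>, the upper boundary moves by \<open>n\<close>
circumferences.
\<close>

definition shear :: "int \<Rightarrow> real \<times> real \<Rightarrow> real \<times> real" where
  "shear n z = (fst z + of_int n * \<kappa> * snd z, snd z)"

text \<open>
Defined through cylinder coordinates at all points. On the boundary of the cylinders this is
consistent because \<open>shear n\<close> fixes boundary points of the surface, see \<open>shear_well_defined\<close>.
\<close>

definition twist :: "int \<Rightarrow> piece surface_point \<Rightarrow> piece surface_point" where
  "twist n = (\<lambda>x\<in>X. SOME y. \<exists>k z. k \<ge> \<iota> \<and> z \<in> strip k \<and> x = \<psi> k z \<and> y = \<psi> k (shear n z))"

text \<open>
The transvection \<open>p \<mapsto> p + n \<kappa> (u \<times> p) u\<close>, the derivative of the twist in every cylinder.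
\<close>

definition twist_matrix :: "int \<Rightarrow> real^2^2" where
  "twist_matrix n = mat2 (1 - of_int n * \<kappa> * u $ 1 * u $ 2) (of_int n * \<kappa> * (u $ 1)\<^sup>2)
     (- of_int n * \<kappa> * (u $ 2)\<^sup>2) (1 + of_int n * \<kappa> * u $ 1 * u $ 2)"

lemma twist_matrix_mult: "twist_matrix n *v p = p + (of_int n * \<kappa> * cross2 u p) *\<^sub>R u"
  by (simp add: vec2_eq_iff twist_matrix_def cross2_def algebra_simps power2_eq_square)

lemma shear_add: "shear n (z + w) = shear n z + shear n w"
  by (simp add: shear_def prod_eq_iff algebra_simps)

lemma frame_shear: "frame u (shear n z) = twist_matrix n *v frame u z"
  by (simp add: twist_matrix_mult cross2_frame norm_u) (simp add: vec2_eq_iff shear_def algebra_simps)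

lemma shear_strip [simp]: "shear n z \<in> strip k \<longleftrightarrow> z \<in> strip k" "shear n z \<in> ostrip k \<longleftrightarrow> z \<in> ostrip k"
  by (auto simp: shear_def strip_def ostrip_def mem_Times_iff)

lemma shear_shear: "shear n (shear m z) = shear (n + m) z" "shear 0 z = z"
  by (simp_all add: shear_def prod_eq_iff algebra_simps)

lemma psi_period': "\<psi> k (z + (of_int n * Lk k, 0)) = \<psi> k z"
  using psi_period[of k "fst z" n "snd z"] by (cases z) simp

lemma shear_boundary:
  assumes k: "k \<ge> \<iota>" and z: "z \<in> strip k - ostrip k" obtains m :: int where "shear n z = z + (of_int m * Lk k, 0)"
proof -
  have "snd z = 0 \<or> snd z = Hk k" using z by (auto simp: strip_def ostrip_def mem_Times_iff)
  then show ?thesis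
  proof
    assume "snd z = 0" then show ?thesis using that[of 0] by (simp add: shear_def prod_eq_iff)
  next
    assume "snd z = Hk k" then show ?thesis using that[of n] Lk_eq[OF k] by (simp add: shear_def prod_eq_iff)
  qed
qed

lemma boundary_fix: assumes "k \<ge> \<iota>" "z \<in> strip k - ostrip k" shows "\<psi> k (shear n z) = \<psi> k z"
  by (rule shear_boundary[OF assms, of n]) (simp add: psi_period')

lemma shear_well_defined:
  assumes k: "k \<ge> \<iota>" "z \<in> strip k" and k': "k' \<ge> \<iota>" "z' \<in> strip k'" and eq: "\<psi> k z = \<psi> k' z'"
  shows "\<psi> k (shear n z) = \<psi> k' (shear n z')"
proof -
  have *: "\<psi> k (shear n z) = \<psi> k' (shear n z')"
    if a: "k \<ge> \<iota>" "z \<in> ostrip k" "k' \<ge> \<iota>" "z' \<in> strip k'" "\<psi> k z = \<psi> k' z'" for k z k' z'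
  proof -
    obtain m :: int where m: "k' = k" "z' = z + (of_int m * Lk k, 0)" using psi_meet[OF a] by blast
    have "shear n z' = shear n z + (of_int m * Lk k, 0)" unfolding m(2) shear_add by (simp add: shear_def)
    then show ?thesis using psi_period' m(1) by simp
  qed
  show ?thesis
  proof (cases "z \<in> ostrip k")
    case True then show ?thesis using *[OF k(1) True k' eq] by simp
  next
    case z: False
    show ?thesis
    proof (cases "z' \<in> ostrip k'")
      case True then show ?thesis using *[OF k'(1) True k eq[symmetric]] by simp
    next
      case False
      then show ?thesis using boundary_fix[OF k(1), of z n] boundary_fix[OF k'(1), of z' n] z k k' eq by simp
    qed
  qed
qed

lemma twist_psi: assumes k: "k \<ge> \<iota>" "z \<in> strip k" shows "twist n (\<psi> k z) = \<psi> k (shear n z)"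
proof -
  have "(SOME y. \<exists>k' z'. k' \<ge> \<iota> \<and> z' \<in> strip k' \<and> \<psi> k z = \<psi> k' z' \<and> y = \<psi> k' (shear n z')) = \<psi> k (shear n z)"
  proof (rule some_equality)
    show "\<exists>k' z'. k' \<ge> \<iota> \<and> z' \<in> strip k' \<and> \<psi> k z = \<psi> k' z' \<and> \<psi> k (shear n z) = \<psi> k' (shear n z')"
      using k by (intro exI[of _ k] exI[of _ z]) simp
    fix y assume "\<exists>k' z'. k' \<ge> \<iota> \<and> z' \<in> strip k' \<and> \<psi> k z = \<psi> k' z' \<and> y = \<psi> k' (shear n z')"
    then obtain k' z' where *: "k' \<ge> \<iota>" "z' \<in> strip k'" "\<psi> k z = \<psi> k' z'" "y = \<psi> k' (shear n z')" by (elim exE conjE)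
    show "y = \<psi> k (shear n z)" unfolding *(4) by (rule shear_well_defined[OF k *(1,2,3), symmetric])
  qed
  then show ?thesis unfolding twist_def using psi_in[OF k] by simp
qed

lemma twist_in: assumes "x \<in> X" shows "twist n x \<in> X"
  by (rule psi_surj[OF assms]) (simp add: twist_psi psi_in)

lemma twist_twist: assumes "x \<in> X" shows "twist n (twist m x) = twist (n + m) x"
  by (rule psi_surj[OF assms]) (simp add: twist_psi shear_shear)

lemma twist_0: assumes "x \<in> X" shows "twist 0 x = x"
  by (rule psi_surj[OF assms]) (simp add: twist_psi shear_shear)

lemma twist_vertex_fix: assumes "x \<in> V" shows "twist n x = x"
proof -
  have "x \<in> X" using assms V_subset by blast
  then obtain k z where k: "k \<ge> \<iota>" "z \<in> strip k" "x = \<psi> k z" by (rule psi_surj)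
  have "z \<notin> ostrip k" using psi_open(2)[OF k(1)] k(3) assms by blast
  then show ?thesis using boundary_fix[OF k(1), of z n] k twist_psi[OF k(1,2)] by simp
qed

lemma twist_V: assumes x: "x \<in> X" shows "twist n x \<in> V \<longleftrightarrow> x \<in> V"
proof
  assume "twist n x \<in> V"
  then have "twist (- n) (twist n x) = twist n x" by (rule twist_vertex_fix)
  then have "x = twist n x" using twist_twist[OF x, of "- n" n] twist_0[OF x] by simp
  then show "x \<in> V" using \<open>twist n x \<in> V\<close> by simp
qed (simp add: twist_vertex_fix)

lemma tendsto_unframe: "filterlim (unframe u) (nhds 0) (nhds 0)"
proof -
  have c: "((\<lambda>h::real^2. h $ 1) \<longlongrightarrow> 0) (nhds 0)" "((\<lambda>h::real^2. h $ 2) \<longlongrightarrow> 0) (nhds 0)"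
    using tendsto_comp[of 0 1] tendsto_comp[of 0 2] by simp_all
  have "((\<lambda>h::real^2. (u $ 1 * h $ 1 + u $ 2 * h $ 2, u $ 1 * h $ 2 - u $ 2 * h $ 1)) \<longlongrightarrow> (u $ 1 * 0 + u $ 2 * 0, u $ 1 * 0 - u $ 2 * 0)) (nhds 0)"
    by (intro tendsto_intros c)
  then show ?thesis by (simp add: unframe_def[abs_def] cross2_def zero_prod_def)
qed

lemma frame_unframe_u [simp]: "frame u (unframe u h) = h" by (rule frame_un)

lemma psi_move: assumes k: "k \<ge> \<iota>" and z: "z \<in> ostrip k"
  shows "\<forall>\<^sub>F h in nhds 0. z + unframe u h \<in> ostrip k \<and> \<psi> k (z + unframe u h) = move (\<psi> k z) h"
proof -
  have n: "\<psi> k z \<in> X - V" by (rule psi_open(2)[OF k z])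
  have "\<forall>\<^sub>F w in at z within ostrip k. \<psi> k w = move (\<psi> k z) (frame u w - frame u z)"
    using psi_loctrans[OF k] z unfolding loctrans_def by blast
  then have "\<forall>\<^sub>F w in nhds z. w \<noteq> z \<longrightarrow> w \<in> ostrip k \<longrightarrow> \<psi> k w = move (\<psi> k z) (frame u w - frame u z)"
    by (simp add: eventually_at_filter)
  moreover have "\<forall>\<^sub>F w in nhds z. w \<in> ostrip k" by (rule eventually_nhds_in_open[OF open_ostrip z])
  ultimately have ev: "\<forall>\<^sub>F w in nhds z. w \<in> ostrip k \<and> \<psi> k w = move (\<psi> k z) (frame u w - frame u z)"
  proof eventually_elim
    case (elim w)
    then show ?case using move_0[OF n] by (cases "w = z") auto
  qed
  have "((\<lambda>h. z + unframe u h) \<longlongrightarrow> z + 0) (nhds 0)" by (intro tendsto_add tendsto_const tendsto_unframe)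
  then have "filterlim (\<lambda>h. z + unframe u h) (nhds z) (nhds 0)" by simp
  from eventually_compose_filterlim[OF ev this] show ?thesis
    by eventually_elim (simp add: frame_linear)
qed

lemma twist_local_open: assumes k: "k \<ge> \<iota>" and z: "z \<in> ostrip k"
  shows "\<forall>\<^sub>F h in nhds 0. twist n (move (\<psi> k z) h) = move (twist n (\<psi> k z)) (twist_matrix n *v h)"
proof -
  have zs: "z \<in> strip k" using z ostrip_strip by blast
  have 1: "\<forall>\<^sub>F h in nhds 0. shear n z + unframe u (twist_matrix n *v h) \<in> ostrip k \<and> \<psi> k (shear n z + unframe u (twist_matrix n *v h)) = move (\<psi> k (shear n z)) (twist_matrix n *v h)"
    by (rule eventually_compose_filterlim[OF psi_move[OF k] matrix_tendsto_0]) (simp add: z)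
  from psi_move[OF k z] 1 show ?thesis
  proof eventually_elim
    case (elim h)
    have "unframe u (twist_matrix n *v h) = shear n (unframe u h)"
      using frame_shear[of n "unframe u h"] frame_un(2)[of "shear n (unframe u h)"] by simp
    then have e: "shear n (z + unframe u h) = shear n z + unframe u (twist_matrix n *v h)" by (simp add: shear_add)
    have "z + unframe u h \<in> strip k" using elim(1) ostrip_strip by blast
    then have "twist n (\<psi> k (z + unframe u h)) = \<psi> k (shear n z + unframe u (twist_matrix n *v h))" using twist_psi[OF k] e by metis
    then show ?case using elim twist_psi[OF k zs] by simp
  qed
qed

text \<open>
The line through an edge supports the polygon, so a chord that has an inner point on this line is
contained in it.
\<close>

lemma edge_level_parallel:
  assumes p: "p \<in> Q" "p \<notin> range P" "cross2 u p = ht k'" and e: "p \<in> edge j" shows "cross2 (E j) u = 0"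
proof -
  obtain k where k: "k \<ge> \<iota>" "ht k = ht k'" by (rule ht_index)
  obtain s where s: "p = pt k (s, 0)" "- ell k \<le> s" "s \<le> 0" using level_point[OF k(1) p(1)] p(3) k(2) by metis
  define C where "C = cross2 (E j) u"
  have a: "edge_side j (pt k (t, 0)) = edge_side j (P k) + t * C" for t
    by (simp add: edge_side_def pt_def frame_pair[of t] frame_linear zero_prod_def[symmetric] C_def)
  have 1: "edge_side j (P k) + s * C = 0" using e a[of s] s(1) edge_iff by auto
  have 2: "edge_side j (P k) \<ge> 0" "edge_side j (P (\<iota> - k)) \<ge> 0" by (rule edge_side_P_nonneg)+
  have 3: "edge_side j (P (\<iota> - k)) = edge_side j (P k) + (- ell k) * C" unfolding P_refl by (rule a)
  have "s \<noteq> 0" using s(1) p(2) by (auto simp: pt_def zero_prod_def[symmetric] frame_linear)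
  moreover have "s \<noteq> - ell k" using s(1) p(2) P_refl[of k] by (metis rangeI)
  ultimately have s': "- ell k < s" "s < 0" using s by auto
  have "s * C \<le> 0" using 1 2 by linarith
  then have "C \<ge> 0" using s' by (simp add: mult_le_0_iff)
  moreover have "(s + ell k) * C \<le> 0" using 1 2 3 by (simp add: algebra_simps)
  then have "C \<le> 0" using s' by (simp add: mult_le_0_iff)
  ultimately show ?thesis by (simp add: C_def)
qed

lemma zone_near:
  assumes k: "k \<ge> \<iota>" and q: "q \<in> poly S i" "\<bar>cross2 u (sg i *\<^sub>R q) - ht k\<bar> < 1"
  obtains k' where "k' \<ge> \<iota>" "ht k' = ht k \<or> ht (k' + 1) = ht k"
    "ht k' \<le> cross2 u (sg i *\<^sub>R q)" "cross2 u (sg i *\<^sub>R q) \<le> ht (k' + 1)" "ht k' \<le> ht k" "ht k \<le> ht (k' + 1)"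
proof (cases "cross2 u (sg i *\<^sub>R q) \<ge> ht k")
  case True
  then show ?thesis using that[of k] k q(2) Hk_ge[OF k] by (simp add: Hk_def)
next
  case False
  have "cross2 u (sg i *\<^sub>R q) \<ge> 0" using hgt_Q_nonneg q(1) poly_S by blast
  then have "k \<noteq> \<iota>" using False ht_d0 by (auto simp: ht_def)
  then have k1: "k - 1 \<ge> \<iota>" using k by simp
  then show ?thesis using that[of "k - 1"] False q(2) Hk_ge[OF k1] by (simp add: Hk_def)
qed

lemma abs_cross2: "\<bar>cross2 u p\<bar> \<le> norm p"
proof -
  have "\<bar>snd (unframe u p)\<bar> \<le> norm (unframe u p)" using norm_snd_le[of "snd (unframe u p)" "fst (unframe u p)"] by simp
  also have "norm (unframe u p) = norm p" using norm_frame[OF norm_u, of "unframe u p"] by simp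
  finally show ?thesis by (simp add: unframe_def)
qed

text \<open>
A regular point on a chord is fixed, and on both sides of the chord the twist is affine with the
same linear part. So it is affine near the point, although two cylinders meet there.
\<close>

lemma twist_local_level:
  assumes x: "x \<in> X - V" and fixed: "twist n x = x" and lev: "\<And>i p. (i, p) \<in> x \<Longrightarrow> \<exists>k\<ge>\<iota>. cross2 u (sg i *\<^sub>R p) = ht k"
  shows "\<forall>\<^sub>F h in nhds 0. twist n (move x h) = move (twist n x) (twist_matrix n *v h)"
proof -
  have sgh: "filterlim (\<lambda>h::real^2. sg i *\<^sub>R h) (nhds 0) (nhds 0)" for i
    by (rule tendsto_eq_intros refl filterlim_ident | simp)+
  have rep: "\<forall>\<^sub>F h in nhds 0. p + h \<in> poly S i \<longrightarrow> twist n (move x h) = move x (twist_matrix n *v h)" if ip: "(i, p) \<in> x" for i p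
  proof -
    have p: "p \<in> poly S i" "x = point_of S i p" using mem_pointD[of x S i p] x ip by auto
    have pQ: "sg i *\<^sub>R p \<in> Q" "sg i *\<^sub>R p \<notin> range P" using p poly_S point_of_V_iff[OF p(1)] x by auto
    obtain k where k: "k \<ge> \<iota>" "cross2 u (sg i *\<^sub>R p) = ht k" using lev[OF ip] by blast
    have par: "cross2 (E j) u = 0" if "sg i *\<^sub>R p \<in> edge j" for j
      by (rule edge_level_parallel[OF pQ k(2) that])
    have loc: "\<forall>\<^sub>F h in nhds 0. p + h \<in> poly S i \<longleftrightarrow> (\<forall>j. sg i *\<^sub>R p \<in> edge j \<longrightarrow> cross2 (E j) (sg i *\<^sub>R h) \<ge> 0)"
      using eventually_compose_filterlim[OF local_Q[OF pQ] sgh[of i]]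
      by eventually_elim (simp add: poly_S scaleR_add_right del: Q_piece.simps)
    have loc': "\<forall>\<^sub>F h in nhds 0. p + twist_matrix n *v h \<in> poly S i \<longleftrightarrow> (\<forall>j. sg i *\<^sub>R p \<in> edge j \<longrightarrow> cross2 (E j) (sg i *\<^sub>R (twist_matrix n *v h)) \<ge> 0)"
      by (rule eventually_compose_filterlim[OF loc matrix_tendsto_0])
    have small: "\<forall>\<^sub>F h in nhds (0::real^2). norm h < 1" unfolding eventually_nhds_metric by (intro exI[of _ 1]) auto
    from loc loc' small show ?thesis
    proof (eventually_elim, intro impI)
      fix h assume L: "p + h \<in> poly S i \<longleftrightarrow> (\<forall>j. sg i *\<^sub>R p \<in> edge j \<longrightarrow> cross2 (E j) (sg i *\<^sub>R h) \<ge> 0)"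
        "p + twist_matrix n *v h \<in> poly S i \<longleftrightarrow> (\<forall>j. sg i *\<^sub>R p \<in> edge j \<longrightarrow> cross2 (E j) (sg i *\<^sub>R (twist_matrix n *v h)) \<ge> 0)"
        and h: "norm h < 1" "p + h \<in> poly S i"
      have "cross2 (E j) (sg i *\<^sub>R (twist_matrix n *v h)) = cross2 (E j) (sg i *\<^sub>R h)" if "sg i *\<^sub>R p \<in> edge j" for j
        using par[OF that] by (simp add: twist_matrix_mult)
      then have ph: "p + twist_matrix n *v h \<in> poly S i" using L h(2) by simp
      have "\<bar>cross2 u (sg i *\<^sub>R (p + h)) - ht k\<bar> = \<bar>cross2 u h\<bar>"
        unfolding k(2)[symmetric] by (simp add: scaleR_add_right abs_mult)
      then have "\<bar>cross2 u (sg i *\<^sub>R (p + h)) - ht k\<bar> < 1" using abs_cross2[of h] h(1) by simp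
      then obtain k' where k': "k' \<ge> \<iota>" "ht k' = ht k \<or> ht (k' + 1) = ht k"
        "ht k' \<le> cross2 u (sg i *\<^sub>R (p + h))" "cross2 u (sg i *\<^sub>R (p + h)) \<le> ht (k' + 1)" "ht k' \<le> ht k" "ht k \<le> ht (k' + 1)"
        by (rule zone_near[OF k(1) h(2)])
      obtain z where z: "z \<in> strip k'" "(i, p) \<in> Dev k' z" using Dev_of[OF p(1), of k'] k'(5,6) k(2) by metis
      have zb: "z \<in> strip k' - ostrip k'"
        using z(1) Dev_height[OF z(2)] k(2) k'(2)
        by (cases i) (auto simp: strip_def ostrip_def mem_Times_iff Hk_def)
      define w where "w = unframe u h"
      have fw: "frame u w = h" "frame u (shear n w) = twist_matrix n *v h" by (simp_all add: w_def frame_shear)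
      have D1: "(i, p + h) \<in> Dev k' (z + w)" using Dev_add[OF z(2), of w] h(2) fw by simp
      have D2: "(i, p + twist_matrix n *v h) \<in> Dev k' (z + shear n w)" using Dev_add[OF z(2), of "shear n w"] ph fw by simp
      have zw: "z + w \<in> strip k'"
        using Dev_height[OF D1] k'(3,4) by (cases i) (auto simp: strip_def mem_Times_iff Hk_def)
      then have zw': "z + shear n w \<in> strip k'" by (simp add: strip_def mem_Times_iff shear_def)
      have "move x h = \<psi> k' (z + w)" using move_eq[OF x ip h(2)] psi_eq[OF k'(1) zw D1] by simp
      then have "twist n (move x h) = \<psi> k' (shear n z + shear n w)" using twist_psi[OF k'(1) zw] by (simp add: shear_add)
      also obtain m :: int where "shear n z = z + (of_int m * Lk k', 0)" using shear_boundary[OF k'(1) zb] by blast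
      then have "shear n z + shear n w = (z + shear n w) + (of_int m * Lk k', 0)" by simp
      also have "\<psi> k' \<dots> = \<psi> k' (z + shear n w)" by (rule psi_period')
      also have "\<dots> = move x (twist_matrix n *v h)" using move_eq[OF x ip ph] psi_eq[OF k'(1) zw' D2] by simp
      finally show "twist n (move x h) = move x (twist_matrix n *v h)" .
    qed
  qed
  have "\<forall>\<^sub>F h in nhds 0. \<forall>ip\<in>x. snd ip + h \<in> poly S (fst ip) \<longrightarrow> twist n (move x h) = move x (twist_matrix n *v h)"
    by (intro eventually_ball_finite nonvertex_finite[OF x] ballI rep) simp
  with full_disc_covered[OF x] show ?thesis
    by eventually_elim (use fixed in fastforce)
qed

lemma twist_local: assumes x: "x \<in> X - V" shows "\<forall>\<^sub>F h in nhds 0. twist n (move x h) = move (twist n x) (twist_matrix n *v h)"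
proof -
  obtain k z where k: "k \<ge> \<iota>" "z \<in> strip k" "x = \<psi> k z" using psi_surj x by blast
  show ?thesis
  proof (cases "z \<in> ostrip k")
    case True
    then show ?thesis unfolding k(3) by (rule twist_local_open[OF k(1)])
  next
    case False
    have "twist n x = x" using boundary_fix[OF k(1), of z n] k False twist_psi[OF k(1,2)] by simp
    moreover have "\<exists>k\<ge>\<iota>. cross2 u (sg i *\<^sub>R p) = ht k" if ip: "(i, p) \<in> x" for i p
    proof (rule ccontr)
      assume no: "\<not> ?thesis"
      have p: "p \<in> poly S i" "x = point_of S i p" using mem_pointD[of x S i p] x ip by auto
      have "0 \<le> cross2 u (sg i *\<^sub>R p)" using hgt_Q_nonneg p(1) poly_S by blast
      then obtain k' where k': "k' \<ge> \<iota>" "ht k' \<le> cross2 u (sg i *\<^sub>R p)" "cross2 u (sg i *\<^sub>R p) < ht (k' + 1)" by (rule zone_exists)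
      obtain z' where z': "z' \<in> strip k'" "(i, p) \<in> Dev k' z'" using Dev_of[OF p(1) k'(2)] k'(3) by auto
      have ne: "ht k' \<noteq> cross2 u (sg i *\<^sub>R p)" using no k'(1) by metis
      have "z' \<in> ostrip k'"
        using z'(1) Dev_height[OF z'(2)] ne k'(3) by (cases i) (auto simp: strip_def ostrip_def mem_Times_iff Hk_def)
      from psi_meet[OF k'(1) this k(1,2)] psi_eq[OF k'(1) z'] p(2) k(3) have "z \<in> ostrip k"
        using \<open>z' \<in> ostrip k'\<close> by (auto simp: ostrip_def mem_Times_iff)
      then show False using False by simp
    qed
    ultimately show ?thesis using twist_local_level[OF x] by blast
  qed
qed

text \<open>
Near the boundary of a cylinder the twist moves points little: near the upper boundary one
compares with \<open>n\<close> full turns.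
\<close>

lemma twist_displacement:
  assumes k: "k \<ge> \<iota>" "z \<in> strip k"
  shows "d (\<psi> k z) (twist n (\<psi> k z)) \<le> \<bar>of_int n\<bar> * \<kappa> * snd z"
    "d (\<psi> k z) (twist n (\<psi> k z)) \<le> \<bar>of_int n\<bar> * \<kappa> * (Hk k - snd z)"
proof -
  have s: "0 \<le> snd z" "snd z \<le> Hk k" using k by (auto simp: strip_def)
  have "d (\<psi> k z) (\<psi> k (shear n z)) \<le> norm (shear n z - z)" by (rule psi_lipschitz[OF k(1)]) (use k in auto)
  also have "shear n z - z = (of_int n * \<kappa> * snd z, 0)" by (simp add: shear_def prod_eq_iff)
  finally show "d (\<psi> k z) (twist n (\<psi> k z)) \<le> \<bar>of_int n\<bar> * \<kappa> * snd z"
    using s kappa_pos by (simp add: twist_psi[OF k] norm_Pair abs_mult)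
  let ?w = "shear n z + (of_int (- n) * Lk k, 0)"
  have "d (\<psi> k z) (\<psi> k ?w) \<le> norm (?w - z)"
    by (rule psi_lipschitz[OF k(1)]) (use k in \<open>auto simp: strip_def shear_def\<close>)
  also have "?w - z = (- (of_int n * \<kappa> * (Hk k - snd z)), 0)" by (simp add: shear_def prod_eq_iff Lk_eq[OF k(1)] algebra_simps)
  finally show "d (\<psi> k z) (twist n (\<psi> k z)) \<le> \<bar>of_int n\<bar> * \<kappa> * (Hk k - snd z)"
    using s kappa_pos by (simp add: twist_psi[OF k] norm_Pair abs_mult psi_period' del: of_int_minus)
qed

text \<open>
At regular points this is local affinity. Infinitely many cylinders meet at a vertex, so the bound
has to be uniform in \<open>k\<close>. It comes from \<open>twist_displacement\<close>, since a point near the vertex is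
near the boundary of its cylinder and \<open>\<kappa>\<close> is common to all cylinders.
\<close>

lemma twist_cont: "cont (twist n)"
  unfolding cont_def
proof (intro ballI allI impI)
  fix x and e :: real assume x: "x \<in> X" and e: "0 < e"
  show "\<exists>\<delta>>0. \<forall>y\<in>X. d x y < \<delta> \<longrightarrow> d (twist n x) (twist n y) < e"
  proof (cases "x \<in> V")
    case False
    then have xn: "x \<in> X - V" using x by simp
    have txn: "twist n x \<in> X - V" using twist_in[OF x] twist_V[OF x] False by simp
    obtain r where r: "r > 0" "disc x r" using disc_exists[OF xn] by blast
    obtain s where s: "s > 0" "disc (twist n x) s" using disc_exists[OF txn] by blast
    have "\<forall>\<^sub>F k in nhds (0::real^2). norm k < min s e" unfolding eventually_nhds_metric using s e by (intro exI[of _ "min s e"]) auto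
    then have "\<forall>\<^sub>F h in nhds 0. norm (twist_matrix n *v h) < min s e" by (rule eventually_compose_filterlim[OF _ matrix_tendsto_0])
    with twist_local[OF xn, of n] have "\<forall>\<^sub>F h in nhds 0. twist n (move x h) = move (twist n x) (twist_matrix n *v h) \<and> norm (twist_matrix n *v h) < min s e"
      by eventually_elim simp
    then obtain \<rho> where \<rho>: "\<rho> > 0" "\<And>h. norm h < \<rho> \<Longrightarrow> twist n (move x h) = move (twist n x) (twist_matrix n *v h) \<and> norm (twist_matrix n *v h) < min s e"
      unfolding eventually_nhds_metric by auto
    have "d (twist n x) (twist n y) < e" if y: "y \<in> X" "d x y < min r \<rho>" for y
    proof -
      obtain h where h: "norm h < min r \<rho>" "y = move x h" using near_move[OF xn r(2) y] by auto
      then have "d (twist n x) (twist n y) \<le> norm (twist_matrix n *v h)" using \<rho>(2)[of h] d_move[OF txn s(2), of "twist_matrix n *v h"] by auto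
      then show ?thesis using \<rho>(2)[of h] h by auto
    qed
    then show ?thesis using r(1) \<rho>(1) by (intro exI[of _ "min r \<rho>"]) auto
  next
    case True
    define K where "K = \<bar>of_int n\<bar> * \<kappa> + 1"
    have K: "K > 0" using kappa_pos by (simp add: K_def add_nonneg_pos)
    \<comment> \<open>1 is an edge radius at every vertex, and 1 is less than or equal to every cylinder height\<close>
    define \<delta> where "\<delta> = min 1 (e / K)"
    have \<delta>: "\<delta> > 0" "\<delta> \<le> 1" "K * \<delta> \<le> e" using e K by (auto simp: \<delta>_def min_def field_simps)
    have "d (twist n x) (twist n y) < e" if y: "y \<in> X" "d x y < \<delta>" for y
    proof -
      obtain i p q where q: "(i, p) \<in> x" "q \<in> poly S i" "y = point_of S i q" "dist q p < \<delta>"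
        using near[OF x y(1) edge_radius_vertex[OF True] y(2) \<delta>(2)] by blast
      obtain j where j: "sg i *\<^sub>R p = P j" using V_rep[OF True q(1)] by blast
      obtain k where k: "k \<ge> \<iota>" "ht k = ht j" by (rule ht_index)
      have hk: "ht k = cross2 u (sg i *\<^sub>R p)" using k(2) j by (simp add: ht_def)
      have "cross2 u (sg i *\<^sub>R q) - ht k = cross2 u (sg i *\<^sub>R (q - p))"
        unfolding hk by (simp only: scaleR_diff_right cross2_simps)
      also have "\<bar>\<dots>\<bar> \<le> norm (sg i *\<^sub>R (q - p))" by (rule abs_cross2)
      also have "\<dots> < \<delta>" using q(4) by (simp add: dist_norm)
      finally have dh: "\<bar>cross2 u (sg i *\<^sub>R q) - ht k\<bar> < \<delta>" .
      then have "\<bar>cross2 u (sg i *\<^sub>R q) - ht k\<bar> < 1" using \<delta>(2) by simp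
      then obtain k' where k': "k' \<ge> \<iota>" "ht k' = ht k \<or> ht (k' + 1) = ht k"
        "ht k' \<le> cross2 u (sg i *\<^sub>R q)" "cross2 u (sg i *\<^sub>R q) \<le> ht (k' + 1)" "ht k' \<le> ht k" "ht k \<le> ht (k' + 1)"
        by (rule zone_near[OF k(1) q(2)])
      obtain z where z: "z \<in> strip k'" "(i, q) \<in> Dev k' z" using Dev_of[OF q(2) k'(3,4)] by blast
      have yz: "y = \<psi> k' z" using psi_eq[OF k'(1) z] q(3) by simp
      have "snd z = \<bar>cross2 u (sg i *\<^sub>R q) - ht k\<bar> \<or> Hk k' - snd z = \<bar>cross2 u (sg i *\<^sub>R q) - ht k\<bar>"
        using Dev_height[OF z(2)] k'(2,3,4) by (cases i) (auto simp: Hk_def)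
      then have "d y (twist n y) \<le> \<bar>of_int n\<bar> * \<kappa> * \<bar>cross2 u (sg i *\<^sub>R q) - ht k\<bar>"
        using twist_displacement[OF k'(1) z(1), of n] unfolding yz by metis
      also have "\<dots> \<le> \<bar>of_int n\<bar> * \<kappa> * \<delta>" using dh kappa_pos by (intro mult_left_mono) auto
      finally have "d y (twist n y) \<le> \<bar>of_int n\<bar> * \<kappa> * \<delta>" .
      moreover have "d x (twist n y) \<le> d x y + d y (twist n y)" using d_triangle[OF x y(1) twist_in[OF y(1)]] .
      ultimately have "d x (twist n y) < K * \<delta>" using y(2) by (simp add: K_def algebra_simps)
      then show ?thesis using twist_vertex_fix[OF True] \<delta>(3) by simp
    qed
    then show ?thesis using \<delta>(1) by blast
  qed
qed

lemma twist_affine_map: "affine_map (twist_matrix n) (twist n)"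
  unfolding affine_map_def using twist_in twist_V twist_local twist_cont by blast

theorem twist_affine_aut: "affine_aut (twist_matrix n) (twist n)"
proof (rule affine_autI[of _ "twist_matrix (- n)" _ "twist (- n)"])
  have "twist_matrix m ** twist_matrix (- m) = mat 1" for m
    unfolding matrix_eq by (simp add: mult_matrix_vector twist_matrix_mult algebra_simps)
  from this[of n] this[of "- n"] show "twist_matrix n ** twist_matrix (- n) = mat 1" "twist_matrix (- n) ** twist_matrix n = mat 1" by simp_all
  show "twist n \<in> extensional X" by (simp add: twist_def)
qed (use twist_affine_map twist_twist twist_0 in auto)

theorem twist_right_twist: "right_twist_in_each_cylinder S u (twist 1)"
  unfolding right_twist_in_each_cylinder_def
proof (intro conjI allI impI ballI decomposition)
  have im: "twist 1 ` (\<psi> k ` strip k) = \<psi> k ` strip k" if k: "k \<ge> \<iota>" for k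
  proof
    show "twist 1 ` (\<psi> k ` strip k) \<subseteq> \<psi> k ` strip k" using twist_psi[OF k] by auto
    show "\<psi> k ` strip k \<subseteq> twist 1 ` (\<psi> k ` strip k)"
    proof
      fix x assume "x \<in> \<psi> k ` strip k"
      then obtain z where z: "z \<in> strip k" "x = \<psi> k z" by blast
      then have "x = twist 1 (\<psi> k (shear (- 1) z))" using twist_psi[OF k, of "shear (- 1) z" 1] by (simp add: shear_shear)
      then show "x \<in> twist 1 ` (\<psi> k ` strip k)" using z by auto
    qed
  qed
  show "(`) (twist 1) ` closed_maximal_cylinders S u = closed_maximal_cylinders S u"
  proof -
    have "twist 1 ` A = A" if "A \<in> closed_maximal_cylinders S u" for A
      using that im unfolding closed_maximal by blast
    then have "(`) (twist 1) ` closed_maximal_cylinders S u = (\<lambda>A. A) ` closed_maximal_cylinders S u"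
      by (intro image_cong) auto
    then show ?thesis by simp
  qed
  fix C H \<phi> x y assume m: "maximal_cylinder S u C H \<phi>" and y: "y \<in> {0..H}"
  obtain k a where k: "k \<ge> \<iota>" "H = Hk k" "C = Lk k" "\<And>z. z \<in> strip k \<Longrightarrow> \<phi> z = \<psi> k (z + (a, 0))"
    using maximal_cylinder_shape[OF m] by blast
  have z: "(x, y) \<in> strip k" "(x, y) + (a, 0) \<in> strip k" "(x + C / H * y, y) \<in> strip k" using y k(2) by (auto simp: strip_def)
  have "C / H = \<kappa>" using k(2,3) Lk_eq[OF k(1)] Hk_ge[OF k(1)] by simp
  then have e: "shear 1 ((x, y) + (a, 0)) = (x + C / H * y, y) + (a, 0)" by (simp add: shear_def)
  have "twist 1 (\<phi> (x, y)) = \<psi> k (shear 1 ((x, y) + (a, 0)))" unfolding k(4)[OF z(1)] by (rule twist_psi[OF k(1) z(2)])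
  also have "\<dots> = \<phi> (x + C / H * y, y)" unfolding e k(4)[OF z(3)] ..
  finally show "twist 1 (\<phi> (x, y)) = \<phi> (x + C / H * y, y)" .
qed

end

context surf begin

section \<open>Saddle connections\<close>

text \<open>
A saddle connection with holonomy \<open>w\<close>, parametrized by the unit interval. The limits say that the
path runs into the vertices \<open>\<gamma> 0\<close> and \<open>\<gamma> 1\<close>.
\<close>

definition saddle :: "real^2 \<Rightarrow> (real \<Rightarrow> piece surface_point) \<Rightarrow> bool" where
  "saddle w \<gamma> \<longleftrightarrow> w \<noteq> 0 \<and> loctrans {0<..<1} (\<lambda>t. t *\<^sub>R w) \<gamma> \<and> \<gamma> 0 \<in> V \<and> \<gamma> 1 \<in> V \<and>
     ((\<lambda>t. d (\<gamma> 0) (\<gamma> t)) \<longlongrightarrow> 0) (at_right 0) \<and> ((\<lambda>t. d (\<gamma> 1) (\<gamma> t)) \<longlongrightarrow> 0) (at_left 1)"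

lemma cont_limit:
  assumes f: "cont f" and x: "x \<in> X" and lim: "((\<lambda>t. d x (\<gamma> t)) \<longlongrightarrow> 0) F" and ev: "\<forall>\<^sub>F t in F. \<gamma> t \<in> X"
    and fX: "\<And>x. x \<in> X \<Longrightarrow> f x \<in> X"
  shows "((\<lambda>t. d (f x) (f (\<gamma> t))) \<longlongrightarrow> 0) F"
proof (rule tendstoI)
  fix e :: real assume "0 < e"
  then obtain \<delta> where \<delta>: "\<delta> > 0" "\<forall>y\<in>X. d x y < \<delta> \<longrightarrow> d (f x) (f y) < e" using f x unfolding cont_def by meson
  have "\<forall>\<^sub>F t in F. d x (\<gamma> t) < \<delta>" by (rule order_tendstoD(2)[OF lim \<delta>(1)])
  with ev show "\<forall>\<^sub>F t in F. dist (d (f x) (f (\<gamma> t))) 0 < e"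
    by eventually_elim (use \<delta>(2) d_nonneg fX x in auto)
qed

lemma saddle_map:
  assumes f: "affine_map M f" and M: "invertible M" and s: "saddle w \<gamma>"
  shows "saddle (M *v w) (\<lambda>t. f (\<gamma> t))"
proof -
  have l: "loctrans {0<..<1} (\<lambda>t. t *\<^sub>R w) \<gamma>" and w: "w \<noteq> 0" and V01: "\<gamma> 0 \<in> V" "\<gamma> 1 \<in> V"
    and lim: "((\<lambda>t. d (\<gamma> 0) (\<gamma> t)) \<longlongrightarrow> 0) (at_right 0)" "((\<lambda>t. d (\<gamma> 1) (\<gamma> t)) \<longlongrightarrow> 0) (at_left 1)"
    using s unfolding saddle_def by auto
  have fX: "f x \<in> X" if "x \<in> X" for x using f that unfolding affine_map_def by auto
  have X01: "\<gamma> 0 \<in> X" "\<gamma> 1 \<in> X" using V01 V_subset by auto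
  have c: "cont f" using f unfolding affine_map_def by blast
  have inX: "\<gamma> t \<in> X" if "0 < t" "t < 1" for t using l that unfolding loctrans_def by auto
  have ev0: "\<forall>\<^sub>F t in at_right 0. \<gamma> t \<in> X"
    by (rule eventually_mono[OF eventually_at_right_real[OF zero_less_one]]) (use inX in auto)
  have ev1: "\<forall>\<^sub>F t in at_left 1. \<gamma> t \<in> X"
    by (rule eventually_mono[OF eventually_at_left_real[OF zero_less_one]]) (use inX in auto)
  have "M *v w \<noteq> 0" using w matrix_inv_cancel(3)[OF M, of w] by force
  moreover have "loctrans {0<..<1} (\<lambda>t. t *\<^sub>R (M *v w)) (\<lambda>t. f (\<gamma> t))"
    using affine_map_loctrans[OF f l] by (simp add: matrix_vector_mult_scaleR continuous_intros)
  moreover have "f (\<gamma> 0) \<in> V" "f (\<gamma> 1) \<in> V" using f V01 X01 unfolding affine_map_def by auto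
  ultimately show ?thesis unfolding saddle_def
    using cont_limit[OF c X01(1) lim(1) ev0 fX] cont_limit[OF c X01(2) lim(2) ev1 fX] by simp
qed

text \<open>
The segment between two vertices of the polygon contains no further vertex, by strict convexity.
\<close>

lemma saddle_diagonal:
  assumes "m \<noteq> n" shows "saddle (P n - P m) (\<lambda>t. point_of S QPlus (P m + t *\<^sub>R (P n - P m)))"
proof -
  have P: "P m \<in> poly S QPlus" "P n \<in> poly S QPlus" using vertex_poly[of QPlus m] vertex_poly[of QPlus n] by simp_all
  have ne: "P m \<noteq> P n" using assms by simp
  note seg = not_vertex_on_segment[OF P ne]
  have in_seg: "P m + t *\<^sub>R (P n - P m) \<in> poly S QPlus" if "0 \<le> t" "t \<le> 1" for t
    using seg(1)[of t] that P by (cases "t = 0 \<or> t = 1") auto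
  have "loctrans {0<..<1} (\<lambda>t. t *\<^sub>R (P n - P m)) (\<lambda>t. point_of S QPlus (P m + t *\<^sub>R (P n - P m)))"
    by (rule loctrans_ray) (use seg in auto)
  moreover have "point_of S QPlus (P m) \<in> V" "point_of S QPlus (P n) \<in> V" using point_of_V_iff P by auto
  moreover have "((\<lambda>t. d (point_of S QPlus (P m)) (point_of S QPlus (P m + t *\<^sub>R (P n - P m)))) \<longlongrightarrow> 0) (at_right 0)"
  proof (rule tendsto_sandwich[OF _ _ tendsto_const])
    have "((\<lambda>t. norm (t *\<^sub>R (P n - P m))) \<longlongrightarrow> norm (0 *\<^sub>R (P n - P m))) (at_right 0)" by (intro tendsto_intros)
    then show "((\<lambda>t. norm (t *\<^sub>R (P n - P m))) \<longlongrightarrow> 0) (at_right 0)" by simp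
    have b: "0 \<le> d (point_of S QPlus (P m)) (point_of S QPlus (P m + t *\<^sub>R (P n - P m))) \<and>
      d (point_of S QPlus (P m)) (point_of S QPlus (P m + t *\<^sub>R (P n - P m))) \<le> norm (t *\<^sub>R (P n - P m))" if "0 < t" "t < 1" for t
      using d_nonneg[OF point_of_in_points[OF P(1)] point_of_in_points[OF in_seg[of t]]] d_segment[OF P(1) in_seg[of t]] that by simp
    show "\<forall>\<^sub>F t in at_right 0. 0 \<le> d (point_of S QPlus (P m)) (point_of S QPlus (P m + t *\<^sub>R (P n - P m)))"
      "\<forall>\<^sub>F t in at_right 0. d (point_of S QPlus (P m)) (point_of S QPlus (P m + t *\<^sub>R (P n - P m))) \<le> norm (t *\<^sub>R (P n - P m))"
      using eventually_at_right_real[of 0 1] by (auto elim!: eventually_mono dest: b)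
  qed
  moreover have "((\<lambda>t. d (point_of S QPlus (P n)) (point_of S QPlus (P m + t *\<^sub>R (P n - P m)))) \<longlongrightarrow> 0) (at_left 1)"
  proof (rule tendsto_sandwich[OF _ _ tendsto_const])
    have "((\<lambda>t. norm ((t - 1) *\<^sub>R (P n - P m))) \<longlongrightarrow> norm ((1 - 1) *\<^sub>R (P n - P m))) (at_left 1)" by (intro tendsto_intros)
    then show "((\<lambda>t. norm ((t - 1) *\<^sub>R (P n - P m))) \<longlongrightarrow> 0) (at_left 1)" by simp
    have e: "P m + t *\<^sub>R (P n - P m) - P n = (t - 1) *\<^sub>R (P n - P m)" for t by (simp add: algebra_simps)
    have b: "0 \<le> d (point_of S QPlus (P n)) (point_of S QPlus (P m + t *\<^sub>R (P n - P m))) \<and>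
      d (point_of S QPlus (P n)) (point_of S QPlus (P m + t *\<^sub>R (P n - P m))) \<le> norm ((t - 1) *\<^sub>R (P n - P m))" if "0 < t" "t < 1" for t
      using d_nonneg[OF point_of_in_points[OF P(2)] point_of_in_points[OF in_seg[of t]]] d_segment[OF P(2) in_seg[of t]] that e[of t] by simp
    show "\<forall>\<^sub>F t in at_left 1. 0 \<le> d (point_of S QPlus (P n)) (point_of S QPlus (P m + t *\<^sub>R (P n - P m)))"
      "\<forall>\<^sub>F t in at_left 1. d (point_of S QPlus (P n)) (point_of S QPlus (P m + t *\<^sub>R (P n - P m))) \<le> norm ((t - 1) *\<^sub>R (P n - P m))"
      using eventually_at_left_real[of 0 1] by (auto elim!: eventually_mono dest: b)
  qed
  ultimately show ?thesis unfolding saddle_def using ne by simp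
qed

lemma saddle_start:
  assumes s: "saddle w \<gamma>"
  obtains i p j \<delta> where "(i, p) \<in> \<gamma> 0" "\<gamma> 0 = point_of S i p" "p = sg i *\<^sub>R P j" "0 < \<delta>" "\<delta> \<le> 1"
    "\<And>t. 0 < t \<Longrightarrow> t < \<delta> \<Longrightarrow> p + t *\<^sub>R w \<in> poly S i \<and> \<gamma> t = point_of S i (p + t *\<^sub>R w)"
proof -
  have g0: "\<gamma> 0 \<in> V" "\<gamma> 0 \<in> X" using s V_subset unfolding saddle_def by auto
  have l: "loctrans {0<..<1} (\<lambda>t. t *\<^sub>R w) \<gamma>" "((\<lambda>t. d (\<gamma> 0) (\<gamma> t)) \<longlongrightarrow> 0) (at_right 0)" using s unfolding saddle_def by auto
  obtain i p \<delta> where g: "(i, p) \<in> \<gamma> 0" "0 < \<delta>" "\<delta> \<le> 1"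
    "\<And>t. 0 < t \<Longrightarrow> t < \<delta> \<Longrightarrow> p + t *\<^sub>R w \<in> poly S i \<and> \<gamma> t = point_of S i (p + t *\<^sub>R w)"
    by (rule germ[OF g0(2) zero_less_one l], rule that)
  obtain j where "sg i *\<^sub>R p = P j" using V_rep[OF g0(1) g(1)] by blast
  then have j: "p = sg i *\<^sub>R P j" by (simp add: sg_eq_iff)
  show ?thesis by (rule that[OF g(1) mem_pointD(2)[OF g0(2) g(1)] j g(2,3,4)])
qed

lemma saddle_continue:
  assumes s: "saddle w \<gamma>" and \<beta>: "loctrans {0<..<T} (\<lambda>t. t *\<^sub>R w) \<beta>" and \<delta>: "0 < \<delta>"
    and eq: "\<And>t. 0 < t \<Longrightarrow> t < \<delta> \<Longrightarrow> t < T \<Longrightarrow> \<gamma> t = \<beta> t" and t: "0 < t" "t < 1" "t < T"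
  shows "\<gamma> t = \<beta> t"
proof -
  have l: "loctrans {0<..<1} (\<lambda>t. t *\<^sub>R w) \<gamma>" using s unfolding saddle_def by auto
  define r where "r = min t (\<delta> / 2)"
  have r: "0 < r" "r \<le> t" "r < \<delta>" using t \<delta> by (auto simp: r_def)
  have l1: "loctrans {r..t} (\<lambda>t. t *\<^sub>R w) \<gamma>" by (rule loctrans_subset[OF l]) (use r t in auto)
  have l2: "loctrans {r..t} (\<lambda>t. t *\<^sub>R w) \<beta>" by (rule loctrans_subset[OF \<beta>]) (use r t in auto)
  show ?thesis
    by (rule loctrans_agree[OF _ _ l1 l2, of r]) (use r t eq in \<open>auto intro!: continuous_intros\<close>)
qed

lemma saddle_limit:
  assumes s: "saddle w \<gamma>" and T: "0 < T" "T \<le> 1" and y: "y \<in> X"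
    and b: "\<And>t. 0 < t \<Longrightarrow> t < T \<Longrightarrow> d (\<gamma> t) y \<le> K * (T - t)"
  shows "\<gamma> T = y"
proof -
  have l: "loctrans {0<..<1} (\<lambda>t. t *\<^sub>R w) \<gamma>" and V1: "\<gamma> 1 \<in> V" and lim1: "((\<lambda>t. d (\<gamma> 1) (\<gamma> t)) \<longlongrightarrow> 0) (at_left 1)"
    using s unfolding saddle_def by auto
  have gT: "\<gamma> T \<in> X" using l V1 V_subset T unfolding loctrans_def by (cases "T = 1") auto
  have inX: "\<gamma> t \<in> X" if "0 < t" "t < T" for t using l that T unfolding loctrans_def by auto
  have lim: "((\<lambda>t. d (\<gamma> T) (\<gamma> t)) \<longlongrightarrow> 0) (at_left T)"
  proof (cases "T = 1")
    case True then show ?thesis using lim1 by simp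
  next
    case False
    then have T1: "T < 1" using T by simp
    show ?thesis
    proof (rule tendsto_sandwich[OF _ _ tendsto_const])
      have "((\<lambda>t. norm w * (T - t)) \<longlongrightarrow> norm w * (T - T)) (at_left T)" by (intro tendsto_intros)
      then show "((\<lambda>t. norm w * (T - t)) \<longlongrightarrow> 0) (at_left T)" by simp
      have bb: "0 \<le> d (\<gamma> T) (\<gamma> t) \<and> d (\<gamma> T) (\<gamma> t) \<le> norm w * (T - t)" if t: "0 < t" "t < T" for t
      proof -
        have "loctrans {t..T} (\<lambda>t. t *\<^sub>R w) \<gamma>" by (rule loctrans_subset[OF l]) (use t T1 in auto)
        from loctrans_lipschitz[OF this invertible_mat_1] t
        show ?thesis using d_nonneg[OF gT inX[OF t]] d_sym[of "\<gamma> t" "\<gamma> T"] by (simp add: dA_1)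
      qed
      show "\<forall>\<^sub>F t in at_left T. 0 \<le> d (\<gamma> T) (\<gamma> t)" "\<forall>\<^sub>F t in at_left T. d (\<gamma> T) (\<gamma> t) \<le> norm w * (T - t)"
        using eventually_at_left_real[OF T(1)] by (auto elim!: eventually_mono dest: bb)
    qed
  qed
  have "((\<lambda>t. d (\<gamma> T) (\<gamma> t) + K * (T - t)) \<longlongrightarrow> 0 + K * (T - T)) (at_left T)" by (intro tendsto_intros lim)
  moreover have "\<forall>\<^sub>F t in at_left T. d (\<gamma> T) y \<le> d (\<gamma> T) (\<gamma> t) + K * (T - t)"
    using eventually_at_left_real[OF T(1)]
  proof eventually_elim
    case (elim t)
    then have t: "0 < t" "t < T" by auto
    show ?case using d_triangle[OF gT inX[OF t] y] b[OF t] by linarith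
  qed
  ultimately have "d (\<gamma> T) y \<le> 0 + K * (T - T)"
    by (intro tendsto_lowerbound[of _ _ "at_left T"]) (auto simp: trivial_limit_at_left_real)
  then have "d (\<gamma> T) y = 0" using d_nonneg[OF gT y] by simp
  then show ?thesis using d_eq_0[OF gT y] by simp
qed

text \<open>
A saddle connection follows the ray on which it starts for as long as the ray stays in the
polygon, and it cannot end while this ray runs through regular points.
\<close>

lemma saddle_straight:
  assumes s: "saddle w \<gamma>" and T: "0 < T" and \<delta>: "0 < \<delta>"
    and start: "\<And>t. 0 < t \<Longrightarrow> t < \<delta> \<Longrightarrow> \<gamma> t = point_of S i (p + t *\<^sub>R w)"
    and ray: "\<And>t. 0 < t \<Longrightarrow> t < T \<Longrightarrow> p + t *\<^sub>R w \<in> poly S i \<and> sg i *\<^sub>R (p + t *\<^sub>R w) \<notin> range P"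
    and endp: "p + T *\<^sub>R w \<in> poly S i"
  shows "\<And>t. 0 < t \<Longrightarrow> t < 1 \<Longrightarrow> t < T \<Longrightarrow> \<gamma> t = point_of S i (p + t *\<^sub>R w)"
    "T \<le> 1 \<Longrightarrow> \<gamma> T = point_of S i (p + T *\<^sub>R w)" "T \<le> 1"
proof -
  have lr: "loctrans {0<..<T} (\<lambda>t. t *\<^sub>R w) (\<lambda>t. point_of S i (p + t *\<^sub>R w))" by (rule loctrans_ray) (use ray in auto)
  show eq: "\<gamma> t = point_of S i (p + t *\<^sub>R w)" if "0 < t" "t < 1" "t < T" for t
    by (rule saddle_continue[OF s lr \<delta> _ that]) (use start in auto)
  have lim: "\<gamma> T' = point_of S i (p + T' *\<^sub>R w)" if T': "0 < T'" "T' \<le> 1" "T' \<le> T" for T'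
  proof (rule saddle_limit[OF s T'(1,2)])
    have e: "p + T' *\<^sub>R w \<in> poly S i" using endp ray[of T'] T' by (cases "T' = T") auto
    then show "point_of S i (p + T' *\<^sub>R w) \<in> X" by (rule point_of_in_points)
    fix t assume t: "0 < t" "t < T'"
    have "d (\<gamma> t) (point_of S i (p + T' *\<^sub>R w)) \<le> norm ((p + T' *\<^sub>R w) - (p + t *\<^sub>R w))"
      using eq[of t] t T' d_segment[OF _ e, of "p + t *\<^sub>R w"] ray[of t] by auto
    also have "(p + T' *\<^sub>R w) - (p + t *\<^sub>R w) = (T' - t) *\<^sub>R w" by (simp add: algebra_simps)
    finally show "d (\<gamma> t) (point_of S i (p + T' *\<^sub>R w)) \<le> norm w * (T' - t)" using t by (simp add: mult.commute)
  qed
  show "\<gamma> T = point_of S i (p + T *\<^sub>R w)" if "T \<le> 1" using lim[of T] T that by simp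
  show "T \<le> 1"
  proof (rule ccontr)
    assume "\<not> T \<le> 1"
    then have "\<gamma> 1 = point_of S i (p + 1 *\<^sub>R w)" using lim[of 1] by simp
    moreover have "p + 1 *\<^sub>R w \<in> poly S i" "sg i *\<^sub>R (p + 1 *\<^sub>R w) \<notin> range P" using ray[of 1] \<open>\<not> T \<le> 1\<close> by auto
    ultimately show False using point_of_V_iff s unfolding saddle_def by metis
  qed
qed

lemma saddle_minus: "saddle w \<gamma> \<Longrightarrow> saddle (- w) (\<lambda>t. minusI (\<gamma> t))"
proof -
  assume s: "saddle w \<gamma>"
  have "(- mat 1 :: real^2^2) *v w = - w"
    by (simp add: vec2_eq_iff matrix_vector_mult_def sum_2 mat_def)
  then show ?thesis using saddle_map[OF affine_autD(3)[OF affine_aut_minusI] affine_autD(1)[OF affine_aut_minusI] s] by simp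
qed

text \<open>
The directions \<open>k\<close> with \<open>qform k \<le> 0\<close> lie between the asymptotes of the vertex sequence, steeper
than all edges.
\<close>

lemma recession: assumes p: "p \<in> Q" and k: "qform k \<le> 0" "k $ 2 \<ge> 0" shows "p + k \<in> Q"
  unfolding Q_halfplanes
proof
  fix j
  have a: "E j $ 1 \<ge> 1" by (rule E1_ge)
  have "(c - 1) * (E j $ 2)\<^sup>2 \<le> (c + 1) * (E j $ 1)\<^sup>2" using qform_E[of j] by (simp add: qform_def)
  then have "((c - 1) * (E j $ 2)\<^sup>2) * (k $ 2)\<^sup>2 \<le> ((c + 1) * (E j $ 1)\<^sup>2) * (k $ 2)\<^sup>2" by (intro mult_right_mono) auto
  moreover have "((c + 1) * (k $ 1)\<^sup>2) * (E j $ 2)\<^sup>2 \<le> ((c - 1) * (k $ 2)\<^sup>2) * (E j $ 2)\<^sup>2"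
    using k(1) by (intro mult_right_mono) (auto simp: qform_def)
  ultimately have "(c + 1) * (E j $ 2 * k $ 1)\<^sup>2 \<le> (c + 1) * (E j $ 1 * k $ 2)\<^sup>2"
    by (simp add: power_mult_distrib algebra_simps)
  then have "(E j $ 2 * k $ 1)\<^sup>2 \<le> (E j $ 1 * k $ 2)\<^sup>2" using c1 by simp
  moreover have "0 \<le> E j $ 1 * k $ 2" using a k(2) by simp
  ultimately have "E j $ 2 * k $ 1 \<le> E j $ 1 * k $ 2" by (rule power2_le_imp_le)
  then have "cross2 (E j) k \<ge> 0" by (simp add: cross2_def)
  then show "0 \<le> edge_side j (p + k)" using edge_side_nonneg[OF p, of j] by (simp add: edge_side_add)
qed

lemma qform_scale: "qform (t *\<^sub>R w) = t\<^sup>2 * qform w" by (simp add: qform_def power_mult_distrib algebra_simps)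

text \<open>
If \<open>qform w \<le> 0\<close>, the ray from a vertex in direction \<open>w\<close> or its opposite lies in the polygon. In
the first case the path never meets a second vertex. In the other case the starting vertex would
be an inner point of a segment in the polygon.
\<close>

theorem saddle_qform: assumes s: "saddle w \<gamma>" shows "qform w > 0"
proof (rule ccontr)
  assume "\<not> qform w > 0"
  then have q: "qform w \<le> 0" by simp
  have w: "w \<noteq> 0" using s unfolding saddle_def by simp
  obtain i p j \<delta> where st: "(i, p) \<in> \<gamma> 0" "\<gamma> 0 = point_of S i p" "p = sg i *\<^sub>R P j" "0 < \<delta>" "\<delta> \<le> 1"
    "\<And>t. 0 < t \<Longrightarrow> t < \<delta> \<Longrightarrow> p + t *\<^sub>R w \<in> poly S i \<and> \<gamma> t = point_of S i (p + t *\<^sub>R w)"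
    by (rule saddle_start[OF s], rule that)
  define v where "v = sg i *\<^sub>R w"
  have v: "qform v \<le> 0" "v \<noteq> 0" using q w by (auto simp: v_def qform_scale power2_eq_square)
  have hat: "sg i *\<^sub>R (p + t *\<^sub>R w) = P j + t *\<^sub>R v" for t by (simp add: st(3) v_def scaleR_add_right mult.commute)
  show False
  proof (cases "v $ 2 \<ge> 0")
    case True
    have inQ: "P j + t *\<^sub>R v \<in> Q" if "t \<ge> 0" for t
      by (rule recession[OF hor.P_in_Q]) (use that v True in \<open>auto simp: qform_scale mult_nonneg_nonpos\<close>)
    have ray: "p + t *\<^sub>R w \<in> poly S i \<and> sg i *\<^sub>R (p + t *\<^sub>R w) \<notin> range P" if t: "0 < t" for t
    proof -
      have e: "P j \<in> poly S QPlus" "P j + (2 * t) *\<^sub>R v \<in> poly S QPlus"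
        using hor.P_in_Q[of j] inQ[of "2 * t"] t by (simp_all add: poly_S del: Q_piece.simps)
      have "P j \<noteq> P j + (2 * t) *\<^sub>R v" using t v(2) by simp
      from not_vertex_on_segment(2)[OF e this, of "1/2"] have "P j + t *\<^sub>R v \<notin> range P" by simp
      then show ?thesis using inQ[of t] t hat[of t] poly_S by simp
    qed
    \<comment> \<open>the path would still be on the ray at time 2\<close>
    have "(2::real) \<le> 1"
      by (rule saddle_straight(3)[OF s _ st(4), of 2 i p]) (use st(6) ray[of 2] ray in auto)
    then show False by simp
  next
    case False
    define t where "t = \<delta> / 2"
    have t: "0 < t" "t < \<delta>" using st(4) by (auto simp: t_def)
    let ?z = "P j + t *\<^sub>R v"
    have z: "?z \<in> Q" using st(6)[OF t] hat[of t] poly_S by metis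
    have "qform ((- (2 * t)) *\<^sub>R v) \<le> 0" unfolding qform_scale by (intro mult_nonneg_nonpos v(1)) simp
    moreover have "((- (2 * t)) *\<^sub>R v) $ 2 \<ge> 0" using t False by (simp add: mult_nonneg_nonpos)
    ultimately have y: "?z + (- (2 * t)) *\<^sub>R v \<in> Q" by (rule recession[OF z])
    have e: "?z \<in> poly S QPlus" "?z + (- (2 * t)) *\<^sub>R v \<in> poly S QPlus" using z y by (simp_all add: poly_S del: Q_piece.simps)
    have "?z \<noteq> ?z + (- (2 * t)) *\<^sub>R v" using t v(2) by simp
    from not_vertex_on_segment(2)[OF e this, of "1/2"] have "P j \<notin> range P" by (simp add: algebra_simps)
    then show False by simp
  qed
qed

end

context chords begin

section \<open>Saddle connections along and across the cylinders\<close>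

lemma ht_eq: assumes "k \<ge> \<iota>" "ht m = ht k" shows "m = k \<or> m = \<iota> - k"
proof -
  obtain k' where k': "k' \<ge> \<iota>" "ht k' = ht m" "m = k' \<or> m = \<iota> - k'" by (rule ht_index)
  have "k' = k"
  proof (rule ccontr)
    assume "k' \<noteq> k"
    then consider "k < k'" | "k' < k" by linarith
    then show False
      by cases (use ht_strict[OF assms(1), of k'] ht_strict[OF k'(1), of k] assms(2) k'(2) in linarith)+
  qed
  then show ?thesis using k' by blast
qed

text \<open>
Being transverse to \<open>u\<close>, the saddle connection starts at the lower boundary of some cylinder and
enters it. It contains no vertex in its interior and the open cylinder contains none either, so
the connection has to cross the cylinder.
\<close>

theorem saddle_height:
  assumes s: "saddle w \<gamma>" and h: "cross2 u w > 0"
  obtains k z where "k \<ge> \<iota>" "z \<in> strip k" "snd z = 0" "\<psi> k z = \<gamma> 0" "Hk k \<le> cross2 u w"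
    "cross2 u w = Hk k \<Longrightarrow> \<psi> k (z + unframe u w) = \<gamma> 1"
proof -
  obtain i p j \<delta> where st: "(i, p) \<in> \<gamma> 0" "\<gamma> 0 = point_of S i p" "p = sg i *\<^sub>R P j" "0 < \<delta>" "\<delta> \<le> 1"
    "\<And>t. 0 < t \<Longrightarrow> t < \<delta> \<Longrightarrow> p + t *\<^sub>R w \<in> poly S i \<and> \<gamma> t = point_of S i (p + t *\<^sub>R w)"
    by (rule saddle_start[OF s], rule that)
  have pp: "p \<in> poly S i" unfolding st(3) by (rule vertex_poly)
  have hp: "cross2 u (sg i *\<^sub>R p) = ht j" by (simp add: st(3) ht_def)
  obtain k where k: "k \<ge> \<iota>" "(i = QPlus \<and> ht k = ht j) \<or> (i = QMinus \<and> ht (k + 1) = ht j)"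
  proof (cases i)
    case QPlus
    obtain k where "k \<ge> \<iota>" "ht k = ht j" by (rule ht_index)
    then show ?thesis using that QPlus by blast
  next
    case QMinus
    obtain k where k: "k \<ge> \<iota>" "ht k = ht j" by (rule ht_index)
    define t where "t = \<delta> / 2"
    have t: "0 < t" "t < \<delta>" using st(4) by (auto simp: t_def)
    have "sg i *\<^sub>R (p + t *\<^sub>R w) \<in> Q" using st(6)[OF t] poly_S by blast
    then have "0 \<le> cross2 u (sg i *\<^sub>R (p + t *\<^sub>R w))" by (rule hgt_Q_nonneg)
    also have "\<dots> = ht j - t * cross2 u w" using hp QMinus by simp
    finally have "ht j > 0" using h t mult_pos_pos[OF t(1) h] by linarith
    then have "k \<noteq> \<iota>" using k ht_d0 by (auto simp: ht_def)
    then show ?thesis using that[of "k - 1"] k QMinus by simp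
  qed
  have "ht k \<le> ht (k + 1)" using Hk_ge[OF k(1)] by (simp add: Hk_def)
  then have hk: "ht k \<le> cross2 u (sg i *\<^sub>R p)" "cross2 u (sg i *\<^sub>R p) \<le> ht (k + 1)" using k(2) hp by auto
  obtain z where z: "z \<in> strip k" "(i, p) \<in> Dev k z" by (rule Dev_of[OF pp hk], rule that)
  have z0: "snd z = 0" using Dev_height[OF z(2)] k(2) hp by auto
  have g0: "\<psi> k z = \<gamma> 0" using psi_eq[OF k(1) z] st(2) by simp
  define \<omega> where "\<omega> = unframe u w"
  have \<omega>: "frame u \<omega> = w" "snd \<omega> = cross2 u w" by (simp_all add: \<omega>_def) (simp add: unframe_def)
  define T where "T = Hk k / cross2 u w"
  have H: "Hk k > 0" using Hk_ge[OF k(1)] by simp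
  have T: "T > 0" using H h by (simp add: T_def)
  have o: "z + t *\<^sub>R \<omega> \<in> ostrip k" if "0 < t" "t < T" for t
    using that z0 \<omega>(2) h by (simp add: ostrip_def mem_Times_iff T_def pos_less_divide_eq)
  have zT: "z + t *\<^sub>R \<omega> \<in> strip k" if "0 \<le> t" "t \<le> T" for t
    using that z0 \<omega>(2) h by (simp add: strip_def mem_Times_iff T_def pos_le_divide_eq)
  have lr: "loctrans {0<..<T} (\<lambda>t. t *\<^sub>R w) (\<lambda>t. \<psi> k (z + t *\<^sub>R \<omega>))"
  proof -
    have "loctrans {0<..<T} (\<lambda>t. frame u (z + t *\<^sub>R \<omega>)) (\<lambda>t. \<psi> k (z + t *\<^sub>R \<omega>))"
      by (rule loctrans_compose[OF psi_loctrans[OF k(1)]]) (use o in \<open>auto intro!: continuous_intros\<close>)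
    then show ?thesis by (rule loctrans_dev) (simp add: frame_linear \<omega>)
  qed
  have start: "\<gamma> t = \<psi> k (z + t *\<^sub>R \<omega>)" if t: "0 < t" "t < \<delta>" "t < T" for t
  proof -
    have "(i, p + frame u (t *\<^sub>R \<omega>)) \<in> Dev k (z + t *\<^sub>R \<omega>)"
      by (rule Dev_add[OF z(2)]) (use st(6)[OF t(1,2)] in \<open>simp add: frame_linear \<omega>\<close>)
    then have "\<psi> k (z + t *\<^sub>R \<omega>) = point_of S i (p + frame u (t *\<^sub>R \<omega>))"
      using psi_eq[OF k(1)] o[OF t(1,3)] ostrip_strip by blast
    then show ?thesis using st(6)[OF t(1,2)] by (simp add: frame_linear \<omega>)
  qed
  have eq: "\<gamma> t = \<psi> k (z + t *\<^sub>R \<omega>)" if "0 < t" "t < 1" "t < T" for t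
    by (rule saddle_continue[OF s lr st(4) start that])
  have end1: "\<gamma> 1 = \<psi> k (z + \<omega>)" if "T \<ge> 1"
  proof (rule saddle_limit[OF s])
    have z1: "z + \<omega> \<in> strip k" using zT[of 1] that by simp
    then show "\<psi> k (z + \<omega>) \<in> X" by (rule psi_in[OF k(1)])
    fix t :: real assume t: "0 < t" "t < 1"
    have "d (\<psi> k (z + t *\<^sub>R \<omega>)) (\<psi> k (z + \<omega>)) \<le> norm ((z + \<omega>) - (z + t *\<^sub>R \<omega>))"
      by (rule psi_lipschitz[OF k(1) zT z1]) (use t that in auto)
    also have "(z + \<omega>) - (z + t *\<^sub>R \<omega>) = (1 - t) *\<^sub>R \<omega>" by (simp add: algebra_simps)
    finally show "d (\<gamma> t) (\<psi> k (z + \<omega>)) \<le> norm \<omega> * (1 - t)" using eq[of t] t that by (simp add: mult.commute)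
  qed auto
  have "Hk k \<le> cross2 u w"
  proof (rule ccontr)
    assume "\<not> Hk k \<le> cross2 u w"
    then have "T > 1" using h by (simp add: T_def)
    then have "\<gamma> 1 = \<psi> k (z + \<omega>)" "z + \<omega> \<in> ostrip k" using end1 o[of 1] by auto
    then show False using psi_open(2)[OF k(1)] s unfolding saddle_def by auto
  qed
  moreover have "\<psi> k (z + unframe u w) = \<gamma> 1" if "cross2 u w = Hk k"
    using end1 that h by (simp add: T_def \<omega>_def)
  ultimately show ?thesis using that[OF k(1) z(1) z0 g0] by blast
qed

text \<open>
A saddle connection in direction \<open>u\<close> starts along a chord, in one of the two pieces, and ends
where the chord ends.
\<close>

theorem saddle_level:
  assumes s: "saddle w \<gamma>" and w: "w = l *\<^sub>R u" and l: "l > 0"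
  obtains k i where "k \<ge> \<iota>" "l = ell k"
    "\<And>t. 0 < t \<Longrightarrow> t < 1 \<Longrightarrow> \<gamma> t = point_of S i (sg i *\<^sub>R P (if i = QPlus then \<iota> - k else k) + t *\<^sub>R w)"
    "\<gamma> 0 = point_of S i (sg i *\<^sub>R P (if i = QPlus then \<iota> - k else k))"
    "\<gamma> 1 = point_of S i (sg i *\<^sub>R P (if i = QPlus then k else \<iota> - k))"
proof -
  obtain i p j \<delta> where st: "(i, p) \<in> \<gamma> 0" "\<gamma> 0 = point_of S i p" "p = sg i *\<^sub>R P j" "0 < \<delta>" "\<delta> \<le> 1"
    "\<And>t. 0 < t \<Longrightarrow> t < \<delta> \<Longrightarrow> p + t *\<^sub>R w \<in> poly S i \<and> \<gamma> t = point_of S i (p + t *\<^sub>R w)"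
    by (rule saddle_start[OF s], rule that)
  obtain k where k: "k \<ge> \<iota>" "ht k = ht j" "j = k \<or> j = \<iota> - k" by (rule ht_index)
  define t where "t = \<delta> / 2"
  have t: "0 < t" "t < \<delta>" using st(4) by (auto simp: t_def)
  define sj where "sj = (if j = k then 0 else - ell k)"
  have Pj: "P j = pt k (sj, 0)"
    using k(3) P_refl[of k] by (auto simp: sj_def pt_def zero_prod_def[symmetric] frame_linear)
  have hat: "sg i *\<^sub>R (p + t *\<^sub>R w) = pt k (sj + sg i * (t * l), 0)"
    by (simp add: st(3) w scaleR_add_right Pj pt_shift)
  have "sg i *\<^sub>R (p + t *\<^sub>R w) \<in> Q" using st(6)[OF t] poly_S by blast
  moreover have "cross2 u (sg i *\<^sub>R (p + t *\<^sub>R w)) = ht k" unfolding hat hgt_pt by simp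
  ultimately obtain s' where s': "sg i *\<^sub>R (p + t *\<^sub>R w) = pt k (s', 0)" "- ell k \<le> s'" "s' \<le> 0"
    using level_point[OF k(1)] by metis
  have sj': "- ell k \<le> sj + sg i * (t * l)" "sj + sg i * (t * l) \<le> 0" using s' hat by auto
  have edge_radius: "t * l > 0" using t l by simp
  define a where "a = (if i = QPlus then \<iota> - k else k)"
  define e where "e = (if i = QPlus then k else \<iota> - k)"
  have e_nonneg: "ell k \<ge> 0" by (rule ell_nonneg[OF k(1)])
  have Pk: "P k = pt k (0, 0)" by (simp add: pt_def zero_prod_def[symmetric] frame_linear)
  have "sj = (if i = QPlus then - ell k else 0) \<and> ell k > 0"
    using sj' edge_radius e_nonneg by (cases i) (auto simp: sj_def split: if_splits)
  then have ell0: "ell k > 0" and "P j = P a" using Pj P_refl[of k] Pk by (auto simp: a_def)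
  then have pa: "p = sg i *\<^sub>R P a" using st(3) by simp
  have "P e - P a = (sg i * ell k) *\<^sub>R u" using chord[of k] by (cases i) (auto simp: a_def e_def algebra_simps)
  then have diff: "sg i *\<^sub>R P e = p + ell k *\<^sub>R u" using pa by (simp add: algebra_simps)
  define T where "T = ell k / l"
  have T: "T > 0" "T * l = ell k" using ell0 l by (simp_all add: T_def)
  have endp: "p + T *\<^sub>R w = sg i *\<^sub>R P e" using diff T by (simp add: w)
  have u0: "u \<noteq> 0" using norm_u by auto
  have "p \<in> poly S i" unfolding pa by (rule vertex_poly)
  moreover have "p + T *\<^sub>R w \<in> poly S i" unfolding endp by (rule vertex_poly)
  ultimately have pp: "p \<in> poly S i" "p + T *\<^sub>R w \<in> poly S i" .
  have ray: "p + r *\<^sub>R w \<in> poly S i \<and> sg i *\<^sub>R (p + r *\<^sub>R w) \<notin> range P" if r: "0 < r" "r < T" for r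
  proof -
    have ee: "p + r *\<^sub>R w = p + (r / T) *\<^sub>R ((p + T *\<^sub>R w) - p)" using T by simp
    have "p \<noteq> p + T *\<^sub>R w" using T u0 l ell0 by (simp add: w)
    then show ?thesis unfolding ee using not_vertex_on_segment[OF pp, of "r / T"] r T by auto
  qed
  have st': "\<gamma> r = point_of S i (p + r *\<^sub>R w)" if "0 < r" "r < \<delta>" for r using st(6)[OF that] by simp
  note str = saddle_straight[OF s T(1) st(4) st' ray pp(2)]
  have gT: "\<gamma> T = point_of S i (p + T *\<^sub>R w)" using str(2,3) by simp
  have "T = 1"
  proof (rule ccontr)
    assume "T \<noteq> 1"
    then have "T < 1" using str(3) by simp
    then have "\<gamma> T \<in> X - V" using s T(1) unfolding saddle_def loctrans_def by auto
    moreover have "\<gamma> T \<in> V" unfolding gT point_of_V_iff[OF pp(2)] unfolding endp by simp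
    ultimately show False by simp
  qed
  show ?thesis
  proof (rule that[OF k(1), of i])
    show "l = ell k" using T \<open>T = 1\<close> by simp
    show "\<gamma> t = point_of S i (sg i *\<^sub>R P (if i = QPlus then \<iota> - k else k) + t *\<^sub>R w)" if "0 < t" "t < 1" for t
      using str(1)[of t] that \<open>T = 1\<close> pa unfolding a_def by simp
    show "\<gamma> 0 = point_of S i (sg i *\<^sub>R P (if i = QPlus then \<iota> - k else k))" using st(2) pa unfolding a_def by simp
    show "\<gamma> 1 = point_of S i (sg i *\<^sub>R P (if i = QPlus then k else \<iota> - k))"
      using gT endp \<open>T = 1\<close> unfolding e_def by simp
  qed
qed

end

context surf begin

section \<open>The derivative determines an affine automorphism\<close>

lemma sqrt2: "2 / sqrt 2 = sqrt 2" by (simp add: real_div_sqrt)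

lemma dia_cross: "cross2 (vector [1 / sqrt 2, 1 / sqrt 2]) p = (p $ 2 - p $ 1) / sqrt 2"
  by (simp add: cross2_def diff_divide_distrib)

lemma hor_cross: "cross2 (vector [1, 0]) p = p $ 2"
  by (simp add: cross2_def)

lemma dia_Hk: "dia.Hk k = (E (k - 1) $ 1 + E (k - 1) $ 2) / sqrt 2"
  using E_diff[of "k - 1"] by (simp add: dia.Hk_def dia.ht_def dia_cross E_def diff_divide_distrib add_divide_distrib)

lemma dia_Hk_bound:
  assumes "k \<ge> 1" shows "sqrt 2 \<le> dia.Hk k" "dia.Hk k \<le> sqrt 2 \<Longrightarrow> k = 1"
proof -
  have e: "E (k - 1) $ 1 \<ge> 1" "E (k - 1) $ 2 \<ge> 1" using E_nonneg_bounds[of "k - 1"] assms by auto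
  have "2 / sqrt 2 \<le> (E (k - 1) $ 1 + E (k - 1) $ 2) / sqrt 2" by (intro divide_right_mono) (use e in auto)
  then show "sqrt 2 \<le> dia.Hk k" unfolding dia_Hk sqrt2 .
  assume h: "dia.Hk k \<le> sqrt 2"
  show "k = 1"
  proof (rule ccontr)
    assume "k \<noteq> 1"
    then have e: "E (k - 2) $ 1 \<ge> 1" "E (k - 2) $ 2 \<ge> 1" using E_nonneg_bounds[of "k - 2"] assms by auto
    have "E (k - 1) $ 1 + E (k - 1) $ 2 = (2 * c + 1) * E (k - 2) $ 1 + (2 * c - 1) * E (k - 2) $ 2"
      using E_Suc[of "k - 2"] by (simp add: algebra_simps)
    moreover have "(2 * c + 1) * E (k - 2) $ 1 \<ge> 3 * 1" by (rule mult_mono) (use e c1 in auto)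
    moreover have "(2 * c - 1) * E (k - 2) $ 2 \<ge> 1 * 1" by (rule mult_mono) (use e c1 in auto)
    ultimately have "2 < E (k - 1) $ 1 + E (k - 1) $ 2" by linarith
    then have "2 / sqrt 2 < dia.Hk k" unfolding dia_Hk by (intro divide_strict_right_mono) auto
    then show False using h unfolding sqrt2 by simp
  qed
qed

lemma dia_ell_bound:
  assumes "k \<ge> 1"
  shows "sqrt 2 * ((c + 1) * P k $ 1 - (c - 1) * P k $ 2 - 1) \<ge> sqrt 2"
    "sqrt 2 * ((c + 1) * P k $ 1 - (c - 1) * P k $ 2 - 1) = sqrt 2 \<Longrightarrow> k = 1"
proof -
  have *: "(c + 1) * P k $ 1 - (c - 1) * P k $ 2 \<ge> 2 \<and> (k \<noteq> 1 \<longrightarrow> (c + 1) * P k $ 1 - (c - 1) * P k $ 2 > 2)"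
    using assms
  proof (induction k rule: int_ge_induct)
    case base then show ?case by (simp add: P_1)
  next
    case (step k)
    have "(c + 1) * E k $ 1 - (c - 1) * E k $ 2 = E (k - 1) $ 1 * (c + 1) + E (k - 1) $ 2 * (c - 1)"
      using E_Suc[of "k - 1"] by (simp add: algebra_simps)
    also have "\<dots> > 0" using E_nonneg_bounds[of "k - 1"] step c1 by (intro add_pos_nonneg) auto
    finally show ?case using step unfolding P_step by (simp add: algebra_simps)
  qed
  then show "sqrt 2 * ((c + 1) * P k $ 1 - (c - 1) * P k $ 2 - 1) \<ge> sqrt 2" by simp
  show "sqrt 2 * ((c + 1) * P k $ 1 - (c - 1) * P k $ 2 - 1) = sqrt 2 \<Longrightarrow> k = 1" using * by auto
qed

lemma point_of_P: "point_of S QPlus (P m) = vtx (even m)"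
  using vtx_eq[of QPlus m] by simp

lemma P_1_nz [simp]: "P 1 \<noteq> 0" by (simp add: P_1 vec2_eq_iff)

text \<open>
The image of the first edge is again a saddle connection with holonomy \<open>P 1 = (1, 1)\<close>. By
\<open>saddle_level\<close> it is a chord of slope 1 and length \<open>sqrt 2\<close>; only the edge itself and the glued
edge of the other piece qualify.
\<close>

lemma fixes_first_edge:
  assumes f: "affine_map M f" and M: "invertible M" "M *v P 1 = P 1"
  shows "\<And>t. 0 < t \<Longrightarrow> t < 1 \<Longrightarrow> f (point_of S QPlus (t *\<^sub>R P 1)) = point_of S QPlus (t *\<^sub>R P 1)"
    "f (vtx True) = vtx True"
proof -
  have s0: "saddle (P 1) (\<lambda>t. point_of S QPlus (t *\<^sub>R P 1))"
    using saddle_diagonal[of 0 1] by simp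
  have s: "saddle (P 1) (\<lambda>t. f (point_of S QPlus (t *\<^sub>R P 1)))"
    using saddle_map[OF f M(1) s0] by (simp add: M(2))
  have w: "P 1 = sqrt 2 *\<^sub>R vector [1 / sqrt 2, 1 / sqrt 2]" by (simp add: P_1 vec2_eq_iff)
  obtain k i where k: "k \<ge> 1" "sqrt 2 = sqrt 2 * ((c + 1) * P k $ 1 - (c - 1) * P k $ 2 - 1)"
    and t: "\<And>t. 0 < t \<Longrightarrow> t < 1 \<Longrightarrow> f (point_of S QPlus (t *\<^sub>R P 1)) =
      point_of S i (sg i *\<^sub>R P (if i = QPlus then 1 - k else k) + t *\<^sub>R P 1)"
    and e: "f (point_of S QPlus (0 *\<^sub>R P 1)) = point_of S i (sg i *\<^sub>R P (if i = QPlus then 1 - k else k))"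
    by (rule dia.saddle_level[OF s w], simp, rule that)
  have k1: "k = 1" using dia_ell_bound(2)[OF k(1)] k(2) by simp
  show "f (vtx True) = vtx True"
    using e unfolding vtx_eq by (cases i) (auto simp: k1 vtx_def)
  show "f (point_of S QPlus (t *\<^sub>R P 1)) = point_of S QPlus (t *\<^sub>R P 1)" if tt: "0 < t" "t < 1" for t
  proof (cases i)
    case QPlus
    then show ?thesis using t[OF tt] by (simp add: k1)
  next
    case QMinus
    \<comment> \<open>the chord of the second piece is glued to the first edge\<close>
    have p: "t *\<^sub>R P 1 \<in> edge 0" unfolding edge_def using tt by (auto simp: in_segment intro!: exI[of _ t])
    have "t *\<^sub>R P 1 = P 0 + t *\<^sub>R (P 1 - P 0)" by simp
    then have q: "t *\<^sub>R P 1 \<in> poly S QPlus"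
      using not_vertex_on_segment(1)[OF vertex_poly[of QPlus 0] vertex_poly[of QPlus 1]] tt by auto
    have st: "step QPlus (t *\<^sub>R P 1) QMinus (t *\<^sub>R P 1 - P 1)"
      unfolding step_def by (intro exI[of _ 0]) (use p in auto)
    have "point_of S QPlus (t *\<^sub>R P 1) = point_of S QMinus (t *\<^sub>R P 1 - P 1)"
      unfolding point_eq[OF q eqv_poly[OF q st]] using st unfolding eqv_def by blast
    then show ?thesis using t[OF tt] QMinus by (simp add: k1)
  qed
qed

text \<open>
The composite with an inverse has derivative 1, so it fixes the midpoint of the first edge by
\<open>fixes_first_edge\<close> and is the identity by \<open>rigidity\<close>.
\<close>

theorem affine_aut_determined: assumes "affine_aut M f" "affine_aut M g" shows "f = g"
proof -
  obtain g' where g': "affine_map (matrix_inv M) g'" "\<forall>x\<in>X. g' (g x) = x \<and> g (g' x) = x" using affine_autD(5)[OF assms(2)] by blast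
  note M = affine_autD(1)[OF assms(1)]
  have "affine_map (matrix_inv M ** M) (\<lambda>x. g' (f x))" by (rule affine_map_comp[OF g'(1) affine_autD(3)[OF assms(1)]])
  then have a: "affine_map (mat 1) (\<lambda>x. g' (f x))" by (simp add: matrix_inv_cancel[OF M])
  let ?x = "point_of S QPlus ((1/2) *\<^sub>R P 1)"
  have "(1/2) *\<^sub>R P 1 = P 0 + (1/2) *\<^sub>R (P 1 - P 0)" by simp
  then have p: "(1/2) *\<^sub>R P 1 \<in> poly S QPlus" "sg QPlus *\<^sub>R ((1/2) *\<^sub>R P 1) \<notin> range P"
    using not_vertex_on_segment[OF vertex_poly[of QPlus 0] vertex_poly[of QPlus 1], of "1/2"] by auto
  then have x: "?x \<in> X - V" using point_of_V_iff[OF p(1)] point_of_in_points[OF p(1)] by auto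
  have fx: "g' (f ?x) = ?x" by (rule fixes_first_edge(1)[OF a invertible_mat_1]) auto
  show "f = g"
  proof (rule affine_aut_ext[OF assms])
    fix y assume y: "y \<in> X"
    have "g' (f y) = y" by (rule rigidity[OF a affine_map_id x fx y])
    then show "f y = g y" using g'(2) affine_autD(4)[OF assms(1) y] by metis
  qed
qed

section \<open>The subgroup generated by the four automorphisms\<close>

definition "Gen = generate (affine_group S) {minusI, reflA, hor.twist 1, dia.twist 1}"

text \<open>
Since automorphisms are determined by their derivatives, membership in the generated subgroup can
be decided on matrices.
\<close>

definition "GenM = {M. \<exists>f\<in>Gen. affine_aut M f}"

lemma generators_Aut: "{minusI, reflA, hor.twist 1, dia.twist 1} \<subseteq> carrier (affine_group S)"
  using affine_aut_minusI affine_aut_reflA hor.twist_affine_aut dia.twist_affine_aut by (auto simp: carrier_Aut Aut_def)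

lemma Gen_subset: "Gen \<subseteq> Aut"
  unfolding Gen_def carrier_Aut[symmetric] by (rule group.generate_incl[OF group_Aut generators_Aut])

lemma GenM_mult: assumes "M \<in> GenM" "N \<in> GenM" shows "M ** N \<in> GenM"
proof -
  obtain f g where fg: "f \<in> Gen" "affine_aut M f" "g \<in> Gen" "affine_aut N g" using assms unfolding GenM_def by auto
  have "f \<otimes>\<^bsub>affine_group S\<^esub> g \<in> Gen" using fg unfolding Gen_def by (intro generate.eng)
  moreover have "f \<otimes>\<^bsub>affine_group S\<^esub> g = compose X f g" using fg Gen_subset by (intro mult_Aut) auto
  ultimately show ?thesis using affine_aut_comp[OF fg(2,4)] unfolding GenM_def by auto
qed

lemma GenM_inv: assumes "M \<in> GenM" shows "matrix_inv M \<in> GenM"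
proof -
  obtain f where f: "f \<in> Gen" "affine_aut M f" using assms unfolding GenM_def by auto
  have sub: "subgroup Gen (affine_group S)"
    unfolding Gen_def by (rule group.generate_is_subgroup[OF group_Aut generators_Aut])
  let ?h = "inv\<^bsub>affine_group S\<^esub> f"
  have h: "?h \<in> Gen" by (rule subgroup.m_inv_closed[OF sub f(1)])
  then obtain N where N: "affine_aut N ?h" using Gen_subset unfolding Aut_def by blast
  have "?h \<otimes>\<^bsub>affine_group S\<^esub> f = \<one>\<^bsub>affine_group S\<^esub>"
    by (rule group.l_inv[OF group_Aut]) (use f(1) Gen_subset carrier_Aut in auto)
  moreover have "?h \<otimes>\<^bsub>affine_group S\<^esub> f = compose X ?h f" using f h Gen_subset by (intro mult_Aut) auto
  ultimately have "affine_aut (N ** M) (\<lambda>x\<in>X. x)" using affine_aut_comp[OF N f(2)] by (simp add: one_Aut)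
  then have "N ** M = mat 1" using derivative_unique affine_autD(3) affine_aut_id by blast
  then have "N = matrix_inv M" by (metis matrix_inv_cancel(2)[OF affine_autD(1)[OF f(2)]] matrix_mul_assoc matrix_mul_lid matrix_mul_rid)
  then show ?thesis using h N unfolding GenM_def by auto
qed

lemma GenM_generators: "- mat 1 \<in> GenM" "refl_matrix \<in> GenM" "hor.twist_matrix 1 \<in> GenM" "dia.twist_matrix 1 \<in> GenM"
  unfolding GenM_def Gen_def using affine_aut_minusI affine_aut_reflA hor.twist_affine_aut dia.twist_affine_aut
  by (auto intro!: generate.incl)

lemma GenM_aff: "affine_aut M f \<Longrightarrow> M \<in> GenM \<Longrightarrow> f \<in> Gen"
  using affine_aut_determined unfolding GenM_def by blast

lemma dia_twist_matrix: "(dia.twist_matrix n *v p) $ 1 = p $ 1 + of_int n * (c + 1) * (p $ 2 - p $ 1)"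
  "(dia.twist_matrix n *v p) $ 2 = p $ 2 + of_int n * (c + 1) * (p $ 2 - p $ 1)"
  unfolding dia.twist_matrix_mult dia_cross by (simp_all add: field_simps)

lemma hor_twist_matrix: "(hor.twist_matrix n *v p) $ 1 = p $ 1 + of_int n * 2 * p $ 2" "(hor.twist_matrix n *v p) $ 2 = p $ 2"
  unfolding hor.twist_matrix_mult hor_cross by simp_all

lemma minus_mat: "(- mat 1 :: real^2^2) *v p = - p"
  by (simp add: vec2_eq_iff matrix_vector_mult_def sum_2 mat_def)

lemma refl_matrix_mult: "(refl_matrix *v p) $ 1 = - (p $ 1)" "(refl_matrix *v p) $ 2 = p $ 2" by (simp_all add: refl_matrix_def)

text \<open>
Up to sign, the linear part of \<open>T_map c\<close> is the product of the two twist derivatives.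
\<close>

lemma shift_matrix_GenM: "shift_matrix \<in> GenM"
proof -
  have "shift_matrix = (- mat 1) ** (dia.twist_matrix 1 ** hor.twist_matrix 1)"
    unfolding vec2_eq_iff matrix_eq mult_matrix_vector shift_matrix_L minus_mat vector_uminus_component dia_twist_matrix hor_twist_matrix L_nth
    by (simp add: algebra_simps)
  then show ?thesis using GenM_mult GenM_generators by metis
qed

lemma dia_twist_matrix_add: "dia.twist_matrix (m + n) = dia.twist_matrix m ** dia.twist_matrix n" and dia_twist_matrix_0: "dia.twist_matrix 0 = mat 1"
  unfolding vec2_eq_iff matrix_eq mult_matrix_vector dia_twist_matrix by (simp_all add: algebra_simps)

lemma dia_twist_matrix_GenM: "dia.twist_matrix n \<in> GenM"
proof (induction n rule: int_induct[where k = 0])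
  case base
  have "dia.twist_matrix 0 = matrix_inv (dia.twist_matrix 1) ** dia.twist_matrix 1"
    using matrix_inv_cancel(1)[OF affine_autD(1)[OF dia.twist_affine_aut]] by (simp only: dia_twist_matrix_0)
  then show ?case using GenM_mult GenM_inv GenM_generators by metis
next
  case (step1 n)
  then show ?case unfolding dia_twist_matrix_add by (intro GenM_mult GenM_generators)
next
  case (step2 n)
  have "dia.twist_matrix 1 ** dia.twist_matrix (-1) = mat 1" "dia.twist_matrix (-1) ** dia.twist_matrix 1 = mat 1"
    unfolding dia_twist_matrix_add[symmetric] by (simp_all only: dia_twist_matrix_0 add.right_inverse add.left_inverse)
  then have "matrix_inv (dia.twist_matrix 1) = dia.twist_matrix (-1)" by (rule matrix_inv_unique)
  then have "dia.twist_matrix (-1) \<in> GenM" using GenM_inv GenM_generators by metis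
  moreover have "dia.twist_matrix (n - 1) = dia.twist_matrix n ** dia.twist_matrix (-1)" using dia_twist_matrix_add[of n "-1"] by simp
  ultimately show ?case using GenM_mult step2 by metis
qed

lemma quadrant:
  obtains M where "M \<in> GenM" "(M *v w) $ 1 = \<bar>w $ 1\<bar>" "(M *v w) $ 2 = \<bar>w $ 2\<bar>"
proof -
  define N1 where "N1 = (if w $ 2 < 0 then - mat 1 else mat 1 :: real^2^2)"
  have "(- mat 1) ** (- mat 1) = (mat 1 :: real^2^2)" by (rule mat2_eqI) (simp_all add: mult_matrix_vector minus_mat)
  then have one: "mat 1 \<in> GenM" using GenM_mult GenM_generators by metis
  then have N1: "N1 \<in> GenM" using GenM_generators by (simp add: N1_def)
  have v: "(N1 *v w) $ 2 = \<bar>w $ 2\<bar>" "\<bar>(N1 *v w) $ 1\<bar> = \<bar>w $ 1\<bar>" by (auto simp: N1_def minus_mat)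
  define N2 where "N2 = (if (N1 *v w) $ 1 < 0 then refl_matrix else mat 1 :: real^2^2)"
  have "N2 \<in> GenM" using GenM_generators one by (simp add: N2_def)
  then have "N2 ** N1 \<in> GenM" using N1 GenM_mult by blast
  moreover have "((N2 ** N1) *v w) $ 1 = \<bar>w $ 1\<bar>" "((N2 ** N1) *v w) $ 2 = \<bar>w $ 2\<bar>"
    using v by (auto simp: N2_def mult_matrix_vector refl_matrix_mult)
  ultimately show ?thesis using that by blast
qed

text \<open>
The dihedral group generated by the rotation, the reflection and \<open>L\<close> acts on the hyperbola
\<open>qform = q\<close>. If \<open>y > x > 0\<close>, then \<open>L\<close> applied to \<open>(x, - y)\<close> either lands in the sector or has a
second coordinate that is smaller in absolute value by \<open>(c + 1) x - (c - 1) y \<ge> q / x\<close>, while the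
first one does not grow. The induction counts steps of size \<open>\<delta> = q / A\<close>, where \<open>A\<close> bounds the
first coordinate.
\<close>

lemma to_first_sector:
  assumes q: "qform w > 0"
  shows "\<exists>M\<in>GenM. 0 \<le> (M *v w) $ 2 \<and> (M *v w) $ 2 \<le> (M *v w) $ 1 \<and> qform (M *v w) = qform w"
proof -
  have "w $ 1 \<noteq> 0"
  proof
    assume "w $ 1 = 0"
    moreover have "(c - 1) * (w $ 2)\<^sup>2 \<ge> 0" using c1 by simp
    ultimately show False using q by (simp add: qform_def)
  qed
  define A where "A = \<bar>w $ 1\<bar>"
  define \<delta> where "\<delta> = qform w / A"
  have A: "A > 0" and \<delta>: "\<delta> > 0" using \<open>w $ 1 \<noteq> 0\<close> q by (simp_all add: A_def \<delta>_def)
  have "\<exists>M\<in>GenM. 0 \<le> (M *v v) $ 2 \<and> (M *v v) $ 2 \<le> (M *v v) $ 1 \<and> qform (M *v v) = qform v"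
    if "\<bar>v $ 2\<bar> < real n * \<delta>" "\<bar>v $ 1\<bar> \<le> A" "qform v = qform w" for n v
    using that
  proof (induction n arbitrary: v)
    case 0 then show ?case by simp
  next
    case (Suc n)
    obtain M where M: "M \<in> GenM" "(M *v v) $ 1 = \<bar>v $ 1\<bar>" "(M *v v) $ 2 = \<bar>v $ 2\<bar>" by (rule quadrant)
    have qM: "qform (M *v v) = qform v" by (simp add: qform_def M)
    define x y where "x = \<bar>v $ 1\<bar>" and "y = \<bar>v $ 2\<bar>"
    show ?case
    proof (cases "y \<le> x")
      case True
      then show ?thesis using M qM by (intro bexI[of _ M]) (auto simp: x_def y_def)
    next
      case False
      have xy: "0 \<le> x" "x < y" using False by (auto simp: x_def)
      have qxy: "qform w = (c + 1) * (x * x) - (c - 1) * (y * y)" using Suc.prems(3) by (simp add: qform_def x_def y_def power2_eq_square)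
      have "x \<noteq> 0"
      proof
        assume "x = 0"
        moreover have "(c - 1) * (y * y) \<ge> 0" using c1 by simp
        ultimately show False using q qxy by simp
      qed
      then have x0: "x > 0" using xy by simp
      \<comment> \<open>the image of \<open>(x, - y)\<close> under \<open>L\<close>\<close>
      define v' where "v' = shift_matrix *v ((- mat 1) *v (refl_matrix *v (M *v v)))"
      have v': "v' $ 1 = c * x - (c - 1) * y" "v' $ 2 = (c + 1) * x - c * y"
        unfolding v'_def shift_matrix_L L_nth minus_mat refl_matrix_mult vector_uminus_component M x_def y_def by simp_all
      define N where "N = shift_matrix ** ((- mat 1) ** (refl_matrix ** M))"
      have N: "N \<in> GenM" unfolding N_def by (intro GenM_mult shift_matrix_GenM GenM_generators M)
      have Nv: "N *v v = v'" by (simp add: N_def v'_def mult_matrix_vector)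
      have qv': "qform v' = qform v" unfolding v'_def shift_matrix_L qform_L using qM by (simp add: qform_def minus_mat refl_matrix_mult)
      define g where "g = (c + 1) * x - (c - 1) * y"
      have "qform w \<le> g * x"
      proof -
        have "(c - 1) * (y * x) \<le> (c - 1) * (y * y)" using xy c1 by (intro mult_left_mono) auto
        then show ?thesis unfolding qxy g_def by (simp add: algebra_simps)
      qed
      then have g: "qform w / x \<le> g" using x0 by (simp add: field_simps)
      have "\<delta> \<le> qform w / x" unfolding \<delta>_def using Suc.prems(2) q x0 by (intro divide_left_mono) (auto simp: x_def A_def)
      then have gd: "g \<ge> \<delta>" using g by simp
      have v'g: "v' $ 1 = g - x" "v' $ 2 = g - y" "v' $ 1 - v' $ 2 = y - x" using v' by (simp_all add: g_def algebra_simps)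
      show ?thesis
      proof (cases "v' $ 2 \<ge> 0")
        case True
        then show ?thesis using N Nv qv' v'g(3) xy by (intro bexI[of _ N]) auto
      next
        case False
        have "(c - 1) * (x - y) \<le> 0" using xy c1 by (intro mult_nonneg_nonpos) auto
        then have "v' $ 1 \<le> x" using v'(1) by (simp add: algebra_simps)
        then have "\<bar>v' $ 1\<bar> \<le> A" using v'g(1) gd \<delta> Suc.prems(2) unfolding x_def by linarith
        moreover have "\<bar>v' $ 2\<bar> < real n * \<delta>" using False v'g(2) gd Suc.prems(1) unfolding y_def by (simp add: algebra_simps)
        moreover have "qform v' = qform w" using qv' Suc.prems(3) by simp
        ultimately obtain M' where M': "M' \<in> GenM" "0 \<le> (M' *v v') $ 2" "(M' *v v') $ 2 \<le> (M' *v v') $ 1" "qform (M' *v v') = qform v'"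
          using Suc.IH[of v'] by blast
        show ?thesis
          by (rule bexI[OF _ GenM_mult[OF M'(1) N]]) (use M' qv' in \<open>simp add: mult_matrix_vector Nv\<close>)
      qed
    qed
  qed
  moreover obtain n where "\<bar>w $ 2\<bar> / \<delta> < real n" using reals_Archimedean2 by blast
  ultimately show ?thesis using \<delta> by (simp add: A_def field_simps)
qed

section \<open>Reduction of saddle connections to the diagonal\<close>

text \<open>
The condition on the end points is invariant under automorphisms and rules out horizontal
directions, see \<open>joins_not_horizontal\<close>.
\<close>

definition "joins w \<longleftrightarrow> (\<exists>\<gamma>. saddle w \<gamma> \<and> \<gamma> 0 \<noteq> \<gamma> 1)"

lemma joins_map: assumes "affine_aut M f" "joins w" shows "joins (M *v w)"
proof -
  obtain \<gamma> where g: "saddle w \<gamma>" "\<gamma> 0 \<noteq> \<gamma> 1" using assms(2) unfolding joins_def by blast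
  then have X: "\<gamma> 0 \<in> X" "\<gamma> 1 \<in> X" unfolding saddle_def using V_subset by auto
  have "inj_on f X" using affine_aut_bij[OF assms(1)] by (auto simp: Bij_def bij_betw_def)
  then have "f (\<gamma> 0) \<noteq> f (\<gamma> 1)" using g(2) X by (auto dest: inj_onD)
  then show ?thesis using saddle_map[OF affine_autD(3)[OF assms(1)] affine_autD(1)[OF assms(1)] g(1)] unfolding joins_def by blast
qed

lemma joins_GenM: "M \<in> GenM \<Longrightarrow> joins w \<Longrightarrow> joins (M *v w)"
  using joins_map unfolding GenM_def by blast

lemma saddle_height_ge_1: assumes "saddle w \<gamma>" "w $ 2 > 0" shows "w $ 2 \<ge> 1"
proof -
  have h: "cross2 (vector [1, 0]) w > 0" using assms(2) by (simp only: hor_cross)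
  obtain k z where "k \<ge> 0" "hor.Hk k \<le> cross2 (vector [1, 0]) w"
    by (rule hor.saddle_height[OF assms(1) h], rule that)
  then show ?thesis using hor.Hk_ge[of k] by (simp add: hor_cross)
qed

lemma saddle_diagonal_height_ge_2: assumes "saddle w \<gamma>" "w $ 2 > w $ 1" shows "w $ 2 - w $ 1 \<ge> 2"
proof -
  have h: "cross2 (vector [1 / sqrt 2, 1 / sqrt 2]) w > 0" using assms(2) unfolding dia_cross by simp
  obtain k z where "k \<ge> 1" "dia.Hk k \<le> cross2 (vector [1 / sqrt 2, 1 / sqrt 2]) w"
    by (rule dia.saddle_height[OF assms(1) h], rule that)
  then have "2 / sqrt 2 \<le> (w $ 2 - w $ 1) / sqrt 2" using dia_Hk_bound(1)[of k] unfolding dia_cross sqrt2 by linarith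
  then show ?thesis by (simp add: divide_le_cancel)
qed

text \<open>
A horizontal chord joins \<open>P k\<close> to \<open>P (- k)\<close>, and these indices have the same parity.
\<close>

lemma joins_not_horizontal: assumes "joins w" shows "w $ 2 \<noteq> 0"
proof
  assume h: "w $ 2 = 0"
  have *: "\<gamma> 0 = \<gamma> 1" if s: "saddle v \<gamma>" and v: "v $ 2 = 0" "v $ 1 > 0" for v \<gamma>
  proof -
    have e: "v = v $ 1 *\<^sub>R vector [1, 0]" using v by (simp add: vec2_eq_iff)
    obtain k i where "\<gamma> 0 = point_of S i (sg i *\<^sub>R P (if i = QPlus then 0 - k else k))"
      "\<gamma> 1 = point_of S i (sg i *\<^sub>R P (if i = QPlus then k else 0 - k))"
      by (rule hor.saddle_level[OF s e v(2)], rule that)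
    then show ?thesis by (simp add: vtx_eq)
  qed
  obtain \<gamma> where g: "saddle w \<gamma>" "\<gamma> 0 \<noteq> \<gamma> 1" using assms unfolding joins_def by blast
  then have "w \<noteq> 0" unfolding saddle_def by blast
  then have "w $ 1 \<noteq> 0" using h by (auto simp: vec2_eq_iff)
  then consider "w $ 1 > 0" | "(- w) $ 1 > 0" by fastforce
  then show False
  proof cases
    case 1 then show False using *[OF g(1) h] g(2) by simp
  next
    case 2
    have m: "saddle (- w) (\<lambda>t. minusI (\<gamma> t))" by (rule saddle_minus[OF g(1)])
    have "(- w) $ 2 = 0" using h by simp
    then have "minusI (\<gamma> 0) = minusI (\<gamma> 1)" using *[OF m _ 2] by simp
    moreover have "inj_on minusI X" using affine_aut_bij[OF affine_aut_minusI] by (auto simp: Bij_def bij_betw_def)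
    moreover have "\<gamma> 0 \<in> X" "\<gamma> 1 \<in> X" using g(1) V_subset unfolding saddle_def by auto
    ultimately show False using g(2) by (auto dest: inj_onD)
  qed
qed

lemma saddle_diagonal_length: assumes "saddle (r *\<^sub>R P 1) \<gamma>" shows "\<bar>r\<bar> \<ge> 1"
proof -
  have *: "l \<ge> 1" if s: "saddle (l *\<^sub>R P 1) \<gamma>" and l: "l > 0" for l \<gamma>
  proof -
    have e: "l *\<^sub>R P 1 = (l * sqrt 2) *\<^sub>R vector [1 / sqrt 2, 1 / sqrt 2]" by (simp add: P_1 vec2_eq_iff)
    have pos: "l * sqrt 2 > 0" using l by simp
    obtain k i where "k \<ge> 1" "l * sqrt 2 = sqrt 2 * ((c + 1) * P k $ 1 - (c - 1) * P k $ 2 - 1)"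
      by (rule dia.saddle_level[OF s e pos], rule that)
    then have "1 * sqrt 2 \<le> l * sqrt 2" using dia_ell_bound(1)[of k] by simp
    then show ?thesis by (simp only: mult_le_cancel_right_pos real_sqrt_gt_0_iff zero_less_numeral)
  qed
  have "r \<noteq> 0" using assms unfolding saddle_def by auto
  then consider "r > 0" | "- r > 0" by linarith
  then show ?thesis
  proof cases
    case 1 then show ?thesis using *[OF assms] by simp
  next
    case 2
    have "saddle ((- r) *\<^sub>R P 1) (\<lambda>t. minusI (\<gamma> t))" using saddle_minus[OF assms] by simp
    from *[OF this 2] show ?thesis by simp
  qed
qed

lemma joins_first_edge: "joins (P 1)"
proof -
  have "saddle (P 1) (\<lambda>t. point_of S QPlus (t *\<^sub>R P 1))" using saddle_diagonal[of 0 1] by simp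
  moreover have "point_of S QPlus (0 *\<^sub>R P 1) \<noteq> point_of S QPlus (1 *\<^sub>R P 1)"
    using point_of_P[of 0] point_of_P[of 1] by simp
  ultimately show ?thesis unfolding joins_def by blast
qed

text \<open>
Descent on \<open>qform\<close> in steps of at least 8. In the sector \<open>0 \<le> y \<le> x\<close>, the case \<open>y = 0\<close> is excluded
and \<open>x = y\<close> is the goal. Otherwise \<open>y \<ge> 1\<close> and \<open>x - y \<ge> 2\<close> because the saddle connection crosses
cylinders of both directions, and \<open>(x, y) \<mapsto> (2 y - x, y)\<close> lowers \<open>qform\<close> by \<open>4 (c + 1) y (x - y)\<close>.
\<close>

theorem reduce_to_diagonal:
  assumes "joins w" shows "\<exists>M\<in>GenM. \<exists>l. M *v w = l *\<^sub>R P 1"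
proof -
  have "\<exists>M\<in>GenM. \<exists>l. M *v v = l *\<^sub>R P 1" if "joins v" "qform v < real n * 8" for n v
    using that
  proof (induction n arbitrary: v)
    case 0
    then show ?case using saddle_qform unfolding joins_def by force
  next
    case (Suc n)
    obtain \<gamma>0 where "saddle v \<gamma>0" using Suc.prems(1) unfolding joins_def by blast
    then have "qform v > 0" by (rule saddle_qform)
    from to_first_sector[OF this] obtain M where M: "M \<in> GenM" "0 \<le> (M *v v) $ 2" "(M *v v) $ 2 \<le> (M *v v) $ 1" "qform (M *v v) = qform v"
      by blast
    define x y where "x = (M *v v) $ 1" and "y = (M *v v) $ 2"
    have j: "joins (M *v v)" by (rule joins_GenM[OF M(1) Suc.prems(1)])
    have y0: "y > 0" using joins_not_horizontal[OF j] M(2) by (simp add: y_def)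
    obtain \<gamma> where g: "saddle (M *v v) \<gamma>" using j unfolding joins_def by blast
    have y1: "y \<ge> 1" using saddle_height_ge_1[OF g] y0 by (simp add: y_def)
    show ?case
    proof (cases "x = y")
      case True
      then have "M *v v = y *\<^sub>R P 1" by (simp add: vec2_eq_iff P_1 x_def y_def)
      then show ?thesis using M(1) by blast
    next
      case False
      then have "x > y" using M(3) by (simp add: x_def y_def)
      then have xy: "x - y \<ge> 2" using saddle_diagonal_height_ge_2[OF saddle_minus[OF g]] by (simp add: x_def y_def)
      define N where "N = hor.twist_matrix 1 ** (refl_matrix ** M)"
      have N: "N \<in> GenM" unfolding N_def by (intro GenM_mult GenM_generators M)
      have Nv: "(N *v v) $ 1 = 2 * y - x" "(N *v v) $ 2 = y"
        unfolding N_def mult_matrix_vector hor_twist_matrix refl_matrix_mult x_def y_def by simp_all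
      have "qform (N *v v) = qform (M *v v) - 4 * (c + 1) * (y * (x - y))"
        unfolding qform_def Nv x_def[symmetric] y_def[symmetric] by algebra
      moreover have "y * (x - y) \<ge> 1 * 2" by (rule mult_mono) (use y1 xy in auto)
      then have "4 * (c + 1) * (y * (x - y)) \<ge> 4 * 2 * (1 * 2)" by (intro mult_mono) (use c1 y1 xy in auto)
      ultimately have "qform (N *v v) < real n * 8" using Suc.prems(2) M(4) by simp
      then obtain M' l where M': "M' \<in> GenM" "M' *v (N *v v) = l *\<^sub>R P 1"
        using Suc.IH[OF joins_GenM[OF N Suc.prems(1)]] by blast
      show ?thesis
        by (rule bexI[OF _ GenM_mult[OF M'(1) N]]) (use M' in \<open>auto simp: mult_matrix_vector\<close>)
    qed
  qed
  moreover obtain n where "qform w / 8 < real n" using reals_Archimedean2 by blast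
  then have "qform w < real n * 8" by simp
  ultimately show ?thesis using assms by blast
qed

section \<open>Automorphisms that fix the diagonal direction\<close>

text \<open>
The positions of one vertex point on the lower boundary of the first diagonal cylinder: once per
circumference, at \<open>P 0\<close>. The other vertex point sits at \<open>P 1\<close>.
\<close>

lemma vtx_True_bottom:
  assumes k: "dia.\<psi> 1 (s, 0) = vtx True"
  obtains m :: int where "s = - sqrt 2 + of_int m * dia.Lk 1"
proof -
  have ell1: "sqrt 2 * ((c + 1) * P 1 $ 1 - (c - 1) * P 1 $ 2 - 1) = sqrt 2" by (simp add: P_1)
  have z: "(s, 0) \<in> dia.strip 1" using dia.Hk_ge[of 1] by (simp add: dia.strip_def)
  obtain i p where ip: "(i, p) \<in> dia.Dev 1 (s, 0)" using dia.Dev_nonempty[OF _ z] by auto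
  then have "(i, p) \<in> vtx True" using dia.Dev_subset[OF _ z] k by auto
  then obtain m' where m': "sg i *\<^sub>R p = P m'" "even (m' + par i)" unfolding vtx_mem vrep_def by auto
  obtain m :: int where p: "p = dia.pt 1 ((s, 0) - (of_int m * dia.Lk 1, 0)) - dia.Cen 1 i"
    using ip unfolding dia.Dev_def by blast
  show ?thesis
  proof (cases i)
    case QPlus
    have e: "P m' = dia.pt 1 (s - of_int m * dia.Lk 1, 0)" using m' p QPlus by (simp add: dia.Cen_def)
    have "dia.ht m' = dia.ht 1" unfolding dia.ht_def[of m'] e dia.hgt_pt by simp
    then have "m' = 1 \<or> m' = 1 - 1" by (rule dia.ht_eq[rotated]) simp
    then have "m' = 1 - 1" using m' QPlus by auto
    then have "P m' = dia.pt 1 (- sqrt 2, 0)" using dia.P_refl[of 1] unfolding ell1 by simp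
    then have "(s - of_int m * dia.Lk 1, 0) = (- sqrt 2, 0 :: real)" unfolding e dia.pt_inject .
    then show ?thesis using that[of m] by simp
  next
    case QMinus
    have "P m' = P 1 + P (1 + 1) - dia.pt 1 (s - of_int m * dia.Lk 1, 0)"
      using m'(1) p QMinus unfolding dia.Cen_def by (simp add: algebra_simps)
    then have e: "P m' = dia.pt 1 (dia.e1 1 - (s - of_int m * dia.Lk 1), dia.Hk 1)"
      unfolding dia.pt_reflect by simp
    have "dia.ht m' = dia.ht (1 + 1)" unfolding dia.ht_def[of m'] e dia.hgt_pt by (simp add: dia.Hk_def)
    then have "m' = 1 + 1 \<or> m' = 1 - (1 + 1)" by (rule dia.ht_eq[rotated]) simp
    then have "m' = 1 - 1 - 1" using m' QMinus by auto
    then have "P m' = dia.pt 1 (dia.e1 1 - sqrt 2 * ((c + 1) * P (1 + 1) $ 1 - (c - 1) * P (1 + 1) $ 2 - 1), dia.Hk 1)"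
      by (simp only: dia.P_refl')
    then have "s - of_int m * dia.Lk 1 = dia.Lk 1 - sqrt 2" unfolding e dia.pt_inject dia.Lk_def ell1 by simp
    then show ?thesis using that[of "m + 1"] by (simp add: algebra_simps)
  qed
qed

text \<open>
On the upper boundary, this vertex point occurs once per circumference as well, at \<open>P 2\<close>.
\<close>

lemma vtx_True_top:
  assumes k: "dia.\<psi> 1 (s, dia.Hk 1) = vtx True"
  obtains m :: int where "s = dia.e1 1 + of_int m * dia.Lk 1"
proof -
  have z: "(s, dia.Hk 1) \<in> dia.strip 1" using dia.Hk_ge[of 1] by (simp add: dia.strip_def)
  obtain i p where ip: "(i, p) \<in> dia.Dev 1 (s, dia.Hk 1)" using dia.Dev_nonempty[OF _ z] by auto
  then have "(i, p) \<in> vtx True" using dia.Dev_subset[OF _ z] k by auto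
  then obtain m' where m': "sg i *\<^sub>R p = P m'" "even (m' + par i)" unfolding vtx_mem vrep_def by auto
  obtain m :: int where p: "p = dia.pt 1 ((s, dia.Hk 1) - (of_int m * dia.Lk 1, 0)) - dia.Cen 1 i"
    using ip unfolding dia.Dev_def by blast
  have "s - of_int m * dia.Lk 1 = dia.e1 1"
  proof (cases i)
    case QPlus
    have e: "P m' = dia.pt 1 (s - of_int m * dia.Lk 1, dia.Hk 1)" using m' p QPlus by (simp add: dia.Cen_def)
    have "dia.ht m' = dia.ht (1 + 1)" unfolding dia.ht_def[of m'] e dia.hgt_pt by (simp add: dia.Hk_def)
    then have "m' = 1 + 1 \<or> m' = 1 - (1 + 1)" by (rule dia.ht_eq[rotated]) simp
    then have "m' = 1 + 1" using m' QPlus by auto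
    then have "P m' = dia.pt 1 (dia.e1 1, dia.Hk 1)" by (simp only: dia.P_right)
    then have "(s - of_int m * dia.Lk 1, dia.Hk 1) = (dia.e1 1, dia.Hk 1)" unfolding e dia.pt_inject .
    then show ?thesis by simp
  next
    case QMinus
    have "P m' = P 1 + P (1 + 1) - dia.pt 1 (s - of_int m * dia.Lk 1, dia.Hk 1)"
      using m'(1) p QMinus unfolding dia.Cen_def by (simp add: algebra_simps)
    then have e: "P m' = dia.pt 1 (dia.e1 1 - (s - of_int m * dia.Lk 1), 0)"
      unfolding dia.pt_reflect by simp
    have "dia.ht m' = dia.ht 1" unfolding dia.ht_def[of m'] e dia.hgt_pt by simp
    then have "m' = 1 \<or> m' = 1 - 1" by (rule dia.ht_eq[rotated]) simp
    then have "m' = 1" using m' QMinus by auto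
    then have "P m' = dia.pt 1 (0, 0)" unfolding dia.pt_def zero_prod_def[symmetric] by (simp add: frame_linear)
    then have "(dia.e1 1 - (s - of_int m * dia.Lk 1), 0) = (0, 0 :: real)" unfolding e dia.pt_inject .
    then show ?thesis by simp
  qed
  then show ?thesis using that[of m] by simp
qed

text \<open>
The diagonal from \<open>P 0\<close> to \<open>P 2\<close> crosses the first diagonal cylinder once and joins a vertex point
to itself. So does its image, since \<open>f\<close> fixes this vertex point and the derivative keeps the
height. The two end points have fixed positions modulo the circumference \<open>2 (c + 1) sqrt 2\<close>, and
the image is longer by \<open>2 a sqrt 2\<close> along the cylinder.
\<close>

lemma transvection_derivative:
  assumes f: "affine_map M f" "invertible M" and M: "\<And>p. M *v p = p + (a * (p $ 2 - p $ 1)) *\<^sub>R P 1"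
  obtains n :: int where "a = of_int n * (c + 1)"
proof -
  have "M *v P 1 = P 1" unfolding M by (simp add: P_1)
  note fv = fixes_first_edge(2)[OF f this]
  have P2: "P 2 = vector [2 * c, 2 * c + 2]" using P_Suc[of 1] by (simp add: vec2_eq_iff P_1)
  have s: "saddle (M *v P 2) (\<lambda>t. f (point_of S QPlus (t *\<^sub>R P 2)))" (is "saddle ?w ?\<gamma>")
    using saddle_map[OF f saddle_diagonal[of 0 2]] by simp
  have end0: "?\<gamma> 0 = vtx True" using point_of_P[of 0] fv by simp
  have end1: "?\<gamma> 1 = vtx True" using point_of_P[of 2] fv by simp
  have w: "?w $ 1 = 2 * c + 2 * a" "?w $ 2 = 2 * c + 2 + 2 * a" unfolding M by (simp_all add: P2 P_1)
  have edge_side: "cross2 (vector [1 / sqrt 2, 1 / sqrt 2]) ?w = sqrt 2" unfolding dia_cross w using sqrt2 by simp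
  have H1: "dia.Hk 1 = sqrt 2" unfolding dia_Hk using sqrt2 by (simp add: E_0)
  have pos: "cross2 (vector [1 / sqrt 2, 1 / sqrt 2]) ?w > 0" unfolding edge_side by simp
  obtain k z where k: "k \<ge> 1" "snd z = 0" "dia.\<psi> k z = ?\<gamma> 0" "dia.Hk k \<le> cross2 (vector [1 / sqrt 2, 1 / sqrt 2]) ?w"
    "cross2 (vector [1 / sqrt 2, 1 / sqrt 2]) ?w = dia.Hk k \<Longrightarrow> dia.\<psi> k (z + unframe (vector [1 / sqrt 2, 1 / sqrt 2]) ?w) = ?\<gamma> 1"
    by (rule dia.saddle_height[OF s pos], rule that)
  have k1: "k = 1" using dia_Hk_bound(2)[OF k(1)] k(4) unfolding edge_side by simp
  define s0 where "s0 = fst z"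
  have z: "z = (s0, 0)" using k(2) by (simp add: s0_def prod_eq_iff)
  have un: "unframe (vector [1 / sqrt 2, 1 / sqrt 2]) ?w = ((4 * c + 2 + 4 * a) / sqrt 2, dia.Hk 1)"
    using edge_side unfolding unframe_def H1 w by (simp add: add_divide_distrib[symmetric])
  have "dia.\<psi> 1 (s0, 0) = vtx True" using k(3) end0 unfolding k1 z by simp
  then obtain m where m: "s0 = - sqrt 2 + of_int m * dia.Lk 1" by (rule vtx_True_bottom)
  have hk: "cross2 (vector [1 / sqrt 2, 1 / sqrt 2]) ?w = dia.Hk k" unfolding k1 edge_side H1 ..
  have "dia.\<psi> 1 (s0 + (4 * c + 2 + 4 * a) / sqrt 2, dia.Hk 1) = vtx True"
    using k(5)[OF hk] end1 unfolding k1 z un by simp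
  then obtain m' where m': "s0 + (4 * c + 2 + 4 * a) / sqrt 2 = dia.e1 1 + of_int m' * dia.Lk 1" by (rule vtx_True_top)
  have E1: "E 1 = vector [2 * c - 1, 2 * c + 1]" using E_Suc[of 0] by (simp add: vec2_eq_iff E_0)
  have e1: "dia.e1 1 = (4 * c) / sqrt 2" unfolding dia.e1_def unframe_def E1 by (simp add: add_divide_distrib[symmetric])
  have L1: "dia.Lk 1 = 2 * (c + 1) * (2 / sqrt 2)" using dia.Lk_eq[of 1] H1 sqrt2 by simp
  \<comment> \<open>measure all lengths in units of \<open>1 / sqrt 2\<close>\<close>
  define r where "r = 1 / sqrt 2"
  have r: "sqrt 2 = 2 * r" "r \<noteq> 0" "x / sqrt 2 = x * r" for x using sqrt2 by (simp_all add: r_def)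
  have "- (2 * r) + of_int m * (2 * (c + 1) * (2 * r)) + (4 * c + 2 + 4 * a) * r = 4 * c * r + of_int m' * (2 * (c + 1) * (2 * r))"
    using m' unfolding m e1 L1 unfolding r(3) unfolding r(1) .
  then have "4 * a * r = of_int (m' - m) * (4 * (c + 1)) * r" by (simp add: algebra_simps)
  then have "4 * a = of_int (m' - m) * (4 * (c + 1))" using r(2) by simp
  then have "a = of_int (m' - m) * (c + 1)" by (simp add: algebra_simps)
  then show ?thesis by (rule that)
qed

section \<open>Generation by the four automorphisms\<close>

lemma GenM_cancel: assumes N: "N \<in> GenM" "invertible N" and NM: "N ** M \<in> GenM" shows "M \<in> GenM"
proof -
  have "M = matrix_inv N ** (N ** M)" by (simp add: matrix_mul_assoc matrix_inv_cancel(1)[OF N(2)])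
  then show ?thesis using GenM_mult[OF GenM_inv[OF N(1)] NM] by simp
qed

lemma GenM_invertible: "M \<in> GenM \<Longrightarrow> invertible M"
  unfolding GenM_def using affine_autD(1) by blast

lemma compose_GenM:
  assumes "affine_aut M f" "N \<in> GenM" obtains g where "affine_aut (N ** M) g"
  using assms affine_aut_comp unfolding GenM_def by blast

text \<open>
The derivative multiplies \<open>h p = y - x\<close> by a factor. Its sign can be made positive by composing
with the reflection \<open>(x, y) \<mapsto> (2 y - x, y)\<close>, and then the factor is 1: the saddle connection with
holonomy \<open>(- 1, 1)\<close>, which has the minimal positive value 2 of \<open>h\<close>, cannot be mapped to one with a
smaller value, by \<open>f\<close> or by its inverse.
\<close>

lemma fixes_diagonal_derivative:
  assumes f: "affine_aut M f" and M: "M *v P 1 = P 1"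
  shows "M \<in> GenM"
proof -
  define ey where "ey = (vector [0, 1] :: real^2)"
  define h where "h p = p $ 2 - p $ 1" for p :: "real^2"
  have dec: "p = p $ 1 *\<^sub>R P 1 + h p *\<^sub>R ey" for p by (simp add: vec2_eq_iff P_1 ey_def h_def)
  have *: "N \<in> GenM" if g: "affine_aut N g" and N: "N *v P 1 = P 1" and pos: "h (N *v ey) > 0" for N g
  proof -
    note inv = affine_autD(1)[OF g]
    have Np: "N *v p = p $ 1 *\<^sub>R P 1 + h p *\<^sub>R (N *v ey)" for p
      by (subst dec[of p]) (simp add: matrix_vector_right_distrib matrix_vector_mult_scaleR N)
    have h_lin: "h (s *\<^sub>R p + t *\<^sub>R q) = s * h p + t * h q" for s t p q by (simp add: h_def algebra_simps)
    have hP: "h (P 1) = 0" by (simp add: h_def P_1)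
    have hN: "h (N *v p) = h p * h (N *v ey)" for p by (subst Np) (simp add: h_lin hP)
    define v where "v = P (- 1)"
    have v: "v $ 1 = - 1" "v $ 2 = 1" using P_neg[of 1] by (simp_all add: v_def P_1)
    have hv: "h v = 2" by (simp add: h_def v)
    have s: "saddle v (\<lambda>t. point_of S QPlus (t *\<^sub>R v))" using saddle_diagonal[of 0 "-1"] by (simp add: v_def)
    have "h (N *v v) \<ge> 2"
      using saddle_diagonal_height_ge_2[OF saddle_map[OF affine_autD(3)[OF g] inv s]] pos hN[of v] hv unfolding h_def by simp
    then have ge: "h (N *v ey) \<ge> 1" using hN[of v] hv by simp
    note gi = affine_aut_inv[OF g]
    let ?v' = "matrix_inv N *v v"
    have hv': "2 = h ?v' * h (N *v ey)" using hN[of ?v'] hv matrix_inv_cancel(4)[OF inv] by simp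
    have "h ?v' > 0"
    proof (rule ccontr)
      assume "\<not> h ?v' > 0"
      then have "h ?v' * h (N *v ey) \<le> 0" using pos by (intro mult_nonpos_nonneg) auto
      then show False using hv' by simp
    qed
    then have "h ?v' \<ge> 2" using saddle_diagonal_height_ge_2[OF saddle_map[OF affine_autD(3)[OF gi] affine_autD(1)[OF gi] s]] unfolding h_def by simp
    then have "2 * h (N *v ey) \<le> 2" using mult_right_mono[of 2 "h ?v'" "h (N *v ey)"] pos hv' by simp
    then have one: "h (N *v ey) = 1" using ge by simp
    define a where "a = (N *v ey) $ 1"
    have Ney: "N *v ey = ey + a *\<^sub>R P 1" using one by (simp add: vec2_eq_iff ey_def P_1 a_def h_def)
    have Na: "N *v p = p + (a * (p $ 2 - p $ 1)) *\<^sub>R P 1" for p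
    proof -
      have "N *v p = p $ 1 *\<^sub>R P 1 + h p *\<^sub>R (ey + a *\<^sub>R P 1)" using Np[of p] Ney by simp
      also have "\<dots> = (p $ 1 *\<^sub>R P 1 + h p *\<^sub>R ey) + (a * h p) *\<^sub>R P 1" by (simp add: algebra_simps)
      also have "\<dots> = p + (a * h p) *\<^sub>R P 1" unfolding dec[of p, symmetric] ..
      finally show ?thesis by (simp add: h_def)
    qed
    obtain n :: int where n: "a = of_int n * (c + 1)" by (rule transvection_derivative[OF affine_autD(3)[OF g] inv Na])
    have "N = dia.twist_matrix n"
      by (rule mat2_eqI; unfold Na dia_twist_matrix n) (simp_all add: P_1 algebra_simps)
    then show ?thesis using dia_twist_matrix_GenM by simp
  qed
  have "h (M *v ey) \<noteq> 0"
  proof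
    assume "h (M *v ey) = 0"
    then have "M *v ey = (M *v ey) $ 1 *\<^sub>R P 1" using dec[of "M *v ey"] by simp
    also have "\<dots> = M *v ((M *v ey) $ 1 *\<^sub>R P 1)" by (simp add: matrix_vector_mult_scaleR M)
    finally have "ey = (M *v ey) $ 1 *\<^sub>R P 1" by (metis matrix_inv_cancel(3)[OF affine_autD(1)[OF f]])
    then show False by (auto simp: vec2_eq_iff ey_def P_1)
  qed
  then consider "h (M *v ey) > 0" | "h (M *v ey) < 0" by linarith
  then show ?thesis
  proof cases
    case 1 then show ?thesis by (rule *[OF f M])
  next
    case 2
    \<comment> \<open>the reflection that fixes \<open>(1, 1)\<close> and changes the sign of \<open>h\<close>\<close>
    define B where "B = hor.twist_matrix 1 ** refl_matrix"
    have B: "B \<in> GenM" unfolding B_def by (intro GenM_mult GenM_generators)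
    have Bp: "(B *v p) $ 1 = 2 * p $ 2 - p $ 1" "(B *v p) $ 2 = p $ 2" for p
      unfolding B_def mult_matrix_vector hor_twist_matrix refl_matrix_mult by simp_all
    obtain g where g: "affine_aut (B ** M) g" by (rule compose_GenM[OF f B])
    have "(B ** M) *v P 1 = P 1" unfolding mult_matrix_vector M by (simp add: vec2_eq_iff Bp P_1)
    moreover have "h ((B ** M) *v ey) > 0" using 2 unfolding mult_matrix_vector by (simp add: h_def Bp)
    ultimately have "B ** M \<in> GenM" by (rule *[OF g])
    then show ?thesis by (rule GenM_cancel[OF B GenM_invertible[OF B]])
  qed
qed

text \<open>
After composing with a generated automorphism the derivative maps \<open>(1, 1)\<close> to \<open>l (1, 1)\<close>. As no
diagonal saddle connection is shorter than the first edge, both \<open>l\<close> and \<open>1 / l\<close> have absolute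
value at least 1.
\<close>

theorem derivative_in_GenM: assumes f: "affine_aut M f" shows "M \<in> GenM"
proof -
  obtain N l where N: "N \<in> GenM" "N *v (M *v P 1) = l *\<^sub>R P 1"
    using reduce_to_diagonal[OF joins_map[OF f joins_first_edge]] by blast
  obtain g where g: "affine_aut (N ** M) g" by (rule compose_GenM[OF f N(1)])
  have s0: "saddle (P 1) (\<lambda>t. point_of S QPlus (t *\<^sub>R P 1))" using saddle_diagonal[of 0 1] by simp
  have K: "(N ** M) *v P 1 = l *\<^sub>R P 1" unfolding mult_matrix_vector by (rule N(2))
  have l: "\<bar>l\<bar> \<ge> 1"
    using saddle_diagonal_length[of l] saddle_map[OF affine_autD(3)[OF g] affine_autD(1)[OF g] s0] unfolding K by blast
  note gi = affine_aut_inv[OF g]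
  have "matrix_inv (N ** M) *v (l *\<^sub>R P 1) = P 1" unfolding K[symmetric] by (rule matrix_inv_cancel(3)[OF affine_autD(1)[OF g]])
  then have "l *\<^sub>R (matrix_inv (N ** M) *v P 1) = P 1" by (simp add: matrix_vector_mult_scaleR)
  then have "matrix_inv (N ** M) *v P 1 = (1 / l) *\<^sub>R P 1" using l by (metis abs_zero divideR_right inverse_eq_divide not_one_le_zero)
  then have "\<bar>1 / l\<bar> \<ge> 1"
    using saddle_diagonal_length[of "1 / l"] saddle_map[OF affine_autD(3)[OF gi] affine_autD(1)[OF gi] s0] by metis
  then have "\<bar>l\<bar> \<le> 1" using l by (simp add: abs_divide field_simps)
  then have "l = 1 \<or> l = - 1" using l by linarith
  then have "N ** M \<in> GenM"
  proof
    assume "l = 1"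
    then show ?thesis using fixes_diagonal_derivative[OF g] K by simp
  next
    assume l: "l = - 1"
    obtain g' where g': "affine_aut ((- mat 1) ** (N ** M)) g'" by (rule compose_GenM[OF g GenM_generators(1)])
    have "((- mat 1) ** (N ** M)) *v P 1 = P 1" unfolding mult_matrix_vector[of "- mat 1"] K l minus_mat by simp
    from fixes_diagonal_derivative[OF g' this] show ?thesis
      by (rule GenM_cancel[OF GenM_generators(1) GenM_invertible[OF GenM_generators(1)]])
  qed
  then show ?thesis by (rule GenM_cancel[OF N(1) GenM_invertible[OF N(1)]])
qed

theorem Gen_eq: "Gen = carrier (affine_group S)"
  using Gen_subset derivative_in_GenM GenM_aff unfolding carrier_Aut Aut_def by blast

lemma kernel_trivial:
  "kernel (affine_group S) (veech_group S) (affine_derivative S) = {\<one>\<^bsub>affine_group S\<^esub>}"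
proof -
  have D: "affine_derivative S f = mat 1 \<longleftrightarrow> f = (\<lambda>x\<in>X. x)" if f: "f \<in> Aut" for f
  proof
    assume "affine_derivative S f = mat 1"
    moreover obtain M where "affine_aut M f" using f unfolding Aut_def by blast
    ultimately have "affine_aut (mat 1) f" using derivative_affine_aut[of M f] by simp
    then show "f = (\<lambda>x\<in>X. x)" by (rule affine_aut_determined[OF _ affine_aut_id])
  next
    assume "f = (\<lambda>x\<in>X. x)"
    then show "affine_derivative S f = mat 1" using derivative_affine_aut[OF affine_aut_id] by simp
  qed
  have "(\<lambda>x\<in>X. x) \<in> Aut" using affine_aut_id unfolding Aut_def by blast
  then have "{f \<in> Aut. affine_derivative S f = mat 1} = {\<lambda>x\<in>X. x}" using D by fast
  then show ?thesis by (simp only: kernel_def carrier_Aut one_Aut veech_group_def monoid.simps)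
qed

end

theorem theorem2:
  fixes c :: real
  assumes "c \<ge> 1"
  shows "kernel (affine_group (S_surface c)) (veech_group (S_surface c)) (affine_derivative (S_surface c))
           = {\<one>\<^bsub>affine_group (S_surface c)\<^esub>}
    \<and> (\<exists>minusI A D E.
         {minusI, A, D, E} \<subseteq> carrier (affine_group (S_surface c))
       \<and> induced_by (S_surface c) swap_pieces uminus minusI
       \<and> induced_by (S_surface c) id reflect_x A
       \<and> right_twist_in_each_cylinder (S_surface c) (vector [1, 0]) D
       \<and> right_twist_in_each_cylinder (S_surface c) (vector [1 / sqrt 2, 1 / sqrt 2]) E
       \<and> generate (affine_group (S_surface c)) {minusI, A, D, E} = carrier (affine_group (S_surface c)))"
proof -
  interpret surf c by unfold_locales (rule assms)
  show ?thesis
    by (rule conjI[OF kernel_trivial], rule exI[of _ minusI], rule exI[of _ reflA],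
        rule exI[of _ "hor.twist 1"], rule exI[of _ "dia.twist 1"])
       (intro conjI generators_Aut induced_minusI induced_reflA hor.twist_right_twist dia.twist_right_twist
        Gen_eq[unfolded Gen_def])
qed

end
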